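(* Let $M$ be an $n|m$-dimensional supermanifold with $n-m\notin\{1,-1\}$ and let $\Pi^k_{ij}$ be a projective class on $M$. Then the formulae $$\tilde\Gamma^k_{ij}=\Pi^k_{ij},\qquad \tilde\Gamma^{c}_{0a}=\tilde\Gamma^{c}_{a0}=-\frac{\delta^{c}_{a}}{n-m+1},$$ $$\tilde\Gamma^0_{ji}=\frac{n-m+1}{n-m-1}\left(\partial_q\Pi^q_{ji}-\Pi^p_{qj}\Pi^q_{pi}\right)(-1)^{\tilde q(1+\tilde\imath+\tilde\jmath)}$$ define a linear connection on the supermanifold $\tilde M$ (that is, these local coefficients, given in each of the adapted coordinate systems of $\tilde M$, transform as the coefficients of a linear connection under the coordinate changes of $\tilde M$). Here the indices $i,j,k,p,q$ range over $1,\dots,n+m$ and the indices $a,c$ over $0,1,\dots,n+m$.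
   Context: Local coordinates on $M$ are $x^1,\dots,x^{n+m}$, $\tilde\imath\in\{0,1\}$ is the parity of $x^i$, $\partial_i=\partial/\partial x^i$ are left derivatives, and repeated indices are summed. Linear connections have coefficients $\nabla_{\partial_i}\partial_j=\Gamma^k_{ij}\partial_k$ and, on $M$, are symmetric: $\Gamma^k_{ij}=(-1)^{\tilde\imath\tilde\jmath}\Gamma^k_{ji}$. For $n-m\ne-1$ put $$\Pi^k_{ji}=\Gamma^k_{ji}-\frac{1}{n-m+1}\left(\Gamma^s_{js}\delta^k_i(-1)^{\tilde s}+\Gamma^s_{is}\delta^k_j(-1)^{\tilde\imath\tilde\jmath+\tilde s}\right).$$ Two symmetric linear connections define the same projective class if their $\Pi^k_{ji}$ coincide in all coordinate systems; the projective class is identified with the $\Pi^k_{ji}$. The supermanifold $\tilde M$, of dimension $n+1|m$, is built from $M$ by adding one even coordinate $x^0$ to every chart: to each coordinate system $(x^1,\dots,x^{n+m})$ on $M$ corresponds the adapted coordinate system $(x^0,x^1,\dots,x^{n+m})$ on $\tilde M$, and a change of coordinates $x'^i=x'^i(x)$ on $M$ is accompanied by $x'^0=x^0+\log J$, where $J=|\mathrm{Ber}(\partial x'/\partial x)|$. *)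

theory Defs
  imports "HOL-Analysis.Analysis"
begin

section \<open>The Grassmann algebra\<close>

text \<open>
  An element is the family of its coefficients with respect to the monomials \<open>\<theta>\<^sub>I\<close>, the product of the
  generators \<open>\<theta>\<^sub>i\<close>, \<open>i \<in> I\<close>, in increasing order, for finite sets \<open>I\<close> of natural numbers.  The algebra on
  a finite set \<open>D\<close> of generators consists of the elements with coefficients supported in \<open>Pow D\<close>.
\<close>

typedef grassmann = "{f :: nat set \<Rightarrow> real. \<forall>I. infinite I \<longrightarrow> f I = 0}"
  morphisms gcoeff Abs_grassmann
  by (rule exI[of _ "\<lambda>_. 0"]) simp

setup_lifting type_definition_grassmann

lemma grassmann_eqI: "(\<And>I. gcoeff a I = gcoeff b I) \<Longrightarrow> a = b"
  by (simp add: gcoeff_inject[symmetric] fun_eq_iff)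

text \<open>For disjoint \<open>I\<close>, \<open>J\<close> one has \<open>\<theta>\<^sub>I * \<theta>\<^sub>J = koszul I J * \<theta>\<^sub>K\<close> with \<open>K = I \<union> J\<close>.\<close>

definition koszul :: "nat set \<Rightarrow> nat set \<Rightarrow> real" where
  "koszul I J = (-1) ^ card {(i, j). i \<in> I \<and> j \<in> J \<and> j < i}"

lemma koszul_empty [simp]: "koszul {} J = 1" "koszul I {} = 1"
  by (simp_all add: koszul_def)

lemma koszul_Un_left:
  assumes "finite I" "finite J" "finite K" "I \<inter> J = {}"
  shows "koszul (I \<union> J) K = koszul I K * koszul J K"
proof -
  have "{(i, j). i \<in> I \<union> J \<and> j \<in> K \<and> j < i} =
        {(i, j). i \<in> I \<and> j \<in> K \<and> j < i} \<union> {(i, j). i \<in> J \<and> j \<in> K \<and> j < i}" by auto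
  moreover have "finite {(i, j). i \<in> I \<and> j \<in> K \<and> j < i}"
    by (rule finite_subset[of _ "I \<times> K"]) (use assms in auto)
  moreover have "finite {(i, j). i \<in> J \<and> j \<in> K \<and> j < i}"
    by (rule finite_subset[of _ "J \<times> K"]) (use assms in auto)
  moreover have "{(i, j). i \<in> I \<and> j \<in> K \<and> j < i} \<inter> {(i, j). i \<in> J \<and> j \<in> K \<and> j < i} = {}"
    using assms by auto
  ultimately show ?thesis
    by (simp add: koszul_def card_Un_disjoint power_add)
qed

lemma koszul_Un_right:
  assumes "finite I" "finite J" "finite K" "J \<inter> K = {}"
  shows "koszul I (J \<union> K) = koszul I J * koszul I K"
proof -
  have "{(i, j). i \<in> I \<and> j \<in> J \<union> K \<and> j < i} =
        {(i, j). i \<in> I \<and> j \<in> J \<and> j < i} \<union> {(i, j). i \<in> I \<and> j \<in> K \<and> j < i}" by auto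
  moreover have "finite {(i, j). i \<in> I \<and> j \<in> J \<and> j < i}"
    by (rule finite_subset[of _ "I \<times> J"]) (use assms in auto)
  moreover have "finite {(i, j). i \<in> I \<and> j \<in> K \<and> j < i}"
    by (rule finite_subset[of _ "I \<times> K"]) (use assms in auto)
  moreover have "{(i, j). i \<in> I \<and> j \<in> J \<and> j < i} \<inter> {(i, j). i \<in> I \<and> j \<in> K \<and> j < i} = {}"
    using assms by auto
  ultimately show ?thesis
    by (simp add: koszul_def card_Un_disjoint power_add)
qed

instantiation grassmann :: real_algebra_1
begin

lift_definition zero_grassmann :: grassmann is "\<lambda>_. 0" by simp

lift_definition one_grassmann :: grassmann is "\<lambda>I. if I = {} then 1 else 0" by auto

lift_definition plus_grassmann :: "grassmann \<Rightarrow> grassmann \<Rightarrow> grassmann" is "\<lambda>a b I. a I + b I" by simp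

lift_definition minus_grassmann :: "grassmann \<Rightarrow> grassmann \<Rightarrow> grassmann" is "\<lambda>a b I. a I - b I" by simp

lift_definition uminus_grassmann :: "grassmann \<Rightarrow> grassmann" is "\<lambda>a I. - a I" by simp

lift_definition scaleR_grassmann :: "real \<Rightarrow> grassmann \<Rightarrow> grassmann" is "\<lambda>r a I. r * a I" by simp

lift_definition times_grassmann :: "grassmann \<Rightarrow> grassmann \<Rightarrow> grassmann" is
  "\<lambda>a b K. \<Sum>I\<in>Pow K. koszul I (K - I) * a I * b (K - I)"
  by (simp add: finite_Pow_iff)

instance
proof
  fix a b c :: grassmann and r s :: real
  show "a + b + c = a + (b + c)" by transfer (simp add: fun_eq_iff)
  show "a + b = b + a" by transfer (simp add: fun_eq_iff)
  show "0 + a = a" by transfer (simp add: fun_eq_iff)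
  show "- a + a = 0" by transfer (simp add: fun_eq_iff)
  show "a - b = a + - b" by transfer (simp add: fun_eq_iff)
  show "r *\<^sub>R (a + b) = r *\<^sub>R a + r *\<^sub>R b" by transfer (simp add: fun_eq_iff algebra_simps)
  show "(r + s) *\<^sub>R a = r *\<^sub>R a + s *\<^sub>R a" by transfer (simp add: fun_eq_iff algebra_simps)
  show "r *\<^sub>R s *\<^sub>R a = (r * s) *\<^sub>R a" by transfer (simp add: fun_eq_iff algebra_simps)
  show "1 *\<^sub>R a = a" by transfer (simp add: fun_eq_iff)
  show "(0::grassmann) \<noteq> 1" by transfer (auto simp: fun_eq_iff)
  show "(a + b) * c = a * c + b * c"
    by transfer (simp add: fun_eq_iff algebra_simps sum.distrib)
  show "a * (b + c) = a * b + a * c"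
    by transfer (simp add: fun_eq_iff algebra_simps sum.distrib)
  show "r *\<^sub>R a * b = r *\<^sub>R (a * b)"
    by transfer (simp add: fun_eq_iff algebra_simps sum_distrib_left)
  show "a * r *\<^sub>R b = r *\<^sub>R (a * b)"
    by transfer (simp add: fun_eq_iff algebra_simps sum_distrib_left)
  show "1 * a = a"
  proof (rule grassmann_eqI)
    fix K
    show "gcoeff (1 * a) K = gcoeff a K"
    proof (cases "finite K")
      case True
      have "gcoeff (1 * a) K = (\<Sum>I\<in>Pow K. if I = {} then gcoeff a K else 0)"
        by (simp add: times_grassmann.rep_eq one_grassmann.rep_eq) (rule sum.cong, auto)
      with True show ?thesis by (simp add: sum.delta)
    next
      case False
      then show ?thesis using gcoeff[of "1 * a"] gcoeff[of a] by simp
    qed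
  qed
  show "a * 1 = a"
  proof (rule grassmann_eqI)
    fix K
    show "gcoeff (a * 1) K = gcoeff a K"
    proof (cases "finite K")
      case True
      have "gcoeff (a * 1) K = (\<Sum>I\<in>Pow K. if I = K then gcoeff a K else 0)"
        by (simp add: times_grassmann.rep_eq one_grassmann.rep_eq) (rule sum.cong, auto)
      with True show ?thesis by (simp add: sum.delta)
    next
      case False
      then show ?thesis using gcoeff[of "a * 1"] gcoeff[of a] by simp
    qed
  qed
  show "a * b * c = a * (b * c)"
  proof (rule grassmann_eqI)
    fix K
    show "gcoeff (a * b * c) K = gcoeff (a * (b * c)) K"
    proof (cases "finite K")
      case False
      then show ?thesis using gcoeff[of "a * b * c"] gcoeff[of "a * (b * c)"] by simp
    next
      case True
      let ?P = "SIGMA L:Pow K. Pow L" and ?Q = "SIGMA I:Pow K. Pow (K - I)"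
      have fin: "finite L" if "L \<subseteq> K" for L using that True by (rule finite_subset)
      have "gcoeff (a * b * c) K = (\<Sum>L\<in>Pow K. \<Sum>I\<in>Pow L.
          koszul L (K - L) * koszul I (L - I) * gcoeff a I * gcoeff b (L - I) * gcoeff c (K - L))"
        by (simp add: times_grassmann.rep_eq sum_distrib_left sum_distrib_right mult_ac)
      also have "\<dots> = (\<Sum>(L, I)\<in>?P.
          koszul L (K - L) * koszul I (L - I) * gcoeff a I * gcoeff b (L - I) * gcoeff c (K - L))"
        by (rule sum.Sigma) (use True fin in auto)
      also have "\<dots> = (\<Sum>(I, J)\<in>?Q.
          koszul I (K - I) * koszul J (K - I - J) * gcoeff a I * gcoeff b J * gcoeff c (K - I - J))"
      proof (rule sum.reindex_bij_witness[where i = "\<lambda>(I, J). (I \<union> J, I)" and j = "\<lambda>(L, I). (I, L - I)"])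
        fix x assume "x \<in> ?P"
        then obtain L I where x: "x = (L, I)" and sub: "L \<subseteq> K" "I \<subseteq> L" by auto
        have d: "K - I - (L - I) = K - L" "K - I = (L - I) \<union> (K - L)" "L = I \<union> (L - I)"
          using sub by auto
        have f: "finite I" "finite (L - I)" "finite (K - L)" using sub True fin by auto
        have "koszul L (K - L) = koszul I (K - L) * koszul (L - I) (K - L)"
          using koszul_Un_left[OF f] d(3) by (metis Diff_disjoint)
        moreover have "koszul I (K - I) = koszul I (L - I) * koszul I (K - L)"
          using koszul_Un_right[OF f] d(2) by (metis Diff_disjoint Diff_subset disjoint_iff subsetD DiffD2)
        ultimately show "(case (case x of (L, I) \<Rightarrow> (I, L - I)) of (I, J) \<Rightarrow>
            koszul I (K - I) * koszul J (K - I - J) * gcoeff a I * gcoeff b J * gcoeff c (K - I - J)) =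
          (case x of (L, I) \<Rightarrow>
            koszul L (K - L) * koszul I (L - I) * gcoeff a I * gcoeff b (L - I) * gcoeff c (K - L))"
          by (simp add: x d(1) mult_ac)
      qed auto
      also have "\<dots> = (\<Sum>I\<in>Pow K. \<Sum>J\<in>Pow (K - I).
          koszul I (K - I) * koszul J (K - I - J) * gcoeff a I * gcoeff b J * gcoeff c (K - I - J))"
        by (rule sum.Sigma[symmetric]) (use True in auto)
      also have "\<dots> = gcoeff (a * (b * c)) K"
        by (simp add: times_grassmann.rep_eq sum_distrib_left sum_distrib_right mult_ac)
      finally show ?thesis .
    qed
  qed
qed

end

lift_definition gvar :: "nat \<Rightarrow> grassmann" is "\<lambda>i I. if I = {i} then 1 else 0" by auto

text \<open>
  Left derivative: \<open>\<theta>\<^sub>i\<close> is moved to the front of the monomial, past the \<open>\<theta>\<^sub>j\<close> with \<open>j < i\<close>, and removed.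
\<close>

lift_definition godd_deriv :: "nat \<Rightarrow> grassmann \<Rightarrow> grassmann" is
  "\<lambda>i a I. if i \<in> I then 0 else (-1) ^ card {j \<in> I. j < i} * a (insert i I)"
  by simp

definition gbody :: "grassmann \<Rightarrow> real" where
  "gbody a = gcoeff a {}"

definition gabs :: "grassmann \<Rightarrow> grassmann" where
  "gabs a = sgn (gbody a) *\<^sub>R a"

definition ginverse :: "grassmann \<Rightarrow> grassmann" where
  "ginverse a = (THE b. a * b = 1 \<and> b * a = 1)"

text \<open>
  Logarithm of an element of the algebra on \<open>D\<close> with positive body \<open>r\<close>, by \<open>a = r * (1 + u)\<close>; the
  logarithmic series in \<open>u\<close> terminates because a product of more than \<open>card D\<close> bodiless factors vanishes.
\<close>

definition gln :: "nat set \<Rightarrow> grassmann \<Rightarrow> grassmann" where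
  "gln D a = of_real (ln (gbody a)) +
     (\<Sum>k = 1..card D. ((-1) ^ (k + 1) / real k) *\<^sub>R ((1 / gbody a) *\<^sub>R a - 1) ^ k)"


section \<open>The Berezinian\<close>

text \<open>
  Matrices are indexed by arbitrary finite sets of natural numbers.  The determinant is only applied to
  matrices whose entries are even, so that the order of the factors is immaterial.
\<close>

type_synonym gmatrix = "nat \<Rightarrow> nat \<Rightarrow> grassmann"

definition gdet :: "nat set \<Rightarrow> gmatrix \<Rightarrow> grassmann" where
  "gdet S A = (\<Sum>p | p permutes S. of_int (sign p) * prod_list (map (\<lambda>i. A i (p i)) (sorted_list_of_set S)))"

definition gmat_inverse :: "nat set \<Rightarrow> gmatrix \<Rightarrow> gmatrix" where
  "gmat_inverse S A = (THE B.
     (\<forall>i\<in>S. \<forall>j\<in>S. (\<Sum>k\<in>S. A i k * B k j) = (if i = j then 1 else 0) \<and>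
                 (\<Sum>k\<in>S. B i k * A k j) = (if i = j then 1 else 0)) \<and>
     (\<forall>i j. i \<notin> S \<or> j \<notin> S \<longrightarrow> B i j = 0))"

text \<open>
  With blocks \<open>A00\<close> (indices in \<open>E \<times> E\<close>), \<open>A01\<close>, \<open>A10\<close>, \<open>A11\<close> (indices in \<open>D \<times> D\<close>):
  the Berezinian is \<open>det (A00 - A01 A11\<inverse> A10) (det A11)\<inverse>\<close>.
\<close>

definition berezinian :: "nat set \<Rightarrow> nat set \<Rightarrow> gmatrix \<Rightarrow> grassmann" where
  "berezinian E D A =
     gdet E (\<lambda>i j. A i j - (\<Sum>k\<in>D. \<Sum>l\<in>D. A i k * gmat_inverse D A k l * A l j)) * ginverse (gdet D A)"


section \<open>Superfunctions\<close>

text \<open>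
  Even coordinates are indexed by a finite set \<open>E\<close> and odd ones by a finite set \<open>D\<close> of natural numbers,
  disjoint from \<open>E\<close>; the generator \<open>\<theta>\<^sub>i\<close>, \<open>i \<in> D\<close>, is the odd coordinate with index \<open>i\<close>.
  The points of \<open>\<real>\<^sup>E\<close> are the families vanishing outside \<open>E\<close>.
\<close>

type_synonym point = "nat \<Rightarrow> real"
type_synonym superfun = "point \<Rightarrow> grassmann"

definition coord_space :: "nat set \<Rightarrow> point topology" where
  "coord_space E = top_of_set {x. \<forall>i. i \<notin> E \<longrightarrow> x i = 0}"

definition partial :: "nat \<Rightarrow> (point \<Rightarrow> real) \<Rightarrow> point \<Rightarrow> real" where
  "partial i f x = deriv (\<lambda>t. f (x(i := t))) (x i)"

abbreviation partials :: "nat list \<Rightarrow> (point \<Rightarrow> real) \<Rightarrow> point \<Rightarrow> real" where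
  "partials is f \<equiv> foldr partial is f"

definition smooth :: "nat set \<Rightarrow> point set \<Rightarrow> (point \<Rightarrow> real) \<Rightarrow> bool" where
  "smooth E U f \<longleftrightarrow> (\<forall>is. set is \<subseteq> E \<longrightarrow> continuous_on U (partials is f) \<and>
     (\<forall>x\<in>U. \<forall>i\<in>E. (\<lambda>t. partials is f (x(i := t))) differentiable (at (x i))))"

definition parity :: "nat set \<Rightarrow> nat \<Rightarrow> nat" where
  "parity D i = (if i \<in> D then 1 else 0)"

text \<open>Superfunctions on \<open>U\<close> of parity \<open>p\<close> modulo 2, that is smooth functions on \<open>U\<close> with values in the
  even or odd part of the Grassmann algebra on \<open>D\<close>.\<close>

definition superfunction :: "nat set \<Rightarrow> nat set \<Rightarrow> point set \<Rightarrow> nat \<Rightarrow> superfun \<Rightarrow> bool" where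
  "superfunction E D U p f \<longleftrightarrow>
     (\<forall>I. smooth E U (\<lambda>x. gcoeff (f x) I)) \<and>
     (\<forall>x\<in>U. \<forall>I. gcoeff (f x) I \<noteq> 0 \<longrightarrow> I \<subseteq> D \<and> (even (card I) \<longleftrightarrow> even p))"

lift_definition even_deriv :: "nat \<Rightarrow> superfun \<Rightarrow> superfun" is
  "\<lambda>i f x I. if finite I then partial i (\<lambda>y. f y I) x else 0" by simp

definition sderiv :: "nat set \<Rightarrow> nat \<Rightarrow> superfun \<Rightarrow> superfun" where
  "sderiv D i f = (if i \<in> D then (\<lambda>x. godd_deriv i (f x)) else even_deriv i f)"

definition coord :: "nat set \<Rightarrow> nat \<Rightarrow> superfun" where
  "coord D i x = (if i \<in> D then gvar i else of_real (x i))"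


section \<open>Changes of coordinates\<close>

text \<open>
  A change of coordinates is given by the new coordinates \<open>\<phi> i\<close> as superfunctions of the old ones;
  \<open>body_map\<close> is the underlying map of points.
\<close>

definition body_map :: "nat set \<Rightarrow> (nat \<Rightarrow> superfun) \<Rightarrow> point \<Rightarrow> point" where
  "body_map E \<phi> x = (\<lambda>i. if i \<in> E then gbody (\<phi> i x) else 0)"

text \<open>
  Substitution of \<open>\<phi>\<close> in \<open>f = (\<Sum>I\<subseteq>D. f\<^sub>I \<theta>\<^sub>I)\<close>: the \<open>\<theta>\<^sub>i\<close> are replaced by the odd superfunctions \<open>\<phi> i\<close>, and
  the smooth function \<open>f\<^sub>I\<close> of the even superfunctions \<open>\<phi> i\<close> is its Taylor series at their bodies in their
  nilpotent parts.  The inner sum runs over all index tuples \<open>is\<close> of length \<open>k\<close>; as even elements commute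
  this is the usual sum over multi-indices.  The terms with \<open>k > card D\<close> vanish.
\<close>

definition subst :: "nat set \<Rightarrow> nat set \<Rightarrow> (nat \<Rightarrow> superfun) \<Rightarrow> superfun \<Rightarrow> superfun" where
  "subst E D \<phi> f x =
     (\<Sum>I\<in>Pow D.
        (\<Sum>k\<le>card D. \<Sum>is | set is \<subseteq> E \<and> length is = k.
           (partials is (\<lambda>y. gcoeff (f y) I) (body_map E \<phi> x) / fact k) *\<^sub>R
             prod_list (map (\<lambda>i. \<phi> i x - of_real (gbody (\<phi> i x))) is)) *
        prod_list (map (\<lambda>i. \<phi> i x) (sorted_list_of_set I)))"


section \<open>Supermanifolds\<close>

text \<open>
  A supermanifold is given by an atlas.  \<open>chart_dom M \<alpha>\<close> is the domain of values of the even coordinates of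
  the chart \<open>\<alpha>\<close>, \<open>overlap M \<alpha> \<beta>\<close> the part of it which lies in the chart \<open>\<beta>\<close> as well, and \<open>change M \<alpha> \<beta> i\<close> the
  coordinate with index \<open>i\<close> of \<open>\<beta>\<close> as a superfunction of the coordinates of \<open>\<alpha>\<close>.
\<close>

record 'c superatlas =
  evens :: "nat set"
  odds :: "nat set"
  charts :: "'c set"
  chart_dom :: "'c \<Rightarrow> point set"
  overlap :: "'c \<Rightarrow> 'c \<Rightarrow> point set"
  change :: "'c \<Rightarrow> 'c \<Rightarrow> nat \<Rightarrow> superfun"

definition indices :: "'c superatlas \<Rightarrow> nat set" where
  "indices M = evens M \<union> odds M"

definition par :: "'c superatlas \<Rightarrow> nat \<Rightarrow> nat" where
  "par M i = parity (odds M) i"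

definition pd :: "'c superatlas \<Rightarrow> nat \<Rightarrow> superfun \<Rightarrow> superfun" where
  "pd M i f = sderiv (odds M) i f"

definition pullback :: "'c superatlas \<Rightarrow> 'c \<Rightarrow> 'c \<Rightarrow> superfun \<Rightarrow> superfun" where
  "pullback M \<alpha> \<beta> f = subst (evens M) (odds M) (change M \<alpha> \<beta>) f"

definition body_change :: "'c superatlas \<Rightarrow> 'c \<Rightarrow> 'c \<Rightarrow> point \<Rightarrow> point" where
  "body_change M \<alpha> \<beta> = body_map (evens M) (change M \<alpha> \<beta>)"

text \<open>The underlying topological space is the quotient of the disjoint union of the chart domains.\<close>

definition glue :: "'c superatlas \<Rightarrow> (('c \<times> point) \<times> ('c \<times> point)) set" where
  "glue M = {((\<alpha>, x), (\<beta>, y)). \<alpha> \<in> charts M \<and> \<beta> \<in> charts M \<and> x \<in> overlap M \<alpha> \<beta> \<and> y = body_change M \<alpha> \<beta> x}"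

definition underlying_space :: "'c superatlas \<Rightarrow> ('c \<times> point) set topology" where
  "underlying_space M = topology (\<lambda>W. W \<subseteq> (SIGMA \<alpha>:charts M. chart_dom M \<alpha>) // glue M \<and>
     (\<forall>\<alpha>\<in>charts M. openin (coord_space (evens M)) {x \<in> chart_dom M \<alpha>. glue M `` {(\<alpha>, x)} \<in> W}))"

lemma istopology_underlying_space:
  assumes "\<And>\<alpha>. \<alpha> \<in> charts M \<Longrightarrow> openin (coord_space (evens M)) (chart_dom M \<alpha>)"
  shows "istopology (\<lambda>W. W \<subseteq> (SIGMA \<alpha>:charts M. chart_dom M \<alpha>) // glue M \<and>
     (\<forall>\<alpha>\<in>charts M. openin (coord_space (evens M)) {x \<in> chart_dom M \<alpha>. glue M `` {(\<alpha>, x)} \<in> W}))"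
  unfolding istopology_def
proof (intro conjI allI impI ballI)
  fix S T \<alpha>
  assume *: "S \<subseteq> (SIGMA \<alpha>:charts M. chart_dom M \<alpha>) // glue M \<and>
       (\<forall>\<alpha>\<in>charts M. openin (coord_space (evens M)) {x \<in> chart_dom M \<alpha>. glue M `` {(\<alpha>, x)} \<in> S})"
    "T \<subseteq> (SIGMA \<alpha>:charts M. chart_dom M \<alpha>) // glue M \<and>
       (\<forall>\<alpha>\<in>charts M. openin (coord_space (evens M)) {x \<in> chart_dom M \<alpha>. glue M `` {(\<alpha>, x)} \<in> T})"
  show "S \<inter> T \<subseteq> (SIGMA \<alpha>:charts M. chart_dom M \<alpha>) // glue M" using * by auto
  assume "\<alpha> \<in> charts M"
  moreover have "{x \<in> chart_dom M \<alpha>. glue M `` {(\<alpha>, x)} \<in> S \<inter> T} =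
      {x \<in> chart_dom M \<alpha>. glue M `` {(\<alpha>, x)} \<in> S} \<inter> {x \<in> chart_dom M \<alpha>. glue M `` {(\<alpha>, x)} \<in> T}" by auto
  ultimately show "openin (coord_space (evens M)) {x \<in> chart_dom M \<alpha>. glue M `` {(\<alpha>, x)} \<in> S \<inter> T}"
    using * by (simp add: openin_Int)
next
  fix K \<alpha>
  assume *: "\<forall>S\<in>K. S \<subseteq> (SIGMA \<alpha>:charts M. chart_dom M \<alpha>) // glue M \<and>
       (\<forall>\<alpha>\<in>charts M. openin (coord_space (evens M)) {x \<in> chart_dom M \<alpha>. glue M `` {(\<alpha>, x)} \<in> S})"
  show "\<Union>K \<subseteq> (SIGMA \<alpha>:charts M. chart_dom M \<alpha>) // glue M" using * by blast
  assume "\<alpha> \<in> charts M"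
  moreover have "{x \<in> chart_dom M \<alpha>. glue M `` {(\<alpha>, x)} \<in> \<Union>K} =
      (\<Union>S\<in>K. {x \<in> chart_dom M \<alpha>. glue M `` {(\<alpha>, x)} \<in> S})" by auto
  ultimately show "openin (coord_space (evens M)) {x \<in> chart_dom M \<alpha>. glue M `` {(\<alpha>, x)} \<in> \<Union>K}"
    using * by (auto intro!: openin_Union)
qed

definition supermanifold :: "nat \<Rightarrow> nat \<Rightarrow> 'c superatlas \<Rightarrow> bool" where
  "supermanifold n m M \<longleftrightarrow>
     evens M = {1..n} \<and> odds M = {n+1..n+m} \<and>
     (\<forall>\<alpha>\<in>charts M. openin (coord_space (evens M)) (chart_dom M \<alpha>)) \<and>
     (\<forall>\<alpha>\<in>charts M. \<forall>\<beta>\<in>charts M.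
        openin (coord_space (evens M)) (overlap M \<alpha> \<beta>) \<and> overlap M \<alpha> \<beta> \<subseteq> chart_dom M \<alpha> \<and>
        (\<forall>i\<in>indices M. superfunction (evens M) (odds M) (overlap M \<alpha> \<beta>) (par M i) (change M \<alpha> \<beta> i))) \<and>
     (\<forall>\<alpha>\<in>charts M. overlap M \<alpha> \<alpha> = chart_dom M \<alpha> \<and>
        (\<forall>x\<in>chart_dom M \<alpha>. \<forall>i\<in>indices M. change M \<alpha> \<alpha> i x = coord (odds M) i x)) \<and>
     (\<forall>\<alpha>\<in>charts M. \<forall>\<beta>\<in>charts M. \<forall>\<gamma>\<in>charts M. \<forall>x\<in>overlap M \<alpha> \<beta> \<inter> overlap M \<alpha> \<gamma>.
        body_change M \<alpha> \<beta> x \<in> overlap M \<beta> \<gamma> \<and>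
        (\<forall>i\<in>indices M. pullback M \<alpha> \<beta> (change M \<beta> \<gamma> i) x = change M \<alpha> \<gamma> i x)) \<and>
     Hausdorff_space (underlying_space M) \<and> second_countable (underlying_space M)"

text \<open>
  The row index of the Jacobi matrix is that of the left derivative: by the chain rule
  \<open>\<partial>\<^sub>i = (\<partial>\<^sub>i x'\<^sup>p) \<partial>'\<^sub>p\<close>, Jacobi matrices, hence Berezinians, are then multiplicative.
\<close>

definition log_J :: "'c superatlas \<Rightarrow> 'c \<Rightarrow> 'c \<Rightarrow> superfun" where
  "log_J M \<alpha> \<beta> x = gln (odds M)
     (gabs (berezinian (evens M) (odds M) (\<lambda>i j. pd M i (change M \<alpha> \<beta> j) x)))"

text \<open>
  The supermanifold with the additional even coordinate \<open>x\<^sup>0\<close>; \<open>base x\<close> is the projection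
  of a point of its charts to the charts of \<open>M\<close>.
\<close>

definition base :: "point \<Rightarrow> point" where
  "base x = x(0 := 0)"

definition thomas_space :: "'c superatlas \<Rightarrow> 'c superatlas" where
  "thomas_space M = \<lparr>
     evens = insert 0 (evens M),
     odds = odds M,
     charts = charts M,
     chart_dom = (\<lambda>\<alpha>. {x. base x \<in> chart_dom M \<alpha>}),
     overlap = (\<lambda>\<alpha> \<beta>. {x. base x \<in> overlap M \<alpha> \<beta>}),
     change = (\<lambda>\<alpha> \<beta> i x. if i = 0 then of_real (x 0) + log_J M \<alpha> \<beta> (base x)
                            else change M \<alpha> \<beta> i (base x)) \<rparr>"


section \<open>Connections\<close>

text \<open>\<open>\<Gamma> \<alpha> k i j\<close> is the coefficient \<open>\<Gamma>\<^sup>k\<^sub>i\<^sub>j\<close> in the chart \<open>\<alpha>\<close>.\<close>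

type_synonym 'c coeffs = "'c \<Rightarrow> nat \<Rightarrow> nat \<Rightarrow> nat \<Rightarrow> superfun"

text \<open>
  The transformation law is obtained from \<open>\<nabla>\<^sub>i \<partial>\<^sub>j = \<Gamma>\<^sup>k\<^sub>i\<^sub>j \<partial>\<^sub>k\<close> by substituting \<open>\<partial>\<^sub>i = (\<partial>\<^sub>i x'\<^sup>p) \<partial>'\<^sub>p\<close> and comparing
  the coefficients of \<open>\<partial>'\<^sub>r\<close>: by the Leibniz rule
  \<open>\<nabla>\<^sub>i ((\<partial>\<^sub>j x'\<^sup>q) \<partial>'\<^sub>q) = (\<partial>\<^sub>i \<partial>\<^sub>j x'\<^sup>q) \<partial>'\<^sub>q + (\<partial>\<^sub>i x'\<^sup>p) (-1)\<^bsup>p(j+q)\<^esup> (\<partial>\<^sub>j x'\<^sup>q) \<nabla>'\<^sub>p \<partial>'\<^sub>q\<close>, where indices in exponents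
  stand for parities.
\<close>

definition linear_connection :: "'c superatlas \<Rightarrow> 'c coeffs \<Rightarrow> bool" where
  "linear_connection M \<Gamma> \<longleftrightarrow>
     (\<forall>\<alpha>\<in>charts M. \<forall>i\<in>indices M. \<forall>j\<in>indices M. \<forall>k\<in>indices M.
        superfunction (evens M) (odds M) (chart_dom M \<alpha>) (par M i + par M j + par M k) (\<Gamma> \<alpha> k i j)) \<and>
     (\<forall>\<alpha>\<in>charts M. \<forall>\<beta>\<in>charts M. \<forall>x\<in>overlap M \<alpha> \<beta>. \<forall>i\<in>indices M. \<forall>j\<in>indices M. \<forall>r\<in>indices M.
        (\<Sum>k\<in>indices M. \<Gamma> \<alpha> k i j x * pd M k (change M \<alpha> \<beta> r) x) =
        pd M i (pd M j (change M \<alpha> \<beta> r)) x +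
        (\<Sum>p\<in>indices M. \<Sum>q\<in>indices M.
           (-1) ^ (par M p * (par M j + par M q)) *
           pd M i (change M \<alpha> \<beta> p) x * pd M j (change M \<alpha> \<beta> q) x *
           pullback M \<alpha> \<beta> (\<Gamma> \<beta> r p q) x))"

definition symmetric_connection :: "'c superatlas \<Rightarrow> 'c coeffs \<Rightarrow> bool" where
  "symmetric_connection M \<Gamma> \<longleftrightarrow> linear_connection M \<Gamma> \<and>
     (\<forall>\<alpha>\<in>charts M. \<forall>x\<in>chart_dom M \<alpha>. \<forall>i\<in>indices M. \<forall>j\<in>indices M. \<forall>k\<in>indices M.
        \<Gamma> \<alpha> k i j x = (-1) ^ (par M i * par M j) * \<Gamma> \<alpha> k j i x)"

text \<open>The superdimension \<open>n - m\<close>.\<close>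

definition sdim :: "'c superatlas \<Rightarrow> real" where
  "sdim M = real (card (evens M)) - real (card (odds M))"

definition kron :: "nat \<Rightarrow> nat \<Rightarrow> grassmann" where
  "kron i j = (if i = j then 1 else 0)"

definition projective_coeffs :: "'c superatlas \<Rightarrow> 'c coeffs \<Rightarrow> 'c coeffs" where
  "projective_coeffs M \<Gamma> \<alpha> k j i x =
     \<Gamma> \<alpha> k j i x - (1 / (sdim M + 1)) *\<^sub>R
       (\<Sum>s\<in>indices M. \<Gamma> \<alpha> s j s x * kron k i * (-1) ^ par M s +
                     \<Gamma> \<alpha> s i s x * kron k j * (-1) ^ (par M i * par M j + par M s))"

text \<open>A projective class is represented by the coefficients common to its members.\<close>

definition projective_class :: "'c superatlas \<Rightarrow> 'c coeffs \<Rightarrow> bool" where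
  "projective_class M P \<longleftrightarrow> (\<exists>\<Gamma>. symmetric_connection M \<Gamma> \<and>
     (\<forall>\<alpha>\<in>charts M. \<forall>x\<in>chart_dom M \<alpha>. \<forall>i\<in>indices M. \<forall>j\<in>indices M. \<forall>k\<in>indices M.
        P \<alpha> k j i x = projective_coeffs M \<Gamma> \<alpha> k j i x))"

definition thomas_coeffs :: "'c superatlas \<Rightarrow> 'c coeffs \<Rightarrow> 'c coeffs" where
  "thomas_coeffs M P \<alpha> c a b x =
     (if a = 0 then - (1 / (sdim M + 1)) *\<^sub>R kron c b
      else if b = 0 then - (1 / (sdim M + 1)) *\<^sub>R kron c a
      else if c = 0 then
        ((sdim M + 1) / (sdim M - 1)) *\<^sub>R
          (\<Sum>q\<in>indices M.
             (pd M q (P \<alpha> q a b) (base x) -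
              (\<Sum>p\<in>indices M. P \<alpha> p q a (base x) * P \<alpha> q p b (base x))) *
             (-1) ^ (par M q * (1 + par M a + par M b)))
      else P \<alpha> c a b (base x))"

end

theory Submission
  imports Defs "HOL-Combinatorics.Permutations"
begin

text \<open>
  Write \<open>\<lambda>\<^sub>i = \<partial>\<^sub>i log J\<close> and \<open>c = 1 / (n - m + 1)\<close>.  By the derivative of the Berezinian, the
  trace \<open>\<Gamma>\<^sup>s\<^sub>i\<^sub>s (-1)\<^sup>s\<close> of a connection transforms like a covector up to the summand \<open>\<lambda>\<^sub>i\<close>.  Hence the symmetric
  coefficients \<open>G\<close> that arise from \<open>\<Pi>\<close> by adding \<open>c \<lambda>\<^sub>i \<delta>\<^sup>k\<^sub>j\<close> and its symmetric counterpart obey the law of a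
  connection with respect to the \<open>\<Pi>\<close> of the new chart; this is the law for \<open>\<Gamma>\<^sup>r\<^sub>i\<^sub>j\<close>, \<open>r \<ge> 1\<close>, on the
  extended space.  For \<open>r = 0\<close> one compares Ricci tensors.  As \<open>\<Pi>\<close> is traceless, its Ricci tensor is the expression
  \<open>(\<partial>\<^sub>q \<Pi>\<^sup>q\<^sub>j\<^sub>i - \<Pi>\<^sup>p\<^sub>q\<^sub>j \<Pi>\<^sup>q\<^sub>p\<^sub>i) (-1)\<close> to the power \<open>q (1 + i + j)\<close> of the statement, and the Ricci tensor of \<open>G\<close> is
  this expression minus \<open>(n - m - 1) (c \<partial>\<^sub>i \<lambda>\<^sub>j - c \<Pi>\<^sup>k\<^sub>i\<^sub>j \<lambda>\<^sub>k - c\<^sup>2 \<lambda>\<^sub>i \<lambda>\<^sub>j)\<close>.  By the law for \<open>G\<close> it equals the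
  transform of the Ricci tensor of the new \<open>\<Pi>\<close>; multiplication by \<open>(n - m + 1) / (n - m - 1)\<close> gives the
  law for \<open>\<Gamma>\<^sup>0\<^sub>i\<^sub>j\<close>.
\<close>

section \<open>Signs and homogeneous elements\<close>

text \<open>The coefficients \<open>- kron c a / (n - m + 1)\<close> fit the cocycle
  \<open>log J\<close>: in the law for an upper index \<open>r\<close> different from 0, the terms
  with exactly one of \<open>p\<close>, \<open>q\<close> equal to 0 contribute \<open>- c\<close>
  times \<open>lambda_i J_j^r\<close> and its symmetric counterpart; moved to the left they turn the
  projective coefficients into \<open>G\<close>. For \<open>r = 0\<close> the Jacobi entry is
  \<open>lambda_i\<close>, and the law relates \<open>d lambda\<close>, \<open>Pi lambda\<close> and
  \<open>lambda lambda\<close> in just the combination that occurs in the Ricci tensor of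
  \<open>G\<close>; the factor \<open>(n - m + 1) / (n - m - 1)\<close> normalises its coefficient.
  Analysis enters only through the Leibniz rule, the chain rule for substituted superfunctions, the
  symmetry of second derivatives and the derivative of \<open>log J\<close>. The curvature
  computations are then identities between Grassmann elements at a point, with values and
  derivatives as separate data. The laws are kept multiplied by the Jacobi matrix, so that no
  derivative of its inverse occurs in them. The obstacle is that Jacobi matrices have odd entries:
  determinants are available only for even blocks and for bodies, and the rest of each inversion
  argument rests on nilpotency.\<close>

lemma minus_one_power_cong: "even a = even b \<Longrightarrow> (-1::'a::ring_1) ^ a = (-1) ^ b"
  by (cases "even a") auto

lemma minus_one_power_scaleR: "((-1)::'a::real_algebra_1) ^ n = ((-1) ^ n) *\<^sub>R 1"
  by (cases "even n") auto

lemma gcoeff_simps [simp]: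
  "gcoeff 0 I = 0" "gcoeff (a + b) I = gcoeff a I + gcoeff b I"
  "gcoeff (a - b) I = gcoeff a I - gcoeff b I" "gcoeff (- a) I = - gcoeff a I"
  "gcoeff (r *\<^sub>R a) I = r * gcoeff a I" "gcoeff 1 I = (if I = {} then 1 else 0)"
  by (simp_all add: zero_grassmann.rep_eq plus_grassmann.rep_eq minus_grassmann.rep_eq
      uminus_grassmann.rep_eq scaleR_grassmann.rep_eq one_grassmann.rep_eq)

lemma gcoeff_of_real [simp]: "gcoeff (of_real r) I = (if I = {} then r else 0)"
  by (simp add: of_real_def)

lemma gcoeff_sum [simp]: "gcoeff (sum f A) I = (\<Sum>x\<in>A. gcoeff (f x) I)"
  by (induction A rule: infinite_finite_induct) simp_all

lemma gcoeff_infinite [simp]: "infinite I \<Longrightarrow> gcoeff a I = 0"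
  using gcoeff[of a] by simp

lemma gcoeff_mult: "gcoeff (a * b) K = (\<Sum>I\<in>Pow K. koszul I (K - I) * gcoeff a I * gcoeff b (K - I))"
  by (simp add: times_grassmann.rep_eq)

lemma koszul_square [simp]: "koszul I J * koszul I J = 1"
  by (simp add: koszul_def power_mult_distrib[symmetric])

lemma koszul_square_left [simp]: "koszul I J * (koszul I J * r) = r"
  by (simp add: mult.assoc[symmetric])

text \<open>As \<open>I\<close> and \<open>J\<close> are disjoint, each pair is inverted in exactly
  one of the two orders, so the two inversion counts add up to
  \<open>card I * card J\<close>.\<close>

lemma koszul_swap:
  assumes "finite I" "finite J" "I \<inter> J = {}"
  shows "koszul J I = (-1) ^ (card I * card J) * koszul I J"
proof -
  let ?P = "{(i, j). i \<in> I \<and> j \<in> J \<and> j < i}" and ?Q = "{(j, i). j \<in> J \<and> i \<in> I \<and> i < j}"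
  have fin: "finite ?P"
    by (rule finite_subset[of _ "I \<times> J"]) (use assms in auto)
  have fin': "finite ?Q"
    by (rule finite_subset[of _ "J \<times> I"]) (use assms in auto)
  have "I \<times> J = ?P \<union> prod.swap ` ?Q"
    using assms(3) by (auto simp: image_iff)
  then have "card (I \<times> J) = card (?P \<union> prod.swap ` ?Q)" by simp
  also have "\<dots> = card ?P + card (prod.swap ` ?Q)"
    by (rule card_Un_disjoint[OF fin finite_imageI[OF fin']]) auto
  also have "card (prod.swap ` ?Q) = card ?Q" by (rule card_image) simp
  finally have *: "card I * card J = card ?P + card ?Q" by (simp only: card_cartesian_product)
  have "(-1::real) ^ (a + b) * (-1) ^ a = (-1) ^ b" for a b :: nat
    by (cases "even a"; cases "even b") auto
  then show ?thesis unfolding koszul_def * by simp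
qed

text \<open>Only \<open>p\<close> modulo 2 matters, and 0 is homogeneous for every \<open>p\<close>.
  The generator set \<open>D\<close> is carried along because it bounds the order of
  nilpotency.\<close>

definition homog :: "nat set \<Rightarrow> nat \<Rightarrow> grassmann \<Rightarrow> bool" where
  "homog D p a \<longleftrightarrow> (\<forall>I. gcoeff a I \<noteq> 0 \<longrightarrow> I \<subseteq> D \<and> (even (card I) \<longleftrightarrow> even p))"

lemma homogD: "homog D p a \<Longrightarrow> gcoeff a I \<noteq> 0 \<Longrightarrow> I \<subseteq> D"
  "homog D p a \<Longrightarrow> gcoeff a I \<noteq> 0 \<Longrightarrow> even (card I) \<longleftrightarrow> even p"
  by (auto simp: homog_def)

lemma homog_cong: "even p = even q \<Longrightarrow> homog D p a \<longleftrightarrow> homog D q a"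
  by (simp add: homog_def)

lemma homog_0 [simp]: "homog D p 0"
  by (simp add: homog_def)

lemma homog_of_real [simp]: "homog D 0 (of_real r)"
  by (simp add: homog_def)

lemma homog_1 [simp]: "homog D 0 1"
  by (simp add: homog_def)

lemma homog_add: "homog D p a \<Longrightarrow> homog D p b \<Longrightarrow> homog D p (a + b)"
  by (auto simp: homog_def) (metis add_eq_0_iff subsetD add.right_neutral)+

lemma homog_scaleR: "homog D p a \<Longrightarrow> homog D p (r *\<^sub>R a)"
  by (auto simp: homog_def)

lemma homog_minus: "homog D p a \<Longrightarrow> homog D p (- a)"
  by (auto simp: homog_def)

lemma homog_diff: "homog D p a \<Longrightarrow> homog D p b \<Longrightarrow> homog D p (a - b)"
  using homog_add[of D p a "- b"] by (simp add: homog_minus)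

lemma homog_sum: "(\<And>x. x \<in> A \<Longrightarrow> homog D p (f x)) \<Longrightarrow> homog D p (sum f A)"
  by (induction A rule: infinite_finite_induct) (auto intro: homog_add)

lemma homog_mult:
  assumes "homog D p a" "homog D q b"
  shows "homog D (p + q) (a * b)"
  unfolding homog_def
proof (intro allI impI)
  fix K assume nz: "gcoeff (a * b) K \<noteq> 0"
  then have fin: "finite K" using gcoeff_infinite[of K "a * b"] by blast
  obtain I where I: "I \<subseteq> K" "gcoeff a I \<noteq> 0" "gcoeff b (K - I) \<noteq> 0"
  proof -
    have "\<exists>I\<in>Pow K. koszul I (K - I) * gcoeff a I * gcoeff b (K - I) \<noteq> 0"
      using nz sum.neutral unfolding gcoeff_mult by (metis (no_types, lifting))
    then show ?thesis using that by auto
  qed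
  have "card K = card I + card (K - I)"
    using I(1) fin by (metis card_Diff_subset card_mono finite_subset le_add_diff_inverse)
  then show "K \<subseteq> D \<and> (even (card K) \<longleftrightarrow> even (p + q))"
    using homogD[OF assms(1) I(2)] homogD[OF assms(2) I(3)] by auto
qed

text \<open>Reindexing the coefficient sum by complements exchanges the factors.
  \<open>koszul_swap\<close> gives each term the sign \<open>(-1) ^ (card I * card (K - I))\<close>,
  which is the same for all terms that do not vanish.\<close>

lemma grassmann_supercommute:
  assumes "homog D p a" "homog D q b"
  shows "a * b = (-1) ^ (p * q) *\<^sub>R (b * a)"
proof (rule grassmann_eqI)
  fix K
  show "gcoeff (a * b) K = gcoeff ((-1) ^ (p * q) *\<^sub>R (b * a)) K"
  proof (cases "finite K")
    case True
    have "gcoeff (a * b) K = (\<Sum>I\<in>Pow K. koszul (K - I) I * gcoeff a (K - I) * gcoeff b I)"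
      unfolding gcoeff_mult
      by (rule sum.reindex_bij_witness[where i = "\<lambda>I. K - I" and j = "\<lambda>I. K - I"])
         (auto simp: double_diff)
    also have "\<dots> = (\<Sum>I\<in>Pow K. (-1) ^ (p * q) * (koszul I (K - I) * gcoeff b I * gcoeff a (K - I)))"
    proof (rule sum.cong[OF refl])
      fix I assume I: "I \<in> Pow K"
      show "koszul (K - I) I * gcoeff a (K - I) * gcoeff b I =
        (-1) ^ (p * q) * (koszul I (K - I) * gcoeff b I * gcoeff a (K - I))"
      proof (cases "gcoeff a (K - I) = 0 \<or> gcoeff b I = 0")
        case False
        then have "even (card (K - I)) = even p" "even (card I) = even q"
          using homogD[OF assms(1)] homogD[OF assms(2)] by auto
        then have "(-1::real) ^ (card I * card (K - I)) = (-1) ^ (p * q)"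
          by (intro minus_one_power_cong) auto
        moreover have "koszul (K - I) I = (-1) ^ (card I * card (K - I)) * koszul I (K - I)"
          by (rule koszul_swap) (use I True in \<open>auto intro: finite_subset\<close>)
        ultimately show ?thesis by (simp add: mult_ac)
      qed auto
    qed
    finally show ?thesis by (simp add: gcoeff_mult sum_distrib_left)
  qed simp
qed

lemma homog_even_commute:
  assumes "homog D 0 a"
  shows "a * b = b * a"
proof -
  \<comment> \<open>\<open>b\<close> is arbitrary, so it is split into its even and odd parts, each
    of which commutes with \<open>a\<close>. Its monomials may use generators outside
    \<open>D\<close>, hence the passage to \<open>UNIV\<close>.\<close>
  define part where "part p = Abs_grassmann (\<lambda>I. if even (card I) = even p then gcoeff b I else 0)" for p :: nat
  have coeff: "gcoeff (part p) I = (if even (card I) = even p then gcoeff b I else 0)" for p I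
    unfolding part_def by (subst Abs_grassmann_inverse) auto
  define D' where "D' = (UNIV :: nat set)"
  have a: "homog D' 0 a" using assms by (auto simp: homog_def D'_def)
  have "b = part 0 + part 1" by (rule grassmann_eqI) (auto simp: coeff)
  moreover have "a * part p = part p * a" for p
    using grassmann_supercommute[OF a, of p "part p"] by (auto simp: homog_def coeff D'_def)
  ultimately show ?thesis by (simp only: distrib_left distrib_right)
qed

section \<open>The left derivatives\<close>

text \<open>With the sign written as a Koszul sign, multiplicativity of \<open>koszul\<close> takes
  care of the signs in the derivation rules below.\<close>

lemma gcoeff_godd_deriv:
  "gcoeff (godd_deriv i a) I = (if i \<in> I then 0 else koszul {i} I * gcoeff a (insert i I))"
proof -
  have "{(k, j). k \<in> {i} \<and> j \<in> I \<and> j < k} = Pair i ` {j \<in> I. j < i}" by auto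
  then have "card {(k, j). k \<in> {i} \<and> j \<in> I \<and> j < k} = card {j \<in> I. j < i}"
    by (simp add: card_image inj_on_def)
  then show ?thesis by (simp add: godd_deriv.rep_eq koszul_def)
qed

lemma godd_deriv_linear:
  "godd_deriv i (a + b) = godd_deriv i a + godd_deriv i b"
  "godd_deriv i (r *\<^sub>R a) = r *\<^sub>R godd_deriv i a" "godd_deriv i 0 = 0"
  by (rule grassmann_eqI; simp add: gcoeff_godd_deriv algebra_simps)+

lemma godd_deriv_gvar: "godd_deriv i (gvar j) = (if i = j then 1 else 0)"
  by (rule grassmann_eqI) (auto simp: gcoeff_godd_deriv gvar.rep_eq)

lemma godd_deriv_of_real: "godd_deriv i (of_real r) = 0"
  by (rule grassmann_eqI) (auto simp: gcoeff_godd_deriv)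

lemma homog_godd_deriv:
  assumes "homog D p a"
  shows "homog D (Suc p) (godd_deriv i a)"
  unfolding homog_def
proof (intro allI impI)
  fix I assume "gcoeff (godd_deriv i a) I \<noteq> 0"
  then have *: "i \<notin> I" "gcoeff a (insert i I) \<noteq> 0" by (auto simp: gcoeff_godd_deriv split: if_splits)
  then have "finite I" using gcoeff_infinite finite_insert by metis
  then show "I \<subseteq> D \<and> (even (card I) \<longleftrightarrow> even (Suc p))"
    using homogD[OF assms *(2)] *(1) by auto
qed

lemma koszul_singletons: "i \<noteq> j \<Longrightarrow> koszul {i} {j} = - koszul {j} {i}"
  using koszul_swap[of "{j}" "{i}"] by simp

lemma koszul_insert_left: "finite I \<Longrightarrow> finite J \<Longrightarrow> i \<notin> I \<Longrightarrow> koszul (insert i I) J = koszul {i} J * koszul I J"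
  using koszul_Un_left[of "{i}" I J] by simp

lemma koszul_insert_right: "finite I \<Longrightarrow> finite J \<Longrightarrow> j \<notin> J \<Longrightarrow> koszul I (insert j J) = koszul I {j} * koszul I J"
  using koszul_Un_right[of I "{j}" J] by simp

lemma godd_deriv_anticommute: "godd_deriv i (godd_deriv j a) = - godd_deriv j (godd_deriv i a)"
proof (rule grassmann_eqI)
  fix I
  show "gcoeff (godd_deriv i (godd_deriv j a)) I = gcoeff (- godd_deriv j (godd_deriv i a)) I"
  proof (cases "finite I \<and> i \<notin> I \<and> j \<notin> I \<and> i \<noteq> j")
    case True
    then show ?thesis
      using koszul_insert_right[of I "{j}" i] koszul_insert_right[of "{i}" I j] koszul_insert_right[of "{j}" I i]
      by (simp add: gcoeff_godd_deriv koszul_singletons[of i j] insert_commute)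
  qed (auto simp: gcoeff_godd_deriv)
qed

lemma godd_deriv_mult:
  assumes "homog D p a"
  shows "godd_deriv i (a * b) = godd_deriv i a * b + (-1) ^ p *\<^sub>R (a * godd_deriv i b)"
proof (rule grassmann_eqI)
  fix K
  show "gcoeff (godd_deriv i (a * b)) K = gcoeff (godd_deriv i a * b + (-1) ^ p *\<^sub>R (a * godd_deriv i b)) K"
  proof (cases "finite K")
    case True
    note fin = finite_subset[OF _ True]
    show ?thesis
    proof (cases "i \<in> K")
      case iK: True
      let ?s = "\<lambda>I. koszul I (K - I) * gcoeff (godd_deriv i a) I * gcoeff b (K - I)"
      let ?t = "\<lambda>I. koszul I (K - I) * gcoeff a I * gcoeff (godd_deriv i b) (K - I)"
      \<comment> \<open>the terms with \<open>i \<in> I\<close> of the second sum cancel those with \<open>i \<notin> I\<close> of the first\<close>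
      have "(\<Sum>I\<in>Pow K. ?s I) = (\<Sum>I\<in>{I \<in> Pow K. i \<notin> I}. ?s I)"
        by (rule sum.mono_neutral_right) (auto simp: True gcoeff_godd_deriv)
      also have "\<dots> = (\<Sum>I\<in>{I \<in> Pow K. i \<in> I}. - ((-1) ^ p * ?t I))"
      proof (rule sum.reindex_bij_witness[where i = "\<lambda>I. I - {i}" and j = "insert i"])
        fix I assume "I \<in> {I \<in> Pow K. i \<notin> I}"
        then have I: "I \<subseteq> K" "i \<notin> I" by auto
        define J where "J = K - insert i I"
        have J: "K - I = insert i J" "i \<notin> J" "finite J" "finite I"
          using I iK True fin by (auto simp: J_def)
        have "koszul I {i} = (-1) ^ card I * koszul {i} I"
          using koszul_swap[of "{i}" I] I J by simp
        moreover have "(-1::real) ^ card I = - ((-1) ^ p)" if "gcoeff a (insert i I) \<noteq> 0"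
          using homogD(2)[OF assms that] I J by (cases "even p") auto
        ultimately show "- ((-1) ^ p * ?t (insert i I)) = ?s I"
          using I J koszul_insert_left[of I J i] koszul_insert_right[of I J i]
          by (cases "gcoeff a (insert i I) = 0")
             (simp_all add: gcoeff_godd_deriv J_def[symmetric] mult_ac)
      qed (use iK in auto)
      also have "\<dots> = - ((-1) ^ p * (\<Sum>I\<in>{I \<in> Pow K. i \<in> I}. ?t I))"
        by (simp add: sum_negf sum_distrib_left)
      also have "(\<Sum>I\<in>{I \<in> Pow K. i \<in> I}. ?t I) = (\<Sum>I\<in>Pow K. ?t I)"
        by (rule sum.mono_neutral_left) (auto simp: True gcoeff_godd_deriv iK)
      finally show ?thesis using iK by (simp add: gcoeff_godd_deriv[of i "a * b"] gcoeff_mult)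
    next
      case iK: False
      \<comment> \<open>The coefficient at \<open>insert i K\<close> is a sum over subsets without
        and with \<open>i\<close>: the former yield the derivative of \<open>b\<close>, with the
        sign of passing the generator over \<open>a\<close>, the latter the derivative of
        \<open>a\<close>.\<close>
      let ?f = "\<lambda>I. koszul I (insert i K - I) * gcoeff a I * gcoeff b (insert i K - I)"
      have "gcoeff (a * b) (insert i K) = sum ?f (Pow K \<union> insert i ` Pow K)"
        unfolding gcoeff_mult by (simp add: Pow_insert)
      also have "\<dots> = sum ?f (Pow K) + sum ?f (insert i ` Pow K)"
        by (rule sum.union_disjoint) (use True iK in auto)
      also have "sum ?f (insert i ` Pow K) = (\<Sum>I\<in>Pow K. ?f (insert i I))"
        by (subst sum.reindex) (use iK in \<open>auto simp: inj_on_def o_def insert_ident subset_eq\<close>)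
      finally have "gcoeff (a * b) (insert i K) = sum ?f (Pow K) + (\<Sum>I\<in>Pow K. ?f (insert i I))" .
      moreover have "koszul {i} K * (sum ?f (Pow K) + (\<Sum>I\<in>Pow K. ?f (insert i I))) =
        (\<Sum>I\<in>Pow K. koszul I (K - I) * gcoeff (godd_deriv i a) I * gcoeff b (K - I)
          + (-1) ^ p * (koszul I (K - I) * gcoeff a I * gcoeff (godd_deriv i b) (K - I)))"
        unfolding sum.distrib[symmetric] sum_distrib_left
      proof (rule sum.cong[OF refl])
        fix I assume "I \<in> Pow K"
        define J where "J = K - I"
        have J: "K = I \<union> J" "I \<inter> J = {}" "i \<notin> I" "i \<notin> J" "finite I" "finite J"
          using \<open>I \<in> Pow K\<close> iK True fin by (auto simp: J_def)
        have JJ: "insert i K - I = insert i J" "insert i K - insert i I = J"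
          using J by auto
        have k1: "koszul {i} K = koszul {i} I * koszul {i} J"
          using koszul_Un_right[of "{i}" I J] J by simp
        have k2: "koszul I {i} = (-1) ^ card I * koszul {i} I"
          using koszul_swap[of "{i}" I] J by simp
        have "(-1::real) ^ card I = (-1) ^ p" if "gcoeff a I \<noteq> 0"
          using homogD(2)[OF assms that] by (intro minus_one_power_cong) auto
        then show "koszul {i} K * (?f I + ?f (insert i I)) =
          koszul I (K - I) * gcoeff (godd_deriv i a) I * gcoeff b (K - I) +
          (-1) ^ p * (koszul I (K - I) * gcoeff a I * gcoeff (godd_deriv i b) (K - I))"
          using J koszul_insert_left[of I J i] koszul_insert_right[of I J i]
          unfolding JJ J_def[symmetric] k1
          by (cases "gcoeff a I = 0") (simp_all add: gcoeff_godd_deriv k2 distrib_left mult_ac)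
      qed
      ultimately show ?thesis
        using iK by (simp add: gcoeff_godd_deriv[of i "a * b"] gcoeff_mult[of "godd_deriv i a"]
            gcoeff_mult[of a] sum.distrib sum_distrib_left)
    qed
  qed simp
qed

section \<open>The degree filtration\<close>

text \<open>The \<open>k\<close>-th power of the ideal generated by the odd generators in the
  algebra on \<open>D\<close>. Degrees add under products and nothing survives above
  \<open>card D\<close>; this justifies the truncation of the Taylor, logarithmic and Neumann
  series.\<close>

definition deg_ge :: "nat set \<Rightarrow> nat \<Rightarrow> grassmann \<Rightarrow> bool" where
  "deg_ge D k a \<longleftrightarrow> (\<forall>I. gcoeff a I \<noteq> 0 \<longrightarrow> I \<subseteq> D \<and> k \<le> card I)"

lemma deg_ge_0: "homog D p a \<Longrightarrow> deg_ge D 0 a"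
  by (auto simp: deg_ge_def homog_def)

lemma deg_ge_1: "homog D p a \<Longrightarrow> gbody a = 0 \<Longrightarrow> finite D \<Longrightarrow> deg_ge D 1 a"
  unfolding deg_ge_def homog_def gbody_def
  by (metis One_nat_def Suc_leI card_gt_0_iff finite_subset)

lemma deg_ge_zero [simp]: "deg_ge D k 0"
  by (simp add: deg_ge_def)

lemma deg_ge_add: "deg_ge D k a \<Longrightarrow> deg_ge D k b \<Longrightarrow> deg_ge D k (a + b)"
  by (auto simp: deg_ge_def) (metis add_eq_0_iff subsetD add.right_neutral)+

lemma deg_ge_scaleR: "deg_ge D k a \<Longrightarrow> deg_ge D k (r *\<^sub>R a)"
  by (auto simp: deg_ge_def)

lemma deg_ge_sum: "(\<And>x. x \<in> A \<Longrightarrow> deg_ge D k (f x)) \<Longrightarrow> deg_ge D k (sum f A)"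
  by (induction A rule: infinite_finite_induct) (auto intro: deg_ge_add)

lemma deg_ge_mult:
  assumes "deg_ge D k a" "deg_ge D l b"
  shows "deg_ge D (k + l) (a * b)"
  unfolding deg_ge_def
proof (intro allI impI)
  fix K assume nz: "gcoeff (a * b) K \<noteq> 0"
  then have fin: "finite K" using gcoeff_infinite[of K "a * b"] by blast
  have "\<exists>I\<in>Pow K. koszul I (K - I) * gcoeff a I * gcoeff b (K - I) \<noteq> 0"
    using nz sum.neutral unfolding gcoeff_mult by (metis (no_types, lifting))
  then obtain I where I: "I \<subseteq> K" "gcoeff a I \<noteq> 0" "gcoeff b (K - I) \<noteq> 0" by auto
  have "card K = card I + card (K - I)"
    using I(1) fin by (metis card_Diff_subset card_mono finite_subset le_add_diff_inverse)
  then show "K \<subseteq> D \<and> k + l \<le> card K"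
    using assms I unfolding deg_ge_def by fastforce
qed

lemma deg_ge_vanish: "deg_ge D k a \<Longrightarrow> finite D \<Longrightarrow> card D < k \<Longrightarrow> a = 0"
  unfolding deg_ge_def by (rule grassmann_eqI) (metis card_mono gcoeff_simps(1) leD le_trans)

lemma gbody_simps [simp]:
  "gbody 0 = 0" "gbody 1 = 1" "gbody (of_real r) = r" "gbody (a + b) = gbody a + gbody b"
  "gbody (a - b) = gbody a - gbody b" "gbody (- a) = - gbody a" "gbody (r *\<^sub>R a) = r * gbody a"
  "gbody (a * b) = gbody a * gbody b" "gbody (sum f A) = (\<Sum>x\<in>A. gbody (f x))"
  by (simp_all add: gbody_def gcoeff_mult)

lemma gbody_odd: "homog D p a \<Longrightarrow> odd p \<Longrightarrow> gbody a = 0"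
  unfolding homog_def gbody_def by (metis card.empty even_zero)

section \<open>Ordered products\<close>

definition oprod :: "(nat \<Rightarrow> grassmann) \<Rightarrow> nat set \<Rightarrow> grassmann" where
  "oprod f I = prod_list (map f (sorted_list_of_set I))"

lemma oprod_empty [simp]: "oprod f {} = 1"
  by (simp add: oprod_def)

lemma oprod_insert_less:
  assumes "finite I" "\<And>j. j \<in> I \<Longrightarrow> i < j"
  shows "oprod f (insert i I) = f i * oprod f I"
proof -
  have "i \<notin> I" using assms by auto
  moreover have "Min (insert i I) = i"
    using assms by (intro Min_eqI) (auto intro: less_imp_le)
  ultimately show ?thesis
    using assms sorted_list_of_set_nonempty[of "insert i I"] by (simp add: oprod_def)
qed

text \<open>Peels off the least index, that is, the first factor of an ordered product.\<close>

lemma finite_min_induct [consumes 1, case_names empty insert]: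
  fixes I :: "nat set"
  assumes "finite I" "P {}"
    "\<And>i J. finite J \<Longrightarrow> (\<And>j. j \<in> J \<Longrightarrow> i < j) \<Longrightarrow> P J \<Longrightarrow> P (insert i J)"
  shows "P I"
  using assms(1)
proof (induction "card I" arbitrary: I)
  case 0 then show ?case using assms(2) by simp
next
  case (Suc n)
  let ?i = "Min I"
  have i: "?i \<in> I" using Suc by (metis Min_in card.empty nat.distinct(1))
  then have "P (I - {?i})" using Suc by simp
  moreover have "?i < j" if "j \<in> I - {?i}" for j
    using that Suc.prems by (simp add: order.not_eq_order_implies_strict)
  ultimately have "P (insert ?i (I - {?i}))" using Suc.prems by (intro assms(3)) auto
  then show ?case using i by (simp add: insert_absorb)
qed

text \<open>\<open>f i\<close> moves right past the smaller factors, with one sign for each, until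
  it reaches its place; if it meets itself the product vanishes, because an odd element squares to
  0.\<close>

lemma mult_oprod:
  assumes "finite I" "homog D 1 (f i)" "\<And>j. j \<in> I \<Longrightarrow> homog D 1 (f j)"
  shows "f i * oprod f I = (if i \<in> I then 0 else koszul {i} I *\<^sub>R oprod f (insert i I))"
  using assms
proof (induction I rule: finite_min_induct)
  case empty then show ?case using oprod_insert_less[of "{}" i f] by simp
next
  case (insert j J)
  have j: "j \<notin> J" using insert by auto
  have anti: "f i * f k = - (f k * f i)" if "homog D 1 (f k)" for k
    using grassmann_supercommute[OF insert.prems(1) that] by simp
  have sq: "f i * f i = 0"
  proof -
    have "f i * f i + f i * f i = 0" using anti[OF insert.prems(1)] by (simp add: eq_neg_iff_add_eq_0)
    then have "2 *\<^sub>R (f i * f i) = 0" by (simp add: scaleR_2)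
    then show ?thesis by simp
  qed
  consider "i = j" | "i < j" | "j < i" by linarith
  then show ?case
  proof cases
    case 1
    then show ?thesis using oprod_insert_less[OF insert.hyps(1,2), of f] sq by (simp flip: mult.assoc)
  next
    case 2
    then have less: "\<And>k. k \<in> insert j J \<Longrightarrow> i < k" using insert(2) by (auto intro: less_trans)
    moreover have "koszul {i} (insert j J) = 1"
    proof -
      have e: "{(a, b). a \<in> {i} \<and> b \<in> insert j J \<and> b < a} = {}"
        using less by (auto dest: less_asym)
      show ?thesis unfolding koszul_def e by simp
    qed
    moreover have "i \<notin> insert j J" using less by blast
    ultimately show ?thesis using insert.hyps(1) oprod_insert_less[of "insert j J" i f] by simp
  next
    case 3
    have "f i * oprod f (insert j J) = - (f j * (f i * oprod f J))"
      using insert.hyps(1) oprod_insert_less[OF insert.hyps(1,2), of f] anti[OF insert.prems(2)[of j]]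
      by (simp flip: mult.assoc)
    also have "\<dots> = (if i \<in> J then 0 else - koszul {i} J *\<^sub>R (f j * oprod f (insert i J)))"
      using insert.IH[OF insert.prems] by simp
    also have "\<dots> = (if i \<in> insert j J then 0 else koszul {i} (insert j J) *\<^sub>R oprod f (insert i (insert j J)))"
    proof -
      have "f j * oprod f (insert i J) = oprod f (insert j (insert i J))"
        using 3 insert by (subst oprod_insert_less) auto
      moreover have "koszul {i} {j} = -1"
      proof -
        have e: "{(a, b). a \<in> {i} \<and> b \<in> {j} \<and> b < a} = {(i, j)}" using 3 by auto
        show ?thesis unfolding koszul_def e by simp
      qed
      ultimately show ?thesis
        using 3 insert j koszul_insert_right[of "{i}" J j] by (simp add: insert_commute)
    qed
    finally show ?thesis .
  qed
qed

text \<open>Arbitrary odd elements multiply like the monomials in the generators, signs included;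
  this makes substitution multiplicative.\<close>

lemma oprod_mult:
  assumes "finite I" "finite J" "\<And>i. i \<in> I \<union> J \<Longrightarrow> homog D 1 (f i)"
  shows "oprod f I * oprod f J = (if I \<inter> J = {} then koszul I J *\<^sub>R oprod f (I \<union> J) else 0)"
  using assms(1,3)
proof (induction I rule: finite_min_induct)
  case (insert i I)
  have i: "i \<notin> I" using insert by auto
  have ki: "koszul {i} I = 1"
  proof -
    have e: "{(a, b). a \<in> {i} \<and> b \<in> I \<and> b < a} = {}" using insert(2) by auto (metis less_asym)
    show ?thesis unfolding koszul_def e by simp
  qed
  have 1: "oprod f (insert i I) * oprod f J = f i * (oprod f I * oprod f J)"
    by (simp only: oprod_insert_less[OF insert.hyps(1,2)] mult.assoc)
  have 2: "oprod f I * oprod f J = (if I \<inter> J = {} then koszul I J *\<^sub>R oprod f (I \<union> J) else 0)"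
    using insert.prems by (intro insert.IH) auto
  have 3: "f i * oprod f (I \<union> J) = (if i \<in> I \<union> J then 0 else koszul {i} (I \<union> J) *\<^sub>R oprod f (insert i (I \<union> J)))"
    by (rule mult_oprod[where D = D]) (use insert.hyps(1) insert.prems assms(2) in auto)
  show ?case
  proof (cases "I \<inter> J = {}")
    case True
    have "koszul {i} (I \<union> J) = koszul {i} J"
      using koszul_Un_right[of "{i}" I J] True insert.hyps(1) assms(2) ki by simp
    moreover have "koszul (insert i I) J = koszul {i} J * koszul I J"
      using koszul_insert_left i insert.hyps(1) assms(2) by blast
    ultimately show ?thesis
      using True i unfolding 1 2 by (simp add: 3 mult.commute)
  next
    case False
    then show ?thesis unfolding 1 2 by auto
  qed
qed simp

section \<open>Smooth functions\<close>

lemma topspace_coord_space: "topspace (coord_space E) = {x. \<forall>i. i \<notin> E \<longrightarrow> x i = 0}"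
  by (simp add: coord_space_def)

lemma coord_space_box:
  assumes "openin (coord_space E) U" "finite E" "x \<in> U"
  shows "\<exists>d>0. \<forall>y. (\<forall>i. i \<notin> E \<longrightarrow> y i = 0) \<longrightarrow> (\<forall>i\<in>E. \<bar>y i - x i\<bar> < d) \<longrightarrow> y \<in> U"
proof -
  obtain T where T: "open T" "U = {x. \<forall>i. i \<notin> E \<longrightarrow> x i = 0} \<inter> T"
    using assms(1) unfolding coord_space_def openin_open by auto
  obtain X where X: "x \<in> Pi\<^sub>E UNIV X" "\<And>i. open (X i)" "Pi\<^sub>E UNIV X \<subseteq> T"
    using product_topology_open_contains_basis[of "\<lambda>_. euclidean" UNIV T x] T assms(3)
    unfolding open_fun_def by auto
  have "\<exists>d>0. \<forall>t. \<bar>t - x i\<bar> < d \<longrightarrow> t \<in> X i" for i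
    using X(1) open_dist[of "X i"] X(2)[of i] by (auto simp: dist_real_def)
  then obtain d where d: "\<And>i. d i > 0" "\<And>i t. \<bar>t - x i\<bar> < d i \<Longrightarrow> t \<in> X i" by metis
  define e where "e = Min (insert 1 (d ` E))"
  have e: "e > 0" "\<And>i. i \<in> E \<Longrightarrow> e \<le> d i" using assms(2) d by (auto simp: e_def)
  show ?thesis
  proof (intro exI[of _ e] conjI e(1) allI impI)
    fix y :: point assume y: "\<forall>i. i \<notin> E \<longrightarrow> y i = 0" "\<forall>i\<in>E. \<bar>y i - x i\<bar> < e"
    have "y i \<in> X i" for i
    proof (cases "i \<in> E")
      case True then show ?thesis using y(2) e(2) d(2) by (meson less_le_trans)
    next
      case False
      then have "y i = x i" using y(1) assms(3) T(2) by auto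
      then show ?thesis using X(1) by auto
    qed
    then show "y \<in> U" using y(1) X(3) T(2) by auto
  qed
qed

text \<open>The end points are unordered because increments of coordinates may have either
  sign.\<close>

lemma mvt_between:
  assumes "\<And>t. min a b \<le> t \<Longrightarrow> t \<le> max a b \<Longrightarrow> (g has_real_derivative g' t) (at t)"
  shows "\<exists>t. min a b \<le> t \<and> t \<le> max a b \<and> g b - g a = g' t * (b - a)"
proof -
  consider "a < b" | "b < a" | "a = b" by linarith
  then show ?thesis
  proof cases
    case 1
    then obtain t where "a < t" "t < b" "g b - g a = (b - a) * g' t"
      using MVT2[OF 1, of g g'] assms by auto
    then show ?thesis using 1 by (intro exI[of _ t]) auto
  next
    case 2
    then obtain t where "b < t" "t < a" "g a - g b = (a - b) * g' t"
      using MVT2[OF 2, of g g'] assms by auto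
    then show ?thesis using 2 by (intro exI[of _ t]) (auto simp: algebra_simps)
  qed auto
qed

locale open_coord =
  fixes E :: "nat set" and U :: "point set"
  assumes fin_E: "finite E" and open_U: "openin (coord_space E) U"
begin

lemma outside: "x \<in> U \<Longrightarrow> i \<notin> E \<Longrightarrow> x i = 0"
  using openin_subset[OF open_U] topspace_coord_space by auto

lemma eventually_line:
  assumes "x \<in> U" "i \<in> E"
  shows "\<forall>\<^sub>F t in nhds (x i). x(i := t) \<in> U"
proof -
  obtain d where d: "d > 0" "\<And>y. (\<And>i. i \<notin> E \<Longrightarrow> y i = 0) \<Longrightarrow> (\<And>i. i \<in> E \<Longrightarrow> \<bar>y i - x i\<bar> < d) \<Longrightarrow> y \<in> U"
    using coord_space_box[OF open_U fin_E assms(1)] by blast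
  have "x(i := t) \<in> U" if "dist t (x i) < d" for t
    using that d(1) assms outside[OF assms(1)] by (intro d(2)) (auto simp: dist_real_def)
  then show ?thesis unfolding eventually_nhds_metric using d(1) by blast
qed

lemma partial_cong:
  assumes "\<And>y. y \<in> U \<Longrightarrow> f y = g y" "x \<in> U" "i \<in> E"
  shows "partial i f x = partial i g x"
  unfolding partial_def
  by (rule deriv_cong_ev) (use eventually_line[OF assms(2,3)] assms(1) in \<open>auto elim!: eventually_mono\<close>)

lemma partials_cong:
  assumes "\<And>y. y \<in> U \<Longrightarrow> f y = g y" "x \<in> U" "set is \<subseteq> E"
  shows "partials is f x = partials is g x"
  using assms(2,3) by (induction "is" arbitrary: x) (auto intro: assms(1) partial_cong)

lemma differentiable_cong:
  fixes f g :: "point \<Rightarrow> real"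
  assumes "\<And>y. y \<in> U \<Longrightarrow> f y = g y" "x \<in> U" "i \<in> E"
  shows "(\<lambda>t. f (x(i := t))) differentiable (at (x i)) \<longleftrightarrow> (\<lambda>t. g (x(i := t))) differentiable (at (x i))"
proof -
  have ev: "\<forall>\<^sub>F t in nhds (x i). f (x(i := t)) = g (x(i := t))"
    using eventually_line[OF assms(2,3)] assms(1) by (auto elim!: eventually_mono)
  show ?thesis unfolding real_differentiable_def
    using DERIV_cong_ev[OF refl ev refl] by blast
qed

lemma smooth_cong:
  assumes "\<And>y. y \<in> U \<Longrightarrow> f y = g y"
  shows "smooth E U f \<longleftrightarrow> smooth E U g"
proof -
  have *: "smooth E U g" if f: "smooth E U f" and eq: "\<And>y. y \<in> U \<Longrightarrow> f y = g y" for f g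
    unfolding smooth_def
  proof (intro allI impI)
    fix "is" assume sub: "set is \<subseteq> E"
    have eq': "partials is f y = partials is g y" if "y \<in> U" for y
      using partials_cong[OF eq that sub] .
    have "continuous_on U (partials is f)"
      "\<And>x i. x \<in> U \<Longrightarrow> i \<in> E \<Longrightarrow> (\<lambda>t. partials is f (x(i := t))) differentiable (at (x i))"
      using f sub unfolding smooth_def by auto
    then show "continuous_on U (partials is g) \<and>
       (\<forall>x\<in>U. \<forall>i\<in>E. (\<lambda>t. partials is g (x(i := t))) differentiable (at (x i)))"
      using continuous_on_cong[OF refl eq', of U] differentiable_cong[of "partials is f" "partials is g", OF eq']
      by simp
  qed
  show ?thesis using *[of f g] *[of g f] assms by auto
qed

lemma partial_has_derivative:
  assumes "(\<lambda>t. f (x(i := t))) differentiable (at (x i))"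
  shows "((\<lambda>t. f (x(i := t))) has_real_derivative partial i f x) (at (x i))"
  using assms unfolding partial_def real_differentiable_def by (metis DERIV_imp_deriv)

lemma smooth_continuous: "smooth E U f \<Longrightarrow> continuous_on U f"
  unfolding smooth_def by (drule spec[of _ "[]"]) simp

lemma smooth_differentiable:
  "smooth E U f \<Longrightarrow> x \<in> U \<Longrightarrow> i \<in> E \<Longrightarrow> (\<lambda>t. f (x(i := t))) differentiable (at (x i))"
  unfolding smooth_def by (drule spec[of _ "[]"]) simp

lemma smooth_derivative:
  "smooth E U f \<Longrightarrow> x \<in> U \<Longrightarrow> i \<in> E \<Longrightarrow> ((\<lambda>t. f (x(i := t))) has_real_derivative partial i f x) (at (x i))"
  by (intro partial_has_derivative smooth_differentiable)

lemma partial_eqI: "((\<lambda>t. f (x(i := t))) has_real_derivative d) (at (x i)) \<Longrightarrow> partial i f x = d"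
  unfolding partial_def by (rule DERIV_imp_deriv)

lemma smooth_partial:
  assumes "smooth E U f" "i \<in> E"
  shows "smooth E U (partial i f)"
  unfolding smooth_def
proof (intro allI impI)
  fix "is" assume "set is \<subseteq> E"
  then have sub: "set (is @ [i]) \<subseteq> E" using assms(2) by simp
  have eq: "partials is (partial i f) = partials (is @ [i]) f" by simp
  show "continuous_on U (partials is (partial i f)) \<and>
     (\<forall>x\<in>U. \<forall>j\<in>E. (\<lambda>t. partials is (partial i f) (x(j := t))) differentiable (at (x j)))"
    using assms(1) sub unfolding smooth_def eq by blast
qed

text \<open>Avoids formulas for higher derivatives: if each first partial of a member of
  \<open>F\<close> agrees on \<open>U\<close> with a member, then so does each iterated partial, and
  continuity and differentiability are checked on \<open>F\<close> alone.\<close>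

lemma smooth_coinduct:
  assumes "f \<in> F"
    and cont: "\<And>f. f \<in> F \<Longrightarrow> continuous_on U f"
    and diff: "\<And>f x i. f \<in> F \<Longrightarrow> x \<in> U \<Longrightarrow> i \<in> E \<Longrightarrow> (\<lambda>t. f (x(i := t))) differentiable (at (x i))"
    and step: "\<And>f i. f \<in> F \<Longrightarrow> i \<in> E \<Longrightarrow> \<exists>g\<in>F. \<forall>x\<in>U. partial i f x = g x"
  shows "smooth E U f"
proof -
  have *: "\<exists>g\<in>F. \<forall>x\<in>U. partials is f x = g x" if "set is \<subseteq> E" for "is"
    using that
  proof (induction "is")
    case Nil then show ?case using assms(1) by auto
  next
    case (Cons i "is")
    then obtain g where g: "g \<in> F" "\<And>x. x \<in> U \<Longrightarrow> partials is f x = g x" by auto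
    obtain h where h: "h \<in> F" "\<forall>x\<in>U. partial i g x = h x" using step[OF g(1), of i] Cons by auto
    then show ?case using partial_cong[of "partials is f" g, OF g(2)] Cons by auto
  qed
  show ?thesis unfolding smooth_def
  proof (intro allI impI)
    fix "is" assume "set is \<subseteq> E"
    then obtain g where g: "g \<in> F" "\<And>x. x \<in> U \<Longrightarrow> partials is f x = g x" using * by blast
    show "continuous_on U (partials is f) \<and>
       (\<forall>x\<in>U. \<forall>i\<in>E. (\<lambda>t. partials is f (x(i := t))) differentiable (at (x i)))"
      using cont[OF g(1)] diff[OF g(1)] continuous_on_cong[OF refl g(2), of U]
        differentiable_cong[of "partials is f" g, OF g(2)] by simp
  qed
qed

end

text \<open>The polynomial expressions in \<open>G\<close>. They serve as the family in
  \<open>smooth_coinduct\<close>; sums are included because the product rule leads from a product to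
  a sum of products.\<close>

inductive_set alg_closure :: "(point \<Rightarrow> real) set \<Rightarrow> (point \<Rightarrow> real) set" for G where
  base: "g \<in> G \<Longrightarrow> g \<in> alg_closure G"
| const: "(\<lambda>_. c) \<in> alg_closure G"
| plus: "f \<in> alg_closure G \<Longrightarrow> g \<in> alg_closure G \<Longrightarrow> (\<lambda>x. f x + g x) \<in> alg_closure G"
| times: "f \<in> alg_closure G \<Longrightarrow> g \<in> alg_closure G \<Longrightarrow> (\<lambda>x. f x * g x) \<in> alg_closure G"

context open_coord
begin

text \<open>It suffices to differentiate the generators once: the closure is then stable under all partial
  derivatives.\<close>

lemma smooth_alg_closure:
  assumes "f \<in> alg_closure G"
    and cont: "\<And>g. g \<in> G \<Longrightarrow> continuous_on U g"
    and deriv: "\<And>g i. g \<in> G \<Longrightarrow> i \<in> E \<Longrightarrow> \<exists>h\<in>alg_closure G. \<forall>x\<in>U.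
      ((\<lambda>t. g (x(i := t))) has_real_derivative h x) (at (x i))"
  shows "smooth E U f"
proof -
  have c: "continuous_on U f" if "f \<in> alg_closure G" for f
    using that by induction (auto intro: cont continuous_intros)
  have d: "\<exists>h\<in>alg_closure G. \<forall>x\<in>U. ((\<lambda>t. f (x(i := t))) has_real_derivative h x) (at (x i))"
    if "f \<in> alg_closure G" "i \<in> E" for f i
    using that
  proof induction
    case (base g) then show ?case using deriv by blast
  next
    case (const c) then show ?case by (intro bexI[of _ "\<lambda>_. 0"]) (auto intro: alg_closure.const)
  next
    case (plus f g)
    then obtain f' g' where "f' \<in> alg_closure G" "\<forall>x\<in>U. ((\<lambda>t. f (x(i := t))) has_real_derivative f' x) (at (x i))"
      "g' \<in> alg_closure G" "\<forall>x\<in>U. ((\<lambda>t. g (x(i := t))) has_real_derivative g' x) (at (x i))" by blast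
    then show ?case
      by (intro bexI[of _ "\<lambda>x. f' x + g' x"] ballI DERIV_add alg_closure.plus) blast+
  next
    case (times f g)
    then obtain f' g' where "f' \<in> alg_closure G" "\<forall>x\<in>U. ((\<lambda>t. f (x(i := t))) has_real_derivative f' x) (at (x i))"
      "g' \<in> alg_closure G" "\<forall>x\<in>U. ((\<lambda>t. g (x(i := t))) has_real_derivative g' x) (at (x i))" by blast
    moreover from this have "((\<lambda>t. f (x(i := t)) * g (x(i := t))) has_real_derivative f' x * g x + g' x * f x) (at (x i))"
      if "x \<in> U" for x
      using DERIV_mult[of "\<lambda>t. f (x(i := t))" "f' x" "x i" UNIV "\<lambda>t. g (x(i := t))" "g' x"] that by simp
    ultimately show ?case using times.hyps
      by (intro bexI[of _ "\<lambda>x. f' x * g x + g' x * f x"] ballI alg_closure.plus alg_closure.times) blast+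
  qed
  show ?thesis
  proof (rule smooth_coinduct[OF assms(1)])
    fix f x i assume f: "f \<in> alg_closure G" and i: "i \<in> E"
    obtain h where h: "h \<in> alg_closure G" "\<forall>x\<in>U. ((\<lambda>t. f (x(i := t))) has_real_derivative h x) (at (x i))"
      using d[OF f i] by blast
    then show "\<exists>g\<in>alg_closure G. \<forall>x\<in>U. partial i f x = g x" using partial_eqI by blast
    show "(\<lambda>t. f (x(i := t))) differentiable (at (x i))" if "x \<in> U"
      using h that real_differentiable_def by blast
  qed (rule c)
qed

lemma smooth_alg_closure_smooth:
  assumes "f \<in> alg_closure {g. smooth E U g}"
  shows "smooth E U f"
  using assms
proof (rule smooth_alg_closure)
  fix g i assume "g \<in> {g. smooth E U g}" "i \<in> E"
  then show "\<exists>h\<in>alg_closure {g. smooth E U g}. \<forall>x\<in>U.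
      ((\<lambda>t. g (x(i := t))) has_real_derivative h x) (at (x i))"
    by (intro bexI[of _ "partial i g"] ballI smooth_derivative alg_closure.base CollectI smooth_partial) auto
qed (auto intro: smooth_continuous)

lemma smooth_const: "smooth E U (\<lambda>_. c)"
  by (rule smooth_alg_closure_smooth[OF alg_closure.const])

lemma smooth_add: "smooth E U f \<Longrightarrow> smooth E U g \<Longrightarrow> smooth E U (\<lambda>x. f x + g x)"
  by (rule smooth_alg_closure_smooth[OF alg_closure.plus]) (auto intro: alg_closure.base)

lemma smooth_mult: "smooth E U f \<Longrightarrow> smooth E U g \<Longrightarrow> smooth E U (\<lambda>x. f x * g x)"
  by (rule smooth_alg_closure_smooth[OF alg_closure.times]) (auto intro: alg_closure.base)

lemma smooth_sum: "(\<And>k. k \<in> K \<Longrightarrow> smooth E U (f k)) \<Longrightarrow> smooth E U (\<lambda>x. \<Sum>k\<in>K. f k x)"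
  by (induction K rule: infinite_finite_induct) (auto intro: smooth_const smooth_add)

text \<open>Meant for functions with a differential equation: the partials of a reciprocal or of a
  logarithm are polynomials in that function and smooth ones, so the closure with the new function
  adjoined is stable under partials.\<close>

lemma smooth_adjoin:
  assumes "continuous_on U f"
    and h: "\<And>i. i \<in> E \<Longrightarrow> h i \<in> alg_closure (insert f {g. smooth E U g})"
    and d: "\<And>i x. i \<in> E \<Longrightarrow> x \<in> U \<Longrightarrow> ((\<lambda>t. f (x(i := t))) has_real_derivative h i x) (at (x i))"
  shows "smooth E U f"
proof (rule smooth_alg_closure[of _ "insert f {g. smooth E U g}"])
  let ?G = "insert f {g. smooth E U g}"
  show "f \<in> alg_closure ?G" by (simp add: alg_closure.base)
  show "continuous_on U g" if "g \<in> ?G" for g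
    using that assms(1) smooth_continuous by blast
  show "\<exists>h\<in>alg_closure ?G. \<forall>x\<in>U. ((\<lambda>t. g (x(i := t))) has_real_derivative h x) (at (x i))"
    if "g \<in> ?G" "i \<in> E" for g i
  proof (cases "g = f")
    case True
    then show ?thesis using h[OF that(2)] d[OF that(2)] by blast
  next
    case False
    then have g: "smooth E U g" using that by auto
    then have "partial i g \<in> alg_closure ?G" using smooth_partial that(2) by (blast intro: alg_closure.base)
    then show ?thesis using smooth_derivative[OF g] that(2) by blast
  qed
qed

lemma smooth_inverse:
  assumes "smooth E U f" "\<And>x. x \<in> U \<Longrightarrow> f x \<noteq> 0"
  shows "smooth E U (\<lambda>x. inverse (f x))"
proof (rule smooth_adjoin[where h = "\<lambda>i x. (-1) * (inverse (f x) * (partial i f x * inverse (f x)))"])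
  show "continuous_on U (\<lambda>x. inverse (f x))"
    using smooth_continuous[OF assms(1)] assms(2) by (intro continuous_on_inverse) auto
  show "(\<lambda>x. (-1) * (inverse (f x) * (partial i f x * inverse (f x)))) \<in>
      alg_closure (insert (\<lambda>x. inverse (f x)) {g. smooth E U g})" if "i \<in> E" for i
    using smooth_partial[OF assms(1) that]
    by (intro alg_closure.times alg_closure.const) (auto intro: alg_closure.base)
  show "((\<lambda>t. inverse (f (x(i := t)))) has_real_derivative
      (-1) * (inverse (f x) * (partial i f x * inverse (f x)))) (at (x i))" if "i \<in> E" "x \<in> U" for i x
    using DERIV_inverse'[OF smooth_derivative[OF assms(1) that(2,1)]] assms(2)[OF that(2)]
    by (simp add: mult.assoc)
qed

lemma ln_abs_derivative:
  assumes "smooth E U f" "x \<in> U" "f x \<noteq> 0" "i \<in> E"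
  shows "((\<lambda>t. ln \<bar>f (x(i := t))\<bar>) has_real_derivative partial i f x * inverse (f x)) (at (x i))"
proof -
  have d: "((\<lambda>t. f (x(i := t))) has_real_derivative partial i f x) (at (x i))"
    using assms smooth_derivative by blast
  have "((\<lambda>t. ln (sgn (f x) * f (x(i := t)))) has_real_derivative partial i f x * inverse (f x)) (at (x i))"
    using assms(3) d
    by (auto intro!: derivative_eq_intros simp: sgn_if field_simps split: if_splits)
  \<comment> \<open>By continuity \<open>f\<close> keeps its sign near \<open>x\<close>, so there
    its absolute value is \<open>f\<close> times the constant \<open>sgn (f x)\<close>.\<close>
  moreover have "\<forall>\<^sub>F t in nhds (x i). ln \<bar>f (x(i := t))\<bar> = ln (sgn (f x) * f (x(i := t)))"
  proof -
    have "isCont (\<lambda>t. f (x(i := t))) (x i)" using d DERIV_isCont by blast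
    then have "((\<lambda>t. sgn (f x) * f (x(i := t))) \<longlongrightarrow> sgn (f x) * f x) (nhds (x i))"
      by (intro tendsto_intros) (metis isCont_def fun_upd_triv tendsto_at_iff_tendsto_nhds)
    moreover have "sgn (f x) * f x > 0" using assms(3) by (simp add: sgn_if)
    ultimately have "\<forall>\<^sub>F t in nhds (x i). 0 < sgn (f x) * f (x(i := t))" by (rule order_tendstoD)
    then show ?thesis
      by (auto elim!: eventually_mono simp: sgn_if abs_if zero_less_mult_iff split: if_splits)
  qed
  ultimately show ?thesis using DERIV_cong_ev[OF refl _ refl, THEN iffD2] by fast
qed

lemma smooth_ln_abs:
  assumes "smooth E U f" "\<And>x. x \<in> U \<Longrightarrow> f x \<noteq> 0"
  shows "smooth E U (\<lambda>x. ln \<bar>f x\<bar>)"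
proof (rule smooth_adjoin[where h = "\<lambda>i x. partial i f x * inverse (f x)"])
  show "continuous_on U (\<lambda>x. ln \<bar>f x\<bar>)"
    using assms(2) by (intro continuous_on_ln continuous_on_rabs smooth_continuous[OF assms(1)]) auto
  show "(\<lambda>x. partial i f x * inverse (f x)) \<in> alg_closure (insert (\<lambda>x. ln \<bar>f x\<bar>) {g. smooth E U g})"
    if "i \<in> E" for i
    using smooth_partial[OF assms(1) that] smooth_inverse[OF assms]
    by (intro alg_closure.times) (auto intro: alg_closure.base)
qed (use ln_abs_derivative assms in blast)

lemma partial_add:
  "smooth E U f \<Longrightarrow> smooth E U g \<Longrightarrow> x \<in> U \<Longrightarrow> i \<in> E \<Longrightarrow> partial i (\<lambda>x. f x + g x) x = partial i f x + partial i g x"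
  by (intro partial_eqI DERIV_add smooth_derivative)

lemma partial_cmult:
  "smooth E U f \<Longrightarrow> x \<in> U \<Longrightarrow> i \<in> E \<Longrightarrow> partial i (\<lambda>x. c * f x) x = c * partial i f x"
  by (intro partial_eqI DERIV_cmult smooth_derivative)

lemma partial_mult:
  assumes "smooth E U f" "smooth E U g" "x \<in> U" "i \<in> E"
  shows "partial i (\<lambda>x. f x * g x) x = partial i f x * g x + f x * partial i g x"
proof (rule partial_eqI)
  show "((\<lambda>t. f (x(i := t)) * g (x(i := t))) has_real_derivative partial i f x * g x + f x * partial i g x) (at (x i))"
    using DERIV_mult[OF smooth_derivative[OF assms(1,3,4)] smooth_derivative[OF assms(2,3,4)]]
    by (simp add: mult.commute)
qed

lemma partial_sum:
  assumes "\<And>k. k \<in> K \<Longrightarrow> smooth E U (f k)" "x \<in> U" "i \<in> E"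
  shows "partial i (\<lambda>x. \<Sum>k\<in>K. f k x) x = (\<Sum>k\<in>K. partial i (f k) x)"
  by (rule partial_eqI[OF DERIV_sum]) (use assms in \<open>auto intro: smooth_derivative\<close>)

lemma partial_const: "partial i (\<lambda>_. c) x = 0"
  unfolding partial_def by simp

section \<open>Linear approximation, the chain rule along curves, symmetry of mixed partials\<close>

lemma openin_near:
  assumes "smooth E U f"
  shows "openin (coord_space E) {y \<in> U. f y \<in> ball c e}"
proof -
  have "openin (top_of_set U) (U \<inter> f -` ball c e)"
    by (rule continuous_openin_preimage_gen[OF smooth_continuous[OF assms] open_ball])
  then have "openin (coord_space E) (U \<inter> f -` ball c e)"
    unfolding coord_space_def by (rule openin_trans) (use open_U in \<open>simp add: coord_space_def\<close>)
  moreover have "U \<inter> f -` ball c e = {y \<in> U. f y \<in> ball c e}" by auto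
  ultimately show ?thesis by simp
qed

text \<open>Changing the coordinates one at a time, the mean value theorem gives the linear approximation.\<close>

lemma linear_approximation:
  assumes "smooth E U f" "x \<in> U" "e > 0"
  shows "\<exists>d>0. \<forall>y. (\<forall>i. i \<notin> E \<longrightarrow> y i = 0) \<longrightarrow> (\<forall>i\<in>E. \<bar>y i - x i\<bar> < d) \<longrightarrow>
      \<bar>f y - f x - (\<Sum>i\<in>E. partial i f x * (y i - x i))\<bar> \<le> e * (\<Sum>i\<in>E. \<bar>y i - x i\<bar>)"
proof -
  \<comment> \<open>An open set on which all first partials stay within \<open>e\<close> of their
    values at \<open>x\<close>; the factor \<open>U\<close> covers the case of empty
    \<open>E\<close>.\<close>
  define W where "W = U \<inter> (\<Inter>i\<in>E. {y\<in>U. partial i f y \<in> ball (partial i f x) e})"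
  have "openin (coord_space E) {y\<in>U. partial i f y \<in> ball (partial i f x) e}" if "i \<in> E" for i
    by (rule openin_near[OF smooth_partial[OF assms(1) that]])
  then have op: "openin (coord_space E) W"
    unfolding W_def using fin_E open_U by (cases "E = {}") auto
  have xW: "x \<in> W" using assms by (auto simp: W_def)
  obtain d where d: "d > 0"
    "\<And>y. (\<And>i. i \<notin> E \<Longrightarrow> y i = 0) \<Longrightarrow> (\<And>i. i \<in> E \<Longrightarrow> \<bar>y i - x i\<bar> < d) \<Longrightarrow> y \<in> W"
    using coord_space_box[OF op fin_E xW] by metis
  \<comment> \<open>Induction over a set of coordinates outside which \<open>y\<close> and
    \<open>z\<close> agree: replacing one coordinate costs at most \<open>e\<close> times its
    increment, since the partial of the mean value theorem is taken at a point of
    \<open>W\<close>.\<close>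
  have *: "\<bar>f y - f z - (\<Sum>i\<in>F. partial i f x * (y i - z i))\<bar> \<le> e * (\<Sum>i\<in>F. \<bar>y i - z i\<bar>)"
    if "finite F" "F \<subseteq> E" "\<And>i. i \<notin> E \<Longrightarrow> y i = 0" "\<And>i. i \<in> E \<Longrightarrow> \<bar>y i - x i\<bar> < d"
      "\<And>i. i \<notin> E \<Longrightarrow> z i = 0" "\<And>i. i \<in> E \<Longrightarrow> \<bar>z i - x i\<bar> < d" "\<And>i. i \<notin> F \<Longrightarrow> y i = z i" for F y z
    using that
  proof (induction F arbitrary: z rule: finite_induct)
    case empty
    then have "y = z" by auto
    then show ?case by simp
  next
    case (insert k F)
    define w where "w = z(k := y k)"
    have IH: "\<bar>f y - f w - (\<Sum>i\<in>F. partial i f x * (y i - w i))\<bar> \<le> e * (\<Sum>i\<in>F. \<bar>y i - w i\<bar>)"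
      using insert.prems by (intro insert.IH) (auto simp: w_def)
    have k: "k \<in> E" using insert by auto
    have zy: "\<bar>z k - x k\<bar> < d" "\<bar>y k - x k\<bar> < d" using insert.prems k by auto
    have seg: "z(k := t) \<in> W" if "min (z k) (y k) \<le> t" "t \<le> max (z k) (y k)" for t
    proof (rule d(2))
      have "\<bar>t - x k\<bar> < d" using that zy by (auto simp: min_def max_def abs_less_iff split: if_splits)
      then show "\<bar>(z(k := t)) i - x i\<bar> < d" if "i \<in> E" for i using insert.prems(5)[OF that] by simp
      show "(z(k := t)) i = 0" if "i \<notin> E" for i using that k insert.prems(4) by auto
    qed
    have "\<exists>t. min (z k) (y k) \<le> t \<and> t \<le> max (z k) (y k) \<and>
        f (z(k := y k)) - f (z(k := z k)) = partial k f (z(k := t)) * (y k - z k)"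
    proof (rule mvt_between)
      fix t assume "min (z k) (y k) \<le> t" "t \<le> max (z k) (y k)"
      then have "z(k := t) \<in> U" using seg by (auto simp: W_def)
      then show "((\<lambda>t. f (z(k := t))) has_real_derivative partial k f (z(k := t))) (at t)"
        using smooth_derivative[OF assms(1), of "z(k := t)" k] k by simp
    qed
    then have "\<exists>t. z(k := t) \<in> W \<and> f w - f z = partial k f (z(k := t)) * (y k - z k)"
      using seg unfolding w_def fun_upd_triv by blast
    then obtain t where t: "z(k := t) \<in> W" "f w - f z = partial k f (z(k := t)) * (y k - z k)"
      by blast
    then have "\<bar>partial k f (z(k := t)) - partial k f x\<bar> \<le> e"
      using k by (auto simp: dist_real_def W_def)
    then have "\<bar>(partial k f (z(k := t)) - partial k f x) * (y k - z k)\<bar> \<le> e * \<bar>y k - z k\<bar>"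
      by (simp add: abs_mult mult_right_mono)
    moreover have "f w - f z - partial k f x * (y k - z k) = (partial k f (z(k := t)) - partial k f x) * (y k - z k)"
      unfolding t(2) by (simp add: algebra_simps)
    moreover have "(\<Sum>i\<in>F. partial i f x * (y i - w i)) = (\<Sum>i\<in>F. partial i f x * (y i - z i))"
      "(\<Sum>i\<in>F. \<bar>y i - w i\<bar>) = (\<Sum>i\<in>F. \<bar>y i - z i\<bar>)"
      using insert(2) by (auto simp: w_def intro!: sum.cong)
    ultimately show ?case using insert(1,2) IH by (simp add: algebra_simps)
  qed
  show ?thesis
  proof (intro exI[of _ d] conjI d(1) allI impI)
    fix y assume "\<forall>i. i \<notin> E \<longrightarrow> y i = 0" "\<forall>i\<in>E. \<bar>y i - x i\<bar> < d"
    then show "\<bar>f y - f x - (\<Sum>i\<in>E. partial i f x * (y i - x i))\<bar> \<le> e * (\<Sum>i\<in>E. \<bar>y i - x i\<bar>)"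
      using d(1) outside[OF assms(2)] by (intro *[OF fin_E order_refl]) auto
  qed
qed

lemma chain_rule_curve:
  assumes f: "smooth E U f" and U: "y s \<in> U" and zero: "\<And>t i. i \<notin> E \<Longrightarrow> y t i = 0"
    and d: "\<And>i. i \<in> E \<Longrightarrow> ((\<lambda>t. y t i) has_real_derivative d i) (at s)"
  shows "((\<lambda>t. f (y t)) has_real_derivative (\<Sum>i\<in>E. partial i f (y s) * d i)) (at s)"
proof -
  define q where "q i t = (y t i - y s i) / (t - s)" for i t
  have q: "(q i \<longlongrightarrow> d i) (at s)" if "i \<in> E" for i
    using d[OF that] unfolding q_def has_field_derivative_iff .
  define L where "L = (\<Sum>i\<in>E. partial i f (y s) * d i)"
  \<comment> \<open>One more than the limit of the sum of the absolute difference quotients: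
    positive, and eventually a strict bound for that sum. The tolerance \<open>e / (2 * B)\<close>
    then produces an error below \<open>e / 2\<close>.\<close>
  define B where "B = (\<Sum>i\<in>E. \<bar>d i\<bar>) + 1"
  have B: "B > 0" unfolding B_def by (simp add: sum_nonneg add_nonneg_pos)
  have lim: "((\<lambda>t. \<Sum>i\<in>E. partial i f (y s) * q i t) \<longlongrightarrow> L) (at s)"
    "((\<lambda>t. \<Sum>i\<in>E. \<bar>q i t\<bar>) \<longlongrightarrow> B - 1) (at s)"
    unfolding L_def B_def by (auto intro!: tendsto_intros q)
  have "((\<lambda>t. (f (y t) - f (y s)) / (t - s)) \<longlongrightarrow> L) (at s)"
  proof (rule tendstoI)
    fix e :: real assume e: "e > 0"
    have eB: "e / (2 * B) > 0" using e B by simp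
    obtain r where r: "r > 0" "\<forall>z. (\<forall>i. i \<notin> E \<longrightarrow> z i = 0) \<longrightarrow> (\<forall>i\<in>E. \<bar>z i - y s i\<bar> < r) \<longrightarrow>
      \<bar>f z - f (y s) - (\<Sum>i\<in>E. partial i f (y s) * (z i - y s i))\<bar> \<le> e / (2 * B) * (\<Sum>i\<in>E. \<bar>z i - y s i\<bar>)"
      using linear_approximation[OF f U eB] by blast
    have "\<forall>\<^sub>F t in at s. \<forall>i\<in>E. \<bar>y t i - y s i\<bar> < r"
    proof (rule eventually_ball_finite[OF fin_E], rule ballI)
      fix i assume "i \<in> E"
      then have lim': "((\<lambda>t. y t i) \<longlongrightarrow> y s i) (at s)" using DERIV_isCont[OF d] by (simp add: isCont_def)
      show "\<forall>\<^sub>F t in at s. \<bar>y t i - y s i\<bar> < r" using tendstoD[OF lim' r(1)] by (simp add: dist_real_def)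
    qed
    moreover have "\<forall>\<^sub>F t in at s. dist (\<Sum>i\<in>E. partial i f (y s) * q i t) L < e / 2"
      using tendstoD[OF lim(1)] e by (meson half_gt_zero)
    moreover have "\<forall>\<^sub>F t in at s. (\<Sum>i\<in>E. \<bar>q i t\<bar>) < B"
      using order_tendstoD(2)[OF lim(2)] by simp
    moreover have "\<forall>\<^sub>F t in at s. t \<noteq> s" by (simp add: eventually_at_filter)
    ultimately show "\<forall>\<^sub>F t in at s. dist ((f (y t) - f (y s)) / (t - s)) L < e"
    proof eventually_elim
      case (elim t)
      let ?S = "\<Sum>i\<in>E. partial i f (y s) * (y t i - y s i)"
      have S: "(\<Sum>i\<in>E. partial i f (y s) * q i t) = ?S / (t - s)"
        unfolding q_def sum_divide_distrib by simp
      have "\<bar>f (y t) - f (y s) - ?S\<bar> \<le> e / (2 * B) * (\<Sum>i\<in>E. \<bar>y t i - y s i\<bar>)"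
        by (rule r(2)[rule_format]) (use elim zero in auto)
      then have "\<bar>f (y t) - f (y s) - ?S\<bar> / \<bar>t - s\<bar> \<le> e / (2 * B) * (\<Sum>i\<in>E. \<bar>y t i - y s i\<bar>) / \<bar>t - s\<bar>"
        by (rule divide_right_mono) simp
      also have "\<dots> = e / (2 * B) * ((\<Sum>i\<in>E. \<bar>y t i - y s i\<bar>) / \<bar>t - s\<bar>)" by simp
      also have "\<dots> = e / (2 * B) * (\<Sum>i\<in>E. \<bar>q i t\<bar>)"
        unfolding q_def by (simp only: sum_divide_distrib abs_divide)
      also have "\<dots> < e / (2 * B) * B" using elim e B by (intro mult_strict_left_mono) auto
      also have "\<dots> = e / 2" using B by simp
      also have "\<bar>f (y t) - f (y s) - ?S\<bar> / \<bar>t - s\<bar> =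
          \<bar>(f (y t) - f (y s)) / (t - s) - (\<Sum>i\<in>E. partial i f (y s) * q i t)\<bar>"
        by (simp only: S diff_divide_distrib abs_divide[symmetric])
      finally have "\<bar>(f (y t) - f (y s)) / (t - s) - (\<Sum>i\<in>E. partial i f (y s) * q i t)\<bar> < e / 2" .
      moreover have "\<bar>(\<Sum>i\<in>E. partial i f (y s) * q i t) - L\<bar> < e / 2"
        using elim by (simp add: dist_real_def)
      ultimately show ?case unfolding dist_real_def by linarith
    qed
  qed
  then show ?thesis unfolding has_field_derivative_iff L_def .
qed

text \<open>Two uses of the mean value theorem: in direction \<open>i\<close> for the increment of
  \<open>f\<close> in direction \<open>j\<close>, then in direction \<open>j\<close> for the
  resulting partial.\<close>

lemma second_difference:
  assumes f: "smooth E U f" and ij: "i \<in> E" "j \<in> E" "i \<noteq> j" and h: "h > 0"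
    and U: "\<And>s t. x i \<le> s \<Longrightarrow> s \<le> x i + h \<Longrightarrow> x j \<le> t \<Longrightarrow> t \<le> x j + h \<Longrightarrow> x(i := s, j := t) \<in> U"
  shows "\<exists>s t. x i \<le> s \<and> s \<le> x i + h \<and> x j \<le> t \<and> t \<le> x j + h \<and>
    f (x(i := x i + h, j := x j + h)) - f (x(i := x i, j := x j + h)) - f (x(i := x i + h, j := x j)) + f x =
      h * h * partial j (partial i f) (x(i := s, j := t))"
proof -
  define F where "F s = f (x(i := s, j := x j + h)) - f (x(i := s, j := x j))" for s
  have di: "((\<lambda>s. f (x(i := s, j := t))) has_real_derivative partial i f (x(i := s, j := t))) (at s)"
    if "x i \<le> s" "s \<le> x i + h" "x j \<le> t" "t \<le> x j + h" for s t
  proof -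
    have "(\<lambda>u. f ((x(i := s, j := t))(i := u))) = (\<lambda>u. f (x(i := u, j := t)))"
      using ij(3) by (simp add: fun_upd_twist)
    then show ?thesis using smooth_derivative[OF f U[OF that] ij(1)] ij(3) by simp
  qed
  have "\<exists>s. min (x i) (x i + h) \<le> s \<and> s \<le> max (x i) (x i + h) \<and> F (x i + h) - F (x i) =
      (partial i f (x(i := s, j := x j + h)) - partial i f (x(i := s, j := x j))) * (x i + h - x i)"
    unfolding F_def by (rule mvt_between, intro DERIV_diff di) (use h in auto)
  then obtain s where s: "x i \<le> s" "s \<le> x i + h"
    "F (x i + h) - F (x i) = (partial i f (x(i := s, j := x j + h)) - partial i f (x(i := s, j := x j))) * h"
    using h by auto
  have "\<exists>t. min (x j) (x j + h) \<le> t \<and> t \<le> max (x j) (x j + h) \<and>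
      partial i f (x(i := s, j := x j + h)) - partial i f (x(i := s, j := x j)) =
      partial j (partial i f) (x(i := s, j := t)) * (x j + h - x j)"
  proof (rule mvt_between)
    fix t assume "min (x j) (x j + h) \<le> t" "t \<le> max (x j) (x j + h)"
    then have "x(i := s, j := t) \<in> U" using s h by (intro U) auto
    from smooth_derivative[OF smooth_partial[OF f ij(1)] this ij(2)]
    show "((\<lambda>t. partial i f (x(i := s, j := t))) has_real_derivative partial j (partial i f) (x(i := s, j := t))) (at t)"
      by simp
  qed
  then obtain t where t: "x j \<le> t" "t \<le> x j + h"
    "partial i f (x(i := s, j := x j + h)) - partial i f (x(i := s, j := x j)) = partial j (partial i f) (x(i := s, j := t)) * h"
    using h by auto
  show ?thesis
    using s t(1,2) ij(3) unfolding t(3)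
    by (intro exI[of _ s] exI[of _ t]) (simp add: F_def algebra_simps)
qed

text \<open>The second difference over a square is symmetric in the two directions. By
  \<open>second_difference\<close> the value of one mixed partial at some point near
  \<open>x\<close> equals that of the other at another such point, and both are continuous at
  \<open>x\<close>.\<close>

lemma partial_commute:
  assumes f: "smooth E U f" and "i \<in> E" "j \<in> E" "x \<in> U"
  shows "partial i (partial j f) x = partial j (partial i f) x"
proof (cases "i = j")
  case ij: False
  have "\<bar>partial i (partial j f) x - partial j (partial i f) x\<bar> < 2 * e" if e: "e > 0" for e
  proof -
    define W where "W = {y\<in>U. partial i (partial j f) y \<in> ball (partial i (partial j f) x) e} \<inter>
      {y\<in>U. partial j (partial i f) y \<in> ball (partial j (partial i f) x) e}"
    have W: "openin (coord_space E) W" "x \<in> W"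
      unfolding W_def using assms e by (auto intro!: openin_Int openin_near smooth_partial simp del: mem_ball)
    obtain d where d: "d > 0" "\<And>y. (\<And>i. i \<notin> E \<Longrightarrow> y i = 0) \<Longrightarrow> (\<And>i. i \<in> E \<Longrightarrow> \<bar>y i - x i\<bar> < d) \<Longrightarrow> y \<in> W"
      using coord_space_box[OF W(1) fin_E W(2)] by metis
    define h where "h = d / 2"
    have h: "h > 0" "h < d" using d(1) by (auto simp: h_def)
    have W: "x(i := s, j := t) \<in> W"
      if "x i \<le> s" "s \<le> x i + h" "x j \<le> t" "t \<le> x j + h" for s t
      using that h assms outside[OF assms(4)] by (intro d(2)) auto
    have W': "x(j := t, i := s) \<in> W"
      if "x i \<le> s" "s \<le> x i + h" "x j \<le> t" "t \<le> x j + h" for s t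
      using W[OF that] ij by (simp add: fun_upd_twist)
    have WU: "W \<subseteq> U" by (auto simp: W_def)
    obtain s t where 1: "x(i := s, j := t) \<in> W"
      "f (x(i := x i + h, j := x j + h)) - f (x(i := x i, j := x j + h)) - f (x(i := x i + h, j := x j)) + f x =
      h * h * partial j (partial i f) (x(i := s, j := t))"
    proof -
      have "\<And>s t. x i \<le> s \<Longrightarrow> s \<le> x i + h \<Longrightarrow> x j \<le> t \<Longrightarrow> t \<le> x j + h \<Longrightarrow> x(i := s, j := t) \<in> U"
        using W WU by blast
      from second_difference[OF f assms(2,3) ij h(1) this] show ?thesis using W that by blast
    qed
    obtain s' t' where 2: "x(j := t', i := s') \<in> W"
      "f (x(j := x j + h, i := x i + h)) - f (x(j := x j, i := x i + h)) - f (x(j := x j + h, i := x i)) + f x =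
      h * h * partial i (partial j f) (x(j := t', i := s'))"
    proof -
      have "\<And>t s. x j \<le> t \<Longrightarrow> t \<le> x j + h \<Longrightarrow> x i \<le> s \<Longrightarrow> s \<le> x i + h \<Longrightarrow> x(j := t, i := s) \<in> U"
        using W' WU by blast
      from second_difference[OF f assms(3,2) ij[symmetric] h(1) this] show ?thesis using W' that by blast
    qed
    have "h * h * partial j (partial i f) (x(i := s, j := t)) = h * h * partial i (partial j f) (x(j := t', i := s'))"
      unfolding 1(2)[symmetric] 2(2)[symmetric] using ij by (simp add: fun_upd_twist)
    then have "partial j (partial i f) (x(i := s, j := t)) = partial i (partial j f) (x(j := t', i := s'))"
      using h(1) by simp
    then show ?thesis using 1(1) 2(1) by (auto simp: W_def dist_real_def)
  qed
  from this[of "\<bar>partial i (partial j f) x - partial j (partial i f) x\<bar> / 2"] show ?thesis by fastforce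
qed simp

end

text \<open>The map \<open>b\<close> is only assumed to have smooth components on \<open>U\<close>; that it vanishes off \<open>E\<close> for all
  arguments keeps the curves of the chain rule inside the coordinate space.\<close>

lemma
  fixes b :: "point \<Rightarrow> point"
  assumes U: "open_coord E U" and V: "open_coord E V"
    and f: "smooth E V f" and b: "\<And>i. i \<in> E \<Longrightarrow> smooth E U (\<lambda>x. b x i)"
    and zero: "\<And>x i. i \<notin> E \<Longrightarrow> b x i = 0" and UV: "\<And>x. x \<in> U \<Longrightarrow> b x \<in> V"
  shows partial_compose: "x \<in> U \<Longrightarrow> i \<in> E \<Longrightarrow>
      partial i (\<lambda>x. f (b x)) x = (\<Sum>j\<in>E. partial i (\<lambda>x. b x j) x * partial j f (b x))"
    and smooth_compose: "smooth E U (\<lambda>x. f (b x))"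
proof -
  interpret U: open_coord E U by fact
  interpret V: open_coord E V by fact
  have d: "((\<lambda>t. f (b (x(i := t)))) has_real_derivative (\<Sum>j\<in>E. partial i (\<lambda>x. b x j) x * partial j f (b x))) (at (x i))"
    if "smooth E V f" "x \<in> U" "i \<in> E" for f x i
  proof -
    have "((\<lambda>t. f (b (x(i := t)))) has_real_derivative
        (\<Sum>j\<in>E. partial j f (b (x(i := x i))) * partial i (\<lambda>x. b x j) x)) (at (x i))"
    proof (rule V.chain_rule_curve[where y = "\<lambda>t. b (x(i := t))", OF that(1)])
      show "b (x(i := x i)) \<in> V" using UV that by simp
      show "((\<lambda>t. b (x(i := t)) j) has_real_derivative partial i (\<lambda>x. b x j) x) (at (x i))" if "j \<in> E" for j
        using U.smooth_derivative[OF b[OF that] \<open>x \<in> U\<close> \<open>i \<in> E\<close>] .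
    qed (rule zero)
    then show ?thesis by (simp add: mult.commute)
  qed
  show "partial i (\<lambda>x. f (b x)) x = (\<Sum>j\<in>E. partial i (\<lambda>x. b x j) x * partial j f (b x))"
    if "x \<in> U" "i \<in> E" using U.partial_eqI[OF d[OF f that]] .
  \<comment> \<open>Composites with functions smooth on \<open>V\<close> are generators too: by the
    chain rule their partials are sums of products of partials of \<open>b\<close> and further
    composites.\<close>
  let ?G = "{g. smooth E U g} \<union> {\<lambda>x. g (b x) | g. smooth E V g}"
  have sum_closed: "(\<lambda>x. \<Sum>j\<in>F. h j x) \<in> alg_closure ?G" if "finite F" "\<And>j. j \<in> F \<Longrightarrow> h j \<in> alg_closure ?G" for F :: "nat set" and h
    using that by (induction rule: finite_induct) (auto intro: alg_closure.const alg_closure.plus)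
  have contb: "continuous_on U b"
  proof (rule continuous_on_coordinatewise_then_product)
    fix i show "continuous_on U (\<lambda>x. b x i)"
      using U.smooth_continuous[OF b] zero by (cases "i \<in> E") auto
  qed
  show "smooth E U (\<lambda>x. f (b x))"
  proof (rule U.smooth_alg_closure[of _ ?G])
    show "(\<lambda>x. f (b x)) \<in> alg_closure ?G" using f by (intro alg_closure.base) auto
    show "continuous_on U g" if g: "g \<in> ?G" for g
    proof (cases "smooth E U g")
      case False
      then obtain h where h: "smooth E V h" "g = (\<lambda>x. h (b x))" using g by auto
      then show ?thesis
        using continuous_on_compose2[OF V.smooth_continuous[OF h(1)] contb] UV by blast
    qed (rule U.smooth_continuous)
    fix g i assume "g \<in> ?G" "i \<in> E"
    then consider "smooth E U g" | h where "smooth E V h" "g = (\<lambda>x. h (b x))" by auto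
    then show "\<exists>h\<in>alg_closure ?G. \<forall>x\<in>U. ((\<lambda>t. g (x(i := t))) has_real_derivative h x) (at (x i))"
    proof cases
      case 1
      then show ?thesis using \<open>i \<in> E\<close> U.smooth_partial U.smooth_derivative
        by (intro bexI[of _ "partial i g"]) (auto intro: alg_closure.base)
    next
      case 2
      have mem: "(\<lambda>x. \<Sum>j\<in>E. partial i (\<lambda>x. b x j) x * partial j h (b x)) \<in> alg_closure ?G"
      proof (rule sum_closed[OF U.fin_E], rule alg_closure.times; rule alg_closure.base)
        fix j assume j: "j \<in> E"
        show "partial i (\<lambda>x. b x j) \<in> ?G" using U.smooth_partial[OF b[OF j] \<open>i \<in> E\<close>] by simp
        show "(\<lambda>x. partial j h (b x)) \<in> ?G" using V.smooth_partial[OF 2(1) j] by blast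
      qed
      show ?thesis
        unfolding 2(2) by (rule bexI[OF _ mem]) (intro ballI d[OF 2(1) _ \<open>i \<in> E\<close>])
    qed
  qed
qed

section \<open>Superfunctions and their derivatives\<close>

lemma gcoeff_even_deriv: "gcoeff (even_deriv i f x) I = partial i (\<lambda>y. gcoeff (f y) I) x"
  by (cases "finite I") (simp_all add: even_deriv.rep_eq partial_def)

locale superdomain = open_coord E U for E U +
  fixes D :: "nat set"
  assumes fin_D: "finite D" and disj: "E \<inter> D = {}"
begin

abbreviation sf :: "nat \<Rightarrow> superfun \<Rightarrow> bool" where
  "sf \<equiv> superfunction E D U"

abbreviation d :: "nat \<Rightarrow> superfun \<Rightarrow> superfun" where
  "d \<equiv> sderiv D"

lemma sfI: "(\<And>I. smooth E U (\<lambda>x. gcoeff (f x) I)) \<Longrightarrow> (\<And>x. x \<in> U \<Longrightarrow> homog D p (f x)) \<Longrightarrow> sf p f"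
  unfolding superfunction_def homog_def by blast

lemma sf_smooth: "sf p f \<Longrightarrow> smooth E U (\<lambda>x. gcoeff (f x) I)"
  unfolding superfunction_def by blast

lemma sf_homog: "sf p f \<Longrightarrow> x \<in> U \<Longrightarrow> homog D p (f x)"
  unfolding superfunction_def homog_def by blast

lemma sf_parity: "even p = even q \<Longrightarrow> sf p f \<Longrightarrow> sf q f"
  unfolding superfunction_def by simp

lemma sf_cong:
  assumes "\<And>x. x \<in> U \<Longrightarrow> f x = g x"
  shows "sf p f \<longleftrightarrow> sf p g"
proof -
  have "smooth E U (\<lambda>x. gcoeff (f x) I) \<longleftrightarrow> smooth E U (\<lambda>x. gcoeff (g x) I)" for I
    by (rule smooth_cong) (simp add: assms)
  then show ?thesis unfolding superfunction_def using assms by simp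
qed

lemma sf_const: "homog D p a \<Longrightarrow> sf p (\<lambda>_. a)"
  by (rule sfI) (auto intro: smooth_const)

lemma sf_of_real: "smooth E U h \<Longrightarrow> sf 0 (\<lambda>x. of_real (h x))"
proof (rule sfI)
  fix I assume "smooth E U h"
  then show "smooth E U (\<lambda>x. gcoeff (of_real (h x)) I)"
    by (cases "I = {}") (simp_all add: smooth_const)
qed simp

lemma sf_add: "sf p f \<Longrightarrow> sf p g \<Longrightarrow> sf p (\<lambda>x. f x + g x)"
  by (rule sfI) (auto intro: smooth_add sf_smooth homog_add sf_homog)

lemma sf_scaleR: "sf p f \<Longrightarrow> sf p (\<lambda>x. r *\<^sub>R f x)"
  by (rule sfI) (auto intro: smooth_mult smooth_const sf_smooth homog_scaleR sf_homog)

lemma sf_diff: "sf p f \<Longrightarrow> sf p g \<Longrightarrow> sf p (\<lambda>x. f x - g x)"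
  using sf_add[of p f "\<lambda>x. (-1) *\<^sub>R g x"] sf_scaleR[of p g "-1"] by simp

lemma sf_sum: "(\<And>k. k \<in> K \<Longrightarrow> sf p (f k)) \<Longrightarrow> sf p (\<lambda>x. \<Sum>k\<in>K. f k x)"
proof (rule sfI)
  fix I assume "\<And>k. k \<in> K \<Longrightarrow> sf p (f k)"
  then show "smooth E U (\<lambda>x. gcoeff (\<Sum>k\<in>K. f k x) I)"
    unfolding gcoeff_sum by (intro smooth_sum sf_smooth)
qed (auto intro: homog_sum sf_homog)

lemma sf_mult: "sf p f \<Longrightarrow> sf q g \<Longrightarrow> sf (p + q) (\<lambda>x. f x * g x)"
proof (rule sfI)
  fix I assume "sf p f" "sf q g"
  then show "smooth E U (\<lambda>x. gcoeff (f x * g x) I)"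
    unfolding gcoeff_mult by (intro smooth_sum smooth_mult smooth_const sf_smooth)
qed (auto intro: homog_mult sf_homog)

lemma sf_mult_even: "sf 0 f \<Longrightarrow> sf p g \<Longrightarrow> sf p (\<lambda>x. f x * g x)"
  using sf_mult[of 0 f p g] by simp

lemma sf_power: "sf 0 f \<Longrightarrow> sf 0 (\<lambda>x. f x ^ k)"
  by (induction k) (auto intro: sf_const sf_mult_even)

lemma sderiv_even: "i \<notin> D \<Longrightarrow> d i f = even_deriv i f"
  and sderiv_odd: "i \<in> D \<Longrightarrow> d i f = (\<lambda>x. godd_deriv i (f x))"
  by (simp_all add: sderiv_def)

lemma parity_simps: "i \<in> D \<Longrightarrow> parity D i = 1" "i \<notin> D \<Longrightarrow> parity D i = 0"
  by (simp_all add: parity_def)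

lemma sderiv_cong:
  assumes "\<And>y. y \<in> U \<Longrightarrow> f y = g y" "x \<in> U" "i \<in> E \<union> D"
  shows "d i f x = d i g x"
proof (cases "i \<in> D")
  case True then show ?thesis using assms by (simp add: sderiv_odd)
next
  case False
  then have i: "i \<in> E" using assms by auto
  have "partial i (\<lambda>y. gcoeff (f y) I) x = partial i (\<lambda>y. gcoeff (g y) I) x" for I
    by (rule partial_cong[OF _ assms(2) i]) (simp add: assms(1))
  then show ?thesis using False by (auto simp: sderiv_even gcoeff_even_deriv intro: grassmann_eqI)
qed

lemma sf_sderiv:
  assumes "sf p f" "i \<in> E \<union> D"
  shows "sf (parity D i + p) (d i f)"
proof (cases "i \<in> D")
  case True
  show ?thesis
  proof (rule sfI)
    fix I show "smooth E U (\<lambda>x. gcoeff (d i f x) I)"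
      using True sf_smooth[OF assms(1)]
      by (cases "i \<in> I") (auto simp: sderiv_odd gcoeff_godd_deriv intro: smooth_const smooth_mult)
  qed (use True homog_godd_deriv sf_homog[OF assms(1)] in \<open>auto simp: sderiv_odd parity_simps\<close>)
next
  case False
  then have i: "i \<in> E" using assms by auto
  show ?thesis
  proof (rule sfI)
    fix I show "smooth E U (\<lambda>x. gcoeff (d i f x) I)"
      using smooth_partial[OF sf_smooth[OF assms(1)] i] by (simp add: sderiv_even False gcoeff_even_deriv)
  next
    fix x assume x: "x \<in> U"
    show "homog D (parity D i + p) (d i f x)"
      unfolding homog_def
    proof (intro allI impI)
      fix I assume nz: "gcoeff (d i f x) I \<noteq> 0"
      \<comment> \<open>A coefficient that vanishes on all of \<open>U\<close> has vanishing
        partials there, so an even derivative introduces no new monomial.\<close>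
      have "\<exists>y\<in>U. gcoeff (f y) I \<noteq> 0"
      proof (rule ccontr)
        assume "\<not> (\<exists>y\<in>U. gcoeff (f y) I \<noteq> 0)"
        then have "partial i (\<lambda>y. gcoeff (f y) I) x = partial i (\<lambda>_. 0) x"
          by (intro partial_cong[OF _ x i]) auto
        then show False using nz by (simp add: sderiv_even False gcoeff_even_deriv partial_const)
      qed
      then show "I \<subseteq> D \<and> (even (card I) \<longleftrightarrow> even (parity D i + p))"
        using homogD[OF sf_homog[OF assms(1)]] False by (auto simp: parity_simps)
    qed
  qed
qed

lemma sderiv_add:
  assumes "sf p f" "sf q g" "x \<in> U" "i \<in> E \<union> D"
  shows "d i (\<lambda>x. f x + g x) x = d i f x + d i g x"
proof (cases "i \<in> D")
  case True then show ?thesis by (simp add: sderiv_odd godd_deriv_linear)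
next
  case False
  then show ?thesis using assms
    by (intro grassmann_eqI) (auto simp: sderiv_even gcoeff_even_deriv intro!: partial_add sf_smooth)
qed

lemma sderiv_scaleR:
  assumes "sf p f" "x \<in> U" "i \<in> E \<union> D"
  shows "d i (\<lambda>x. r *\<^sub>R f x) x = r *\<^sub>R d i f x"
proof (cases "i \<in> D")
  case True then show ?thesis by (simp add: sderiv_odd godd_deriv_linear)
next
  case False
  then show ?thesis using assms
    by (intro grassmann_eqI) (auto simp: sderiv_even gcoeff_even_deriv intro!: partial_cmult sf_smooth)
qed

lemma sderiv_const_of_real: "d i (\<lambda>_. of_real r) x = 0"
proof (cases "i \<in> D")
  case True then show ?thesis by (simp add: sderiv_odd godd_deriv_of_real)
next
  case False
  then show ?thesis by (intro grassmann_eqI) (simp add: sderiv_even gcoeff_even_deriv partial_const)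
qed

lemma sderiv_of_real:
  assumes "i \<in> E \<union> D"
  shows "d i (\<lambda>x. of_real (h x)) x = (if i \<in> D then 0 else of_real (partial i h x))"
proof (cases "i \<in> D")
  case True then show ?thesis by (simp add: sderiv_odd godd_deriv_of_real)
next
  case False
  then show ?thesis by (intro grassmann_eqI) (simp add: sderiv_even gcoeff_even_deriv partial_const)
qed

lemma sderiv_sum:
  assumes "\<And>k. k \<in> K \<Longrightarrow> sf (p k) (f k)" "x \<in> U" "i \<in> E \<union> D"
  shows "d i (\<lambda>x. \<Sum>k\<in>K. f k x) x = (\<Sum>k\<in>K. d i (f k) x)"
proof (cases "i \<in> D")
  case True
  then show ?thesis
    by (simp add: sderiv_odd) (induction K rule: infinite_finite_induct; simp add: godd_deriv_linear)
next
  case False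
  then show ?thesis using assms
    by (intro grassmann_eqI) (auto simp: sderiv_even gcoeff_even_deriv intro!: partial_sum sf_smooth)
qed

lemma sderiv_diff:
  assumes "sf p f" "sf q g" "x \<in> U" "i \<in> E \<union> D"
  shows "d i (\<lambda>x. f x - g x) x = d i f x - d i g x"
  using sderiv_add[OF assms(1) sf_scaleR[OF assms(2), of "-1"] assms(3,4)]
    sderiv_scaleR[OF assms(2-4), of "-1"] by simp

lemma sderiv_mult:
  assumes "sf p f" "sf q g" "x \<in> U" "i \<in> E \<union> D"
  shows "d i (\<lambda>x. f x * g x) x = d i f x * g x + (-1) ^ (parity D i * p) *\<^sub>R (f x * d i g x)"
proof (cases "i \<in> D")
  case True
  then show ?thesis using godd_deriv_mult[OF sf_homog[OF assms(1,3)]] by (simp add: sderiv_odd parity_simps)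
next
  case False
  then have i: "i \<in> E" using assms by auto
  show ?thesis
  proof (rule grassmann_eqI)
    fix K
    let ?F = "\<lambda>I y. gcoeff (f y) I" and ?G = "\<lambda>I y. gcoeff (g y) I"
    have s: "smooth E U (?F I)" "smooth E U (?G I)" for I using sf_smooth assms by auto
    have "gcoeff (d i (\<lambda>x. f x * g x) x) K = partial i (\<lambda>y. \<Sum>I\<in>Pow K. koszul I (K - I) * ?F I y * ?G (K - I) y) x"
      by (simp add: sderiv_even False gcoeff_even_deriv gcoeff_mult)
    also have "\<dots> = (\<Sum>I\<in>Pow K. partial i (\<lambda>y. koszul I (K - I) * ?F I y * ?G (K - I) y) x)"
      by (rule partial_sum[OF _ assms(3) i]) (intro smooth_mult smooth_const s)
    also have "\<dots> = (\<Sum>I\<in>Pow K. koszul I (K - I) * partial i (?F I) x * ?G (K - I) x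
        + koszul I (K - I) * ?F I x * partial i (?G (K - I)) x)"
    proof (rule sum.cong[OF refl])
      fix I
      have "partial i (\<lambda>y. koszul I (K - I) * ?F I y * ?G (K - I) y) x =
          partial i (\<lambda>y. koszul I (K - I) * ?F I y) x * ?G (K - I) x
          + koszul I (K - I) * ?F I x * partial i (?G (K - I)) x"
        by (rule partial_mult[OF _ s(2) assms(3) i]) (intro smooth_mult smooth_const s)
      also have "partial i (\<lambda>y. koszul I (K - I) * ?F I y) x = koszul I (K - I) * partial i (?F I) x"
        by (rule partial_cmult[OF s(1) assms(3) i])
      finally show "partial i (\<lambda>y. koszul I (K - I) * ?F I y * ?G (K - I) y) x =
          koszul I (K - I) * partial i (?F I) x * ?G (K - I) x
          + koszul I (K - I) * ?F I x * partial i (?G (K - I)) x" .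
    qed
    also have "\<dots> = gcoeff (d i f x * g x + (-1) ^ (parity D i * p) *\<^sub>R (f x * d i g x)) K"
      by (simp add: sderiv_even False gcoeff_even_deriv gcoeff_mult sum.distrib parity_simps)
    finally show "gcoeff (d i (\<lambda>x. f x * g x) x) K =
        gcoeff (d i f x * g x + (-1) ^ (parity D i * p) *\<^sub>R (f x * d i g x)) K" .
  qed
qed

text \<open>Odd derivatives anticommute algebraically and even ones commute by the symmetry of mixed
  partials; a mixed pair commutes because an odd derivative only moves coefficients and multiplies
  them by constants.\<close>

lemma sderiv_commute:
  assumes f: "sf p f" and x: "x \<in> U" and ij: "i \<in> E \<union> D" "j \<in> E \<union> D"
  shows "d i (d j f) x = (-1) ^ (parity D i * parity D j) *\<^sub>R d j (d i f) x"
proof -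
  have eo: "d i (d j f) x = d j (d i f) x" if "i \<in> E" "i \<notin> D" "j \<in> D" for i j
  proof (rule grassmann_eqI)
    fix I
    show "gcoeff (d i (d j f) x) I = gcoeff (d j (d i f) x) I"
      using that partial_cmult[OF sf_smooth[OF f] x that(1), of "koszul {j} I"]
      by (cases "j \<in> I") (simp_all add: sderiv_even sderiv_odd gcoeff_even_deriv gcoeff_godd_deriv partial_const)
  qed
  have ED: "k \<in> E \<longleftrightarrow> k \<notin> D" if "k \<in> E \<union> D" for k using disj that by auto
  consider "i \<in> D" "j \<in> D" | "i \<in> D" "j \<notin> D" | "i \<notin> D" "j \<in> D" | "i \<notin> D" "j \<notin> D" by blast
  then show ?thesis
  proof cases
    case 1
    then show ?thesis
      using godd_deriv_anticommute[of i j "f x"] by (simp add: sderiv_odd parity_simps)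
  next
    case 2
    then show ?thesis using eo[of j i] ij ED by (simp add: parity_simps)
  next
    case 3
    then show ?thesis using eo[of i j] ij ED by (simp add: parity_simps)
  next
    case 4
    then have E: "i \<in> E" "j \<in> E" using ij by auto
    show ?thesis
    proof (rule grassmann_eqI)
      fix I
      show "gcoeff (d i (d j f) x) I = gcoeff ((-1) ^ (parity D i * parity D j) *\<^sub>R d j (d i f) x) I"
        using partial_commute[OF sf_smooth[OF f] E x] 4
        by (simp add: sderiv_even parity_simps gcoeff_even_deriv)
    qed
  qed
qed

end

section \<open>Substitution\<close>

definition taylor_term :: "nat set \<Rightarrow> point \<Rightarrow> (nat \<Rightarrow> grassmann) \<Rightarrow> nat \<Rightarrow> (point \<Rightarrow> real) \<Rightarrow> grassmann" where
  "taylor_term E b v k g = (\<Sum>is | set is \<subseteq> E \<and> length is = k.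
     (partials is g b / fact k) *\<^sub>R prod_list (map v is))"

lemma subst_taylor_term:
  "subst E D \<phi> f x = (\<Sum>I\<in>Pow D. (\<Sum>k\<le>card D.
     taylor_term E (body_map E \<phi> x) (\<lambda>i. \<phi> i x - of_real (gbody (\<phi> i x))) k (\<lambda>y. gcoeff (f y) I)) *
     oprod (\<lambda>i. \<phi> i x) I)"
  by (simp add: subst_def taylor_term_def oprod_def)

lemma taylor_term_0: "taylor_term E b v 0 g = of_real (g b)"
proof -
  have "{is. set is \<subseteq> E \<and> length is = 0} = {[]}" by auto
  then show ?thesis by (simp add: taylor_term_def of_real_def)
qed

text \<open>Euler's relation for the part of degree \<open>k + 1\<close> of the Taylor series; the
  later inductions on the degree run through it.\<close>

lemma taylor_term_Suc:
  assumes "\<And>i. i \<in> E \<Longrightarrow> homog D 0 (v i)"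
  shows "real (Suc k) *\<^sub>R taylor_term E b v (Suc k) g = (\<Sum>i\<in>E. v i * taylor_term E b v k (partial i g))"
proof -
  let ?L = "\<lambda>k. {is. set is \<subseteq> E \<and> length is = k}"
  have fact: "real (Suc k) * (c / fact (Suc k)) = c / fact k" for c :: real
    by (simp add: divide_simps)
  have "real (Suc k) *\<^sub>R taylor_term E b v (Suc k) g =
      (\<Sum>is\<in>?L (Suc k). (partials is g b / fact k) *\<^sub>R prod_list (map v is))"
    unfolding taylor_term_def scaleR_sum_right scaleR_scaleR fact ..
  \<comment> \<open>The last entry is split off because \<open>partials\<close> applies it first, so
    that \<open>partials (is @ [i]) g\<close> is \<open>partials is (partial i g)\<close>. As
    \<open>v i\<close> is even, the last factor can afterwards move to the front.\<close>
  also have "\<dots> = (\<Sum>(i, is)\<in>E \<times> ?L k. (partials (is @ [i]) g b / fact k) *\<^sub>R prod_list (map v (is @ [i])))"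
  proof (rule sum.reindex_bij_witness[where i = "\<lambda>(i, is). is @ [i]" and j = "\<lambda>is. (last is, butlast is)"])
    fix a assume a: "a \<in> ?L (Suc k)"
    then have "a \<noteq> []" by auto
    then show "(case (last a, butlast a) of (i, is) \<Rightarrow> is @ [i]) = a" by simp
    show "(last a, butlast a) \<in> E \<times> ?L k"
      using a \<open>a \<noteq> []\<close> by (auto dest: in_set_butlastD)
    show "(case (last a, butlast a) of (i, is) \<Rightarrow> (partials (is @ [i]) g b / fact k) *\<^sub>R prod_list (map v (is @ [i]))) =
        (partials a g b / fact k) *\<^sub>R prod_list (map v a)"
      using \<open>a \<noteq> []\<close> by (metis (mono_tags, lifting) append_butlast_last_id case_prod_conv)
  qed auto
  also have "\<dots> = (\<Sum>i\<in>E. \<Sum>is\<in>?L k. (partials (is @ [i]) g b / fact k) *\<^sub>R prod_list (map v (is @ [i])))"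
    by (rule sum.cartesian_product[symmetric])
  also have "\<dots> = (\<Sum>i\<in>E. v i * taylor_term E b v k (partial i g))"
  proof (rule sum.cong[OF refl])
    fix i assume "i \<in> E"
    show "(\<Sum>is\<in>?L k. (partials (is @ [i]) g b / fact k) *\<^sub>R prod_list (map v (is @ [i]))) =
        v i * taylor_term E b v k (partial i g)"
      unfolding taylor_term_def sum_distrib_left
      by (rule sum.cong[OF refl]) (simp add: homog_even_commute[OF assms[OF \<open>i \<in> E\<close>]])
  qed
  finally show ?thesis .
qed

text \<open>The superfunctions \<open>\<phi>\<close> on \<open>U\<close> are the coordinates of a morphism to \<open>V\<close>; \<open>nil\<close> are the nilpotent
  parts of its even coordinates.\<close>

locale supermap = U: superdomain E U D + V: superdomain E V D for E U V D +
  fixes \<phi> :: "nat \<Rightarrow> superfun"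
  assumes sf_phi: "i \<in> E \<union> D \<Longrightarrow> superfunction E D U (parity D i) (\<phi> i)"
    and body: "x \<in> U \<Longrightarrow> body_map E \<phi> x \<in> V"
begin

abbreviation b :: "point \<Rightarrow> point" where "b \<equiv> body_map E \<phi>"

definition nil :: "nat \<Rightarrow> superfun" where "nil i x = \<phi> i x - of_real (gbody (\<phi> i x))"

definition T :: "nat \<Rightarrow> (point \<Rightarrow> real) \<Rightarrow> superfun" where
  "T k g x = taylor_term E (b x) (\<lambda>i. nil i x) k g"

definition taylor :: "(point \<Rightarrow> real) \<Rightarrow> superfun" where
  "taylor g x = (\<Sum>k\<le>card D. T k g x)"

lemma subst_taylor: "subst E D \<phi> f x = (\<Sum>I\<in>Pow D. taylor (\<lambda>y. gcoeff (f y) I) x * oprod (\<lambda>i. \<phi> i x) I)"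
  by (simp add: subst_taylor_term taylor_def T_def nil_def)

lemma sf_even: "i \<in> E \<Longrightarrow> U.sf 0 (\<phi> i)"
  using sf_phi[of i] U.disj by (auto simp: parity_def disjoint_iff)

lemma sf_odd: "i \<in> D \<Longrightarrow> U.sf 1 (\<phi> i)"
  using sf_phi[of i] by (simp add: parity_def)

lemma b_outside: "i \<notin> E \<Longrightarrow> b x i = 0"
  by (simp add: body_map_def)

lemma smooth_b: "i \<in> E \<Longrightarrow> smooth E U (\<lambda>x. b x i)"
  using U.sf_smooth[OF sf_even, of i "{}"] by (simp add: body_map_def gbody_def)

lemma sf_b: "i \<in> E \<Longrightarrow> U.sf 0 (\<lambda>x. of_real (b x i))"
  by (rule U.sf_of_real[OF smooth_b])

lemma nil_eq: "i \<in> E \<Longrightarrow> nil i = (\<lambda>x. \<phi> i x - of_real (b x i))"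
  by (simp add: nil_def body_map_def fun_eq_iff)

lemma sf_nil: "i \<in> E \<Longrightarrow> U.sf 0 (nil i)"
  unfolding nil_eq by (intro U.sf_diff sf_even sf_b)

lemma homog_nil: "i \<in> E \<Longrightarrow> x \<in> U \<Longrightarrow> homog D 0 (nil i x)"
  by (rule U.sf_homog[OF sf_nil])

lemma deg_nil: "i \<in> E \<Longrightarrow> x \<in> U \<Longrightarrow> deg_ge D 1 (nil i x)"
  by (rule deg_ge_1[OF homog_nil]) (auto simp: nil_def U.fin_D)

lemma T_0: "T 0 g x = of_real (g (b x))"
  by (simp add: T_def taylor_term_0)

lemma T_Suc: "x \<in> U \<Longrightarrow> real (Suc k) *\<^sub>R T (Suc k) g x = (\<Sum>i\<in>E. nil i x * T k (partial i g) x)"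
  unfolding T_def by (rule taylor_term_Suc) (rule homog_nil)

lemma T_Suc': "x \<in> U \<Longrightarrow> T (Suc k) g x = (1 / real (Suc k)) *\<^sub>R (\<Sum>i\<in>E. nil i x * T k (partial i g) x)"
  by (simp add: T_Suc[symmetric] del: of_nat_Suc)

lemma T_cong:
  assumes "\<And>y. y \<in> V \<Longrightarrow> g y = h y" "x \<in> U"
  shows "T k g x = T k h x"
  unfolding T_def taylor_term_def
  using V.partials_cong[OF assms(1) body[OF assms(2)]] by (intro sum.cong[OF refl]) simp

lemma taylor_cong: "(\<And>y. y \<in> V \<Longrightarrow> g y = h y) \<Longrightarrow> x \<in> U \<Longrightarrow> taylor g x = taylor h x"
  unfolding taylor_def using T_cong by (intro sum.cong[OF refl]) blast

lemma deg_T: "x \<in> U \<Longrightarrow> deg_ge D k (T k g x)"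
proof (induction k arbitrary: g)
  case 0
  show ?case unfolding T_0 by (rule deg_ge_0[OF homog_of_real])
next
  case (Suc k)
  have "deg_ge D (Suc k) (nil i x * T k (partial i g) x)" if "i \<in> E" for i
    using deg_ge_mult[OF deg_nil[OF that Suc.prems] Suc.IH[OF Suc.prems]] by simp
  then show ?case unfolding T_Suc'[OF Suc.prems] by (auto intro: deg_ge_scaleR deg_ge_sum)
qed

lemma T_vanish: "x \<in> U \<Longrightarrow> card D < k \<Longrightarrow> T k g x = 0"
  by (rule deg_ge_vanish[OF deg_T U.fin_D])

lemma sf_T: "smooth E V g \<Longrightarrow> U.sf 0 (T k g)"
proof (induction k arbitrary: g)
  case 0
  have "smooth E U (\<lambda>x. g (b x))"
    by (rule smooth_compose[OF U.open_coord_axioms V.open_coord_axioms 0 smooth_b b_outside body])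
  then show ?case using U.sf_of_real by (simp add: T_0[abs_def])
next
  case (Suc k)
  have "U.sf 0 (\<lambda>x. (1 / real (Suc k)) *\<^sub>R (\<Sum>i\<in>E. nil i x * T k (partial i g) x))"
    by (intro U.sf_scaleR U.sf_sum U.sf_mult_even sf_nil Suc.IH V.smooth_partial Suc.prems)
  then show ?case by (rule U.sf_cong[THEN iffD1, rotated]) (rule T_Suc'[symmetric])
qed

lemma sf_taylor: "smooth E V g \<Longrightarrow> U.sf 0 (taylor g)"
  unfolding taylor_def by (intro U.sf_sum sf_T)

lemma T_add: 
  assumes "smooth E V g" "smooth E V h" "x \<in> U"
  shows "T k (\<lambda>y. g y + h y) x = T k g x + T k h x"
  using assms(1,2)
proof (induction k arbitrary: g h)
  case 0 show ?case by (simp add: T_0)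
next
  case (Suc k)
  have "T k (partial i (\<lambda>y. g y + h y)) x = T k (\<lambda>y. partial i g y + partial i h y) x" if "i \<in> E" for i
    using V.partial_add[OF Suc.prems _ that] by (rule T_cong[OF _ assms(3)])
  then show ?case
    using Suc.IH[OF V.smooth_partial[OF Suc.prems(1)] V.smooth_partial[OF Suc.prems(2)]]
    by (simp add: T_Suc'[OF assms(3)] distrib_left sum.distrib scaleR_add_right)
qed

lemma T_cmult: 
  assumes "smooth E V g" "x \<in> U"
  shows "T k (\<lambda>y. c * g y) x = c *\<^sub>R T k g x"
  using assms(1)
proof (induction k arbitrary: g)
  case 0 show ?case by (simp add: T_0 scaleR_conv_of_real)
next
  case (Suc k)
  have "T k (partial i (\<lambda>y. c * g y)) x = T k (\<lambda>y. c * partial i g y) x" if "i \<in> E" for i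
    using V.partial_cmult[OF Suc.prems _ that] by (rule T_cong[OF _ assms(2)])
  then show ?case
    using Suc.IH[OF V.smooth_partial[OF Suc.prems]]
    by (simp add: T_Suc'[OF assms(2)] scaleR_sum_right mult.commute)
qed

lemma taylor_add:
  "smooth E V g \<Longrightarrow> smooth E V h \<Longrightarrow> x \<in> U \<Longrightarrow> taylor (\<lambda>y. g y + h y) x = taylor g x + taylor h x"
  by (simp add: taylor_def T_add sum.distrib)

lemma taylor_cmult: "smooth E V g \<Longrightarrow> x \<in> U \<Longrightarrow> taylor (\<lambda>y. c * g y) x = c *\<^sub>R taylor g x"
  by (simp add: taylor_def T_cmult scaleR_sum_right)

lemma taylor_zero: "x \<in> U \<Longrightarrow> taylor (\<lambda>_. 0) x = 0"
  using taylor_cmult[OF V.smooth_const, of x 0 0] by simp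

lemma taylor_sum:
  assumes "\<And>k. k \<in> K \<Longrightarrow> smooth E V (g k)" "x \<in> U"
  shows "taylor (\<lambda>y. \<Sum>k\<in>K. g k y) x = (\<Sum>k\<in>K. taylor (g k) x)"
  using assms(1)
proof (induction K rule: infinite_finite_induct)
  case (insert k K)
  have "taylor (\<lambda>y. g k y + (\<Sum>k\<in>K. g k y)) x = taylor (g k) x + taylor (\<lambda>y. \<Sum>k\<in>K. g k y) x"
    by (intro taylor_add V.smooth_sum assms(2) insert.prems) auto
  also have "taylor (\<lambda>y. \<Sum>k\<in>K. g k y) x = (\<Sum>k\<in>K. taylor (g k) x)"
    using insert.IH insert.prems by simp
  finally show ?case using insert.hyps by simp
qed (simp_all add: taylor_zero assms(2))

text \<open>Euler's relation and the product rule reduce degree \<open>k + 1\<close> to degree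
  \<open>k\<close>. In the two resulting sums the product of the parts of degrees \<open>j\<close>
  and \<open>k + 1 - j\<close> has the weights \<open>j\<close> and \<open>k + 1 - j\<close>, which
  add up to \<open>k + 1\<close>.\<close>

lemma T_mult:
  assumes "smooth E V g" "smooth E V h" and x: "x \<in> U"
  shows "T k (\<lambda>y. g y * h y) x = (\<Sum>j\<le>k. T j g x * T (k - j) h x)"
  using assms(1,2)
proof (induction k arbitrary: g h)
  case 0 show ?case by (simp add: T_0)
next
  case (Suc k)
  note g = Suc.prems(1) and h = Suc.prems(2)
  have com: "nil i x * (a * c) = a * (nil i x * c)" if "i \<in> E" for i a c
    by (simp only: mult.assoc[symmetric] homog_even_commute[OF homog_nil[OF that x], of a])
  have step: "nil i x * T k (partial i (\<lambda>y. g y * h y)) x =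
     (\<Sum>j\<le>k. nil i x * T j (partial i g) x * T (k - j) h x + T j g x * (nil i x * T (k - j) (partial i h) x))"
    if i: "i \<in> E" for i
  proof -
    have "T k (partial i (\<lambda>y. g y * h y)) x = T k (\<lambda>y. partial i g y * h y + g y * partial i h y) x"
      by (rule T_cong[OF _ x]) (rule V.partial_mult[OF g h _ i])
    also have "\<dots> = T k (\<lambda>y. partial i g y * h y) x + T k (\<lambda>y. g y * partial i h y) x"
      by (intro T_add V.smooth_mult V.smooth_partial g h i x)
    also have "\<dots> = (\<Sum>j\<le>k. T j (partial i g) x * T (k - j) h x) + (\<Sum>j\<le>k. T j g x * T (k - j) (partial i h) x)"
      by (simp add: Suc.IH[OF V.smooth_partial[OF g i] h] Suc.IH[OF g V.smooth_partial[OF h i]])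
    finally show ?thesis
      by (simp add: distrib_left sum_distrib_left sum.distrib com[OF i] mult.assoc)
  qed
  have "real (Suc k) *\<^sub>R T (Suc k) (\<lambda>y. g y * h y) x =
     (\<Sum>i\<in>E. \<Sum>j\<le>k. nil i x * T j (partial i g) x * T (k - j) h x + T j g x * (nil i x * T (k - j) (partial i h) x))"
    unfolding T_Suc[OF x] by (rule sum.cong[OF refl step])
  also have "\<dots> = (\<Sum>j\<le>k. \<Sum>i\<in>E. nil i x * T j (partial i g) x * T (k - j) h x + T j g x * (nil i x * T (k - j) (partial i h) x))"
    by (rule sum.swap)
  also have "\<dots> = (\<Sum>j\<le>k. (\<Sum>i\<in>E. nil i x * T j (partial i g) x) * T (k - j) h x + T j g x * (\<Sum>i\<in>E. nil i x * T (k - j) (partial i h) x))"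
    by (simp add: sum.distrib sum_distrib_left sum_distrib_right)
  also have "\<dots> = (\<Sum>j\<le>k. real (Suc j) *\<^sub>R (T (Suc j) g x * T (k - j) h x))
      + (\<Sum>j\<le>k. real (Suc (k - j)) *\<^sub>R (T j g x * T (Suc (k - j)) h x))"
    unfolding T_Suc[OF x, symmetric] by (simp only: sum.distrib mult_scaleR_left mult_scaleR_right)
  also have "(\<Sum>j\<le>k. real (Suc j) *\<^sub>R (T (Suc j) g x * T (k - j) h x)) =
      (\<Sum>j\<le>Suc k. real j *\<^sub>R (T j g x * T (Suc k - j) h x))"
    unfolding sum.atMost_Suc_shift by simp
  also have "(\<Sum>j\<le>k. real (Suc (k - j)) *\<^sub>R (T j g x * T (Suc (k - j)) h x)) =
      (\<Sum>j\<le>Suc k. real (Suc k - j) *\<^sub>R (T j g x * T (Suc k - j) h x))"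
    by (simp add: Suc_diff_le add_diff_eq)
  also have "(\<Sum>j\<le>Suc k. real j *\<^sub>R (T j g x * T (Suc k - j) h x)) +
      (\<Sum>j\<le>Suc k. real (Suc k - j) *\<^sub>R (T j g x * T (Suc k - j) h x)) =
      real (Suc k) *\<^sub>R (\<Sum>j\<le>Suc k. T j g x * T (Suc k - j) h x)"
    unfolding sum.distrib[symmetric] scaleR_sum_right
    by (rule sum.cong[OF refl]) (simp add: of_nat_diff flip: scaleR_add_left)
  finally show ?case by simp
qed

text \<open>The truncated product runs over a square of degree pairs, the truncated series of the
  product over a triangle; the difference consists of terms of degree above \<open>card D\<close>,
  which vanish.\<close>

lemma taylor_mult:
  assumes "smooth E V g" "smooth E V h" and x: "x \<in> U"
  shows "taylor (\<lambda>y. g y * h y) x = taylor g x * taylor h x"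
proof -
  let ?N = "card D" and ?f = "\<lambda>(j, l). T j g x * T l h x"
  have van: "j + l \<le> ?N" if "T j g x * T l h x \<noteq> 0" for j l
    using deg_ge_vanish[OF deg_ge_mult[OF deg_T[OF x] deg_T[OF x]] U.fin_D] that by (meson not_le)
  have "taylor (\<lambda>y. g y * h y) x = (\<Sum>k\<le>?N. \<Sum>j\<le>k. T j g x * T (k - j) h x)"
    by (simp add: taylor_def T_mult[OF assms])
  also have "\<dots> = (\<Sum>(k, j)\<in>(SIGMA k:{..?N}. {..k}). T j g x * T (k - j) h x)"
    by (rule sum.Sigma) auto
  also have "\<dots> = sum ?f {(j, l). j + l \<le> ?N}"
    by (rule sum.reindex_bij_witness[where i = "\<lambda>(j, l). (j + l, j)" and j = "\<lambda>(k, j). (j, k - j)"]) auto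
  also have "\<dots> = sum ?f ({..?N} \<times> {..?N})"
    by (rule sum.mono_neutral_left) (auto intro: van)
  also have "\<dots> = (\<Sum>j\<le>?N. \<Sum>l\<le>?N. T j g x * T l h x)"
    by (rule sum.cartesian_product[symmetric])
  finally show ?thesis by (simp add: taylor_def sum_product)
qed

text \<open>A term of degree \<open>k\<close> depends on the coordinates through its base point and
  through the \<open>k\<close> nilpotent factors. Differentiating the base point keeps the degree,
  differentiating a factor lowers it by one.\<close>

lemma sderiv_T:
  assumes "smooth E V g" and x: "x \<in> U" and i: "i \<in> E \<union> D"
  shows "U.d i (T k g) x = (\<Sum>j\<in>E. U.d i (\<lambda>x. of_real (b x j)) x * T k (partial j g) x) +
    (if k = 0 then 0 else (\<Sum>j\<in>E. U.d i (nil j) x * T (k - 1) (partial j g) x))"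
  using assms(1)
proof (induction k arbitrary: g)
  case 0
  have "partial i (\<lambda>x. g (b x)) x = (\<Sum>j\<in>E. partial i (\<lambda>x. b x j) x * partial j g (b x))" if "i \<in> E"
    by (rule partial_compose[OF U.open_coord_axioms V.open_coord_axioms 0 smooth_b b_outside body x that])
  then show ?case using i unfolding T_0[abs_def] U.sderiv_of_real[OF i] T_0 by auto
next
  case (Suc k)
  note g = Suc.prems
  have com: "nil l x * (a * c) = a * (nil l x * c)" if "l \<in> E" for l a c
    by (simp only: mult.assoc[symmetric] homog_even_commute[OF homog_nil[OF that x], of a])
  have swap: "T m (partial j (partial l g)) x = T m (partial l (partial j g)) x" if "j \<in> E" "l \<in> E" for j l m
    by (rule T_cong[OF _ x]) (rule V.partial_commute[OF g that])
  let ?b = "\<lambda>j. U.d i (\<lambda>x. of_real (b x j)) x" and ?n = "\<lambda>j. U.d i (nil j) x"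
  have "real (Suc k) *\<^sub>R U.d i (T (Suc k) g) x = U.d i (\<lambda>x. real (Suc k) *\<^sub>R T (Suc k) g x) x"
    by (rule U.sderiv_scaleR[OF sf_T[OF g] x i, symmetric])
  also have "\<dots> = U.d i (\<lambda>x. \<Sum>l\<in>E. nil l x * T k (partial l g) x) x"
    by (rule U.sderiv_cong[OF _ x i]) (rule T_Suc)
  also have "\<dots> = (\<Sum>l\<in>E. U.d i (\<lambda>x. nil l x * T k (partial l g) x) x)"
    by (rule U.sderiv_sum[where p = "\<lambda>_. 0", OF _ x i]) (intro U.sf_mult_even sf_nil sf_T V.smooth_partial g)
  also have "\<dots> = (\<Sum>l\<in>E. ?n l * T k (partial l g) x + nil l x * U.d i (T k (partial l g)) x)"
    using U.sderiv_mult[OF sf_nil sf_T[OF V.smooth_partial[OF g]] x i] by (intro sum.cong[OF refl]) simp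
  also have "\<dots> = (\<Sum>l\<in>E. ?n l * T k (partial l g) x) + ((\<Sum>l\<in>E. nil l x * (\<Sum>j\<in>E. ?b j * T k (partial j (partial l g)) x)) +
      (\<Sum>l\<in>E. nil l x * (if k = 0 then 0 else (\<Sum>j\<in>E. ?n j * T (k - 1) (partial j (partial l g)) x))))"
    by (simp add: Suc.IH[OF V.smooth_partial[OF g]] sum.distrib distrib_left)
  also have "(\<Sum>l\<in>E. nil l x * (\<Sum>j\<in>E. ?b j * T k (partial j (partial l g)) x)) =
      real (Suc k) *\<^sub>R (\<Sum>j\<in>E. ?b j * T (Suc k) (partial j g) x)"
  proof -
    have "(\<Sum>l\<in>E. nil l x * (\<Sum>j\<in>E. ?b j * T k (partial j (partial l g)) x)) =
        (\<Sum>l\<in>E. \<Sum>j\<in>E. ?b j * (nil l x * T k (partial l (partial j g)) x))"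
      unfolding sum_distrib_left by (intro sum.cong refl) (simp add: com swap)
    also have "\<dots> = (\<Sum>j\<in>E. ?b j * (\<Sum>l\<in>E. nil l x * T k (partial l (partial j g)) x))"
      unfolding sum_distrib_left by (rule sum.swap)
    finally show ?thesis
      unfolding T_Suc[OF x, symmetric] by (simp add: scaleR_sum_right)
  qed
  also have "(\<Sum>l\<in>E. nil l x * (if k = 0 then 0 else (\<Sum>j\<in>E. ?n j * T (k - 1) (partial j (partial l g)) x))) =
      real k *\<^sub>R (\<Sum>j\<in>E. ?n j * T k (partial j g) x)"
  proof (cases k)
    case (Suc m)
    have "(\<Sum>l\<in>E. nil l x * (\<Sum>j\<in>E. ?n j * T m (partial j (partial l g)) x)) =
        (\<Sum>l\<in>E. \<Sum>j\<in>E. ?n j * (nil l x * T m (partial l (partial j g)) x))"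
      unfolding sum_distrib_left by (intro sum.cong refl) (simp add: com swap)
    also have "\<dots> = (\<Sum>j\<in>E. ?n j * (\<Sum>l\<in>E. nil l x * T m (partial l (partial j g)) x))"
      unfolding sum_distrib_left by (rule sum.swap)
    also have "\<dots> = real (Suc m) *\<^sub>R (\<Sum>j\<in>E. ?n j * T (Suc m) (partial j g) x)"
      unfolding T_Suc[OF x, symmetric] by (simp add: scaleR_sum_right)
    finally show ?thesis by (simp add: Suc)
  qed simp
  finally have *: "real (Suc k) *\<^sub>R U.d i (T (Suc k) g) x =
      real (Suc k) *\<^sub>R ((\<Sum>j\<in>E. ?b j * T (Suc k) (partial j g) x) + (\<Sum>j\<in>E. ?n j * T k (partial j g) x))"
    by (simp add: scaleR_add_right scaleR_add_left add_ac)
  then show ?case by (simp del: of_nat_Suc)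
qed

lemma sderiv_taylor:
  assumes g: "smooth E V g" and x: "x \<in> U" and i: "i \<in> E \<union> D"
  shows "U.d i (taylor g) x = (\<Sum>j\<in>E. U.d i (\<phi> j) x * taylor (partial j g) x)"
proof -
  let ?b = "\<lambda>j. U.d i (\<lambda>x. of_real (b x j)) x" and ?n = "\<lambda>j. U.d i (nil j) x"
  let ?N = "card D"
  \<comment> \<open>including the vanishing term of degree \<open>card D + 1\<close> makes the two truncations agree\<close>
  have "U.d i (taylor g) x = U.d i (\<lambda>x. \<Sum>k\<le>Suc ?N. T k g x) x"
    by (rule U.sderiv_cong[OF _ x i]) (simp add: taylor_def T_vanish)
  also have "\<dots> = (\<Sum>k\<le>Suc ?N. U.d i (T k g) x)"
    by (rule U.sderiv_sum[where p = "\<lambda>_. 0", OF sf_T[OF g] x i])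
  also have "\<dots> = (\<Sum>k\<le>Suc ?N. \<Sum>j\<in>E. ?b j * T k (partial j g) x) +
      (\<Sum>k\<le>Suc ?N. if k = 0 then 0 else (\<Sum>j\<in>E. ?n j * T (k - 1) (partial j g) x))"
    by (simp only: sderiv_T[OF g x i] sum.distrib)
  also have "(\<Sum>k\<le>Suc ?N. \<Sum>j\<in>E. ?b j * T k (partial j g) x) = (\<Sum>j\<in>E. ?b j * taylor (partial j g) x)"
    unfolding taylor_def sum_distrib_left by (subst sum.swap) (simp add: T_vanish[OF x])
  also have "(\<Sum>k\<le>Suc ?N. if k = 0 then 0 else (\<Sum>j\<in>E. ?n j * T (k - 1) (partial j g) x)) =
      (\<Sum>k\<le>?N. \<Sum>j\<in>E. ?n j * T k (partial j g) x)"
    unfolding sum.atMost_Suc_shift by simp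
  also have "\<dots> = (\<Sum>j\<in>E. ?n j * taylor (partial j g) x)"
    unfolding taylor_def sum_distrib_left by (rule sum.swap)
  also have "(\<Sum>j\<in>E. ?b j * taylor (partial j g) x) + (\<Sum>j\<in>E. ?n j * taylor (partial j g) x) =
      (\<Sum>j\<in>E. (?b j + ?n j) * taylor (partial j g) x)"
    by (simp add: distrib_right sum.distrib)
  also have "\<dots> = (\<Sum>j\<in>E. U.d i (\<phi> j) x * taylor (partial j g) x)"
  proof (rule sum.cong[OF refl])
    fix j assume "j \<in> E"
    then have "?n j = U.d i (\<phi> j) x - ?b j"
      unfolding nil_eq[OF \<open>j \<in> E\<close>] by (intro U.sderiv_diff[OF sf_even sf_b x i])
    then show "(?b j + ?n j) * taylor (partial j g) x = U.d i (\<phi> j) x * taylor (partial j g) x" by simp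
  qed
  finally show ?thesis .
qed

section \<open>Pullback of superfunctions and its chain rule\<close>

abbreviation pull :: "superfun \<Rightarrow> superfun" where "pull \<equiv> subst E D \<phi>"

abbreviation odd_prod :: "nat set \<Rightarrow> superfun" where "odd_prod I x \<equiv> oprod (\<lambda>i. \<phi> i x) I"

lemma fin_sub: "I \<subseteq> D \<Longrightarrow> finite I"
  using U.fin_D finite_subset by blast

lemma sf_odd_prod:
  assumes "I \<subseteq> D"
  shows "U.sf (card I) (odd_prod I)"
  using fin_sub[OF assms] assms
proof (induction I rule: finite_min_induct)
  case empty show ?case by (simp add: U.sf_const)
next
  case (insert i J)
  then have "i \<notin> J" by auto
  then show ?case
    using U.sf_mult[OF sf_odd insert.IH, of i] insert
    by (simp add: oprod_insert_less[OF insert.hyps(1,2)])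
qed

lemma odd_homog: "i \<in> D \<Longrightarrow> x \<in> U \<Longrightarrow> homog D 1 (\<phi> i x)"
  by (rule U.sf_homog[OF sf_odd])

lemma homog_taylor: "smooth E V g \<Longrightarrow> x \<in> U \<Longrightarrow> homog D 0 (taylor g x)"
  by (rule U.sf_homog[OF sf_taylor])

lemma pull_cong:
  assumes "\<And>y. y \<in> V \<Longrightarrow> f y = g y" "x \<in> U"
  shows "pull f x = pull g x"
  unfolding subst_taylor
  by (intro sum.cong refl arg_cong2[where f = "(*)"] taylor_cong assms(2)) (simp add: assms(1))

lemma sf_pull:
  assumes "V.sf p f"
  shows "U.sf p (pull f)"
proof -
  have "U.sf p (\<lambda>x. taylor (\<lambda>y. gcoeff (f y) I) x * odd_prod I x)" if I: "I \<in> Pow D" for I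
  proof (cases "even (card I) = even p")
    case True
    then show ?thesis
      using I by (intro U.sf_mult_even[OF sf_taylor[OF V.sf_smooth[OF assms]]] U.sf_parity[OF True sf_odd_prod]) auto
  next
    case False
    then have "gcoeff (f y) I = 0" if "y \<in> V" for y
      using homogD(2)[OF V.sf_homog[OF assms that]] by blast
    then have "taylor (\<lambda>y. gcoeff (f y) I) x = 0" if "x \<in> U" for x
      using taylor_cong[of "\<lambda>y. gcoeff (f y) I" "\<lambda>_. 0" x] taylor_zero that by simp
    then show ?thesis
      by (subst U.sf_cong[where g = "\<lambda>_. 0"]) (simp_all add: U.sf_const)
  qed
  then show ?thesis unfolding subst_taylor[abs_def] by (rule U.sf_sum)
qed

lemma pull_add:
  assumes "V.sf p f" "V.sf q g" "x \<in> U"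
  shows "pull (\<lambda>y. f y + g y) x = pull f x + pull g x"
  unfolding subst_taylor
  by (simp add: taylor_add[OF V.sf_smooth[OF assms(1)] V.sf_smooth[OF assms(2)] assms(3)]
      distrib_right sum.distrib)

lemma pull_scaleR:
  assumes "V.sf p f" "x \<in> U"
  shows "pull (\<lambda>y. c *\<^sub>R f y) x = c *\<^sub>R pull f x"
  unfolding subst_taylor
  by (simp add: taylor_cmult[OF V.sf_smooth[OF assms(1)] assms(2)] scaleR_sum_right)

lemma pull_diff:
  assumes "V.sf p f" "V.sf q g" "x \<in> U"
  shows "pull (\<lambda>y. f y - g y) x = pull f x - pull g x"
  using pull_add[OF assms(1) V.sf_scaleR[OF assms(2), of "-1"] assms(3)] pull_scaleR[OF assms(2,3), of "-1"]
  by simp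

lemma pull_zero: "x \<in> U \<Longrightarrow> pull (\<lambda>_. 0) x = 0"
  using pull_scaleR[OF V.sf_const[OF homog_0], where x = x and c = 0] by simp

lemma pull_sum:
  assumes "\<And>k. k \<in> K \<Longrightarrow> V.sf p (f k)" "x \<in> U"
  shows "pull (\<lambda>y. \<Sum>k\<in>K. f k y) x = (\<Sum>k\<in>K. pull (f k) x)"
  using assms(1)
proof (induction K rule: infinite_finite_induct)
  case (insert k K)
  have "pull (\<lambda>y. f k y + (\<Sum>k\<in>K. f k y)) x = pull (f k) x + pull (\<lambda>y. \<Sum>k\<in>K. f k y) x"
    by (rule pull_add[OF insert.prems V.sf_sum assms(2)]) (auto intro: insert.prems)
  also have "pull (\<lambda>y. \<Sum>k\<in>K. f k y) x = (\<Sum>k\<in>K. pull (f k) x)"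
    using insert.IH insert.prems by simp
  finally show ?case using insert.hyps by simp
qed (simp_all add: pull_zero assms(2))

text \<open>Only disjoint \<open>I\<close> and \<open>J\<close> contribute, and such pairs
  correspond to a set \<open>K = I \<union> J\<close> with a subset \<open>I\<close>; the sign from
  \<open>oprod_mult\<close> is the one in the Grassmann product.\<close>

lemma pull_mult:
  assumes f: "V.sf p f" and g: "V.sf q g" and x: "x \<in> U"
  shows "pull (\<lambda>y. f y * g y) x = pull f x * pull g x"
proof -
  let ?F = "\<lambda>I. taylor (\<lambda>y. gcoeff (f y) I) x" and ?G = "\<lambda>I. taylor (\<lambda>y. gcoeff (g y) I) x"
  let ?h = "\<lambda>I J. koszul I J *\<^sub>R (?F I * ?G J * odd_prod (I \<union> J) x)"
  note s = V.sf_smooth[OF f] V.sf_smooth[OF g]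
  have FG: "taylor (\<lambda>y. gcoeff (f y * g y) K) x = (\<Sum>I\<in>Pow K. koszul I (K - I) *\<^sub>R (?F I * ?G (K - I)))" for K
  proof -
    have "taylor (\<lambda>y. gcoeff (f y * g y) K) x =
        taylor (\<lambda>y. \<Sum>I\<in>Pow K. koszul I (K - I) * (gcoeff (f y) I * gcoeff (g y) (K - I))) x"
      by (simp add: gcoeff_mult mult.assoc)
    also have "\<dots> = (\<Sum>I\<in>Pow K. taylor (\<lambda>y. koszul I (K - I) * (gcoeff (f y) I * gcoeff (g y) (K - I))) x)"
      by (rule taylor_sum[OF _ x]) (intro V.smooth_mult V.smooth_const s)
    also have "\<dots> = (\<Sum>I\<in>Pow K. koszul I (K - I) *\<^sub>R (?F I * ?G (K - I)))"
      by (intro sum.cong refl) (simp only: taylor_cmult[OF V.smooth_mult[OF s] x] taylor_mult[OF s x])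
    finally show ?thesis .
  qed
  have prod: "(?F I * odd_prod I x) * (?G J * odd_prod J x) = (if I \<inter> J = {} then ?h I J else 0)"
    if "I \<subseteq> D" "J \<subseteq> D" for I J
  proof -
    have "(?F I * odd_prod I x) * (?G J * odd_prod J x) = ?F I * ((odd_prod I x * ?G J) * odd_prod J x)"
      by (simp only: mult.assoc)
    also have "odd_prod I x * ?G J = ?G J * odd_prod I x"
      by (rule homog_even_commute[OF homog_taylor[OF s(2) x], symmetric])
    also have "?F I * ((?G J * odd_prod I x) * odd_prod J x) = (?F I * ?G J) * (odd_prod I x * odd_prod J x)"
      by (simp only: mult.assoc)
    also have "odd_prod I x * odd_prod J x = (if I \<inter> J = {} then koszul I J *\<^sub>R odd_prod (I \<union> J) x else 0)"
      using fin_sub[OF that(1)] fin_sub[OF that(2)]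
    proof (rule oprod_mult[where D = D])
      fix i assume "i \<in> I \<union> J"
      then show "homog D 1 (\<phi> i x)" using that odd_homog[OF _ x] by blast
    qed
    finally show ?thesis by (simp add: mult.assoc)
  qed
  have dd: "J - I = J" if "J \<subseteq> D - I" for I J
    using that by blast
  have "pull f x * pull g x = (\<Sum>I\<in>Pow D. \<Sum>J\<in>Pow D. (?F I * odd_prod I x) * (?G J * odd_prod J x))"
    by (simp only: subst_taylor sum_product)
  also have "\<dots> = (\<Sum>I\<in>Pow D. \<Sum>J\<in>Pow D. if I \<inter> J = {} then ?h I J else 0)"
    using prod by (intro sum.cong refl) auto
  also have "\<dots> = (\<Sum>I\<in>Pow D. \<Sum>J\<in>Pow (D - I). ?h I J)"
    by (intro sum.cong[OF refl] sum.mono_neutral_cong_right) (auto simp: U.fin_D)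
  also have "\<dots> = (\<Sum>(I, J)\<in>(SIGMA I:Pow D. Pow (D - I)). ?h I J)"
    by (rule sum.Sigma) (auto simp: U.fin_D)
  also have "\<dots> = (\<Sum>(K, I)\<in>(SIGMA K:Pow D. Pow K). ?h I (K - I))"
    by (rule sum.reindex_bij_witness[where i = "\<lambda>(K, I). (I, K - I)" and j = "\<lambda>(I, J). (I \<union> J, I)"])
       (auto simp: Un_absorb1 Un_Diff dd)
  also have "\<dots> = (\<Sum>K\<in>Pow D. \<Sum>I\<in>Pow K. ?h I (K - I))"
    by (rule sum.Sigma[symmetric]) (auto simp: U.fin_D fin_sub)
  also have "\<dots> = pull (\<lambda>y. f y * g y) x"
    unfolding subst_taylor FG sum_distrib_right mult_scaleR_left
    by (intro sum.cong refl) (auto simp: Un_absorb1)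
  finally show ?thesis by simp
qed

text \<open>Each factor before \<open>j\<close> is passed twice, by the derivative with sign
  \<open>(-1) ^ parity D i\<close> and by the differentiated factor, of parity one higher, on its
  way to the front. Together this is one minus sign per earlier factor, counted by
  \<open>koszul {j} (I - {j})\<close>.\<close>

lemma sderiv_odd_prod:
  assumes I: "I \<subseteq> D" and x: "x \<in> U" and i: "i \<in> E \<union> D"
  shows "U.d i (odd_prod I) x = (\<Sum>j\<in>I. koszul {j} (I - {j}) *\<^sub>R (U.d i (\<phi> j) x * odd_prod (I - {j}) x))"
  using fin_sub[OF I] I
proof (induction I rule: finite_min_induct)
  case empty
  show ?case using U.sderiv_const_of_real[of i 1 x] by simp
next
  case (insert k J)
  then have k: "k \<notin> J" "k \<in> D" "J \<subseteq> D" by auto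
  have anti: "\<phi> k x * U.d i (\<phi> j) x = (-1) ^ Suc (parity D i) *\<^sub>R (U.d i (\<phi> j) x * \<phi> k x)" if "j \<in> J" for j
    using grassmann_supercommute[OF odd_homog[OF k(2) x] U.sf_homog[OF U.sf_sderiv[OF sf_odd i] x, of j]] that k(3)
    by auto
  have step: "(-1) ^ parity D i *\<^sub>R (\<phi> k x * (koszul {j} (J - {j}) *\<^sub>R (U.d i (\<phi> j) x * odd_prod (J - {j}) x))) =
      koszul {j} (insert k J - {j}) *\<^sub>R (U.d i (\<phi> j) x * odd_prod (insert k J - {j}) x)" if j: "j \<in> J" for j
  proof -
    have kj: "k < j" using insert.hyps(2) j .
    have e: "{(a, b). a \<in> {j} \<and> b \<in> {k} \<and> b < a} = {(j, k)}" using kj by auto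
    have "koszul {j} {k} = -1" unfolding koszul_def e by simp
    then have kz: "koszul {j} (insert k (J - {j})) = - koszul {j} (J - {j})"
      using koszul_insert_right[of "{j}" "J - {j}" k] k insert.hyps(1) by simp
    have ins: "insert k J - {j} = insert k (J - {j})" using kj by auto
    have op: "odd_prod (insert k (J - {j})) x = \<phi> k x * odd_prod (J - {j}) x"
      by (rule oprod_insert_less) (use insert.hyps in auto)
    have "(-1) ^ parity D i *\<^sub>R (\<phi> k x * (koszul {j} (J - {j}) *\<^sub>R (U.d i (\<phi> j) x * odd_prod (J - {j}) x))) =
        ((-1) ^ parity D i * koszul {j} (J - {j})) *\<^sub>R ((\<phi> k x * U.d i (\<phi> j) x) * odd_prod (J - {j}) x)"
      by (simp add: mult.assoc)
    also have "\<dots> = - koszul {j} (J - {j}) *\<^sub>R (U.d i (\<phi> j) x * (\<phi> k x * odd_prod (J - {j}) x))"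
      unfolding anti[OF j] by (simp add: mult.assoc power_mult_distrib[symmetric])
    finally show ?thesis unfolding ins kz op .
  qed
  have "U.d i (odd_prod (insert k J)) x = U.d i (\<lambda>x. \<phi> k x * odd_prod J x) x"
    by (simp add: oprod_insert_less[OF insert.hyps(1,2)])
  also have "\<dots> = U.d i (\<phi> k) x * odd_prod J x + (-1) ^ parity D i *\<^sub>R (\<phi> k x * U.d i (odd_prod J) x)"
    using U.sderiv_mult[OF sf_odd[OF k(2)] sf_odd_prod[OF k(3)] x i] by simp
  also have "U.d i (odd_prod J) x = (\<Sum>j\<in>J. koszul {j} (J - {j}) *\<^sub>R (U.d i (\<phi> j) x * odd_prod (J - {j}) x))"
    by (rule insert.IH[OF k(3)])
  also have "(-1) ^ parity D i *\<^sub>R (\<phi> k x * (\<Sum>j\<in>J. koszul {j} (J - {j}) *\<^sub>R (U.d i (\<phi> j) x * odd_prod (J - {j}) x))) =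
      (\<Sum>j\<in>J. koszul {j} (insert k J - {j}) *\<^sub>R (U.d i (\<phi> j) x * odd_prod (insert k J - {j}) x))"
    unfolding sum_distrib_left scaleR_sum_right by (rule sum.cong[OF refl step])
  also have "U.d i (\<phi> k) x * odd_prod J x = koszul {k} (insert k J - {k}) *\<^sub>R (U.d i (\<phi> k) x * odd_prod (insert k J - {k}) x)"
  proof -
    have e: "{(a, b). a \<in> {k} \<and> b \<in> J \<and> b < a} = {}" using insert.hyps(2) by (auto dest: less_asym)
    have "koszul {k} J = 1" unfolding koszul_def e by simp
    then show ?thesis using k(1) by simp
  qed
  finally show ?case using k(1) insert.hyps(1) by simp
qed

text \<open>The even indices \<open>j\<close> come from the Taylor coefficients by
  \<open>sderiv_taylor\<close>, the odd ones from the monomials by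
  \<open>sderiv_odd_prod\<close>.\<close>

theorem chain_rule:
  assumes f: "V.sf p f" and x: "x \<in> U" and i: "i \<in> E \<union> D"
  shows "U.d i (pull f) x = (\<Sum>j\<in>E \<union> D. U.d i (\<phi> j) x * pull (V.d j f) x)"
proof -
  let ?F = "\<lambda>I. taylor (\<lambda>y. gcoeff (f y) I)"
  note s = V.sf_smooth[OF f]
  have "U.d i (pull f) x = (\<Sum>I\<in>Pow D. U.d i (\<lambda>x. ?F I x * odd_prod I x) x)"
    unfolding subst_taylor[abs_def]
    by (rule U.sderiv_sum[where p = card, OF _ x i]) (use U.sf_mult_even[OF sf_taylor[OF s] sf_odd_prod] in auto)
  also have "\<dots> = (\<Sum>I\<in>Pow D. U.d i (?F I) x * odd_prod I x + ?F I x * U.d i (odd_prod I) x)"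
    using U.sderiv_mult[OF sf_taylor[OF s] sf_odd_prod x i] by (intro sum.cong[OF refl]) simp
  also have "\<dots> = (\<Sum>I\<in>Pow D. U.d i (?F I) x * odd_prod I x) + (\<Sum>I\<in>Pow D. ?F I x * U.d i (odd_prod I) x)"
    by (rule sum.distrib)
  also have "(\<Sum>I\<in>Pow D. U.d i (?F I) x * odd_prod I x) = (\<Sum>j\<in>E. U.d i (\<phi> j) x * pull (V.d j f) x)"
  proof -
    have "(\<Sum>I\<in>Pow D. U.d i (?F I) x * odd_prod I x) =
        (\<Sum>I\<in>Pow D. \<Sum>j\<in>E. U.d i (\<phi> j) x * (taylor (partial j (\<lambda>y. gcoeff (f y) I)) x * odd_prod I x))"
      by (simp add: sderiv_taylor[OF s x i] sum_distrib_right mult.assoc)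
    also have "\<dots> = (\<Sum>j\<in>E. U.d i (\<phi> j) x * (\<Sum>I\<in>Pow D. taylor (partial j (\<lambda>y. gcoeff (f y) I)) x * odd_prod I x))"
      unfolding sum_distrib_left by (rule sum.swap)
    also have "\<dots> = (\<Sum>j\<in>E. U.d i (\<phi> j) x * pull (V.d j f) x)"
    proof (rule sum.cong[OF refl])
      fix j assume "j \<in> E"
      then have "j \<notin> D" using U.disj by auto
      then show "U.d i (\<phi> j) x * (\<Sum>I\<in>Pow D. taylor (partial j (\<lambda>y. gcoeff (f y) I)) x * odd_prod I x) =
          U.d i (\<phi> j) x * pull (V.d j f) x"
        by (simp add: subst_taylor V.sderiv_even gcoeff_even_deriv)
    qed
    finally show ?thesis .
  qed
  also have "(\<Sum>I\<in>Pow D. ?F I x * U.d i (odd_prod I) x) = (\<Sum>j\<in>D. U.d i (\<phi> j) x * pull (V.d j f) x)"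
  proof -
    let ?h = "\<lambda>j I. koszul {j} (I - {j}) *\<^sub>R (U.d i (\<phi> j) x * (?F I x * odd_prod (I - {j}) x))"
    have "(\<Sum>I\<in>Pow D. ?F I x * U.d i (odd_prod I) x) = (\<Sum>I\<in>Pow D. \<Sum>j\<in>I. ?h j I)"
    proof (intro sum.cong[OF refl])
      fix I assume "I \<in> Pow D"
      then have I: "I \<subseteq> D" by simp
      have com: "?F I x * (a * c) = a * (?F I x * c)" for a c
        by (simp only: mult.assoc[symmetric] homog_even_commute[OF homog_taylor[OF s x], of I a])
      show "?F I x * U.d i (odd_prod I) x = (\<Sum>j\<in>I. ?h j I)"
        unfolding sderiv_odd_prod[OF I x i] sum_distrib_left mult_scaleR_right com ..
    qed
    also have "\<dots> = (\<Sum>(I, j)\<in>(SIGMA I:Pow D. I). ?h j I)"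
      by (rule sum.Sigma) (auto simp: U.fin_D fin_sub)
    \<comment> \<open>Removing the differentiated index \<open>j\<close> from \<open>I\<close>
      leaves the monomial \<open>J\<close> of the \<open>j\<close>-th odd derivative; the Koszul
      sign is exactly the one in \<open>gcoeff_godd_deriv\<close>.\<close>
    also have "\<dots> = (\<Sum>(j, J)\<in>(SIGMA j:D. {J \<in> Pow D. j \<notin> J}). ?h j (insert j J))"
      by (rule sum.reindex_bij_witness[where i = "\<lambda>(j, J). (insert j J, j)" and j = "\<lambda>(I, j). (j, I - {j})"])
         (auto simp: insert_absorb)
    also have "\<dots> = (\<Sum>j\<in>D. \<Sum>J\<in>{J \<in> Pow D. j \<notin> J}. ?h j (insert j J))"
      by (rule sum.Sigma[symmetric]) (auto simp: U.fin_D)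
    also have "\<dots> = (\<Sum>j\<in>D. U.d i (\<phi> j) x * pull (V.d j f) x)"
    proof (rule sum.cong[OF refl])
      fix j assume j: "j \<in> D"
      have t: "taylor (\<lambda>y. gcoeff (V.d j f y) J) x = (if j \<in> J then 0 else koszul {j} J *\<^sub>R ?F (insert j J) x)" for J
        using taylor_cmult[OF s x] taylor_zero[OF x] by (simp add: V.sderiv_odd[OF j] gcoeff_godd_deriv)
      have "U.d i (\<phi> j) x * pull (V.d j f) x =
          (\<Sum>J\<in>Pow D. if j \<in> J then 0 else ?h j (insert j J))"
        unfolding subst_taylor t sum_distrib_left by (intro sum.cong[OF refl]) simp
      also have "\<dots> = (\<Sum>J\<in>{J \<in> Pow D. j \<notin> J}. ?h j (insert j J))"
        by (rule sum.mono_neutral_cong_right) (auto simp: U.fin_D)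
      finally show "(\<Sum>J\<in>{J \<in> Pow D. j \<notin> J}. ?h j (insert j J)) = U.d i (\<phi> j) x * pull (V.d j f) x" by simp
    qed
    finally show ?thesis .
  qed
  finally show ?thesis by (simp add: sum.union_disjoint[OF U.fin_E U.fin_D U.disj])
qed

end

section \<open>Determinants over commutative rings\<close>

definition cdet :: "nat set \<Rightarrow> (nat \<Rightarrow> nat \<Rightarrow> 'a::comm_ring_1) \<Rightarrow> 'a" where
  "cdet S A = (\<Sum>p | p permutes S. of_int (sign p) * (\<Prod>i\<in>S. A i (p i)))"

lemma cdet_cong: "(\<And>i j. i \<in> S \<Longrightarrow> j \<in> S \<Longrightarrow> A i j = B i j) \<Longrightarrow> cdet S A = cdet S B"
  unfolding cdet_def by (intro sum.cong refl arg_cong2[where f = "(*)"] prod.cong) (auto simp: permutes_in_image)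

lemma cdet_permute_rows:
  assumes "finite S" "q permutes S"
  shows "cdet S (\<lambda>i j. A (q i) j) = of_int (sign q) * cdet S A"
proof -
  have pm: "permutation p" if "p permutes S" for p using that assms(1) permutation_permutes by blast
  have "cdet S (\<lambda>i j. A (q i) j) = (\<Sum>p | p permutes S. of_int (sign (p \<circ> q)) * (\<Prod>i\<in>S. A (q i) ((p \<circ> q) i)))"
    unfolding cdet_def by (rule sum_permutations_compose_right[OF assms(2)])
  also have "\<dots> = (\<Sum>p | p permutes S. of_int (sign q) * (of_int (sign p) * (\<Prod>i\<in>S. A i (p i))))"
  proof (rule sum.cong[OF refl])
    fix p assume "p \<in> {p. p permutes S}"
    then have "sign (p \<circ> q) = sign q * sign p" using sign_compose pm assms(2) by (metis mem_Collect_eq mult.commute)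
    moreover have "(\<Prod>i\<in>S. A i (p i)) = (\<Prod>i\<in>S. A (q i) (p (q i)))"
      using prod.permute[OF assms(2), of "\<lambda>i. A i (p i)"] by (simp add: o_def)
    ultimately show "of_int (sign (p \<circ> q)) * (\<Prod>i\<in>S. A (q i) ((p \<circ> q) i)) =
        of_int (sign q) * (of_int (sign p) * (\<Prod>i\<in>S. A i (p i)))"
      by (simp add: mult.assoc)
  qed
  finally show ?thesis by (simp add: cdet_def sum_distrib_left)
qed

text \<open>Composition with the transposition pairs even with odd permutations of opposite terms.
  The pairing works over any commutative ring, without division by 2.\<close>

lemma cdet_identical_rows:
  assumes fin: "finite S" and kl: "k \<in> S" "l \<in> S" "k \<noteq> l" and eq: "\<And>j. A k j = A l j"
  shows "cdet S A = 0"
proof -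
  let ?t = "Transposition.transpose k l"
  let ?f = "\<lambda>p. of_int (sign p) * (\<Prod>i\<in>S. A i (p i))"
  let ?P = "{p. p permutes S \<and> evenperm p}" and ?N = "{p. p permutes S \<and> \<not> evenperm p}"
  have t: "?t permutes S" using kl by (intro permutes_swap_id)
  have pm: "permutation p" if "p permutes S" for p using that fin permutation_permutes by blast
  have fin': "finite ?P" "finite ?N" using finite_permutations[OF fin] by auto
  have odd: "evenperm (p \<circ> ?t) \<longleftrightarrow> \<not> evenperm p" if "p permutes S" for p
    using evenperm_comp[OF pm[OF that] pm[OF t]] kl(3) evenperm_swap[of k l] by auto
  have tt: "p \<circ> ?t \<circ> ?t = p" for p by (simp add: comp_assoc)
  have f: "?f (p \<circ> ?t) = - ?f p" if p: "p permutes S" for p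
  proof -
    have "sign (p \<circ> ?t) = - sign p" using odd[OF p] by (auto simp: sign_def)
    moreover have "(\<Prod>i\<in>S. A i ((p \<circ> ?t) i)) = (\<Prod>i\<in>S. A (?t i) (p i))"
      using prod.permute[OF t, of "\<lambda>i. A (?t i) (p i)"] by (simp add: o_def)
    moreover have "A (?t i) j = A i j" for i j using eq by (auto simp: Transposition.transpose_def)
    ultimately show ?thesis by simp
  qed
  have "cdet S A = sum ?f (?P \<union> ?N)" unfolding cdet_def by (rule sum.cong) auto
  also have "\<dots> = sum ?f ?P + sum ?f ?N" by (rule sum.union_disjoint) (use fin' in auto)
  also have "sum ?f ?N = (\<Sum>p\<in>?P. ?f (p \<circ> ?t))"
    by (rule sum.reindex_bij_witness[where i = "\<lambda>p. p \<circ> ?t" and j = "\<lambda>p. p \<circ> ?t"])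
       (auto simp: odd tt intro: permutes_compose t)
  also have "\<dots> = - sum ?f ?P" unfolding sum_negf[symmetric] by (rule sum.cong[OF refl]) (use f in auto)
  finally show ?thesis by simp
qed

lemma cdet_row:
  assumes "finite S" "k \<in> S"
  shows "cdet S (A(k := r)) = (\<Sum>p | p permutes S. of_int (sign p) * (r (p k) * (\<Prod>i\<in>S - {k}. A i (p i))))"
proof -
  have "(\<Prod>i\<in>S. (A(k := r)) i (p i)) = r (p k) * (\<Prod>i\<in>S - {k}. A i (p i))" for p
    by (subst prod.remove[OF assms]) (auto intro!: arg_cong2[where f = "(*)"] prod.cong)
  then show ?thesis by (simp add: cdet_def)
qed

lemma cdet_row_other:
  assumes "finite S" "k \<in> S" "l \<in> S"
  shows "cdet S (A(k := A l)) = (if k = l then cdet S A else 0)"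
  using cdet_identical_rows[OF assms, of "A(k := A l)"] by auto

text \<open>Expansion along row \<open>k\<close>; the cofactors appear as determinants with that row
  replaced by a unit vector.\<close>

lemma cdet_row_linear:
  assumes "finite S" "k \<in> S"
  shows "cdet S (A(k := r)) = (\<Sum>j\<in>S. r j * cdet S (A(k := (\<lambda>i. if i = j then 1 else 0))))"
proof -
  have "(\<Sum>j\<in>S. r j * cdet S (A(k := (\<lambda>i. if i = j then 1 else 0)))) =
      (\<Sum>p | p permutes S. \<Sum>j\<in>S. r j * (of_int (sign p) * ((if p k = j then 1 else 0) * (\<Prod>i\<in>S - {k}. A i (p i)))))"
    unfolding cdet_row[OF assms] sum_distrib_left by (rule sum.swap)
  also have "\<dots> = (\<Sum>p | p permutes S. of_int (sign p) * (r (p k) * (\<Prod>i\<in>S - {k}. A i (p i))))"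
  proof (rule sum.cong[OF refl])
    fix p assume "p \<in> {p. p permutes S}"
    then have "p k \<in> S" using assms(2) permutes_in_image by fastforce
    have "(\<Sum>j\<in>S. r j * (of_int (sign p) * ((if p k = j then 1 else 0) * (\<Prod>i\<in>S - {k}. A i (p i))))) =
        (\<Sum>j\<in>S. if p k = j then of_int (sign p) * (r j * (\<Prod>i\<in>S - {k}. A i (p i))) else 0)"
      by (intro sum.cong) auto
    then show "(\<Sum>j\<in>S. r j * (of_int (sign p) * ((if p k = j then 1 else 0) * (\<Prod>i\<in>S - {k}. A i (p i))))) =
        of_int (sign p) * (r (p k) * (\<Prod>i\<in>S - {k}. A i (p i)))"
      using \<open>p k \<in> S\<close> assms(1) by simp
  qed
  finally show ?thesis by (simp add: cdet_row[OF assms])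
qed

lemma cdet_mult:
  assumes fin: "finite S"
  shows "cdet S (\<lambda>i j. \<Sum>l\<in>S. A i l * B l j) = cdet S A * cdet S B"
proof -
  let ?P = "{p. p permutes S}" and ?F = "S \<rightarrow>\<^sub>E S"
  let ?g = "\<lambda>f. (\<Prod>i\<in>S. A i (f i)) * cdet S (\<lambda>i j. B (f i) j)"
  have "cdet S (\<lambda>i j. \<Sum>l\<in>S. A i l * B l j) = (\<Sum>p\<in>?P. of_int (sign p) * (\<Sum>f\<in>?F. \<Prod>i\<in>S. A i (f i) * B (f i) (p i)))"
    unfolding cdet_def by (subst prod_sum_PiE) (use fin in auto)
  also have "\<dots> = (\<Sum>p\<in>?P. \<Sum>f\<in>?F. (\<Prod>i\<in>S. A i (f i)) * (of_int (sign p) * (\<Prod>i\<in>S. B (f i) (p i))))"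
    by (simp add: sum_distrib_left prod.distrib mult_ac)
  also have "\<dots> = (\<Sum>f\<in>?F. ?g f)"
    unfolding cdet_def sum_distrib_left by (rule sum.swap)
  \<comment> \<open>A choice of columns that repeats an index gives two equal rows of
    \<open>B\<close>; the injective choices are the permutations of \<open>S\<close>.\<close>
  also have "\<dots> = (\<Sum>f\<in>{f \<in> ?F. inj_on f S}. ?g f)"
  proof (rule sum.mono_neutral_right)
    show "\<forall>f\<in>?F - {f \<in> ?F. inj_on f S}. ?g f = 0"
    proof
      fix f assume "f \<in> ?F - {f \<in> ?F. inj_on f S}"
      then obtain k l where "k \<in> S" "l \<in> S" "k \<noteq> l" "f k = f l" by (auto simp: inj_on_def)
      then show "?g f = 0" using cdet_identical_rows[OF fin, of k l "\<lambda>i j. B (f i) j"] by simp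
    qed
  qed (use fin finite_PiE in auto)
  also have "\<dots> = (\<Sum>q\<in>?P. ?g q)"
  proof (rule sum.reindex_bij_witness[where i = "\<lambda>q. restrict q S" and j = "\<lambda>f i. if i \<in> S then f i else i"])
    fix f assume f: "f \<in> {f \<in> ?F. inj_on f S}"
    then have im: "f ` S = S" using fin endo_inj_surj[OF fin, of f] by auto
    show "restrict (\<lambda>i. if i \<in> S then f i else i) S = f" using f by (auto simp: restrict_def PiE_def extensional_def)
    have "bij_betw (\<lambda>i. if i \<in> S then f i else i) S S"
      using f im by (auto simp: bij_betw_def inj_on_def)
    then show "(\<lambda>i. if i \<in> S then f i else i) \<in> ?P" by (auto intro: bij_imp_permutes)
    have "cdet S (\<lambda>i j. B (if i \<in> S then f i else i) j) = cdet S (\<lambda>i j. B (f i) j)"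
      by (rule cdet_cong) simp
    then show "?g (\<lambda>i. if i \<in> S then f i else i) = ?g f" by simp
  next
    fix q assume "q \<in> ?P"
    then have q: "q permutes S" by simp
    show "(\<lambda>i. if i \<in> S then restrict q S i else i) = q"
      using permutes_not_in[OF q] by (auto simp: fun_eq_iff)
    show "restrict q S \<in> {f \<in> ?F. inj_on f S}"
      using permutes_in_image[OF q] permutes_inj_on[OF q] by (auto simp: inj_on_def)
  qed
  also have "\<dots> = (\<Sum>q\<in>?P. of_int (sign q) * (\<Prod>i\<in>S. A i (q i)) * cdet S B)"
    by (intro sum.cong refl) (simp add: cdet_permute_rows[OF fin] mult_ac)
  also have "\<dots> = cdet S A * cdet S B" by (simp add: cdet_def[of S A] sum_distrib_right)
  finally show ?thesis .
qed

lemma cdet_one: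
  assumes "finite S"
  shows "cdet S (\<lambda>i j. if i = j then 1 else 0) = 1"
proof -
  have "(\<Prod>i\<in>S. if i = p i then 1 else (0::'a)) = (if p = id then 1 else 0)" if "p permutes S" for p
  proof (cases "p = id")
    case False
    then obtain i where "i \<noteq> p i" by (metis eq_id_iff)
    moreover from this have "i \<in> S" using permutes_not_in[OF that] by metis
    ultimately show ?thesis using False assms by (auto intro!: prod_zero)
  qed simp
  then have "cdet S (\<lambda>i j. if i = j then 1 else (0::'a)) = (\<Sum>p | p permutes S. if p = id then 1 else 0)"
    unfolding cdet_def by (intro sum.cong refl) auto
  also have "\<dots> = 1" using finite_permutations[OF assms] permutes_id[of S] by simp
  finally show ?thesis .
qed

text \<open>If \<open>A B = 1\<close> then \<open>B\<close> has an invertible determinant, hence a right inverse by the cofactor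
  formula, which must be \<open>A\<close>.\<close>

lemma matrix_left_inverse:
  fixes A B :: "nat \<Rightarrow> nat \<Rightarrow> 'a::comm_ring_1"
  assumes fin: "finite S"
    and AB: "\<And>i j. i \<in> S \<Longrightarrow> j \<in> S \<Longrightarrow> (\<Sum>l\<in>S. A i l * B l j) = (if i = j then 1 else 0)"
    and ij: "i \<in> S" "j \<in> S"
  shows "(\<Sum>l\<in>S. B i l * A l j) = (if i = j then 1 else 0)"
proof -
  have "cdet S A * cdet S B = cdet S (\<lambda>i j. if i = j then 1 else 0)"
    unfolding cdet_mult[OF fin, symmetric] by (rule cdet_cong) (simp add: AB)
  then have det: "cdet S A * cdet S B = 1" by (simp add: cdet_one[OF fin])
  define C where "C j k = cdet S A * cdet S (B(k := (\<lambda>i. if i = j then 1 else 0)))" for j k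
  have BC: "(\<Sum>j\<in>S. B l j * C j k) = (if l = k then 1 else 0)" if "l \<in> S" "k \<in> S" for l k
  proof -
    have "(\<Sum>j\<in>S. B l j * C j k) = cdet S A * (\<Sum>j\<in>S. B l j * cdet S (B(k := (\<lambda>i. if i = j then 1 else 0))))"
      by (simp add: C_def sum_distrib_left mult_ac)
    also have "\<dots> = cdet S A * cdet S (B(k := B l))" by (simp only: cdet_row_linear[OF fin that(2), symmetric])
    finally show ?thesis using det by (simp add: cdet_row_other[OF fin that(2,1)])
  qed
  have "C l k = A l k" if "l \<in> S" "k \<in> S" for l k
  proof -
    have "(\<Sum>m\<in>S. (\<Sum>j\<in>S. A l j * B j m) * C m k) = (\<Sum>m\<in>S. if l = m then C m k else 0)"
      by (intro sum.cong refl) (simp add: AB that)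
    then have "C l k = (\<Sum>m\<in>S. (\<Sum>j\<in>S. A l j * B j m) * C m k)" using that fin by simp
    also have "\<dots> = (\<Sum>m\<in>S. \<Sum>j\<in>S. A l j * (B j m * C m k))"
      by (simp only: sum_distrib_right mult.assoc)
    also have "\<dots> = (\<Sum>j\<in>S. A l j * (\<Sum>m\<in>S. B j m * C m k))"
      unfolding sum_distrib_left by (rule sum.swap)
    also have "\<dots> = (\<Sum>j\<in>S. if j = k then A l j else 0)" by (intro sum.cong refl) (simp add: BC that)
    finally show ?thesis using that fin by simp
  qed
  then have "(\<Sum>l\<in>S. B i l * A l j) = (\<Sum>l\<in>S. B i l * C l j)" using ij by (intro sum.cong refl) simp
  then show ?thesis using BC ij by simp
qed

section \<open>Matrices over the Grassmann algebra\<close>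

lemma deg_ge_bodiless:
  assumes "deg_ge D 0 a" "gbody a = 0" "finite D"
  shows "deg_ge D 1 a"
  unfolding deg_ge_def
proof (intro allI impI)
  fix I assume nz: "gcoeff a I \<noteq> 0"
  then have "I \<subseteq> D" "I \<noteq> {}" using assms by (auto simp: deg_ge_def gbody_def)
  then show "I \<subseteq> D \<and> 1 \<le> card I" using assms(3) finite_subset by (simp add: Suc_le_eq card_gt_0_iff)
qed

text \<open>Entries need not commute, so determinants are used only for the real matrices of bodies,
  where they show that \<open>P\<close>, that is \<open>B A - 1\<close>, has no body. Iterating
  \<open>P = - P P\<close> then pushes \<open>P\<close> into every degree of the filtration.\<close>

lemma gmatrix_left_inverse:
  fixes A B :: gmatrix
  assumes fin: "finite S" "finite D"
    and A: "\<And>i j. i \<in> S \<Longrightarrow> j \<in> S \<Longrightarrow> deg_ge D 0 (A i j)" and B: "\<And>i j. i \<in> S \<Longrightarrow> j \<in> S \<Longrightarrow> deg_ge D 0 (B i j)"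
    and AB: "\<And>i j. i \<in> S \<Longrightarrow> j \<in> S \<Longrightarrow> (\<Sum>l\<in>S. A i l * B l j) = (if i = j then 1 else 0)"
    and ij: "i \<in> S" "j \<in> S"
  shows "(\<Sum>l\<in>S. B i l * A l j) = (if i = j then 1 else 0)"
proof -
  define one :: gmatrix where "one i j = (if i = j then 1 else 0)" for i j
  define R where "R i j = (\<Sum>l\<in>S. B i l * A l j)" for i j
  define P where "P i j = R i j - one i j" for i j
  have mult_one: "(\<Sum>l\<in>S. X i l * one l j) = X i j" "(\<Sum>l\<in>S. one i l * X l j) = X i j"
    if "i \<in> S" "j \<in> S" for X :: gmatrix and i j
  proof -
    have "(\<Sum>l\<in>S. X i l * one l j) = (\<Sum>l\<in>S. if l = j then X i l else 0)"
      "(\<Sum>l\<in>S. one i l * X l j) = (\<Sum>l\<in>S. if i = l then X l j else 0)"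
      by (auto simp: one_def intro!: sum.cong)
    then show "(\<Sum>l\<in>S. X i l * one l j) = X i j" "(\<Sum>l\<in>S. one i l * X l j) = X i j"
      using that fin by auto
  qed
  have assoc: "(\<Sum>k\<in>S. (\<Sum>l\<in>S. X i l * Y l k) * Z k j) = (\<Sum>l\<in>S. X i l * (\<Sum>k\<in>S. Y l k * Z k j))"
    for X Y Z :: gmatrix and i j
    unfolding sum_distrib_left sum_distrib_right mult.assoc by (rule sum.swap)
  \<comment> \<open>\<open>B A - 1\<close> is bodiless, and minus its own square because \<open>B A\<close> is idempotent\<close>
  have idem: "(\<Sum>k\<in>S. R i k * R k j) = R i j" if "i \<in> S" "j \<in> S" for i j
  proof -
    have "(\<Sum>k\<in>S. R i k * R k j) = (\<Sum>l\<in>S. B i l * (\<Sum>k\<in>S. A l k * R k j))"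
      unfolding R_def[of i] by (rule assoc)
    also have "\<dots> = (\<Sum>l\<in>S. B i l * (\<Sum>m\<in>S. (\<Sum>k\<in>S. A l k * B k m) * A m j))"
      unfolding R_def assoc ..
    also have "\<dots> = (\<Sum>l\<in>S. B i l * (\<Sum>m\<in>S. one l m * A m j))"
      by (intro sum.cong refl arg_cong2[where f = "(*)"]) (simp_all add: AB one_def)
    also have "\<dots> = R i j"
      unfolding R_def by (intro sum.cong refl arg_cong2[where f = "(*)"] mult_one(2)) (use that in auto)
    finally show ?thesis .
  qed
  have PP: "P i j = - (\<Sum>k\<in>S. P i k * P k j)" if "i \<in> S" "j \<in> S" for i j
  proof -
    have "(\<Sum>k\<in>S. P i k * P k j) = (\<Sum>k\<in>S. R i k * R k j) - (\<Sum>k\<in>S. R i k * one k j)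
        - (\<Sum>k\<in>S. one i k * R k j) + (\<Sum>k\<in>S. one i k * one k j)"
      unfolding P_def left_diff_distrib right_diff_distrib sum_subtractf by simp
    also have "\<dots> = - P i j"
      using that by (simp add: idem mult_one P_def)
    finally show ?thesis by simp
  qed
  have "gbody (P i j) = 0" if "i \<in> S" "j \<in> S" for i j
  proof -
    have "(\<Sum>l\<in>S. gbody (B i l) * gbody (A l j)) = (if i = j then 1 else 0)"
    proof (rule matrix_left_inverse[OF fin(1) _ that])
      fix i j assume *: "i \<in> S" "j \<in> S"
      show "(\<Sum>l\<in>S. gbody (A i l) * gbody (B l j)) = (if i = j then 1 else 0)"
        using arg_cong[OF AB[OF *], of gbody] by auto
    qed
    then show ?thesis by (simp add: P_def R_def one_def)
  qed
  moreover have "deg_ge D 0 (P i j)" if "i \<in> S" "j \<in> S" for i j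
  proof -
    have "deg_ge D (0 + 0) (B i l * A l j)" if "l \<in> S" for l
      by (rule deg_ge_mult) (use A B that \<open>i \<in> S\<close> \<open>j \<in> S\<close> in auto)
    then have "deg_ge D 0 (R i j)" unfolding R_def by (intro deg_ge_sum) auto
    moreover have "deg_ge D 0 (- one i j)" by (auto simp: one_def deg_ge_def)
    ultimately show ?thesis using deg_ge_add[of D 0 "R i j" "- one i j"] by (simp add: P_def)
  qed
  ultimately have deg1: "deg_ge D (Suc 0) (P i j)" if "i \<in> S" "j \<in> S" for i j
    using deg_ge_bodiless[of D "P i j"] that fin(2) by simp
  have "deg_ge D (Suc k) (P i j)" if "i \<in> S" "j \<in> S" for k i j
    using that
  proof (induction k arbitrary: i j)
    case (Suc k)
    have "deg_ge D (Suc 0 + Suc k) (P i l * P l j)" if "l \<in> S" for l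
      by (rule deg_ge_mult[OF deg1 Suc.IH]) (use that Suc.prems in auto)
    then have "deg_ge D (Suc (Suc k)) ((-1) *\<^sub>R (\<Sum>l\<in>S. P i l * P l j))"
      by (intro deg_ge_scaleR deg_ge_sum) auto
    then show ?case using PP[OF Suc.prems] by simp
  qed (rule deg1)
  then have "P i j = 0" using deg_ge_vanish[of D "Suc (card D)"] fin(2) ij by blast
  then show ?thesis by (simp add: P_def R_def one_def)
qed

section \<open>The commutative ring of even elements\<close>

typedef geven = "{a. homog UNIV 0 a}"
  by (rule exI[of _ 0]) simp

setup_lifting type_definition_geven

instantiation geven :: comm_ring_1
begin

lift_definition zero_geven :: geven is 0 by simp
lift_definition one_geven :: geven is 1 by simp
lift_definition plus_geven :: "geven \<Rightarrow> geven \<Rightarrow> geven" is "(+)" by (rule homog_add)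
lift_definition minus_geven :: "geven \<Rightarrow> geven \<Rightarrow> geven" is "(-)" by (rule homog_diff)
lift_definition uminus_geven :: "geven \<Rightarrow> geven" is uminus by (rule homog_minus)
lift_definition times_geven :: "geven \<Rightarrow> geven \<Rightarrow> geven" is "(*)"
  using homog_mult[of UNIV 0 _ 0] by simp

instance
proof
  fix a b c :: geven
  show "a * b = b * a"
    by transfer (rule homog_even_commute)
qed (transfer; simp add: algebra_simps)+

end

lemma Rep_geven_simps [simp]:
  "Rep_geven 0 = 0" "Rep_geven 1 = 1" "Rep_geven (a + b) = Rep_geven a + Rep_geven b"
  "Rep_geven (- a) = - Rep_geven a" "Rep_geven (a * b) = Rep_geven a * Rep_geven b"
  by (simp_all add: zero_geven.rep_eq one_geven.rep_eq plus_geven.rep_eq uminus_geven.rep_eq times_geven.rep_eq)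

lemma Rep_geven_sum: "Rep_geven (sum f S) = (\<Sum>x\<in>S. Rep_geven (f x))"
  by (induction S rule: infinite_finite_induct) simp_all

lemma Rep_geven_sign: "Rep_geven (of_int (sign p)) = of_int (sign p)"
  by (simp add: sign_def)

lemma homog_UNIV: "homog D p a \<Longrightarrow> homog UNIV p a"
  by (simp add: homog_def)

definition geven :: "grassmann \<Rightarrow> geven" where "geven = Abs_geven"

lemma Rep_geven: "homog D 0 a \<Longrightarrow> Rep_geven (geven a) = a"
  unfolding geven_def using homog_UNIV by (auto intro: Abs_geven_inverse)

lemma oprod_even:
  assumes "finite S" "\<And>i. i \<in> S \<Longrightarrow> homog D 0 (f i)"
  shows "oprod f S = Rep_geven (\<Prod>i\<in>S. geven (f i))"
  using assms
proof (induction S rule: finite_min_induct)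
  case (insert i J)
  then have "i \<notin> J" by auto
  then show ?case
    using insert.hyps(1) insert.IH insert.prems
    by (simp add: oprod_insert_less[OF insert.hyps(1,2)] Rep_geven[of D])
qed simp

lemma gdet_oprod: "gdet S A = (\<Sum>p | p permutes S. of_int (sign p) * oprod (\<lambda>i. A i (p i)) S)"
  by (simp add: gdet_def oprod_def)

lemma gdet_cdet:
  assumes "finite S" "\<And>i j. i \<in> S \<Longrightarrow> j \<in> S \<Longrightarrow> homog D 0 (A i j)"
  shows "gdet S A = Rep_geven (cdet S (\<lambda>i j. geven (A i j)))"
proof -
  have "oprod (\<lambda>i. A i (p i)) S = Rep_geven (\<Prod>i\<in>S. geven (A i (p i)))" if "p permutes S" for p
    by (rule oprod_even[OF assms(1)]) (use assms(2) permutes_in_image[OF that] in auto)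
  then show ?thesis by (simp add: gdet_oprod cdet_def Rep_geven_sum Rep_geven_sign)
qed

lemma gdet_inverse:
  assumes fin: "finite S" and A: "\<And>i j. i \<in> S \<Longrightarrow> j \<in> S \<Longrightarrow> homog D 0 (A i j)"
    and B: "\<And>i j. i \<in> S \<Longrightarrow> j \<in> S \<Longrightarrow> homog D 0 (B i j)"
    and AB: "\<And>i j. i \<in> S \<Longrightarrow> j \<in> S \<Longrightarrow> (\<Sum>l\<in>S. A i l * B l j) = (if i = j then 1 else 0)"
  shows "gdet S A * gdet S B = 1" "gdet S B * gdet S A = 1"
proof -
  let ?A = "\<lambda>i j. geven (A i j)" and ?B = "\<lambda>i j. geven (B i j)"
  have "(\<Sum>l\<in>S. ?A i l * ?B l j) = (if i = j then 1 else 0)" if "i \<in> S" "j \<in> S" for i j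
  proof -
    have "Rep_geven (\<Sum>l\<in>S. ?A i l * ?B l j) = (\<Sum>l\<in>S. A i l * B l j)"
      unfolding Rep_geven_sum by (intro sum.cong refl) (simp add: that Rep_geven[OF A] Rep_geven[OF B])
    also have "\<dots> = Rep_geven (if i = j then 1 else 0)" by (simp add: AB that)
    finally show ?thesis by (simp only: Rep_geven_inject)
  qed
  then have "cdet S (\<lambda>i j. \<Sum>l\<in>S. ?A i l * ?B l j) = cdet S (\<lambda>i j. if i = j then 1 else 0)"
    by (intro cdet_cong) auto
  then have "cdet S ?A * cdet S ?B = 1"
    by (simp add: cdet_mult[OF fin] cdet_one[OF fin])
  then have "Rep_geven (cdet S ?A) * Rep_geven (cdet S ?B) = 1" "Rep_geven (cdet S ?B) * Rep_geven (cdet S ?A) = 1"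
    by (metis Rep_geven_simps(2,5)) (metis Rep_geven_simps(2,5) \<open>cdet S ?A * cdet S ?B = 1\<close> mult.commute)
  then show "gdet S A * gdet S B = 1" "gdet S B * gdet S A = 1"
    by (simp_all add: gdet_cdet[OF fin A] gdet_cdet[OF fin B])
qed

lemma ginverse_eqI:
  assumes "a * b = 1" "b * a = 1"
  shows "ginverse a = b"
  unfolding ginverse_def
proof (rule the_equality)
  fix c assume "a * c = 1 \<and> c * a = 1"
  then show "c = b" using assms by (metis mult.assoc mult_1_left mult_1_right)
qed (use assms in simp)

lemma gmat_inverse_eqI:
  assumes fin: "finite S"
    and AB: "\<And>i j. i \<in> S \<Longrightarrow> j \<in> S \<Longrightarrow> (\<Sum>l\<in>S. A i l * B l j) = (if i = j then 1 else 0)"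
    and BA: "\<And>i j. i \<in> S \<Longrightarrow> j \<in> S \<Longrightarrow> (\<Sum>l\<in>S. B i l * A l j) = (if i = j then 1 else 0)"
  shows "gmat_inverse S A = (\<lambda>i j. if i \<in> S \<and> j \<in> S then B i j else 0)"
  unfolding gmat_inverse_def
proof (rule the_equality)
  let ?B = "\<lambda>i j. if i \<in> S \<and> j \<in> S then B i j else 0"
  show "(\<forall>i\<in>S. \<forall>j\<in>S. (\<Sum>k\<in>S. A i k * ?B k j) = (if i = j then 1 else 0) \<and>
      (\<Sum>k\<in>S. ?B i k * A k j) = (if i = j then 1 else 0)) \<and> (\<forall>i j. i \<notin> S \<or> j \<notin> S \<longrightarrow> ?B i j = 0)"
    using AB BA by simp
  fix C assume C: "(\<forall>i\<in>S. \<forall>j\<in>S. (\<Sum>k\<in>S. A i k * C k j) = (if i = j then 1 else 0) \<and>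
      (\<Sum>k\<in>S. C i k * A k j) = (if i = j then 1 else 0)) \<and> (\<forall>i j. i \<notin> S \<or> j \<notin> S \<longrightarrow> C i j = 0)"
  show "C = ?B"
  proof (intro ext)
    fix i j
    show "C i j = ?B i j"
    proof (cases "i \<in> S \<and> j \<in> S")
      case True
      have "C i j = (\<Sum>l\<in>S. if i = l then C l j else 0)" using True fin by simp
      also have "\<dots> = (\<Sum>l\<in>S. (\<Sum>k\<in>S. B i k * A k l) * C l j)"
        using True BA by (intro sum.cong refl) simp
      also have "\<dots> = (\<Sum>k\<in>S. B i k * (\<Sum>l\<in>S. A k l * C l j))"
        unfolding sum_distrib_left sum_distrib_right mult.assoc by (rule sum.swap)
      also have "\<dots> = (\<Sum>k\<in>S. if k = j then B i k else 0)"
        using True C by (intro sum.cong refl) simp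
      finally show ?thesis using True fin by simp
    qed (use C in auto)
  qed
qed

lemma geometric_sum_ring: "(1 - a) * (\<Sum>k<n. a ^ k) = 1 - (a :: 'a::ring_1) ^ n"
proof (induction n)
  case (Suc n)
  then show ?case by (simp add: distrib_left left_diff_distrib)
qed simp

section \<open>Derivatives of determinants, powers and logarithms of even superfunctions\<close>

context superdomain
begin

lemma sf_oprod_even:
  assumes "finite S" "\<And>i. i \<in> S \<Longrightarrow> sf 0 (f i)"
  shows "sf 0 (\<lambda>x. oprod (\<lambda>i. f i x) S)"
  using assms
proof (induction S rule: finite_min_induct)
  case (insert i J)
  then show ?case by (simp add: oprod_insert_less[OF insert.hyps(1,2)] sf_mult_even)
qed (simp add: sf_const)

lemma sderiv_oprod_even:
  assumes "finite S" "\<And>i. i \<in> S \<Longrightarrow> sf 0 (f i)" and x: "x \<in> U" and a: "a \<in> E \<union> D"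
  shows "d a (\<lambda>x. oprod (\<lambda>i. f i x) S) x = (\<Sum>k\<in>S. d a (f k) x * oprod (\<lambda>i. f i x) (S - {k}))"
  using assms(1,2)
proof (induction S rule: finite_min_induct)
  case empty
  show ?case using sderiv_const_of_real[of a 1 x] by simp
next
  case (insert i J)
  have i: "i \<notin> J" using insert.hyps(2) by auto
  have sfi: "sf 0 (f i)" and sfJ: "\<And>j. j \<in> J \<Longrightarrow> sf 0 (f j)" using insert.prems by auto
  have step: "f i x * (d a (f k) x * oprod (\<lambda>i. f i x) (J - {k})) = d a (f k) x * oprod (\<lambda>i. f i x) (insert i J - {k})"
    if "k \<in> J" for k
  proof -
    have "insert i J - {k} = insert i (J - {k})" using that i by auto
    moreover have "oprod (\<lambda>i. f i x) (insert i (J - {k})) = f i x * oprod (\<lambda>i. f i x) (J - {k})"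
      by (rule oprod_insert_less) (use insert.hyps in auto)
    ultimately show ?thesis
      using homog_even_commute[OF sf_homog[OF sfi x], of "d a (f k) x"] by (simp flip: mult.assoc)
  qed
  have "d a (\<lambda>x. oprod (\<lambda>i. f i x) (insert i J)) x = d a (\<lambda>x. f i x * oprod (\<lambda>i. f i x) J) x"
    by (simp add: oprod_insert_less[OF insert.hyps(1,2)])
  also have "\<dots> = d a (f i) x * oprod (\<lambda>i. f i x) J + f i x * d a (\<lambda>x. oprod (\<lambda>i. f i x) J) x"
    using sderiv_mult[OF sfi sf_oprod_even[OF insert.hyps(1) sfJ] x a] by simp
  also have "d a (\<lambda>x. oprod (\<lambda>i. f i x) J) x = (\<Sum>k\<in>J. d a (f k) x * oprod (\<lambda>i. f i x) (J - {k}))"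
    by (rule insert.IH[OF sfJ])
  also have "f i x * \<dots> = (\<Sum>k\<in>J. d a (f k) x * oprod (\<lambda>i. f i x) (insert i J - {k}))"
    unfolding sum_distrib_left by (rule sum.cong[OF refl step])
  finally show ?case using i insert.hyps(1) by simp
qed

lemma of_int_sign_scaleR: "of_int (sign p) * a = real_of_int (sign p) *\<^sub>R (a :: grassmann)"
  by (simp add: sign_def)

lemma sf_gdet:
  assumes "finite S" "\<And>i j. i \<in> S \<Longrightarrow> j \<in> S \<Longrightarrow> sf 0 (X i j)"
  shows "sf 0 (\<lambda>x. gdet S (\<lambda>i j. X i j x))"
  unfolding gdet_oprod of_int_sign_scaleR
  by (intro sf_sum sf_scaleR sf_oprod_even assms) (auto simp: permutes_in_image)

text \<open>Jacobi's formula: replacing a row by its derivative, expressed through the rows of \<open>X\<close>, only the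
  diagonal terms survive.\<close>

lemma sderiv_gdet:
  assumes fin: "finite S" and X: "\<And>i j. i \<in> S \<Longrightarrow> j \<in> S \<Longrightarrow> sf 0 (X i j)"
    and YX: "\<And>i j. i \<in> S \<Longrightarrow> j \<in> S \<Longrightarrow> (\<Sum>l\<in>S. Y i l * X l j x) = (if i = j then 1 else 0)"
    and x: "x \<in> U" and a: "a \<in> E \<union> D"
  shows "d a (\<lambda>x. gdet S (\<lambda>i j. X i j x)) x =
    (\<Sum>k\<in>S. \<Sum>m\<in>S. d a (X k m) x * Y m k) * gdet S (\<lambda>i j. X i j x)"
proof -
  let ?o = "\<lambda>p k. oprod (\<lambda>i. X i (p i) x) (S - {k})" and ?P = "{p. p permutes S}"
  let ?X = "\<lambda>i j. geven (X i j x)"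
  define Z where "Z k l = (\<Sum>m\<in>S. d a (X k m) x * Y m l)" for k l
  have hX: "homog D 0 (X i j x)" if "i \<in> S" "j \<in> S" for i j using sf_homog[OF X[OF that] x] .
  have dX: "d a (X k j) x = (\<Sum>l\<in>S. Z k l * X l j x)" if "k \<in> S" "j \<in> S" for k j
  proof -
    have "(\<Sum>l\<in>S. Z k l * X l j x) = (\<Sum>m\<in>S. d a (X k m) x * (\<Sum>l\<in>S. Y m l * X l j x))"
      unfolding Z_def sum_distrib_left sum_distrib_right mult.assoc by (rule sum.swap)
    also have "\<dots> = (\<Sum>m\<in>S. if m = j then d a (X k m) x else 0)"
      using that by (intro sum.cong refl) (simp add: YX)
    finally show ?thesis using that fin by simp
  qed
  have row: "(\<Sum>p\<in>?P. real_of_int (sign p) *\<^sub>R (X l (p k) x * ?o p k)) = (if k = l then gdet S (\<lambda>i j. X i j x) else 0)"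
    if kl: "k \<in> S" "l \<in> S" for k l
  proof -
    have "X l (p k) x * ?o p k = Rep_geven (?X l (p k) * (\<Prod>i\<in>S - {k}. ?X i (p i)))" if "p permutes S" for p
      using oprod_even[of "S - {k}" D "\<lambda>i. X i (p i) x"] fin hX permutes_in_image[OF that] kl
      by (simp add: Rep_geven[OF hX])
    then have "(\<Sum>p\<in>?P. real_of_int (sign p) *\<^sub>R (X l (p k) x * ?o p k)) =
        Rep_geven (cdet S (?X(k := ?X l)))"
      unfolding cdet_row[OF fin kl(1)]
      by (simp add: Rep_geven_sum Rep_geven_sign of_int_sign_scaleR)
    then show ?thesis using cdet_row_other[OF fin kl, of ?X] by (auto simp: gdet_cdet[OF fin hX])
  qed
  have "d a (\<lambda>x. gdet S (\<lambda>i j. X i j x)) x =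
      (\<Sum>p\<in>?P. d a (\<lambda>x. real_of_int (sign p) *\<^sub>R oprod (\<lambda>i. X i (p i) x) S) x)"
    unfolding gdet_oprod of_int_sign_scaleR
    by (rule sderiv_sum[where p = "\<lambda>_. 0", OF _ x a])
       (auto intro!: sf_scaleR sf_oprod_even fin X simp: permutes_in_image)
  also have "\<dots> = (\<Sum>p\<in>?P. real_of_int (sign p) *\<^sub>R (\<Sum>k\<in>S. d a (X k (p k)) x * ?o p k))"
  proof (rule sum.cong[OF refl])
    fix p assume "p \<in> ?P"
    then have X': "sf 0 (X i (p i))" if "i \<in> S" for i using X that by (auto simp: permutes_in_image)
    have "d a (\<lambda>x. real_of_int (sign p) *\<^sub>R oprod (\<lambda>i. X i (p i) x) S) x =
        real_of_int (sign p) *\<^sub>R d a (\<lambda>x. oprod (\<lambda>i. X i (p i) x) S) x"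
      by (rule sderiv_scaleR[OF sf_oprod_even[OF fin X'] x a])
    also have "d a (\<lambda>x. oprod (\<lambda>i. X i (p i) x) S) x = (\<Sum>k\<in>S. d a (X k (p k)) x * ?o p k)"
      by (rule sderiv_oprod_even[OF fin X' x a])
    finally show "d a (\<lambda>x. real_of_int (sign p) *\<^sub>R oprod (\<lambda>i. X i (p i) x) S) x =
        real_of_int (sign p) *\<^sub>R (\<Sum>k\<in>S. d a (X k (p k)) x * ?o p k)" .
  qed
  also have "\<dots> = (\<Sum>p\<in>?P. \<Sum>k\<in>S. \<Sum>l\<in>S. Z k l * (real_of_int (sign p) *\<^sub>R (X l (p k) x * ?o p k)))"
    unfolding scaleR_sum_right
  proof (intro sum.cong[OF refl])
    fix p k assume "p \<in> ?P" "k \<in> S"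
    then have "d a (X k (p k)) x = (\<Sum>l\<in>S. Z k l * X l (p k) x)" by (intro dX) (auto simp: permutes_in_image)
    then show "real_of_int (sign p) *\<^sub>R (d a (X k (p k)) x * ?o p k) =
        (\<Sum>l\<in>S. Z k l * (real_of_int (sign p) *\<^sub>R (X l (p k) x * ?o p k)))"
      by (simp add: sum_distrib_right scaleR_sum_right mult.assoc)
  qed
  also have "\<dots> = (\<Sum>k\<in>S. \<Sum>p\<in>?P. \<Sum>l\<in>S. Z k l * (real_of_int (sign p) *\<^sub>R (X l (p k) x * ?o p k)))"
    by (rule sum.swap)
  also have "\<dots> = (\<Sum>k\<in>S. \<Sum>l\<in>S. Z k l * (\<Sum>p\<in>?P. real_of_int (sign p) *\<^sub>R (X l (p k) x * ?o p k)))"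
    unfolding sum_distrib_left by (intro sum.cong[OF refl] sum.swap)
  also have "\<dots> = (\<Sum>k\<in>S. \<Sum>l\<in>S. if k = l then Z k l * gdet S (\<lambda>i j. X i j x) else 0)"
    by (intro sum.cong refl) (simp add: row)
  also have "\<dots> = (\<Sum>k\<in>S. Z k k) * gdet S (\<lambda>i j. X i j x)"
    using fin by (simp add: sum_distrib_right)
  finally show ?thesis by (simp add: Z_def)
qed

lemma sderiv_power:
  assumes u: "sf 0 u" and x: "x \<in> U" and a: "a \<in> E \<union> D"
  shows "d a (\<lambda>x. u x ^ k) x = real k *\<^sub>R (u x ^ (k - 1) * d a u x)"
proof (induction k)
  case 0
  show ?case using sderiv_const_of_real[of a 1 x] by simp
next
  case (Suc k)
  have com: "b * u x = u x * b" for b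
    using homog_even_commute[OF sf_homog[OF u x]] by simp
  have "d a (\<lambda>x. u x ^ Suc k) x = d a u x * u x ^ k + u x * d a (\<lambda>x. u x ^ k) x"
    using sderiv_mult[OF u sf_power[OF u] x a, of k] by simp
  also have "d a u x * u x ^ k = u x ^ k * d a u x"
    by (rule power_commuting_commutes[symmetric]) (rule com[symmetric])
  also have "u x * d a (\<lambda>x. u x ^ k) x = real k *\<^sub>R (u x ^ k * d a u x)"
    unfolding Suc.IH by (cases k) (simp_all add: mult.assoc)
  finally show ?case by (simp add: scaleR_add_left)
qed

text \<open>The logarithm is truncated at \<open>u ^ card D\<close>; the boundary term of the geometric series in its derivative
  is \<open>u ^ card D * d u\<close>, which vanishes as the derivative of \<open>u ^ (card D + 1) = 0\<close>.\<close>

lemma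
  assumes f: "sf 0 f" and g: "sf 0 g" and fg: "\<And>x. x \<in> U \<Longrightarrow> f x * g x = 1"
  shows sf_gln: "sf 0 (\<lambda>x. gln D (gabs (f x)))"
    and sderiv_gln: "x \<in> U \<Longrightarrow> a \<in> E \<union> D \<Longrightarrow> d a (\<lambda>x. gln D (gabs (f x))) x = d a f x * g x"
proof -
  let ?N = "card D"
  define b where "b x = gbody (f x)" for x
  \<comment> \<open>The nilpotent part after normalisation by the body:
    \<open>f = b (1 + u)\<close>.\<close>
  define u where "u x = of_real (inverse (b x)) * f x - 1" for x
  have b0: "b x \<noteq> 0" if "x \<in> U" for x
    using arg_cong[OF fg[OF that], of gbody] by (auto simp: b_def)
  have sb: "smooth E U b" using sf_smooth[OF f, of "{}"] by (simp add: b_def[abs_def] gbody_def)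
  have sib: "smooth E U (\<lambda>x. inverse (b x))" by (rule smooth_inverse[OF sb b0])
  have su: "sf 0 u" unfolding u_def[abs_def] by (intro sf_diff sf_mult_even sf_of_real sib f sf_const homog_1)
  let ?G = "\<lambda>x. of_real (ln \<bar>b x\<bar>) + (\<Sum>k=1..?N. ((-1) ^ (k + 1) / real k) *\<^sub>R u x ^ k)"
  have gln: "gln D (gabs (f x)) = ?G x" if "x \<in> U" for x
  proof -
    have "1 / gbody (gabs (f x)) * sgn (gbody (f x)) = inverse (b x)"
      using b0[OF that] by (auto simp: gabs_def b_def sgn_if field_simps)
    then have "(1 / gbody (gabs (f x))) *\<^sub>R gabs (f x) - 1 = u x"
      by (simp add: u_def gabs_def[of "f x"] flip: scaleR_conv_of_real)
    moreover have "gbody (gabs (f x)) = \<bar>b x\<bar>"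
      by (simp add: gabs_def b_def sgn_if)
    ultimately show ?thesis by (simp add: gln_def)
  qed
  have sln: "sf 0 (\<lambda>x. of_real (ln \<bar>b x\<bar>))" by (rule sf_of_real[OF smooth_ln_abs[OF sb b0]])
  have sterm: "sf 0 (\<lambda>x. c k *\<^sub>R u x ^ k)" for c :: "nat \<Rightarrow> real" and k by (intro sf_scaleR sf_power su)
  have sG: "sf 0 ?G" by (intro sf_add sln sf_sum sterm)
  show "sf 0 (\<lambda>x. gln D (gabs (f x)))" by (rule sf_cong[THEN iffD2, OF gln sG])
  assume x: "x \<in> U" and a: "a \<in> E \<union> D"
  let ?B = "d a (\<lambda>x. of_real (b x)) x" and ?i = "of_real (inverse (b x)) :: grassmann"
  have comi: "?i * c = c * ?i" for c by (rule homog_even_commute[OF homog_of_real])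
  have comu: "u x * c = c * u x" for c by (rule homog_even_commute[OF sf_homog[OF su x]])
  have comf: "f x * c = c * f x" for c by (rule homog_even_commute[OF sf_homog[OF f x]])
  have comg: "g x * c = c * g x" for c by (rule homog_even_commute[OF sf_homog[OF g x]])
  have ib: "of_real (b x) * ?i = 1" using b0[OF x] by (simp flip: of_real_mult)
  have dln: "d a (\<lambda>x. of_real (ln \<bar>b x\<bar>)) x = ?B * ?i"
    using a partial_eqI[OF ln_abs_derivative[OF sb x b0[OF x]]] unfolding sderiv_of_real[OF a] by auto
  have dinv: "d a (\<lambda>x. of_real (inverse (b x))) x = - (?B * ?i * ?i)"
  proof -
    have sinv: "sf 0 (\<lambda>x. of_real (inverse (b x)))" by (rule sf_of_real[OF sib])
    have "d a (\<lambda>x. of_real (b x) * of_real (inverse (b x))) x = d a (\<lambda>x. of_real 1) x"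
      by (rule sderiv_cong[OF _ x a]) (use b0 in \<open>simp flip: of_real_mult\<close>)
    then have "?B * ?i + of_real (b x) * d a (\<lambda>x. of_real (inverse (b x))) x = 0"
      unfolding sderiv_const_of_real sderiv_mult[OF sf_of_real[OF sb] sinv x a] by simp
    then have *: "of_real (b x) * d a (\<lambda>x. of_real (inverse (b x))) x = - (?B * ?i)"
      by (simp add: eq_neg_iff_add_eq_0 add.commute)
    have "d a (\<lambda>x. of_real (inverse (b x))) x = (of_real (b x) * ?i) * d a (\<lambda>x. of_real (inverse (b x))) x"
      unfolding ib by simp
    also have "\<dots> = ?i * (of_real (b x) * d a (\<lambda>x. of_real (inverse (b x))) x)"
      by (simp only: comi[of "of_real (b x)", symmetric] mult.assoc)
    also have "\<dots> = - (?B * ?i * ?i)"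
      unfolding * by (simp only: mult_minus_right comi[of "?B * ?i"])
    finally show ?thesis .
  qed
  have du: "d a u x = ?i * d a f x - ?B * ?i * (1 + u x)"
  proof -
    have "d a u x = d a (\<lambda>x. of_real (inverse (b x)) * f x) x"
      unfolding u_def[abs_def]
      using sderiv_diff[OF sf_mult_even[OF sf_of_real[OF sib] f] sf_const[OF homog_1] x a]
        sderiv_const_of_real[of a 1 x] by simp
    also have "\<dots> = - (?B * ?i * ?i) * f x + ?i * d a f x"
      using sderiv_mult[OF sf_of_real[OF sib] f x a] dinv by simp
    finally show ?thesis by (simp add: u_def mult.assoc)
  qed
  have top: "u x ^ ?N * d a u x = 0"
  proof -
    have "deg_ge D k (u y ^ k)" if "y \<in> U" for y k
    proof (induction k)
      case (Suc k)
      have "gbody (u y) = 0" using b0[OF that] by (simp add: u_def b_def)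
      then show ?case using deg_ge_mult[OF deg_ge_1[OF sf_homog[OF su that]] Suc] fin_D by simp
    qed (simp add: deg_ge_def)
    then have "u y ^ Suc ?N = 0" if "y \<in> U" for y
      using deg_ge_vanish[OF _ fin_D, of "Suc ?N"] that by blast
    then have "d a (\<lambda>x. u x ^ Suc ?N) x = d a (\<lambda>_. of_real 0) x"
      by (intro sderiv_cong[OF _ x a]) simp
    then have "real (Suc ?N) *\<^sub>R (u x ^ ?N * d a u x) = 0"
      unfolding sderiv_const_of_real sderiv_power[OF su x a] by simp
    then show ?thesis by simp
  qed
  \<comment> \<open>The inverse of \<open>1 + u\<close>, because \<open>g\<close> inverts
    \<open>f = b (1 + u)\<close>. It replaces the finite geometric series, which inverts
    \<open>1 + u\<close> only up to a power of \<open>u\<close> killed by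
    \<open>d u\<close>.\<close>
  define w where "w = of_real (b x) * g x"
  have w: "w * (1 + u x) = 1"
  proof -
    have "w * (1 + u x) = of_real (b x) * (g x * ?i) * f x" by (simp add: w_def u_def mult.assoc)
    also have "\<dots> = (of_real (b x) * ?i) * (g x * f x)" by (simp only: comi mult.assoc)
    finally show ?thesis by (simp only: ib comg[of "f x"] fg[OF x] mult_1_left)
  qed
  let ?S = "\<Sum>k<?N. (- u x) ^ k"
  have geo: "(1 + u x) * ?S = 1 - (- u x) ^ ?N"
    using geometric_sum_ring[of "- u x" ?N] by simp
  have "?S * d a u x = w * d a u x"
  proof -
    have "?S * d a u x = w * ((1 + u x) * ?S) * d a u x" by (simp add: w flip: mult.assoc)
    also have "\<dots> = w * d a u x - w * ((- u x) ^ ?N * d a u x)"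
      unfolding geo by (simp add: left_diff_distrib right_diff_distrib mult.assoc)
    also have "(- u x) ^ ?N * d a u x = (-1) ^ ?N * (u x ^ ?N * d a u x)"
      by (simp add: power_minus[of "u x"] mult.assoc)
    finally show ?thesis by (simp add: top)
  qed
  have "d a (\<lambda>x. gln D (gabs (f x))) x = d a ?G x"
    by (rule sderiv_cong[OF gln x a])
  also have "\<dots> = ?B * ?i + d a (\<lambda>x. \<Sum>k=1..?N. ((-1) ^ (k + 1) / real k) *\<^sub>R u x ^ k) x"
    by (subst sderiv_add[OF sln sf_sum[OF sterm] x a]) (simp add: dln)
  also have "d a (\<lambda>x. \<Sum>k=1..?N. ((-1) ^ (k + 1) / real k) *\<^sub>R u x ^ k) x =
      (\<Sum>k=1..?N. (-1) ^ (k + 1) *\<^sub>R (u x ^ (k - 1) * d a u x))"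
  proof -
    have "d a (\<lambda>x. \<Sum>k=1..?N. ((-1) ^ (k + 1) / real k) *\<^sub>R u x ^ k) x =
        (\<Sum>k=1..?N. d a (\<lambda>x. ((-1) ^ (k + 1) / real k) *\<^sub>R u x ^ k) x)"
      by (rule sderiv_sum[where p = "\<lambda>_. 0", OF sterm x a])
    also have "\<dots> = (\<Sum>k=1..?N. ((-1) ^ (k + 1) / real k) *\<^sub>R d a (\<lambda>x. u x ^ k) x)"
      by (intro sum.cong refl sderiv_scaleR[OF sf_power[OF su] x a])
    finally show ?thesis by (simp add: sderiv_power[OF su x a])
  qed
  also have "\<dots> = ?S * d a u x"
  proof -
    have "(- u x) ^ k = (-1) ^ k *\<^sub>R u x ^ k" for k
      by (simp add: uminus_power_if)
    then show ?thesis
      unfolding sum_distrib_right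
      by (intro sum.reindex_bij_witness[where i = Suc and j = "\<lambda>k. k - 1"]) (auto simp: Suc_le_eq gr0_conv_Suc)
  qed
  also have "\<dots> = w * d a u x" by fact
  \<comment> \<open>The subtracted term comes from differentiating the normalising factor
    \<open>1 / b\<close> and cancels the derivative of \<open>ln \<bar>b\<bar>\<close>.\<close>
  also have "w * d a u x = g x * d a f x - ?B * ?i"
  proof -
    have "w * (?i * d a f x) = g x * d a f x"
      using ib by (simp add: w_def comg mult.assoc) (simp flip: mult.assoc)
    moreover have "w * (?B * ?i * (1 + u x)) = ?B * ?i"
    proof -
      have "w * (?B * ?i * (1 + u x)) = ?B * ?i * (w * (1 + u x))"
        using homog_even_commute[of D w "?B * ?i"] homog_mult[OF homog_of_real sf_homog[OF g x]]
        by (simp add: w_def flip: mult.assoc)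
      then show ?thesis by (simp add: w)
    qed
    ultimately show ?thesis by (simp add: du right_diff_distrib)
  qed
  finally show "d a (\<lambda>x. gln D (gabs (f x))) x = d a f x * g x" by (simp add: comg)
qed

end

section \<open>The logarithm of the Berezinian\<close>

fun gmat_pow :: "nat set \<Rightarrow> gmatrix \<Rightarrow> nat \<Rightarrow> gmatrix" where
  "gmat_pow S A 0 = (\<lambda>i j. if i = j then 1 else 0)"
| "gmat_pow S A (Suc k) = (\<lambda>i j. \<Sum>l\<in>S. A i l * gmat_pow S A k l j)"

lemma neumann_series:
  assumes fin: "finite S" "finite D" and A: "\<And>i j. i \<in> S \<Longrightarrow> j \<in> S \<Longrightarrow> deg_ge D 1 (A i j)" and ij: "i \<in> S" "j \<in> S"
  shows "(\<Sum>l\<in>S. ((if i = l then 1 else 0) - A i l) * (\<Sum>k\<le>card D. gmat_pow S A k l j)) = (if i = j then 1 else 0)"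
proof -
  let ?p = "\<lambda>k. gmat_pow S A k i j"
  have deg: "deg_ge D k (gmat_pow S A k i j)" if "i \<in> S" "j \<in> S" for k i j
    using that
  proof (induction k arbitrary: i)
    case (Suc k)
    have "deg_ge D (1 + k) (A i l * gmat_pow S A k l j)" if "l \<in> S" for l
      by (rule deg_ge_mult[OF A Suc.IH]) (use that Suc.prems in auto)
    then show ?case by (auto intro!: deg_ge_sum)
  qed (simp add: deg_ge_def)
  have "(\<Sum>l\<in>S. ((if i = l then 1 else 0) - A i l) * (\<Sum>k\<le>card D. gmat_pow S A k l j)) =
      (\<Sum>k\<le>card D. \<Sum>l\<in>S. ((if i = l then 1 else 0) - A i l) * gmat_pow S A k l j)"
    unfolding sum_distrib_left by (rule sum.swap)
  also have "\<dots> = (\<Sum>k\<le>card D. ?p k - ?p (Suc k))"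
  proof (rule sum.cong[OF refl])
    fix k
    have "(\<Sum>l\<in>S. (if i = l then 1 else 0) * gmat_pow S A k l j) = (\<Sum>l\<in>S. if i = l then gmat_pow S A k l j else 0)"
      by (intro sum.cong) auto
    also have "\<dots> = ?p k" using ij fin by simp
    finally show "(\<Sum>l\<in>S. ((if i = l then 1 else 0) - A i l) * gmat_pow S A k l j) = ?p k - ?p (Suc k)"
      by (simp add: left_diff_distrib sum_subtractf)
  qed
  also have "\<dots> = ?p 0 - ?p (Suc (card D))"
    by (rule sum_telescope)
  also have "?p (Suc (card D)) = 0"
    by (rule deg_ge_vanish[OF deg[OF ij] fin(2)]) simp
  finally show ?thesis by simp
qed

lemma matrix_assoc:
  fixes f h :: "_ \<Rightarrow> 'a::semiring_0"
  shows "(\<Sum>l\<in>A. f l * (\<Sum>m\<in>B. g l m * h m)) = (\<Sum>m\<in>B. (\<Sum>l\<in>A. f l * g l m) * h m)"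
  unfolding sum_distrib_left sum_distrib_right mult.assoc by (rule sum.swap)

locale jacobian = superdomain +
  fixes J K :: "nat \<Rightarrow> nat \<Rightarrow> superfun"
  assumes sf_J: "i \<in> E \<union> D \<Longrightarrow> j \<in> E \<union> D \<Longrightarrow> superfunction E D U (parity D i + parity D j) (J i j)"
    and sf_K: "i \<in> E \<union> D \<Longrightarrow> j \<in> E \<union> D \<Longrightarrow> superfunction E D U (parity D i + parity D j) (K i j)"
    and JK: "x \<in> U \<Longrightarrow> i \<in> E \<union> D \<Longrightarrow> j \<in> E \<union> D \<Longrightarrow>
      (\<Sum>l\<in>E \<union> D. J i l x * K l j x) = (if i = j then 1 else 0)"
begin

lemma fin_ED: "finite (E \<union> D)"
  using fin_E fin_D by simp

lemma sum_ED: "sum f (E \<union> D) = sum f E + (sum f D :: grassmann)"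
  by (rule sum.union_disjoint[OF fin_E fin_D disj])

lemma parity_E: "i \<in> E \<Longrightarrow> parity D i = 0"
  using disj by (auto simp: parity_def)

lemma parity_D: "i \<in> D \<Longrightarrow> parity D i = 1"
  by (simp add: parity_def)

lemma KJ:
  assumes "x \<in> U" "i \<in> E \<union> D" "j \<in> E \<union> D"
  shows "(\<Sum>l\<in>E \<union> D. K i l x * J l j x) = (if i = j then 1 else 0)"
  by (rule gmatrix_left_inverse[OF fin_ED fin_D deg_ge_0[OF sf_homog[OF sf_J assms(1)]]
        deg_ge_0[OF sf_homog[OF sf_K assms(1)]] JK[OF assms(1)] assms(2,3)])

text \<open>The inverse of the odd-odd block of \<open>J\<close>. Since \<open>J K = 1\<close>, that
  block times the same block of \<open>K\<close> is \<open>1 - N\<close> with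
  \<open>N = J10 K01\<close>; \<open>N\<close> is nilpotent, being made of odd entries, and the
  inner sum is the Neumann series of \<open>1 - N\<close>.\<close>

definition W :: "nat \<Rightarrow> nat \<Rightarrow> superfun" where
  "W i j x = (\<Sum>l\<in>D. K i l x * (\<Sum>k\<le>card D. gmat_pow D (\<lambda>i j. \<Sum>e\<in>E. J i e x * K e j x) k l j))"

lemma sf_W: "i \<in> D \<Longrightarrow> j \<in> D \<Longrightarrow> sf 0 (W i j)"
proof -
  let ?N = "\<lambda>x i j. \<Sum>e\<in>E. J i e x * K e j x"
  have N: "sf 0 (\<lambda>x. ?N x i j)" if "i \<in> D" "j \<in> D" for i j
  proof (rule sf_sum)
    fix e assume e: "e \<in> E"
    show "sf 0 (\<lambda>x. J i e x * K e j x)"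
      by (rule sf_parity[OF _ sf_mult[OF sf_J sf_K]]) (use that e in \<open>auto simp: parity_E parity_D\<close>)
  qed
  have "sf 0 (\<lambda>x. gmat_pow D (?N x) k i j)" if "i \<in> D" "j \<in> D" for k i j
    using that
  proof (induction k arbitrary: i)
    case 0
    show ?case by (cases "i = j") (simp_all add: sf_const)
  next
    case (Suc k)
    then show ?case by (simp, intro sf_sum sf_mult_even N) auto
  qed
  moreover have "sf 0 (K i j)" if "i \<in> D" "j \<in> D" for i j
    by (rule sf_parity[OF _ sf_K]) (use that in \<open>auto simp: parity_D\<close>)
  moreover assume "i \<in> D" "j \<in> D"
  ultimately show ?thesis unfolding W_def[abs_def] by (intro sf_sum sf_mult_even)
qed

lemma JW:
  assumes x: "x \<in> U" and ij: "i \<in> D" "j \<in> D"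
  shows "(\<Sum>l\<in>D. J i l x * W l j x) = (if i = j then 1 else 0)"
proof -
  let ?N = "\<lambda>i j. \<Sum>e\<in>E. J i e x * K e j x"
  let ?G = "\<lambda>l j. \<Sum>k\<le>card D. gmat_pow D ?N k l j"
  have N: "deg_ge D 1 (?N i j)" if "i \<in> D" "j \<in> D" for i j
  proof (rule deg_ge_sum)
    fix e assume e: "e \<in> E"
    have o: "homog D 1 (J i e x)" using sf_homog[OF sf_J[of i e] x] that e by (simp add: parity_E parity_D)
    have "deg_ge D (1 + 0) (J i e x * K e j x)"
      by (rule deg_ge_mult[OF deg_ge_1[OF o gbody_odd[OF o] fin_D] deg_ge_0[OF sf_homog[OF sf_K x]]])
         (use that e in auto)
    then show "deg_ge D 1 (J i e x * K e j x)" by simp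
  qed
  have "(\<Sum>l\<in>D. J i l x * W l j x) = (\<Sum>m\<in>D. (\<Sum>l\<in>D. J i l x * K l m x) * ?G m j)"
    unfolding W_def by (rule matrix_assoc)
  also have "\<dots> = (\<Sum>m\<in>D. ((if i = m then 1 else 0) - ?N i m) * ?G m j)"
    using JK[OF x] ij by (intro sum.cong refl arg_cong2[where f = "(*)"]) (simp add: sum_ED eq_diff_eq add.commute)
  also have "\<dots> = (if i = j then 1 else 0)"
    by (rule neumann_series[OF fin_D fin_D N ij])
  finally show ?thesis .
qed

lemma WJ:
  assumes "x \<in> U" "i \<in> D" "j \<in> D"
  shows "(\<Sum>l\<in>D. W i l x * J l j x) = (if i = j then 1 else 0)"
  by (rule gmatrix_left_inverse[OF fin_D fin_D deg_ge_0[OF sf_homog[OF sf_J assms(1)]]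
        deg_ge_0[OF sf_homog[OF sf_W assms(1)]] JW[OF assms(1)] assms(2,3)]) auto

text \<open>The block product \<open>J01 J11^-1\<close>.\<close>

definition P :: "nat \<Rightarrow> nat \<Rightarrow> superfun" where
  "P i j x = (\<Sum>l\<in>D. J i l x * W l j x)"

text \<open>The Schur complement of the odd-odd block; its inverse is the even-even block of
  \<open>K\<close>, see \<open>KS\<close>.\<close>

definition S :: "nat \<Rightarrow> nat \<Rightarrow> superfun" where
  "S i j x = J i j x - (\<Sum>l\<in>D. P i l x * J l j x)"

lemma sf_P: "i \<in> E \<Longrightarrow> j \<in> D \<Longrightarrow> sf 1 (P i j)"
  unfolding P_def[abs_def]
  by (intro sf_sum sf_parity[OF _ sf_mult[OF sf_J sf_W]]) (auto simp: parity_E parity_D)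

lemma sf_J_even: "i \<in> E \<Longrightarrow> j \<in> E \<Longrightarrow> sf 0 (J i j)" "i \<in> D \<Longrightarrow> j \<in> D \<Longrightarrow> sf 0 (J i j)"
  and sf_K_even: "i \<in> E \<Longrightarrow> j \<in> E \<Longrightarrow> sf 0 (K i j)"
  using sf_J[of i j] sf_K[of i j] sf_parity[of 2 0] by (auto simp: parity_E parity_D numeral_2_eq_2)

lemma sf_S: "i \<in> E \<Longrightarrow> j \<in> E \<Longrightarrow> sf 0 (S i j)"
  unfolding S_def[abs_def]
  by (intro sf_diff sf_sum sf_J_even sf_parity[OF _ sf_mult[OF sf_P sf_J]]) (auto simp: parity_E parity_D)

lemma PJ:
  assumes "x \<in> U" "i \<in> E" "j \<in> D"
  shows "(\<Sum>l\<in>D. P i l x * J l j x) = J i j x"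
proof -
  have "(\<Sum>l\<in>D. P i l x * J l j x) = (\<Sum>k\<in>D. J i k x * (\<Sum>l\<in>D. W k l x * J l j x))"
    unfolding P_def sum_distrib_left sum_distrib_right mult.assoc by (rule sum.swap)
  also have "\<dots> = (\<Sum>k\<in>D. if k = j then J i k x else 0)"
    using assms by (intro sum.cong refl) (simp add: WJ)
  finally show ?thesis using assms(3) fin_D by simp
qed

text \<open>The odd columns of \<open>K J = 1\<close>, multiplied from the right by the inverse
  \<open>W\<close> of the odd-odd block of \<open>J\<close>.\<close>

lemma KP:
  assumes "x \<in> U" "i \<in> E \<union> D" "j \<in> D"
  shows "(\<Sum>m\<in>E. K i m x * P m j x) = (if i \<in> D then W i j x else 0) - K i j x"
proof -
  have KJ': "(\<Sum>m\<in>E. K i m x * J m l x) = (if i = l then 1 else 0) - (\<Sum>m\<in>D. K i m x * J m l x)" if "l \<in> D" for l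
    using KJ[OF assms(1,2), of l] that by (simp add: sum_ED eq_diff_eq)
  have "(\<Sum>m\<in>E. K i m x * P m j x) = (\<Sum>l\<in>D. (\<Sum>m\<in>E. K i m x * J m l x) * W l j x)"
    unfolding P_def sum_distrib_left sum_distrib_right mult.assoc by (rule sum.swap)
  also have "\<dots> = (\<Sum>l\<in>D. (if i = l then 1 else 0) * W l j x) - (\<Sum>l\<in>D. (\<Sum>m\<in>D. K i m x * J m l x) * W l j x)"
    by (simp add: KJ' left_diff_distrib sum_subtractf cong: sum.cong)
  also have "(\<Sum>l\<in>D. (if i = l then 1 else 0) * W l j x) = (\<Sum>l\<in>D. if i = l then W l j x else 0)"
    by (intro sum.cong) auto
  also have "(\<Sum>l\<in>D. (\<Sum>m\<in>D. K i m x * J m l x) * W l j x) = (\<Sum>m\<in>D. K i m x * (\<Sum>l\<in>D. J m l x * W l j x))"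
    unfolding sum_distrib_left sum_distrib_right mult.assoc by (rule sum.swap)
  also have "\<dots> = (\<Sum>m\<in>D. if m = j then K i m x else 0)"
    using assms by (intro sum.cong refl) (simp add: JW)
  finally show ?thesis using fin_D assms(3) by simp
qed

lemma KS:
  assumes x: "x \<in> U" and ij: "i \<in> E" "j \<in> E"
  shows "(\<Sum>m\<in>E. K i m x * S m j x) = (if i = j then 1 else 0)"
proof -
  have nD: "i \<notin> D" using ij disj by auto
  have "(\<Sum>m\<in>E. K i m x * S m j x) = (\<Sum>m\<in>E. K i m x * J m j x) - (\<Sum>l\<in>D. (\<Sum>m\<in>E. K i m x * P m l x) * J l j x)"
    unfolding S_def right_diff_distrib sum_subtractf sum_distrib_left sum_distrib_right mult.assoc
    by (subst (2) sum.swap) (rule refl)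
  also have "(\<Sum>l\<in>D. (\<Sum>m\<in>E. K i m x * P m l x) * J l j x) = - (\<Sum>l\<in>D. K i l x * J l j x)"
    using ij nD by (simp add: KP[OF x] sum_negf cong: sum.cong)
  finally show ?thesis using KJ[OF x, of i j] ij by (simp add: sum_ED)
qed

lemma berezinian_eq:
  assumes x: "x \<in> U"
  shows "berezinian E D (\<lambda>i j. J i j x) = gdet E (\<lambda>i j. S i j x) * gdet D (\<lambda>i j. W i j x)"
proof -
  have inv: "gmat_inverse D (\<lambda>i j. J i j x) = (\<lambda>i j. if i \<in> D \<and> j \<in> D then W i j x else 0)"
    by (rule gmat_inverse_eqI[OF fin_D JW[OF x] WJ[OF x]])
  have "(\<Sum>k\<in>D. \<Sum>l\<in>D. J i k x * gmat_inverse D (\<lambda>i j. J i j x) k l * J l j x) = (\<Sum>l\<in>D. P i l x * J l j x)" for i j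
  proof -
    have "(\<Sum>k\<in>D. \<Sum>l\<in>D. J i k x * gmat_inverse D (\<lambda>i j. J i j x) k l * J l j x) =
        (\<Sum>k\<in>D. \<Sum>l\<in>D. J i k x * W k l x * J l j x)"
      unfolding inv by (intro sum.cong refl) simp
    also have "\<dots> = (\<Sum>l\<in>D. P i l x * J l j x)"
      unfolding P_def sum_distrib_right by (rule sum.swap)
    finally show ?thesis .
  qed
  moreover have "ginverse (gdet D (\<lambda>i j. J i j x)) = gdet D (\<lambda>i j. W i j x)"
    by (rule ginverse_eqI; rule gdet_inverse[OF fin_D sf_homog[OF sf_J_even(2) x] sf_homog[OF sf_W x] JW[OF x]])
  ultimately show ?thesis unfolding berezinian_def S_def by simp
qed

definition L :: superfun where
  "L x = gln D (gabs (berezinian E D (\<lambda>i j. J i j x)))"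

abbreviation ber :: superfun where "ber x \<equiv> gdet E (\<lambda>i j. S i j x) * gdet D (\<lambda>i j. W i j x)"

text \<open>The inverse of \<open>ber\<close>: \<open>W\<close> and the odd-odd block of
  \<open>J\<close> are inverse to each other, and so are \<open>S\<close> and the even-even block of
  \<open>K\<close>.\<close>

abbreviation ber' :: superfun where "ber' x \<equiv> gdet D (\<lambda>i j. J i j x) * gdet E (\<lambda>i j. K i j x)"

lemma sf_ber: "sf 0 ber" "sf 0 ber'"
  by (intro sf_mult_even sf_gdet fin_E fin_D sf_S sf_W sf_J_even sf_K_even; assumption)+

lemma gdet_WJ: "x \<in> U \<Longrightarrow> gdet D (\<lambda>i j. W i j x) * gdet D (\<lambda>i j. J i j x) = 1"
  by (rule gdet_inverse(2)[OF fin_D sf_homog[OF sf_J_even(2)] sf_homog[OF sf_W] JW])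

lemma gdet_SK: "x \<in> U \<Longrightarrow> gdet E (\<lambda>i j. S i j x) * gdet E (\<lambda>i j. K i j x) = 1"
  by (rule gdet_inverse(2)[OF fin_E sf_homog[OF sf_K_even] sf_homog[OF sf_S] KS])

lemma ber_inverse:
  assumes "x \<in> U"
  shows "ber x * ber' x = 1"
proof -
  have "ber x * ber' x = gdet E (\<lambda>i j. S i j x) *
      ((gdet D (\<lambda>i j. W i j x) * gdet D (\<lambda>i j. J i j x)) * gdet E (\<lambda>i j. K i j x))"
    by (simp only: mult.assoc)
  then show ?thesis by (simp only: gdet_WJ[OF assms] mult_1_left gdet_SK[OF assms])
qed

lemma sf_L: "sf 0 L"
  by (rule sf_cong[THEN iffD2, OF _ sf_gln[OF sf_ber ber_inverse]]) (simp_all add: L_def berezinian_eq)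

text \<open>The derivative of the logarithm of the Berezinian is the supertrace of
  \<open>dJ K\<close>. Jacobi's formula gives the traces of \<open>dS K\<close> and
  \<open>dW J\<close>; after elimination of \<open>dP\<close> by \<open>dP\<close> and
  \<open>KP\<close>, the terms with \<open>W\<close> in the first cancel the second.\<close>

lemma sderiv_L:
  assumes x: "x \<in> U" and a: "a \<in> E \<union> D"
  shows "d a L x = (\<Sum>j\<in>E \<union> D. (-1) ^ parity D j *\<^sub>R (\<Sum>r\<in>E \<union> D. d a (J j r) x * K r j x))"
proof -
  let ?dJ = "\<lambda>j r. d a (J j r) x" and ?e = "(-1) ^ parity D a :: real"
  let ?detS = "gdet E (\<lambda>i j. S i j x)" and ?detW = "gdet D (\<lambda>i j. W i j x)"
  let ?trS = "\<Sum>k\<in>E. \<Sum>m\<in>E. d a (S k m) x * K m k x"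
  let ?trW = "\<Sum>k\<in>D. \<Sum>m\<in>D. d a (W k m) x * J m k x"
  have sdetS: "sf 0 (\<lambda>x. gdet E (\<lambda>i j. S i j x))" and sdetW: "sf 0 (\<lambda>x. gdet D (\<lambda>i j. W i j x))"
    by (intro sf_gdet fin_E fin_D sf_S sf_W; assumption)+
  have "d a L x = d a (\<lambda>x. gln D (gabs (ber x))) x"
    by (rule sderiv_cong[OF _ x a]) (simp add: L_def berezinian_eq)
  also have "\<dots> = d a ber x * ber' x"
    by (rule sderiv_gln[OF sf_ber ber_inverse x a])
  also have "d a ber x = ?trS * ?detS * ?detW + ?detS * (?trW * ?detW)"
    using sderiv_mult[OF sdetS sdetW x a]
      sderiv_gdet[OF fin_E sf_S KS[OF x] x a] sderiv_gdet[OF fin_D sf_W JW[OF x] x a] by simp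
  also have "?detS * (?trW * ?detW) = ?trW * ?detS * ?detW"
    using homog_even_commute[OF sf_homog[OF sdetS x], of ?trW] by (simp flip: mult.assoc)
  also have "(?trS * ?detS * ?detW + ?trW * ?detS * ?detW) * ber' x = (?trS + ?trW) * (ber x * ber' x)"
    by (simp add: distrib_right mult.assoc)
  finally have L: "d a L x = ?trS + ?trW" by (simp add: ber_inverse[OF x])

  \<comment> \<open>Differentiate \<open>W J = 1\<close> on the odd block; no sign occurs and the
    factors may be exchanged because \<open>W\<close> is even.\<close>
  have trW: "?trW = - (\<Sum>k\<in>D. \<Sum>m\<in>D. ?dJ k m * W m k x)"
  proof -
    have "(\<Sum>m\<in>D. d a (W k m) x * J m k x + W k m x * ?dJ m k) = 0" if k: "k \<in> D" for k
    proof -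
      have "(\<Sum>m\<in>D. d a (W k m) x * J m k x + W k m x * ?dJ m k) = (\<Sum>m\<in>D. d a (\<lambda>x. W k m x * J m k x) x)"
        using sderiv_mult[OF sf_W sf_J_even(2) x a] k by (intro sum.cong refl) simp
      also have "\<dots> = d a (\<lambda>x. \<Sum>m\<in>D. W k m x * J m k x) x"
        by (rule sderiv_sum[symmetric, where p = "\<lambda>_. 0", OF sf_mult_even[OF sf_W sf_J_even(2)] x a]) (use k in auto)
      also have "\<dots> = d a (\<lambda>_. of_real 1) x"
        by (rule sderiv_cong[OF _ x a]) (simp add: WJ k)
      finally show ?thesis by (simp only: sderiv_const_of_real)
    qed
    then have "?trW + (\<Sum>k\<in>D. \<Sum>m\<in>D. W k m x * ?dJ m k) = 0"
      by (simp add: sum.distrib[symmetric])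
    also have "(\<Sum>k\<in>D. \<Sum>m\<in>D. W k m x * ?dJ m k) = (\<Sum>m\<in>D. \<Sum>k\<in>D. ?dJ m k * W k m x)"
      by (subst sum.swap, intro sum.cong refl homog_even_commute[OF sf_homog[OF sf_W x]])
    finally show ?thesis by (simp add: eq_neg_iff_add_eq_0)
  qed

  have dS: "d a (S k m) x = ?dJ k m - (\<Sum>l\<in>D. d a (P k l) x * J l m x + ?e *\<^sub>R (P k l x * ?dJ l m))"
    if k: "k \<in> E" and m: "m \<in> E" for k m
  proof -
    have PJ': "sf (1 + (parity D l + parity D m)) (\<lambda>x. P k l x * J l m x)" if "l \<in> D" for l
      by (rule sf_mult[OF sf_P[OF k that] sf_J]) (use that m in auto)
    have "d a (S k m) x = ?dJ k m - d a (\<lambda>x. \<Sum>l\<in>D. P k l x * J l m x) x"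
      unfolding S_def[abs_def]
      by (rule sderiv_diff[OF sf_J_even(1)[OF k m] sf_sum[where p = 0] x a])
         (rule sf_parity[OF _ PJ'], use m in \<open>auto simp: parity_D parity_E\<close>)
    also have "d a (\<lambda>x. \<Sum>l\<in>D. P k l x * J l m x) x = (\<Sum>l\<in>D. d a (\<lambda>x. P k l x * J l m x) x)"
      by (rule sderiv_sum[OF PJ' x a])
    also have "\<dots> = (\<Sum>l\<in>D. d a (P k l) x * J l m x + ?e *\<^sub>R (P k l x * ?dJ l m))"
      using sderiv_mult[OF sf_P[OF k] sf_J x a] m by (intro sum.cong refl) simp
    finally show ?thesis .
  qed
  \<comment> \<open>Differentiates \<open>PJ\<close>; the sign \<open>?e\<close> comes from passing
    the derivative over the odd entries of \<open>P\<close>.\<close>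
  have dP: "(\<Sum>l\<in>D. d a (P k l) x * J l t x) = ?dJ k t - ?e *\<^sub>R (\<Sum>l\<in>D. P k l x * ?dJ l t)"
    if k: "k \<in> E" and t: "t \<in> D" for k t
  proof -
    have PJ': "sf (1 + (parity D l + parity D t)) (\<lambda>x. P k l x * J l t x)" if "l \<in> D" for l
      by (rule sf_mult[OF sf_P[OF k that] sf_J]) (use that t in auto)
    have "?dJ k t = d a (\<lambda>x. \<Sum>l\<in>D. P k l x * J l t x) x"
      by (rule sderiv_cong[OF _ x a]) (simp add: PJ k t)
    also have "\<dots> = (\<Sum>l\<in>D. d a (\<lambda>x. P k l x * J l t x) x)"
      by (rule sderiv_sum[OF PJ' x a])
    also have "\<dots> = (\<Sum>l\<in>D. d a (P k l) x * J l t x + ?e *\<^sub>R (P k l x * ?dJ l t))"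
      using sderiv_mult[OF sf_P[OF k] sf_J x a] t by (intro sum.cong refl) simp
    finally show ?thesis by (simp add: sum.distrib scaleR_sum_right)
  qed
  have JK': "(\<Sum>m\<in>E. J l m x * K m k x) = - (\<Sum>t\<in>D. J l t x * K t k x)" if "l \<in> D" "k \<in> E" for l k
  proof -
    have "l \<noteq> k" using that disj by auto
    then show ?thesis using JK[OF x, of l k] that by (simp add: sum_ED eq_neg_iff_add_eq_0)
  qed
  have row: "(\<Sum>m\<in>E. d a (S k m) x * K m k x) =
      (\<Sum>m\<in>E \<union> D. ?dJ k m * K m k x) - ?e *\<^sub>R (\<Sum>l\<in>D. P k l x * (\<Sum>m\<in>E \<union> D. ?dJ l m * K m k x))"
    if k: "k \<in> E" for k
  proof -
    have "(\<Sum>m\<in>E. d a (S k m) x * K m k x) = (\<Sum>m\<in>E. ?dJ k m * K m k x)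
        - (\<Sum>m\<in>E. \<Sum>l\<in>D. d a (P k l) x * (J l m x * K m k x))
        - (\<Sum>m\<in>E. \<Sum>l\<in>D. ?e *\<^sub>R (P k l x * (?dJ l m * K m k x)))"
      by (simp add: dS[OF k] left_diff_distrib sum_subtractf sum_distrib_right distrib_right sum.distrib
          mult.assoc diff_diff_eq)
    also have "(\<Sum>m\<in>E. \<Sum>l\<in>D. d a (P k l) x * (J l m x * K m k x)) =
        (\<Sum>l\<in>D. d a (P k l) x * (\<Sum>m\<in>E. J l m x * K m k x))"
      unfolding sum_distrib_left by (rule sum.swap)
    also have "\<dots> = - (\<Sum>l\<in>D. \<Sum>t\<in>D. d a (P k l) x * J l t x * K t k x)"
      by (simp add: JK' k sum_negf sum_distrib_left mult.assoc)
    also have "(\<Sum>l\<in>D. \<Sum>t\<in>D. d a (P k l) x * J l t x * K t k x) =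
        (\<Sum>t\<in>D. (\<Sum>l\<in>D. d a (P k l) x * J l t x) * K t k x)"
      unfolding sum_distrib_right by (rule sum.swap)
    also have "\<dots> = (\<Sum>t\<in>D. ?dJ k t * K t k x) - ?e *\<^sub>R (\<Sum>t\<in>D. \<Sum>l\<in>D. P k l x * (?dJ l t * K t k x))"
      by (simp add: dP[OF k] left_diff_distrib sum_subtractf sum_distrib_right mult.assoc scaleR_sum_right)
    finally have "(\<Sum>m\<in>E. d a (S k m) x * K m k x) = (\<Sum>m\<in>E \<union> D. ?dJ k m * K m k x)
        - ?e *\<^sub>R (\<Sum>m\<in>E \<union> D. \<Sum>l\<in>D. P k l x * (?dJ l m * K m k x))"
      by (simp add: sum_ED scaleR_add_right scaleR_sum_right)
    also have "(\<Sum>m\<in>E \<union> D. \<Sum>l\<in>D. P k l x * (?dJ l m * K m k x)) =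
        (\<Sum>l\<in>D. P k l x * (\<Sum>m\<in>E \<union> D. ?dJ l m * K m k x))"
      unfolding sum_distrib_left by (rule sum.swap)
    finally show ?thesis .
  qed
  \<comment> \<open>Moving the odd \<open>P k l\<close> to the end brings it next to
    \<open>K\<close>, where \<open>KP\<close> applies; the sign contains a second \<open>?e\<close>,
    which cancels the one in \<open>row\<close>.\<close>
  have swap: "P k l x * (?dJ l m * K m k x) = - ?e *\<^sub>R (?dJ l m * (K m k x * P k l x))"
    if k: "k \<in> E" and l: "l \<in> D" and m: "m \<in> E \<union> D" for k l m
  proof -
    have "homog D (parity D a + (parity D l + parity D m) + (parity D m + parity D k)) (?dJ l m * K m k x)"
      by (rule homog_mult[OF sf_homog[OF sf_sderiv[OF sf_J a] x] sf_homog[OF sf_K x]]) (use k l m in auto)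
    moreover have "(-1::real) ^ (1 * (parity D a + (parity D l + parity D m) + (parity D m + parity D k))) = - ?e"
      using k l by (simp add: parity_D parity_E power_add)
    ultimately show ?thesis
      using grassmann_supercommute[OF sf_homog[OF sf_P[OF k l] x]] by (simp add: mult.assoc)
  qed
  have "?trS = (\<Sum>k\<in>E. \<Sum>m\<in>E \<union> D. ?dJ k m * K m k x)
      - (\<Sum>k\<in>E. ?e *\<^sub>R (\<Sum>l\<in>D. P k l x * (\<Sum>m\<in>E \<union> D. ?dJ l m * K m k x)))"
    by (simp add: row sum_subtractf)
  also have "(\<Sum>k\<in>E. ?e *\<^sub>R (\<Sum>l\<in>D. P k l x * (\<Sum>m\<in>E \<union> D. ?dJ l m * K m k x))) =
      (\<Sum>k\<in>E. \<Sum>l\<in>D. \<Sum>m\<in>E \<union> D. - (?dJ l m * (K m k x * P k l x)))"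
    unfolding sum_distrib_left scaleR_sum_right
    by (intro sum.cong refl) (simp add: swap)
  also have "\<dots> = (\<Sum>l\<in>D. \<Sum>k\<in>E. \<Sum>m\<in>E \<union> D. - (?dJ l m * (K m k x * P k l x)))"
    by (rule sum.swap)
  also have "\<dots> = (\<Sum>l\<in>D. \<Sum>m\<in>E \<union> D. \<Sum>k\<in>E. - (?dJ l m * (K m k x * P k l x)))"
    by (intro sum.cong[OF refl] sum.swap)
  also have "\<dots> = (\<Sum>l\<in>D. \<Sum>m\<in>E \<union> D. ?dJ l m * (K m l x - (if m \<in> D then W m l x else 0)))"
  proof (intro sum.cong[OF refl])
    fix l m assume l: "l \<in> D" and m: "m \<in> E \<union> D"
    have "(\<Sum>k\<in>E. - (?dJ l m * (K m k x * P k l x))) = - (?dJ l m * (\<Sum>k\<in>E. K m k x * P k l x))"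
      by (simp add: sum_negf sum_distrib_left)
    then show "(\<Sum>k\<in>E. - (?dJ l m * (K m k x * P k l x))) = ?dJ l m * (K m l x - (if m \<in> D then W m l x else 0))"
      unfolding KP[OF x m l] by (simp add: right_diff_distrib)
  qed
  also have "\<dots> = (\<Sum>l\<in>D. \<Sum>m\<in>E \<union> D. ?dJ l m * K m l x) - (\<Sum>l\<in>D. \<Sum>m\<in>D. ?dJ l m * W m l x)"
  proof -
    have "(\<Sum>m\<in>E \<union> D. ?dJ l m * (if m \<in> D then W m l x else 0)) = (\<Sum>m\<in>D. ?dJ l m * W m l x)" for l
      by (rule sum.mono_neutral_cong_right) (use fin_ED in auto)
    then show ?thesis by (simp add: right_diff_distrib sum_subtractf)
  qed
  finally have "d a L x = (\<Sum>k\<in>E. \<Sum>m\<in>E \<union> D. ?dJ k m * K m k x) - (\<Sum>l\<in>D. \<Sum>m\<in>E \<union> D. ?dJ l m * K m l x)"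
    unfolding L trW by simp
  then show ?thesis
    using sum_ED[of "\<lambda>j. (-1) ^ parity D j *\<^sub>R (\<Sum>r\<in>E \<union> D. ?dJ j r * K r j x)"]
    by (simp add: parity_E parity_D sum_negf cong: sum.cong)
qed

end

section \<open>Curvature at a point\<close>

text \<open>Here the components of tensors and connections and their derivatives are elements of the Grassmann
  algebra: \<open>g k i j\<close> stands for \<open>\<Gamma>\<^sup>k\<^sub>i\<^sub>j\<close> and \<open>dg a k i j\<close> for \<open>\<partial>\<^sub>a \<Gamma>\<^sup>k\<^sub>i\<^sub>j\<close>.\<close>

abbreviation sg :: "nat \<Rightarrow> real" where "sg n \<equiv> (-1) ^ n"

lemma sg_cong: "even a = even b \<Longrightarrow> sg a = sg b"
  by (rule minus_one_power_cong)

lemma sg_scaleR: "sg a *\<^sub>R sg b *\<^sub>R x = sg (a + b) *\<^sub>R (x :: grassmann)"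
  by (simp add: power_add)

lemma sg_mult_1: "even (m + n) \<Longrightarrow> sg m * sg n = 1"
  unfolding power_add[symmetric] by (rule neg_one_even_power)

lemma sg_scaleR_1: "even (m + n) \<Longrightarrow> sg m *\<^sub>R sg n *\<^sub>R x = (x :: grassmann)"
  by (simp only: scaleR_scaleR sg_mult_1 scaleR_one)

lemma sg_scaleR_eq: "even (m + n) = even k \<Longrightarrow> sg m *\<^sub>R sg n *\<^sub>R x = sg k *\<^sub>R (x :: grassmann)"
  unfolding sg_scaleR by (intro arg_cong[where f = "\<lambda>r. r *\<^sub>R x"] sg_cong)

lemma scaleR_3: "3 *\<^sub>R x = x + x + (x :: 'a::real_vector)"
  using scaleR_add_left[of 2 1 x] by (simp add: scaleR_2)

lemma sum_single:
  assumes "finite I" "j \<in> I" "\<And>k. k \<in> I \<Longrightarrow> k \<noteq> j \<Longrightarrow> F k = 0"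
  shows "sum F I = F j"
  using assms by (simp add: sum.remove)

lemma homog_mult_cong: "homog D p a \<Longrightarrow> homog D q b \<Longrightarrow> even r = even (p + q) \<Longrightarrow> homog D r (a * b)"
  using homog_mult homog_cong by blast

lemma kron_sum [simp]:
  fixes f :: "nat \<Rightarrow> grassmann"
  assumes "finite I" "j \<in> I"
  shows "(\<Sum>k\<in>I. f k * kron k j) = f j" "(\<Sum>k\<in>I. f k * kron j k) = f j"
    "(\<Sum>k\<in>I. kron k j * f k) = f j" "(\<Sum>k\<in>I. kron j k * f k) = f j"
proof -
  have "(\<Sum>k\<in>I. f k * kron k j) = (\<Sum>k\<in>I. if k = j then f k else 0)"
    "(\<Sum>k\<in>I. f k * kron j k) = (\<Sum>k\<in>I. if j = k then f k else 0)"
    "(\<Sum>k\<in>I. kron k j * f k) = (\<Sum>k\<in>I. if k = j then f k else 0)"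
    "(\<Sum>k\<in>I. kron j k * f k) = (\<Sum>k\<in>I. if j = k then f k else 0)"
    by (auto simp: kron_def intro!: sum.cong)
  then show "(\<Sum>k\<in>I. f k * kron k j) = f j" "(\<Sum>k\<in>I. f k * kron j k) = f j"
    "(\<Sum>k\<in>I. kron k j * f k) = f j" "(\<Sum>k\<in>I. kron j k * f k) = f j"
    using assms by simp_all
qed

locale tensor_indices =
  fixes D I :: "nat set"
  assumes fin_I: "finite I"
begin

abbreviation par :: "nat \<Rightarrow> nat" where "par \<equiv> parity D"

text \<open>The coefficient of the frame vector \<open>l\<close> in \<open>nabla_a nabla_i\<close>
  applied to the frame vector \<open>j\<close>; the sign comes from passing index \<open>a\<close>
  over \<open>g k i j\<close>.\<close>

definition curv1 :: "(nat \<Rightarrow> nat \<Rightarrow> nat \<Rightarrow> grassmann) \<Rightarrow> (nat \<Rightarrow> nat \<Rightarrow> nat \<Rightarrow> nat \<Rightarrow> grassmann) \<Rightarrow>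
    nat \<Rightarrow> nat \<Rightarrow> nat \<Rightarrow> nat \<Rightarrow> grassmann" where
  "curv1 g dg a i j l = dg a l i j + (\<Sum>k\<in>I. sg (par a * (par i + par j + par k)) *\<^sub>R (g k i j * g l a k))"

text \<open>The supercommutator of \<open>nabla_a\<close> and \<open>nabla_i\<close>; there is no
  further term because coordinate fields supercommute.\<close>

definition curv where
  "curv g dg a i j l = curv1 g dg a i j l - sg (par a * par i) *\<^sub>R curv1 g dg i a j l"

text \<open>The supertrace in \<open>a\<close> and the upper index of a matrix of total parity
  \<open>i + j\<close>; the exponent is the one that \<open>str_conj\<close> shows to be
  invariant.\<close>

definition ric where
  "ric g dg i j = (\<Sum>a\<in>I. sg (par a * (1 + par i + par j)) *\<^sub>R curv g dg a i j a)"

definition ric0 where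
  "ric0 g dg i j = (\<Sum>q\<in>I. sg (par q * (1 + par i + par j)) *\<^sub>R (dg q q i j - (\<Sum>p\<in>I. g p q i * g q p j)))"

text \<open>Here \<open>dg\<close> is separate data rather than a derivative of \<open>g\<close>;
  parity and symmetry are all that the algebra uses of it.\<close>

definition conn :: "(nat \<Rightarrow> nat \<Rightarrow> nat \<Rightarrow> grassmann) \<Rightarrow> (nat \<Rightarrow> nat \<Rightarrow> nat \<Rightarrow> nat \<Rightarrow> grassmann) \<Rightarrow> bool" where
  "conn g dg \<longleftrightarrow> (\<forall>i\<in>I. \<forall>j\<in>I. \<forall>k\<in>I. homog D (par i + par j + par k) (g k i j) \<and>
     g k i j = sg (par i * par j) *\<^sub>R g k j i \<and>
     (\<forall>a\<in>I. homog D (par a + par i + par j + par k) (dg a k i j) \<and> dg a k i j = sg (par i * par j) *\<^sub>R dg a k j i))"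

lemma conn_homog: "conn g dg \<Longrightarrow> i \<in> I \<Longrightarrow> j \<in> I \<Longrightarrow> k \<in> I \<Longrightarrow> homog D (par i + par j + par k) (g k i j)"
  and conn_sym: "conn g dg \<Longrightarrow> i \<in> I \<Longrightarrow> j \<in> I \<Longrightarrow> k \<in> I \<Longrightarrow> g k i j = sg (par i * par j) *\<^sub>R g k j i"
  and conn_dhomog: "conn g dg \<Longrightarrow> a \<in> I \<Longrightarrow> i \<in> I \<Longrightarrow> j \<in> I \<Longrightarrow> k \<in> I \<Longrightarrow>
     homog D (par a + par i + par j + par k) (dg a k i j)"
  and conn_dsym: "conn g dg \<Longrightarrow> a \<in> I \<Longrightarrow> i \<in> I \<Longrightarrow> j \<in> I \<Longrightarrow> k \<in> I \<Longrightarrow>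
     dg a k i j = sg (par i * par j) *\<^sub>R dg a k j i"
  unfolding conn_def by blast+

definition tr :: "(nat \<Rightarrow> nat \<Rightarrow> nat \<Rightarrow> grassmann) \<Rightarrow> nat \<Rightarrow> grassmann" where
  "tr g i = (\<Sum>s\<in>I. sg (par s) *\<^sub>R g s i s)"

text \<open>The four terms of the curvature are traced separately. Symmetry in the lower indices
  makes two of them traces of \<open>g\<close> and \<open>dg\<close>; in the last quadratic one a
  supercommutation and a renaming of indices give the product in \<open>ric0\<close>.\<close>

lemma ric_formula:
  assumes c: "conn g dg" and ij: "i \<in> I" "j \<in> I"
  shows "ric g dg i j = ric0 g dg i j + (\<Sum>k\<in>I. g k i j * tr g k) - tr (dg i) j"
proof -
  let ?e = "\<lambda>a. 1 + par i + par j"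
  have "ric g dg i j =
      (\<Sum>a\<in>I. sg (par a * ?e a) *\<^sub>R dg a a i j)
      + (\<Sum>a\<in>I. \<Sum>k\<in>I. sg (par a * ?e a + par a * (par i + par j + par k)) *\<^sub>R (g k i j * g a a k))
      - (\<Sum>a\<in>I. sg (par a * ?e a + par a * par i) *\<^sub>R dg i a a j)
      - (\<Sum>a\<in>I. \<Sum>k\<in>I. sg (par a * ?e a + par a * par i + par i * (par a + par j + par k)) *\<^sub>R (g k a j * g a i k))"
    unfolding ric_def curv_def curv1_def
    by (simp add: scaleR_add_right scaleR_diff_right sum.distrib sum_subtractf scaleR_sum_right power_add mult.assoc)
  also have "(\<Sum>a\<in>I. \<Sum>k\<in>I. sg (par a * ?e a + par a * (par i + par j + par k)) *\<^sub>R (g k i j * g a a k)) =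
      (\<Sum>k\<in>I. g k i j * tr g k)"
  proof -
    have "sg (par a * ?e a + par a * (par i + par j + par k)) *\<^sub>R (g k i j * g a a k) = g k i j * (sg (par a) *\<^sub>R g a k a)"
      if "a \<in> I" "k \<in> I" for a k
    proof -
      have "sg (par a * ?e a + par a * (par i + par j + par k) + par a * par k) = sg (par a)"
        by (rule sg_cong) auto
      then show ?thesis
        unfolding conn_sym[OF c that(1,2,1)] by (simp add: power_add[symmetric])
    qed
    then have "(\<Sum>a\<in>I. \<Sum>k\<in>I. sg (par a * ?e a + par a * (par i + par j + par k)) *\<^sub>R (g k i j * g a a k)) =
        (\<Sum>a\<in>I. \<Sum>k\<in>I. g k i j * (sg (par a) *\<^sub>R g a k a))"
      by (intro sum.cong refl)
    then show ?thesis unfolding tr_def sum_distrib_left by (subst (asm) (2) sum.swap)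
  qed
  also have "(\<Sum>a\<in>I. sg (par a * ?e a + par a * par i) *\<^sub>R dg i a a j) = tr (dg i) j"
    unfolding tr_def
  proof (rule sum.cong[OF refl])
    fix a assume a: "a \<in> I"
    have "sg (par a * ?e a + par a * par i + par a * par j) = sg (par a)"
      by (rule sg_cong) auto
    then show "sg (par a * ?e a + par a * par i) *\<^sub>R dg i a a j = sg (par a) *\<^sub>R dg i a j a"
      unfolding conn_dsym[OF c ij(1) a ij(2) a] by (simp add: power_add[symmetric])
  qed
  also have "(\<Sum>a\<in>I. \<Sum>k\<in>I. sg (par a * ?e a + par a * par i + par i * (par a + par j + par k)) *\<^sub>R (g k a j * g a i k)) =
      (\<Sum>k\<in>I. \<Sum>a\<in>I. sg (par k * ?e k) *\<^sub>R (g a k i * g k a j))"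
  proof -
    have "sg (par a * ?e a + par a * par i + par i * (par a + par j + par k)) *\<^sub>R (g k a j * g a i k) =
        sg (par k * ?e k) *\<^sub>R (g a k i * g k a j)" if "a \<in> I" "k \<in> I" for a k
    proof -
      have "g k a j * g a i k = sg ((par a + par j + par k) * (par i + par k + par a) + par i * par k) *\<^sub>R (g a k i * g k a j)"
        using grassmann_supercommute[OF conn_homog[OF c that(1) ij(2) that(2)] conn_homog[OF c ij(1) that(2,1)]]
        unfolding conn_sym[OF c ij(1) that(2,1)] by (simp add: power_add)
      moreover have "sg (par a * ?e a + par a * par i + par i * (par a + par j + par k)
          + ((par a + par j + par k) * (par i + par k + par a) + par i * par k)) = sg (par k * ?e k)"
        by (rule sg_cong) auto
      ultimately show ?thesis by (simp add: power_add[symmetric])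
    qed
    then have "(\<Sum>a\<in>I. \<Sum>k\<in>I. sg (par a * ?e a + par a * par i + par i * (par a + par j + par k)) *\<^sub>R (g k a j * g a i k)) =
        (\<Sum>a\<in>I. \<Sum>k\<in>I. sg (par k * ?e k) *\<^sub>R (g a k i * g k a j))"
      by (intro sum.cong refl)
    then show ?thesis by (subst (asm) (2) sum.swap)
  qed
  finally show ?thesis
    by (simp add: ric0_def scaleR_diff_right sum_subtractf scaleR_sum_right)
qed

text \<open>Weyl's change of a connection within its projective class by a covector
  \<open>f\<close>. Being linear in \<open>g\<close> and \<open>f\<close>, the same expression
  applied to \<open>dg a\<close> and \<open>df a\<close> gives the derivatives of the changed
  coefficients.\<close>

definition proj_change :: "(nat \<Rightarrow> nat \<Rightarrow> nat \<Rightarrow> grassmann) \<Rightarrow> (nat \<Rightarrow> grassmann) \<Rightarrow> nat \<Rightarrow> nat \<Rightarrow> nat \<Rightarrow> grassmann" where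
  "proj_change g f k i j = g k i j + f i * kron k j + sg (par i * par j) *\<^sub>R (f j * kron k i)"

lemma sum_kron: "j \<in> I \<Longrightarrow> (\<Sum>k\<in>I. c k *\<^sub>R (f k * kron k j)) = c j *\<^sub>R f j"
  "j \<in> I \<Longrightarrow> (\<Sum>k\<in>I. c k *\<^sub>R (f k * kron j k)) = c j *\<^sub>R f j"
  using kron_sum(1,2)[OF fin_I, of j "\<lambda>k. c k *\<^sub>R f k"] by simp_all

definition sdim' :: real where "sdim' = (\<Sum>s\<in>I. sg (par s))"

text \<open>Origin of the constant \<open>n - m + 1\<close>: tracing the first Kronecker term gives
  the superdimension, the second gives 1.\<close>

lemma tr_proj_change:
  assumes i: "i \<in> I"
  shows "tr (proj_change g f) i = tr g i + (sdim' + 1) *\<^sub>R f i"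
proof -
  have "tr (proj_change g f) i = tr g i + (\<Sum>s\<in>I. sg (par s) *\<^sub>R (f i * kron s s))
      + (\<Sum>s\<in>I. sg (par s + par i * par s) *\<^sub>R (f s * kron s i))"
    unfolding tr_def proj_change_def by (simp add: scaleR_add_right sum.distrib power_add)
  also have "(\<Sum>s\<in>I. sg (par s) *\<^sub>R (f i * kron s s)) = sdim' *\<^sub>R f i"
    by (simp add: kron_def sdim'_def scaleR_sum_left)
  also have "(\<Sum>s\<in>I. sg (par s + par i * par s) *\<^sub>R (f s * kron s i)) = f i"
    unfolding sum_kron(1)[OF i] by simp
  finally show ?thesis by (simp add: scaleR_add_left)
qed

text \<open>Of the nine products in the quadratic part, two are traces of \<open>g\<close> and
  vanish, two give \<open>g f\<close>, three give \<open>f f\<close>, and the product of both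
  Kronecker terms along the summation indices gives \<open>sdim'\<close> times \<open>f f\<close>;
  hence the constant \<open>sdim' + 3\<close>.\<close>

lemma ric0_proj_change:
  assumes c: "conn g dg" and ij: "i \<in> I" "j \<in> I"
    and f: "\<And>i. i \<in> I \<Longrightarrow> homog D (par i) (f i)"
    and df: "\<And>a i. a \<in> I \<Longrightarrow> i \<in> I \<Longrightarrow> df a i = sg (par a * par i) *\<^sub>R df i a"
    and tr0: "\<And>i. i \<in> I \<Longrightarrow> tr g i = 0"
  shows "ric0 (proj_change g f) (\<lambda>a. proj_change (dg a) (df a)) i j =
    ric0 g dg i j + 2 *\<^sub>R df i j - 2 *\<^sub>R (\<Sum>k\<in>I. g k i j * f k) - (sdim' + 3) *\<^sub>R (f i * f j)"
proof -
  let ?s = "\<lambda>q. sg (par q * (1 + par i + par j))"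
  have fji: "f j * f i = sg (par i * par j) *\<^sub>R (f i * f j)"
    using grassmann_supercommute[OF f f, of j i] ij by (simp add: mult.commute)
  have div: "(\<Sum>q\<in>I. ?s q *\<^sub>R proj_change (dg q) (df q) q i j) = (\<Sum>q\<in>I. ?s q *\<^sub>R dg q q i j) + 2 *\<^sub>R df i j"
  proof -
    have "(\<Sum>q\<in>I. ?s q *\<^sub>R proj_change (dg q) (df q) q i j) = (\<Sum>q\<in>I. ?s q *\<^sub>R dg q q i j)
        + (\<Sum>q\<in>I. ?s q *\<^sub>R (df q i * kron q j)) + (\<Sum>q\<in>I. (?s q * sg (par i * par j)) *\<^sub>R (df q j * kron q i))"
      unfolding proj_change_def by (simp add: scaleR_add_right sum.distrib)
    also have "(\<Sum>q\<in>I. ?s q *\<^sub>R (df q i * kron q j)) = df i j"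
      unfolding sum_kron(1)[OF ij(2)] df[OF ij(2,1)]
      by (rule sg_scaleR_1) auto
    also have "(\<Sum>q\<in>I. (?s q * sg (par i * par j)) *\<^sub>R (df q j * kron q i)) = df i j"
      unfolding sum_kron(1)[OF ij(1)]
      by (subst sg_mult_1) auto
    finally show ?thesis by (simp add: scaleR_2)
  qed
  have quad: "(\<Sum>q\<in>I. \<Sum>p\<in>I. ?s q *\<^sub>R (proj_change g f p q i * proj_change g f q p j)) =
     (\<Sum>q\<in>I. \<Sum>p\<in>I. ?s q *\<^sub>R (g p q i * g q p j)) + 2 *\<^sub>R (\<Sum>k\<in>I. g k i j * f k) + (sdim' + 3) *\<^sub>R (f i * f j)"
  proof -
    let ?S = "\<lambda>h. \<Sum>q\<in>I. \<Sum>p\<in>I. ?s q *\<^sub>R (h q p)"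
    let ?a = "\<lambda>q p. g p q i" and ?b = "\<lambda>q p. f q * kron p i" and ?c = "\<lambda>q p. sg (par q * par i) *\<^sub>R (f i * kron p q)"
    let ?x = "\<lambda>q p. g q p j" and ?y = "\<lambda>q p. f p * kron q j" and ?z = "\<lambda>q p. sg (par p * par j) *\<^sub>R (f j * kron q p)"
    have "?S (\<lambda>q p. proj_change g f p q i * proj_change g f q p j) =
      ?S (\<lambda>q p. ?a q p * ?x q p) + ?S (\<lambda>q p. ?a q p * ?y q p) + ?S (\<lambda>q p. ?a q p * ?z q p) +
      (?S (\<lambda>q p. ?b q p * ?x q p) + ?S (\<lambda>q p. ?b q p * ?y q p) + ?S (\<lambda>q p. ?b q p * ?z q p)) +
      (?S (\<lambda>q p. ?c q p * ?x q p) + ?S (\<lambda>q p. ?c q p * ?y q p) + ?S (\<lambda>q p. ?c q p * ?z q p))"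
      unfolding proj_change_def by (simp only: distrib_left distrib_right scaleR_add_right sum.distrib add_ac)
    moreover have "?S (\<lambda>q p. ?a q p * ?y q p) = (\<Sum>k\<in>I. g k i j * f k)"
    proof -
      have "?S (\<lambda>q p. ?a q p * ?y q p) = (\<Sum>p\<in>I. \<Sum>q\<in>I. ?s q *\<^sub>R (?a q p * ?y q p))" by (rule sum.swap)
      also have "\<dots> = (\<Sum>p\<in>I. ?s j *\<^sub>R (g p j i * f p))"
        by (intro sum.cong refl, subst sum_single[OF fin_I ij(2)]) (simp_all add: kron_def)
      also have "\<dots> = (\<Sum>p\<in>I. g p i j * f p)"
      proof (rule sum.cong[OF refl])
        fix p assume "p \<in> I"
        show "?s j *\<^sub>R (g p j i * f p) = g p i j * f p"
          unfolding conn_sym[OF c ij(2,1) \<open>p \<in> I\<close>] mult_scaleR_left by (rule sg_scaleR_1) auto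
      qed
      finally show ?thesis .
    qed
    moreover have "?S (\<lambda>q p. ?a q p * ?z q p) = 0"
    proof -
      have "?S (\<lambda>q p. ?a q p * ?z q p) = (\<Sum>q\<in>I. ?s q *\<^sub>R (g q q i * (sg (par q * par j) *\<^sub>R f j)))"
        by (intro sum.cong refl, subst sum_single[OF fin_I]) (auto simp: kron_def)
      also have "\<dots> = (\<Sum>q\<in>I. (sg (par q) *\<^sub>R g q i q) * f j)"
      proof (rule sum.cong[OF refl])
        fix q assume q: "q \<in> I"
        show "?s q *\<^sub>R (g q q i * (sg (par q * par j) *\<^sub>R f j)) = (sg (par q) *\<^sub>R g q i q) * f j"
          unfolding conn_sym[OF c q ij(1) q] mult_scaleR_left mult_scaleR_right sg_scaleR
          by (subst sg_cong[where b = "par q"]) auto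
      qed
      also have "\<dots> = 0"
        by (simp only: sum_distrib_right[symmetric] tr0[OF ij(1), unfolded tr_def] mult_zero_left)
      finally show ?thesis .
    qed
    moreover have "?S (\<lambda>q p. ?b q p * ?x q p) = (\<Sum>k\<in>I. g k i j * f k)"
    proof (rule sum.cong[OF refl])
      fix q assume q: "q \<in> I"
      have "(\<Sum>p\<in>I. ?s q *\<^sub>R (?b q p * ?x q p)) = ?s q *\<^sub>R (f q * g q i j)"
        by (subst sum_single[OF fin_I ij(1)]) (simp_all add: kron_def)
      also have "\<dots> = g q i j * f q"
        unfolding grassmann_supercommute[OF f[OF q] conn_homog[OF c ij q]] by (rule sg_scaleR_1) auto
      finally show "(\<Sum>p\<in>I. ?s q *\<^sub>R (?b q p * ?x q p)) = g q i j * f q" .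
    qed
    moreover have "?S (\<lambda>q p. ?b q p * ?y q p) = f i * f j"
    proof -
      have "?S (\<lambda>q p. ?b q p * ?y q p) = (\<Sum>q\<in>I. ?s q *\<^sub>R (f q * (f i * kron q j)))"
        by (intro sum.cong refl, subst sum_single[OF fin_I ij(1)]) (simp_all add: kron_def)
      also have "\<dots> = ?s j *\<^sub>R (f j * f i)"
        by (subst sum_single[OF fin_I ij(2)]) (simp_all add: kron_def)
      also have "\<dots> = f i * f j" unfolding fji by (rule sg_scaleR_1) auto
      finally show ?thesis .
    qed
    moreover have "?S (\<lambda>q p. ?b q p * ?z q p) = f i * f j"
    proof -
      have "?S (\<lambda>q p. ?b q p * ?z q p) = (\<Sum>q\<in>I. ?s q *\<^sub>R (f q * (sg (par i * par j) *\<^sub>R (f j * kron q i))))"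
        by (intro sum.cong refl, subst sum_single[OF fin_I ij(1)]) (simp_all add: kron_def)
      also have "\<dots> = ?s i *\<^sub>R sg (par i * par j) *\<^sub>R (f i * f j)"
        by (subst sum_single[OF fin_I ij(1)]) (simp_all add: kron_def)
      also have "\<dots> = f i * f j" by (rule sg_scaleR_1) auto
      finally show ?thesis .
    qed
    moreover have "?S (\<lambda>q p. ?c q p * ?x q p) = 0"
    proof -
      have "?S (\<lambda>q p. ?c q p * ?x q p) = (\<Sum>q\<in>I. ?s q *\<^sub>R (sg (par q * par i) *\<^sub>R (f i * g q q j)))"
        by (intro sum.cong refl, subst sum_single[OF fin_I]) (auto simp: kron_def)
      also have "\<dots> = (\<Sum>q\<in>I. f i * (sg (par q) *\<^sub>R g q j q))"
      proof (rule sum.cong[OF refl])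
        fix q assume q: "q \<in> I"
        show "?s q *\<^sub>R (sg (par q * par i) *\<^sub>R (f i * g q q j)) = f i * (sg (par q) *\<^sub>R g q j q)"
          unfolding conn_sym[OF c q ij(2) q] mult_scaleR_left mult_scaleR_right sg_scaleR
          by (subst sg_cong[where b = "par q"]) auto
      qed
      also have "\<dots> = 0"
        by (simp only: sum_distrib_left[symmetric] tr0[OF ij(2), unfolded tr_def] mult_zero_right)
      finally show ?thesis .
    qed
    moreover have "?S (\<lambda>q p. ?c q p * ?y q p) = f i * f j"
    proof -
      have "?S (\<lambda>q p. ?c q p * ?y q p) = (\<Sum>q\<in>I. ?s q *\<^sub>R (sg (par q * par i) *\<^sub>R (f i * (f q * kron q j))))"
        by (intro sum.cong refl, subst sum_single[OF fin_I]) (auto simp: kron_def)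
      also have "\<dots> = ?s j *\<^sub>R sg (par j * par i) *\<^sub>R (f i * f j)"
        by (subst sum_single[OF fin_I ij(2)]) (simp_all add: kron_def)
      also have "\<dots> = f i * f j" by (rule sg_scaleR_1) auto
      finally show ?thesis .
    qed
    moreover have "?S (\<lambda>q p. ?c q p * ?z q p) = sdim' *\<^sub>R (f i * f j)"
    proof -
      have "?S (\<lambda>q p. ?c q p * ?z q p) =
          (\<Sum>q\<in>I. ?s q *\<^sub>R (sg (par q * par i) *\<^sub>R (sg (par q * par j) *\<^sub>R (f i * f j))))"
        by (intro sum.cong refl, subst sum_single[OF fin_I]) (auto simp: kron_def)
      also have "\<dots> = (\<Sum>q\<in>I. sg (par q) *\<^sub>R (f i * f j))"
      proof (rule sum.cong[OF refl])
        fix q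
        show "?s q *\<^sub>R (sg (par q * par i) *\<^sub>R (sg (par q * par j) *\<^sub>R (f i * f j))) = sg (par q) *\<^sub>R (f i * f j)"
          unfolding sg_scaleR by (subst sg_cong[where b = "par q"]) auto
      qed
      finally show ?thesis by (simp add: sdim'_def scaleR_sum_left)
    qed
    ultimately show ?thesis by (simp only: scaleR_add_left scaleR_2 scaleR_3) (simp add: add_ac)
  qed
  show ?thesis
    unfolding ric0_def scaleR_diff_right sum_subtractf scaleR_sum_right div quad by simp
qed

lemma conn_proj_change:
  assumes c: "conn g dg" and f: "\<And>i. i \<in> I \<Longrightarrow> homog D (par i) (f i)"
    and df: "\<And>a i. a \<in> I \<Longrightarrow> i \<in> I \<Longrightarrow> homog D (par a + par i) (df a i)"
  shows "conn (proj_change g f) (\<lambda>a. proj_change (dg a) (df a))"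
proof -
  have h: "homog D p (b * kron k j)" if "homog D q b" "k = j \<Longrightarrow> even p = even q" for p q b k j
    using that homog_cong[of p q D b] by (cases "k = j") (simp_all add: kron_def)
  have sym: "proj_change G F k i j = sg (par i * par j) *\<^sub>R proj_change G F k j i"
    if "G k i j = sg (par i * par j) *\<^sub>R G k j i" for G F k i j
    unfolding proj_change_def that
    by (simp add: scaleR_add_right mult.commute[of "par j"] sg_mult_1 add_ac)
  show ?thesis
    unfolding conn_def
  proof (intro ballI conjI)
    fix a i j k assume I: "i \<in> I" "j \<in> I" "k \<in> I"
    show "homog D (par i + par j + par k) (proj_change g f k i j)"
      unfolding proj_change_def
      by (intro homog_add homog_scaleR conn_homog[OF c] h[OF f] I) auto
    show "proj_change g f k i j = sg (par i * par j) *\<^sub>R proj_change g f k j i"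
      by (rule sym, rule conn_sym[OF c I])
    assume a: "a \<in> I"
    show "homog D (par a + par i + par j + par k) (proj_change (dg a) (df a) k i j)"
      unfolding proj_change_def
      by (intro homog_add homog_scaleR conn_dhomog[OF c] h[OF df] I a) auto
    show "proj_change (dg a) (df a) k i j = sg (par i * par j) *\<^sub>R proj_change (dg a) (df a) k j i"
      by (rule sym, rule conn_dsym[OF c a I])
  qed
qed

text \<open>The traces add \<open>sdim' + 1\<close> times \<open>- df + g f + 2 f f\<close> to the
  change of \<open>ric0\<close>; the coefficients then become \<open>- (sdim' - 1)\<close>,
  \<open>sdim' - 1\<close> and \<open>sdim' - 1\<close>, so that a common factor splits off. This is
  the origin of \<open>n - m - 1\<close>.\<close>

lemma ric_proj_change:
  assumes c: "conn g dg" and ij: "i \<in> I" "j \<in> I"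
    and f: "\<And>i. i \<in> I \<Longrightarrow> homog D (par i) (f i)"
    and df: "\<And>a i. a \<in> I \<Longrightarrow> i \<in> I \<Longrightarrow> homog D (par a + par i) (df a i)"
      "\<And>a i. a \<in> I \<Longrightarrow> i \<in> I \<Longrightarrow> df a i = sg (par a * par i) *\<^sub>R df i a"
    and tr0: "\<And>i. i \<in> I \<Longrightarrow> tr g i = 0" "\<And>a i. a \<in> I \<Longrightarrow> i \<in> I \<Longrightarrow> tr (dg a) i = 0"
  shows "ric (proj_change g f) (\<lambda>a. proj_change (dg a) (df a)) i j =
    ric0 g dg i j - (sdim' - 1) *\<^sub>R (df i j - (\<Sum>k\<in>I. g k i j * f k) - f i * f j)"
proof -
  have fji: "sg (par i * par j) *\<^sub>R (f j * f i) = f i * f j"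
    unfolding grassmann_supercommute[OF f[OF ij(2)] f[OF ij(1)]] by (rule sg_scaleR_1) auto
  have "(\<Sum>k\<in>I. proj_change g f k i j * tr (proj_change g f) k) =
      (sdim' + 1) *\<^sub>R (\<Sum>k\<in>I. g k i j * f k + f i * kron k j * f k + sg (par i * par j) *\<^sub>R (f j * kron k i * f k))"
    by (simp add: tr_proj_change tr0 proj_change_def scaleR_sum_right distrib_right cong: sum.cong)
  also have "(\<Sum>k\<in>I. g k i j * f k + f i * kron k j * f k + sg (par i * par j) *\<^sub>R (f j * kron k i * f k)) =
      (\<Sum>k\<in>I. g k i j * f k) + f i * f j + sg (par i * par j) *\<^sub>R (f j * f i)"
  proof -
    have "(\<Sum>k\<in>I. f i * kron k j * f k) = f i * f j"
      by (subst sum_single[OF fin_I ij(2)]) (simp_all add: kron_def)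
    moreover have "(\<Sum>k\<in>I. sg (par i * par j) *\<^sub>R (f j * kron k i * f k)) = sg (par i * par j) *\<^sub>R (f j * f i)"
      by (subst sum_single[OF fin_I ij(1)]) (simp_all add: kron_def)
    ultimately show ?thesis by (simp add: sum.distrib)
  qed
  finally have tau: "(\<Sum>k\<in>I. proj_change g f k i j * tr (proj_change g f) k) =
      (sdim' + 1) *\<^sub>R ((\<Sum>k\<in>I. g k i j * f k) + f i * f j + f i * f j)"
    unfolding fji .
  have "ric (proj_change g f) (\<lambda>a. proj_change (dg a) (df a)) i j =
      ric0 (proj_change g f) (\<lambda>a. proj_change (dg a) (df a)) i j
      + (\<Sum>k\<in>I. proj_change g f k i j * tr (proj_change g f) k) - tr (proj_change (dg i) (df i)) j"
    by (rule ric_formula[OF conn_proj_change[OF c] ij]) (rule f df(1); assumption)+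
  also have "tr (proj_change (dg i) (df i)) j = (sdim' + 1) *\<^sub>R df i j"
    using ij by (simp add: tr_proj_change tr0)
  also have "ric0 (proj_change g f) (\<lambda>a. proj_change (dg a) (df a)) i j =
      ric0 g dg i j + 2 *\<^sub>R df i j - 2 *\<^sub>R (\<Sum>k\<in>I. g k i j * f k) - (sdim' + 3) *\<^sub>R (f i * f j)"
    by (rule ric0_proj_change[OF c ij]) (rule f df(2) tr0(1); assumption)+
  finally show ?thesis
    unfolding tau
    by (simp add: scaleR_add_left scaleR_diff_left scaleR_add_right scaleR_diff_right scaleR_3 scaleR_2)
qed

section \<open>Transformation laws at a point\<close>

text \<open>Invariance of the supertrace under conjugation, for matrices of parity \<open>w\<close>.
  Moving \<open>J j q\<close> to the end turns the sign at \<open>j\<close> into the sign at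
  \<open>q\<close>, after which \<open>K J = 1\<close> applies.\<close>

lemma str_conj:
  assumes J: "\<And>j q. j \<in> I \<Longrightarrow> q \<in> I \<Longrightarrow> homog D (par j + par q) (J j q)"
    and K: "\<And>r j. r \<in> I \<Longrightarrow> j \<in> I \<Longrightarrow> homog D (par r + par j) (K r j)"
    and KJ: "\<And>r q. r \<in> I \<Longrightarrow> q \<in> I \<Longrightarrow> (\<Sum>j\<in>I. K r j * J j q) = kron r q"
    and Y: "\<And>q r. q \<in> I \<Longrightarrow> r \<in> I \<Longrightarrow> homog D (par q + par r + w) (Y q r)"
  shows "(\<Sum>j\<in>I. sg (par j * (1 + w)) *\<^sub>R (\<Sum>q\<in>I. \<Sum>r\<in>I. J j q * Y q r * K r j)) =
    (\<Sum>q\<in>I. sg (par q * (1 + w)) *\<^sub>R Y q q)"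
proof -
  have "sg (par j * (1 + w)) *\<^sub>R (J j q * Y q r * K r j) = sg (par q * (1 + w)) *\<^sub>R (Y q r * (K r j * J j q))"
    if "j \<in> I" "q \<in> I" "r \<in> I" for j q r
  proof -
    have "homog D (par q + par j + w) (Y q r * K r j)"
      by (rule homog_mult_cong[OF Y[OF that(2,3)] K[OF that(3,1)]]) auto
    from grassmann_supercommute[OF J[OF that(1,2)] this]
    have "J j q * Y q r * K r j = sg ((par j + par q) * (par q + par j + w)) *\<^sub>R (Y q r * (K r j * J j q))"
      by (simp add: mult.assoc)
    then show ?thesis by (simp only:) (rule sg_scaleR_eq, auto)
  qed
  then have "(\<Sum>j\<in>I. sg (par j * (1 + w)) *\<^sub>R (\<Sum>q\<in>I. \<Sum>r\<in>I. J j q * Y q r * K r j)) =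
      (\<Sum>j\<in>I. \<Sum>q\<in>I. \<Sum>r\<in>I. sg (par q * (1 + w)) *\<^sub>R (Y q r * (K r j * J j q)))"
    unfolding scaleR_sum_right by (intro sum.cong refl)
  also have "\<dots> = (\<Sum>q\<in>I. \<Sum>j\<in>I. \<Sum>r\<in>I. sg (par q * (1 + w)) *\<^sub>R (Y q r * (K r j * J j q)))"
    by (rule sum.swap)
  also have "\<dots> = (\<Sum>q\<in>I. \<Sum>r\<in>I. \<Sum>j\<in>I. sg (par q * (1 + w)) *\<^sub>R (Y q r * (K r j * J j q)))"
    by (intro sum.cong[OF refl] sum.swap)
  also have "\<dots> = (\<Sum>q\<in>I. sg (par q * (1 + w)) *\<^sub>R (\<Sum>r\<in>I. Y q r * kron r q))"
    by (intro sum.cong refl) (simp add: KJ scaleR_sum_right sum_distrib_left flip: scaleR_sum_right sum_distrib_left cong: sum.cong)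
  also have "\<dots> = (\<Sum>q\<in>I. sg (par q * (1 + w)) *\<^sub>R Y q q)"
    by (intro sum.cong refl) (simp add: fin_I)
  finally show ?thesis .
qed

end

locale tensor_change = tensor_indices +
  fixes J K :: gmatrix and dJ :: "nat \<Rightarrow> nat \<Rightarrow> nat \<Rightarrow> grassmann"
  assumes J: "i \<in> I \<Longrightarrow> j \<in> I \<Longrightarrow> homog D (parity D i + parity D j) (J i j)"
    and K: "i \<in> I \<Longrightarrow> j \<in> I \<Longrightarrow> homog D (parity D i + parity D j) (K i j)"
    and JK: "i \<in> I \<Longrightarrow> j \<in> I \<Longrightarrow> (\<Sum>l\<in>I. J i l * K l j) = kron i j"
    and KJ: "i \<in> I \<Longrightarrow> j \<in> I \<Longrightarrow> (\<Sum>l\<in>I. K i l * J l j) = kron i j"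
begin

definition conn_law :: "(nat \<Rightarrow> nat \<Rightarrow> nat \<Rightarrow> grassmann) \<Rightarrow> (nat \<Rightarrow> nat \<Rightarrow> nat \<Rightarrow> grassmann) \<Rightarrow> bool" where
  "conn_law g h \<longleftrightarrow> (\<forall>i\<in>I. \<forall>j\<in>I. \<forall>r\<in>I. (\<Sum>k\<in>I. g k i j * J k r) =
     dJ i j r + (\<Sum>p\<in>I. \<Sum>q\<in>I. sg (par p * (par j + par q)) *\<^sub>R (J i p * J j q * h r p q)))"

lemma recover:
  assumes "l \<in> I"
  shows "(\<Sum>r\<in>I. (\<Sum>k\<in>I. x k * J k r) * K r l) = x l"
proof -
  have "(\<Sum>r\<in>I. (\<Sum>k\<in>I. x k * J k r) * K r l) = (\<Sum>k\<in>I. x k * (\<Sum>r\<in>I. J k r * K r l))"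
    by (rule matrix_assoc[symmetric])
  also have "\<dots> = (\<Sum>k\<in>I. x k * kron k l)" using assms by (intro sum.cong refl) (simp add: JK)
  finally show ?thesis using assms fin_I by simp
qed

text \<open>Multiplication by \<open>K\<close> isolates \<open>g j i j\<close>. In the supertrace
  the homogeneous part is a conjugation for each fixed \<open>p\<close>, covered by
  \<open>str_conj\<close>; the rest is the supertrace of \<open>dJ K\<close>.\<close>

lemma trace_law:
  assumes law: "conn_law g h" and i: "i \<in> I"
    and h: "\<And>p q r. p \<in> I \<Longrightarrow> q \<in> I \<Longrightarrow> r \<in> I \<Longrightarrow> homog D (par p + par q + par r) (h r p q)"
  shows "tr g i = (\<Sum>j\<in>I. sg (par j) *\<^sub>R (\<Sum>r\<in>I. dJ i j r * K r j)) + (\<Sum>p\<in>I. J i p * tr h p)"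
proof -
  define X where "X j r = (\<Sum>p\<in>I. \<Sum>q\<in>I. sg (par p * (par j + par q)) *\<^sub>R (J i p * J j q * h r p q))" for j r
  let ?Y = "\<lambda>p q r. sg (par p * par q) *\<^sub>R h r p q"
  have g: "g j i j = (\<Sum>r\<in>I. dJ i j r * K r j) + (\<Sum>r\<in>I. X j r * K r j)" if "j \<in> I" for j
  proof -
    have "g j i j = (\<Sum>r\<in>I. (\<Sum>k\<in>I. g k i j * J k r) * K r j)"
      by (rule recover[OF that, of "\<lambda>k. g k i j", symmetric])
    also have "\<dots> = (\<Sum>r\<in>I. (dJ i j r + X j r) * K r j)"
      using law i that unfolding conn_law_def X_def by (intro sum.cong refl) simp
    finally show ?thesis by (simp add: distrib_right sum.distrib)
  qed
  have "(\<Sum>j\<in>I. sg (par j) *\<^sub>R (\<Sum>r\<in>I. X j r * K r j)) =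
      (\<Sum>j\<in>I. \<Sum>r\<in>I. \<Sum>p\<in>I. \<Sum>q\<in>I. J i p * (sg (par j * (1 + par p)) *\<^sub>R (J j q * ?Y p q r * K r j)))"
    unfolding X_def sum_distrib_right scaleR_sum_right
  proof (intro sum.cong refl)
    fix j r p q
    have "sg (par j + par p * (par j + par q)) = sg (par j * (1 + par p) + par p * par q)"
      by (rule sg_cong) auto
    then show "sg (par j) *\<^sub>R (sg (par p * (par j + par q)) *\<^sub>R (J i p * J j q * h r p q) * K r j) =
        J i p * (sg (par j * (1 + par p)) *\<^sub>R (J j q * ?Y p q r * K r j))"
      by (simp only: mult_scaleR_left mult_scaleR_right sg_scaleR mult.assoc)
  qed
  also have "\<dots> = (\<Sum>p\<in>I. J i p * (\<Sum>j\<in>I. sg (par j * (1 + par p)) *\<^sub>R (\<Sum>q\<in>I. \<Sum>r\<in>I. J j q * ?Y p q r * K r j)))"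
    (is "?L = ?R")
  proof -
    let ?h = "\<lambda>j r p q. J i p * (sg (par j * (1 + par p)) *\<^sub>R (J j q * ?Y p q r * K r j))"
    have "?L = (\<Sum>j\<in>I. \<Sum>p\<in>I. \<Sum>r\<in>I. \<Sum>q\<in>I. ?h j r p q)" by (intro sum.cong[OF refl] sum.swap)
    also have "\<dots> = (\<Sum>p\<in>I. \<Sum>j\<in>I. \<Sum>r\<in>I. \<Sum>q\<in>I. ?h j r p q)" by (rule sum.swap)
    also have "\<dots> = (\<Sum>p\<in>I. \<Sum>j\<in>I. \<Sum>q\<in>I. \<Sum>r\<in>I. ?h j r p q)" by (intro sum.cong[OF refl] sum.swap)
    finally show ?thesis by (simp only: sum_distrib_left scaleR_sum_right)
  qed
  also have "\<dots> = (\<Sum>p\<in>I. J i p * (\<Sum>q\<in>I. sg (par q * (1 + par p)) *\<^sub>R ?Y p q q))"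
  proof (rule sum.cong[OF refl])
    fix p assume p: "p \<in> I"
    have "(\<Sum>j\<in>I. sg (par j * (1 + par p)) *\<^sub>R (\<Sum>q\<in>I. \<Sum>r\<in>I. J j q * ?Y p q r * K r j)) =
        (\<Sum>q\<in>I. sg (par q * (1 + par p)) *\<^sub>R ?Y p q q)"
    proof (rule str_conj[OF J K KJ])
      fix q r assume q: "q \<in> I" and r: "r \<in> I"
      show "homog D (par q + par r + par p) (?Y p q r)"
        using h[OF p q r] by (intro homog_scaleR) (simp add: add_ac)
    qed
    then show "J i p * (\<Sum>j\<in>I. sg (par j * (1 + par p)) *\<^sub>R (\<Sum>q\<in>I. \<Sum>r\<in>I. J j q * ?Y p q r * K r j)) =
        J i p * (\<Sum>q\<in>I. sg (par q * (1 + par p)) *\<^sub>R ?Y p q q)" by (simp only:)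
  qed
  also have "\<dots> = (\<Sum>p\<in>I. J i p * tr h p)"
  proof (rule sum.cong[OF refl])
    fix p
    have "(\<Sum>q\<in>I. sg (par q * (1 + par p)) *\<^sub>R ?Y p q q) = tr h p"
      unfolding tr_def by (intro sum.cong refl sg_scaleR_eq) auto
    then show "J i p * (\<Sum>q\<in>I. sg (par q * (1 + par p)) *\<^sub>R ?Y p q q) = J i p * tr h p" by (simp only:)
  qed
  finally show ?thesis
    by (simp add: tr_def[of g] g scaleR_add_right sum.distrib cong: sum.cong)
qed

text \<open>The added terms are built from a covector and the invariant Kronecker symbol, hence
  transform as a tensor and leave the inhomogeneous term \<open>dJ\<close> untouched.\<close>

lemma conn_law_proj_change:
  assumes law: "conn_law g h" and f': "\<And>p. p \<in> I \<Longrightarrow> homog D (par p) (f' p)"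
    and f: "\<And>i. i \<in> I \<Longrightarrow> f i = (\<Sum>p\<in>I. J i p * f' p)"
  shows "conn_law (proj_change g f) (proj_change h f')"
  unfolding conn_law_def
proof (intro ballI)
  fix i j r assume I: "i \<in> I" "j \<in> I" "r \<in> I"
  have fh: "homog D (par j) (f j)" unfolding f[OF I(2)]
  proof (rule homog_sum)
    fix p assume "p \<in> I"
    then show "homog D (par j) (J j p * f' p)" using homog_mult_cong[OF J f', of j p p] I by auto
  qed
  have "(\<Sum>k\<in>I. proj_change g f k i j * J k r) = (\<Sum>k\<in>I. g k i j * J k r)
      + (\<Sum>k\<in>I. f i * kron k j * J k r) + (\<Sum>k\<in>I. sg (par i * par j) *\<^sub>R (f j * kron k i * J k r))"
    unfolding proj_change_def by (simp add: distrib_right sum.distrib)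
  also have "(\<Sum>k\<in>I. f i * kron k j * J k r) = f i * J j r"
    by (subst sum_single[OF fin_I I(2)]) (simp_all add: kron_def)
  also have "(\<Sum>k\<in>I. sg (par i * par j) *\<^sub>R (f j * kron k i * J k r)) = sg (par i * par j) *\<^sub>R (f j * J i r)"
    by (subst sum_single[OF fin_I I(1)]) (simp_all add: kron_def)
  finally have l: "(\<Sum>k\<in>I. proj_change g f k i j * J k r) =
      (\<Sum>k\<in>I. g k i j * J k r) + f i * J j r + sg (par i * par j) *\<^sub>R (f j * J i r)" .
  let ?s = "\<lambda>p q. sg (par p * (par j + par q))"
  have "(\<Sum>p\<in>I. \<Sum>q\<in>I. ?s p q *\<^sub>R (J i p * J j q * proj_change h f' r p q)) =
      (\<Sum>p\<in>I. \<Sum>q\<in>I. ?s p q *\<^sub>R (J i p * J j q * h r p q))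
      + (\<Sum>p\<in>I. \<Sum>q\<in>I. ?s p q *\<^sub>R (J i p * J j q * (f' p * kron r q)))
      + (\<Sum>p\<in>I. \<Sum>q\<in>I. ?s p q *\<^sub>R (J i p * J j q * (sg (par p * par q) *\<^sub>R (f' q * kron r p))))"
    unfolding proj_change_def by (simp only: distrib_left scaleR_add_right sum.distrib)
  also have "(\<Sum>p\<in>I. \<Sum>q\<in>I. ?s p q *\<^sub>R (J i p * J j q * (f' p * kron r q))) = f i * J j r"
  proof -
    have "(\<Sum>q\<in>I. ?s p q *\<^sub>R (J i p * J j q * (f' p * kron r q))) = J i p * f' p * J j r" if p: "p \<in> I" for p
    proof -
      have "(\<Sum>q\<in>I. ?s p q *\<^sub>R (J i p * J j q * (f' p * kron r q))) = ?s p r *\<^sub>R (J i p * (J j r * f' p))"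
        by (subst sum_single[OF fin_I I(3)]) (simp_all add: kron_def mult.assoc)
      also have "\<dots> = J i p * f' p * J j r"
        unfolding grassmann_supercommute[OF J[OF I(2,3)] f'[OF p]] mult_scaleR_right mult.assoc
        by (rule sg_scaleR_1) auto
      finally show ?thesis .
    qed
    then show ?thesis by (simp add: f[OF I(1)] sum_distrib_right cong: sum.cong)
  qed
  also have "(\<Sum>p\<in>I. \<Sum>q\<in>I. ?s p q *\<^sub>R (J i p * J j q * (sg (par p * par q) *\<^sub>R (f' q * kron r p)))) =
      sg (par i * par j) *\<^sub>R (f j * J i r)"
  proof -
    have "(\<Sum>p\<in>I. \<Sum>q\<in>I. ?s p q *\<^sub>R (J i p * J j q * (sg (par p * par q) *\<^sub>R (f' q * kron r p)))) =
        (\<Sum>q\<in>I. ?s r q *\<^sub>R (J i r * J j q * (sg (par r * par q) *\<^sub>R f' q)))"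
      by (subst sum_single[OF fin_I I(3)]) (simp_all add: kron_def)
    also have "\<dots> = (\<Sum>q\<in>I. sg (par r * par j) *\<^sub>R (J i r * (J j q * f' q)))"
      unfolding mult_scaleR_right mult.assoc by (intro sum.cong refl sg_scaleR_eq) auto
    also have "\<dots> = sg (par r * par j) *\<^sub>R (J i r * f j)"
      by (simp add: f[OF I(2)] sum_distrib_left scaleR_sum_right)
    also have "\<dots> = sg (par i * par j) *\<^sub>R (f j * J i r)"
      unfolding grassmann_supercommute[OF J[OF I(1,3)] fh] by (rule sg_scaleR_eq) auto
    finally show ?thesis .
  qed
  finally show "(\<Sum>k\<in>I. proj_change g f k i j * J k r) =
      dJ i j r + (\<Sum>p\<in>I. \<Sum>q\<in>I. ?s p q *\<^sub>R (J i p * J j q * proj_change h f' r p q))"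
    unfolding l using law I by (simp add: conn_law_def add.assoc)
qed

end

text \<open>\<open>ddJ\<close>, \<open>dg\<close>, \<open>dA\<close> are the derivatives of \<open>dJ\<close>, \<open>g\<close>, \<open>A\<close>, where \<open>A i q r\<close> are the coefficients of the
  pulled back connection along \<open>\<partial>\<^sub>i\<close> in the new frame.\<close>

locale tensor_change2 = tensor_change +
  fixes g h A :: "nat \<Rightarrow> nat \<Rightarrow> nat \<Rightarrow> grassmann" and dg dh dA ddJ :: "nat \<Rightarrow> nat \<Rightarrow> nat \<Rightarrow> nat \<Rightarrow> grassmann"
  assumes h: "p \<in> I \<Longrightarrow> q \<in> I \<Longrightarrow> r \<in> I \<Longrightarrow> homog D (parity D p + parity D q + parity D r) (h r p q)"
    and dh: "t \<in> I \<Longrightarrow> p \<in> I \<Longrightarrow> q \<in> I \<Longrightarrow> r \<in> I \<Longrightarrow>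
      homog D (parity D t + parity D p + parity D q + parity D r) (dh t r p q)"
    and A: "i \<in> I \<Longrightarrow> q \<in> I \<Longrightarrow> r \<in> I \<Longrightarrow> A i q r = (\<Sum>p\<in>I. J i p * h r p q)"
    and dA: "a \<in> I \<Longrightarrow> i \<in> I \<Longrightarrow> q \<in> I \<Longrightarrow> r \<in> I \<Longrightarrow> dA a i q r = (\<Sum>p\<in>I. dJ a i p * h r p q +
      sg (parity D a * (parity D i + parity D p)) *\<^sub>R (J i p * (\<Sum>t\<in>I. J a t * dh t r p q)))"
    and law: "i \<in> I \<Longrightarrow> j \<in> I \<Longrightarrow> r \<in> I \<Longrightarrow> (\<Sum>k\<in>I. g k i j * J k r) =
      dJ i j r + (\<Sum>q\<in>I. sg (parity D i * (parity D j + parity D q)) *\<^sub>R (J j q * A i q r))"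
    and dlaw: "a \<in> I \<Longrightarrow> i \<in> I \<Longrightarrow> j \<in> I \<Longrightarrow> r \<in> I \<Longrightarrow>
      (\<Sum>k\<in>I. dg a k i j * J k r + sg (parity D a * (parity D i + parity D j + parity D k)) *\<^sub>R (g k i j * dJ a k r)) =
      ddJ a i j r + (\<Sum>q\<in>I. sg (parity D i * (parity D j + parity D q)) *\<^sub>R
        (dJ a j q * A i q r + sg (parity D a * (parity D j + parity D q)) *\<^sub>R (J j q * dA a i q r)))"
    and dJ_sym: "a \<in> I \<Longrightarrow> i \<in> I \<Longrightarrow> p \<in> I \<Longrightarrow> dJ a i p = sg (parity D a * parity D i) *\<^sub>R dJ i a p"
    and ddJ_sym: "a \<in> I \<Longrightarrow> i \<in> I \<Longrightarrow> j \<in> I \<Longrightarrow> r \<in> I \<Longrightarrow> ddJ a i j r = sg (parity D a * parity D i) *\<^sub>R ddJ i a j r"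
begin

text \<open>The analogue of \<open>curv1\<close> in the mixed setting: the coefficients of
  \<open>nabla_a nabla_i\<close>, along old coordinate fields, applied to the new frame vector
  \<open>q\<close>.\<close>

definition F1 where
  "F1 a i q r = dA a i q r + (\<Sum>s\<in>I. sg (par a * (par i + par q + par s)) *\<^sub>R (A i q s * A a s r))"

text \<open>Expands \<open>nabla_a nabla_i\<close> of the old frame vector \<open>j\<close> written
  in the new frame. The bracketed terms of first order in \<open>dJ\<close> form a sum that is
  supersymmetric in \<open>a\<close> and \<open>i\<close>, as is \<open>ddJ\<close>;
  \<open>curv_law\<close> removes both.\<close>

lemma curv1_law:
  assumes I: "a \<in> I" "i \<in> I" "j \<in> I" "r \<in> I"
  shows "(\<Sum>l\<in>I. curv1 g dg a i j l * J l r) = ddJ a i j r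
    + ((\<Sum>q\<in>I. sg (par i * (par j + par q)) *\<^sub>R (dJ a j q * A i q r))
       + (\<Sum>q\<in>I. sg (par a * (par i + par j + par q)) *\<^sub>R (dJ i j q * A a q r)))
    + (\<Sum>q\<in>I. sg ((par i + par a) * (par j + par q)) *\<^sub>R (J j q * F1 a i q r))"
proof -
  let ?s = "\<lambda>k. sg (par a * (par i + par j + par k))"
  have "(\<Sum>l\<in>I. curv1 g dg a i j l * J l r) = (\<Sum>l\<in>I. dg a l i j * J l r)
      + (\<Sum>l\<in>I. (\<Sum>k\<in>I. (?s k *\<^sub>R g k i j) * g l a k) * J l r)"
    unfolding curv1_def by (simp add: distrib_right sum.distrib)
  also have "(\<Sum>l\<in>I. (\<Sum>k\<in>I. (?s k *\<^sub>R g k i j) * g l a k) * J l r) =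
      (\<Sum>k\<in>I. (?s k *\<^sub>R g k i j) * (\<Sum>l\<in>I. g l a k * J l r))"
    by (rule matrix_assoc[symmetric])
  also have "\<dots> = (\<Sum>k\<in>I. ?s k *\<^sub>R (g k i j * dJ a k r))
      + (\<Sum>k\<in>I. \<Sum>q\<in>I. ?s q *\<^sub>R (g k i j * J k q * A a q r))"
    unfolding sum.distrib[symmetric]
  proof (rule sum.cong[OF refl])
    fix k assume k: "k \<in> I"
    have "(?s k *\<^sub>R g k i j) * (\<Sum>q\<in>I. sg (par a * (par k + par q)) *\<^sub>R (J k q * A a q r)) =
        (\<Sum>q\<in>I. ?s q *\<^sub>R (g k i j * J k q * A a q r))"
      unfolding sum_distrib_left mult_scaleR_left mult_scaleR_right mult.assoc
      by (intro sum.cong refl sg_scaleR_eq) auto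
    then show "(?s k *\<^sub>R g k i j) * (\<Sum>l\<in>I. g l a k * J l r) =
        ?s k *\<^sub>R (g k i j * dJ a k r) + (\<Sum>q\<in>I. ?s q *\<^sub>R (g k i j * J k q * A a q r))"
      unfolding law[OF I(1) k I(4)] by (simp add: distrib_left)
  qed
  also have "(\<Sum>k\<in>I. \<Sum>q\<in>I. ?s q *\<^sub>R (g k i j * J k q * A a q r)) =
      (\<Sum>q\<in>I. ?s q *\<^sub>R ((\<Sum>k\<in>I. g k i j * J k q) * A a q r))"
    unfolding sum_distrib_right scaleR_sum_right by (rule sum.swap)
  also have "\<dots> = (\<Sum>q\<in>I. ?s q *\<^sub>R (dJ i j q * A a q r))
      + (\<Sum>q\<in>I. ?s q *\<^sub>R ((\<Sum>s\<in>I. sg (par i * (par j + par s)) *\<^sub>R (J j s * A i s q)) * A a q r))"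
    using I by (simp add: law distrib_right scaleR_add_right sum.distrib cong: sum.cong)
  also have "(\<Sum>q\<in>I. ?s q *\<^sub>R ((\<Sum>s\<in>I. sg (par i * (par j + par s)) *\<^sub>R (J j s * A i s q)) * A a q r)) =
      (\<Sum>s\<in>I. sg ((par i + par a) * (par j + par s)) *\<^sub>R
        (J j s * (\<Sum>q\<in>I. sg (par a * (par i + par s + par q)) *\<^sub>R (A i s q * A a q r))))"
  proof -
    have "(\<Sum>q\<in>I. ?s q *\<^sub>R ((\<Sum>s\<in>I. sg (par i * (par j + par s)) *\<^sub>R (J j s * A i s q)) * A a q r)) =
        (\<Sum>q\<in>I. \<Sum>s\<in>I. sg ((par i + par a) * (par j + par s)) *\<^sub>R
          (sg (par a * (par i + par s + par q)) *\<^sub>R (J j s * (A i s q * A a q r))))"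
      unfolding sum_distrib_right scaleR_sum_right
    proof (intro sum.cong refl)
      fix q s
      have "sg (par a * (par i + par j + par q) + par i * (par j + par s)) =
          sg ((par i + par a) * (par j + par s) + par a * (par i + par s + par q))"
        by (rule sg_cong) auto
      then show "?s q *\<^sub>R (sg (par i * (par j + par s)) *\<^sub>R (J j s * A i s q) * A a q r) =
          sg ((par i + par a) * (par j + par s)) *\<^sub>R
          (sg (par a * (par i + par s + par q)) *\<^sub>R (J j s * (A i s q * A a q r)))"
        by (simp only: mult_scaleR_left sg_scaleR mult.assoc)
    qed
    also have "\<dots> = (\<Sum>s\<in>I. \<Sum>q\<in>I. sg ((par i + par a) * (par j + par s)) *\<^sub>R
          (sg (par a * (par i + par s + par q)) *\<^sub>R (J j s * (A i s q * A a q r))))"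
      by (rule sum.swap)
    finally show ?thesis by (simp only: sum_distrib_left scaleR_sum_right mult_scaleR_right)
  qed
  finally have "(\<Sum>l\<in>I. curv1 g dg a i j l * J l r) =
      (\<Sum>k\<in>I. dg a k i j * J k r + ?s k *\<^sub>R (g k i j * dJ a k r))
      + ((\<Sum>q\<in>I. ?s q *\<^sub>R (dJ i j q * A a q r))
      + (\<Sum>s\<in>I. sg ((par i + par a) * (par j + par s)) *\<^sub>R
        (J j s * (\<Sum>q\<in>I. sg (par a * (par i + par s + par q)) *\<^sub>R (A i s q * A a q r)))))"
    by (simp add: sum.distrib add.assoc)
  also have "(\<Sum>k\<in>I. dg a k i j * J k r + ?s k *\<^sub>R (g k i j * dJ a k r)) =
      ddJ a i j r + (\<Sum>q\<in>I. sg (par i * (par j + par q)) *\<^sub>R (dJ a j q * A i q r))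
      + (\<Sum>q\<in>I. sg ((par i + par a) * (par j + par q)) *\<^sub>R (J j q * dA a i q r))"
  proof -
    have "sg (par i * (par j + par q)) *\<^sub>R sg (par a * (par j + par q)) *\<^sub>R (J j q * dA a i q r) =
        sg ((par i + par a) * (par j + par q)) *\<^sub>R (J j q * dA a i q r)" for q
      by (rule sg_scaleR_eq) auto
    then show ?thesis unfolding dlaw[OF I] by (simp only: scaleR_add_right sum.distrib add.assoc)
  qed
  finally show ?thesis
    by (simp add: F1_def distrib_left scaleR_add_right sum.distrib add_ac)
qed

lemma curv_law:
  assumes I: "a \<in> I" "i \<in> I" "j \<in> I" "r \<in> I"
  shows "(\<Sum>l\<in>I. curv g dg a i j l * J l r) =
    (\<Sum>q\<in>I. sg ((par i + par a) * (par j + par q)) *\<^sub>R (J j q * (F1 a i q r - sg (par a * par i) *\<^sub>R F1 i a q r)))"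
proof -
  let ?e = "sg (par a * par i)"
  have 1: "?e *\<^sub>R (\<Sum>q\<in>I. sg (par a * (par j + par q)) *\<^sub>R (dJ i j q * A a q r)) =
      (\<Sum>q\<in>I. sg (par a * (par i + par j + par q)) *\<^sub>R (dJ i j q * A a q r))"
    unfolding scaleR_sum_right by (intro sum.cong refl sg_scaleR_eq) auto
  have 2: "?e *\<^sub>R (\<Sum>q\<in>I. sg (par i * (par a + par j + par q)) *\<^sub>R (dJ a j q * A i q r)) =
      (\<Sum>q\<in>I. sg (par i * (par j + par q)) *\<^sub>R (dJ a j q * A i q r))"
    unfolding scaleR_sum_right by (intro sum.cong refl sg_scaleR_eq) auto
  have 3: "?e *\<^sub>R (\<Sum>q\<in>I. sg ((par a + par i) * (par j + par q)) *\<^sub>R (J j q * F1 i a q r)) =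
      (\<Sum>q\<in>I. sg ((par i + par a) * (par j + par q)) *\<^sub>R (J j q * ?e *\<^sub>R F1 i a q r))"
    unfolding scaleR_sum_right mult_scaleR_right sg_scaleR by (intro sum.cong refl arg_cong2[where f = scaleR] sg_cong) auto
  have "(\<Sum>l\<in>I. curv g dg a i j l * J l r) =
      (\<Sum>l\<in>I. curv1 g dg a i j l * J l r) - ?e *\<^sub>R (\<Sum>l\<in>I. curv1 g dg i a j l * J l r)"
    by (simp add: curv_def left_diff_distrib sum_subtractf scaleR_sum_right)
  then show ?thesis
    unfolding curv1_law[OF I] curv1_law[OF I(2,1,3,4)] ddJ_sym[OF I] scaleR_add_right 1 2 3
    by (simp add: right_diff_distrib scaleR_diff_right sum_subtractf add_ac)
qed

lemma F1_eq:
  assumes I: "a \<in> I" "i \<in> I" "q \<in> I" "r \<in> I"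
  shows "F1 a i q r = (\<Sum>p\<in>I. dJ a i p * h r p q) +
    (\<Sum>t\<in>I. \<Sum>p\<in>I. sg (par t * (par i + par p)) *\<^sub>R (J a t * J i p * curv1 h dh t p q r))"
proof -
  have swap: "x * (J a t * y) = sg (m * (par a + par t)) *\<^sub>R (J a t * (x * y))"
    if "homog D m x" "t \<in> I" for x y t m
    using grassmann_supercommute[OF that(1) J[OF I(1) that(2)]] by (simp flip: mult.assoc)
  have 1: "(\<Sum>p\<in>I. sg (par a * (par i + par p)) *\<^sub>R (J i p * (\<Sum>t\<in>I. J a t * dh t r p q))) =
      (\<Sum>t\<in>I. \<Sum>p\<in>I. sg (par t * (par i + par p)) *\<^sub>R (J a t * J i p * dh t r p q))"
  proof -
    have "(\<Sum>p\<in>I. sg (par a * (par i + par p)) *\<^sub>R (J i p * (\<Sum>t\<in>I. J a t * dh t r p q))) =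
        (\<Sum>p\<in>I. \<Sum>t\<in>I. sg (par t * (par i + par p)) *\<^sub>R (J a t * J i p * dh t r p q))"
      unfolding sum_distrib_left scaleR_sum_right
    proof (intro sum.cong refl)
      fix p t assume "p \<in> I" "t \<in> I"
      show "sg (par a * (par i + par p)) *\<^sub>R (J i p * (J a t * dh t r p q)) =
          sg (par t * (par i + par p)) *\<^sub>R (J a t * J i p * dh t r p q)"
        unfolding swap[OF J[OF I(2) \<open>p \<in> I\<close>] \<open>t \<in> I\<close>] mult.assoc sg_scaleR
        by (intro arg_cong2[where f = scaleR] refl sg_cong) auto
    qed
    also have "\<dots> = (\<Sum>t\<in>I. \<Sum>p\<in>I. sg (par t * (par i + par p)) *\<^sub>R (J a t * J i p * dh t r p q))"
      by (rule sum.swap)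
    finally show ?thesis .
  qed
  have 2: "(\<Sum>s\<in>I. sg (par a * (par i + par q + par s)) *\<^sub>R (A i q s * A a s r)) =
      (\<Sum>t\<in>I. \<Sum>p\<in>I. sg (par t * (par i + par p)) *\<^sub>R
        (J a t * J i p * (\<Sum>s\<in>I. sg (par t * (par p + par q + par s)) *\<^sub>R (h s p q * h r t s))))"
  proof -
    let ?h = "\<lambda>s p t. sg (par t * (par i + par p)) *\<^sub>R
        (J a t * J i p * (sg (par t * (par p + par q + par s)) *\<^sub>R (h s p q * h r t s)))"
    have "(\<Sum>s\<in>I. sg (par a * (par i + par q + par s)) *\<^sub>R (A i q s * A a s r)) =
        (\<Sum>s\<in>I. \<Sum>p\<in>I. \<Sum>t\<in>I. ?h s p t)"
    proof (rule sum.cong[OF refl])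
      fix s assume s: "s \<in> I"
      have "sg (par a * (par i + par q + par s)) *\<^sub>R (J i p * h s p q * (J a t * h r t s)) = ?h s p t"
        if p: "p \<in> I" and t: "t \<in> I" for p t
      proof -
        have "homog D (par i + par q + par s) (J i p * h s p q)"
          by (rule homog_mult_cong[OF J h]) (use I s p in auto)
        note eq = swap[OF this t, of "h r t s"]
        have "sg (par a * (par i + par q + par s) + (par i + par q + par s) * (par a + par t)) =
            sg (par t * (par i + par p) + par t * (par p + par q + par s))"
          by (rule sg_cong) auto
        then show ?thesis
          by (simp only: eq mult_scaleR_right sg_scaleR) (simp only: mult.assoc)
      qed
      then show "sg (par a * (par i + par q + par s)) *\<^sub>R (A i q s * A a s r) = (\<Sum>p\<in>I. \<Sum>t\<in>I. ?h s p t)"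
        unfolding A[OF I(2,3) s] A[OF I(1) s I(4)] sum_product scaleR_sum_right by (intro sum.cong refl)
    qed
    also have "\<dots> = (\<Sum>s\<in>I. \<Sum>t\<in>I. \<Sum>p\<in>I. ?h s p t)" by (intro sum.cong[OF refl] sum.swap)
    also have "\<dots> = (\<Sum>t\<in>I. \<Sum>s\<in>I. \<Sum>p\<in>I. ?h s p t)" by (rule sum.swap)
    also have "\<dots> = (\<Sum>t\<in>I. \<Sum>p\<in>I. \<Sum>s\<in>I. ?h s p t)" by (intro sum.cong[OF refl] sum.swap)
    finally show ?thesis by (simp only: sum_distrib_left scaleR_sum_right)
  qed
  show ?thesis
    unfolding F1_def dA[OF I] sum.distrib 1 2 curv1_def distrib_left[where 'a = grassmann] scaleR_add_right by (simp only: add.assoc)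
qed

text \<open>By \<open>F1_eq\<close> the only part that is not tensorial contains
  \<open>dJ a i p\<close>, which is supersymmetric in \<open>a\<close> and \<open>i\<close> and
  cancels in the supercommutator.\<close>

lemma F1_diff:
  assumes I: "a \<in> I" "i \<in> I" "q \<in> I" "r \<in> I"
  shows "F1 a i q r - sg (par a * par i) *\<^sub>R F1 i a q r =
    (\<Sum>t\<in>I. \<Sum>p\<in>I. sg (par t * (par i + par p)) *\<^sub>R (J a t * J i p * curv h dh t p q r))"
proof -
  let ?e = "sg (par a * par i)"
  have 1: "?e *\<^sub>R (\<Sum>p\<in>I. dJ i a p * h r p q) = (\<Sum>p\<in>I. dJ a i p * h r p q)"
    using I by (simp add: dJ_sym[OF I(1,2)] scaleR_sum_right cong: sum.cong)
  have 2: "?e *\<^sub>R (\<Sum>t\<in>I. \<Sum>p\<in>I. sg (par t * (par a + par p)) *\<^sub>R (J i t * J a p * curv1 h dh t p q r)) =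
      (\<Sum>t\<in>I. \<Sum>p\<in>I. sg (par t * (par i + par p)) *\<^sub>R (J a t * J i p * (sg (par t * par p) *\<^sub>R curv1 h dh p t q r)))"
  proof -
    have "?e *\<^sub>R (\<Sum>t\<in>I. \<Sum>p\<in>I. sg (par t * (par a + par p)) *\<^sub>R (J i t * J a p * curv1 h dh t p q r)) =
        (\<Sum>t\<in>I. \<Sum>p\<in>I. sg (par p * (par i + par t)) *\<^sub>R (J a p * J i t * (sg (par p * par t) *\<^sub>R curv1 h dh t p q r)))"
      unfolding scaleR_sum_right
    proof (intro sum.cong refl)
      fix t p assume "t \<in> I" "p \<in> I"
      then have "J i t * J a p = sg ((par i + par t) * (par a + par p)) *\<^sub>R (J a p * J i t)"
        using I by (intro grassmann_supercommute[where D = D] J)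
      moreover have "sg (par a * par i + (par t * (par a + par p) + (par i + par t) * (par a + par p))) =
          sg (par p * (par i + par t) + par p * par t)"
        by (rule sg_cong) auto
      ultimately show "?e *\<^sub>R sg (par t * (par a + par p)) *\<^sub>R (J i t * J a p * curv1 h dh t p q r) =
          sg (par p * (par i + par t)) *\<^sub>R (J a p * J i t * (sg (par p * par t) *\<^sub>R curv1 h dh t p q r))"
        by (simp only: mult_scaleR_left mult_scaleR_right sg_scaleR)
    qed
    also have "\<dots> = (\<Sum>p\<in>I. \<Sum>t\<in>I. sg (par p * (par i + par t)) *\<^sub>R
        (J a p * J i t * (sg (par p * par t) *\<^sub>R curv1 h dh t p q r)))"
      by (rule sum.swap)
    finally show ?thesis .
  qed
  show ?thesis
    unfolding F1_eq[OF I] F1_eq[OF I(2,1,3,4)] scaleR_add_right 1 2 curv_def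
    by (simp add: right_diff_distrib scaleR_diff_right sum_subtractf)
qed

lemma curv_homog:
  assumes "t \<in> I" "p \<in> I" "q \<in> I" "r \<in> I"
  shows "homog D (par t + par p + par q + par r) (curv h dh t p q r)"
proof -
  have 1: "homog D (par t + par p + par q + par r) (curv1 h dh t p q r)"
    if "t \<in> I" "p \<in> I" "q \<in> I" "r \<in> I" for t p q r
    unfolding curv1_def
  proof (intro homog_add dh that homog_sum homog_scaleR)
    fix k assume "k \<in> I"
    then show "homog D (par t + par p + par q + par r) (h k p q * h r t k)"
      using that by (intro homog_mult_cong[OF h h]) auto
  qed
  have "homog D (par t + par p + par q + par r) (curv1 h dh p t q r)"
    using 1[OF assms(2,1,3,4)] by (simp add: add_ac)
  then show ?thesis unfolding curv_def by (intro homog_diff homog_scaleR 1 assms)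
qed

text \<open>\<open>curv_law\<close> and \<open>F1_diff\<close> express the old curvature as a
  conjugate by \<open>J\<close> and \<open>K\<close> of the matrix \<open>Y t r\<close> of parity
  \<open>i + j\<close>; \<open>str_conj\<close> then evaluates its supertrace.\<close>

theorem ric_law:
  assumes I: "i \<in> I" "j \<in> I"
  shows "ric g dg i j = (\<Sum>p\<in>I. \<Sum>q\<in>I. sg (par p * (par j + par q)) *\<^sub>R (J i p * J j q * ric h dh p q))"
proof -
  let ?w = "par i + par j"
  define Y where "Y t r = (\<Sum>p\<in>I. \<Sum>q\<in>I. sg (par t * (par i + par p + par j + par q) + par p * (par j + par q)) *\<^sub>R
      (J i p * J j q * curv h dh t p q r))" for t r
  have curv: "curv g dg a i j a = (\<Sum>t\<in>I. \<Sum>r\<in>I. J a t * Y t r * K r a)" if a: "a \<in> I" for a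
  proof -
    have "(\<Sum>l\<in>I. curv g dg a i j l * J l r) = (\<Sum>t\<in>I. J a t * Y t r)" if r: "r \<in> I" for r
    proof -
      let ?h = "\<lambda>q t p. J a t * (sg (par t * (par i + par p + par j + par q) + par p * (par j + par q)) *\<^sub>R
          (J i p * J j q * curv h dh t p q r))"
      have "(\<Sum>l\<in>I. curv g dg a i j l * J l r) = (\<Sum>q\<in>I. \<Sum>t\<in>I. \<Sum>p\<in>I. ?h q t p)"
        unfolding curv_law[OF a I r]
      proof (rule sum.cong[OF refl])
        fix q assume q: "q \<in> I"
        have "sg ((par i + par a) * (par j + par q)) *\<^sub>R
            (J j q * (sg (par t * (par i + par p)) *\<^sub>R (J a t * J i p * curv h dh t p q r))) = ?h q t p"
          if t: "t \<in> I" and p: "p \<in> I" for t p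
        proof -
          have "homog D (par a + par t + (par i + par p)) (J a t * J i p)"
            by (intro homog_mult J a t p I)
          note swap = grassmann_supercommute[OF J[OF I(2) q] this]
          have "J j q * (J a t * J i p * curv h dh t p q r) = J j q * (J a t * J i p) * curv h dh t p q r"
            by (simp only: mult.assoc)
          then have "J j q * (J a t * J i p * curv h dh t p q r) =
              sg ((par j + par q) * (par a + par t + (par i + par p))) *\<^sub>R (J a t * (J i p * (J j q * curv h dh t p q r)))"
            unfolding swap mult_scaleR_left by (simp only: mult.assoc)
          moreover have "sg ((par i + par a) * (par j + par q) + (par t * (par i + par p)
              + (par j + par q) * (par a + par t + (par i + par p)))) =
              sg (par t * (par i + par p + par j + par q) + par p * (par j + par q))"
            by (rule sg_cong) auto
          ultimately show ?thesis
            by (simp only: mult_scaleR_right sg_scaleR mult.assoc)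
        qed
        then show "sg ((par i + par a) * (par j + par q)) *\<^sub>R
            (J j q * (F1 a i q r - sg (par a * par i) *\<^sub>R F1 i a q r)) = (\<Sum>t\<in>I. \<Sum>p\<in>I. ?h q t p)"
          unfolding F1_diff[OF a I(1) q r] sum_distrib_left scaleR_sum_right by (intro sum.cong refl)
      qed
      also have "\<dots> = (\<Sum>t\<in>I. \<Sum>q\<in>I. \<Sum>p\<in>I. ?h q t p)" by (rule sum.swap)
      also have "\<dots> = (\<Sum>t\<in>I. \<Sum>p\<in>I. \<Sum>q\<in>I. ?h q t p)" by (intro sum.cong[OF refl] sum.swap)
      finally show ?thesis by (simp only: Y_def sum_distrib_left)
    qed
    then have "curv g dg a i j a = (\<Sum>r\<in>I. (\<Sum>t\<in>I. J a t * Y t r) * K r a)"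
      using recover[OF a, of "\<lambda>l. curv g dg a i j l"] by (simp cong: sum.cong)
    also have "\<dots> = (\<Sum>t\<in>I. \<Sum>r\<in>I. J a t * Y t r * K r a)"
      unfolding sum_distrib_right by (rule sum.swap)
    finally show ?thesis .
  qed
  have Y: "homog D (par t + par r + ?w) (Y t r)" if "t \<in> I" "r \<in> I" for t r
    unfolding Y_def
  proof (intro homog_sum homog_scaleR)
    fix p q assume "p \<in> I" "q \<in> I"
    then show "homog D (par t + par r + ?w) (J i p * J j q * curv h dh t p q r)"
      using that I by (intro homog_mult_cong[OF homog_mult[OF J J] curv_homog]) auto
  qed
  have "ric g dg i j = (\<Sum>a\<in>I. sg (par a * (1 + ?w)) *\<^sub>R (\<Sum>t\<in>I. \<Sum>r\<in>I. J a t * Y t r * K r a))"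
    unfolding ric_def add.assoc by (intro sum.cong refl) (simp only: curv)
  also have "\<dots> = (\<Sum>t\<in>I. sg (par t * (1 + ?w)) *\<^sub>R Y t t)"
    by (rule str_conj[OF J K KJ Y])
  also have "\<dots> = (\<Sum>t\<in>I. \<Sum>p\<in>I. \<Sum>q\<in>I. sg (par p * (par j + par q)) *\<^sub>R
      (J i p * J j q * (sg (par t * (1 + par p + par q)) *\<^sub>R curv h dh t p q t)))"
    unfolding Y_def scaleR_sum_right
  proof (intro sum.cong refl)
    fix t p q
    have "sg (par t * (1 + ?w) + (par t * (par i + par p + par j + par q) + par p * (par j + par q))) =
        sg (par p * (par j + par q) + par t * (1 + par p + par q))"
      by (rule sg_cong) auto
    then show "sg (par t * (1 + ?w)) *\<^sub>R
        sg (par t * (par i + par p + par j + par q) + par p * (par j + par q)) *\<^sub>R (J i p * J j q * curv h dh t p q t) =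
        sg (par p * (par j + par q)) *\<^sub>R (J i p * J j q * (sg (par t * (1 + par p + par q)) *\<^sub>R curv h dh t p q t))"
      by (simp only: mult_scaleR_right sg_scaleR)
  qed
  also have "\<dots> = (\<Sum>p\<in>I. \<Sum>t\<in>I. \<Sum>q\<in>I. sg (par p * (par j + par q)) *\<^sub>R
      (J i p * J j q * (sg (par t * (1 + par p + par q)) *\<^sub>R curv h dh t p q t)))"
    by (rule sum.swap)
  also have "\<dots> = (\<Sum>p\<in>I. \<Sum>q\<in>I. \<Sum>t\<in>I. sg (par p * (par j + par q)) *\<^sub>R
      (J i p * J j q * (sg (par t * (1 + par p + par q)) *\<^sub>R curv h dh t p q t)))"
    by (intro sum.cong[OF refl] sum.swap)
  finally show ?thesis
    by (simp only: ric_def sum_distrib_left scaleR_sum_right)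
qed

end

section \<open>Projective connections under a change of coordinates\<close>

lemma superfunction_subset: "superfunction E D U p f \<Longrightarrow> V \<subseteq> U \<Longrightarrow> superfunction E D V p f"
  unfolding superfunction_def smooth_def by (meson continuous_on_subset subsetD)

sublocale superdomain \<subseteq> tensor_indices D "E \<union> D"
  by unfold_locales (simp add: fin_E fin_D)

context tensor_indices
begin

lemma ric_cong:
  assumes "\<And>i j k. i \<in> I \<Longrightarrow> j \<in> I \<Longrightarrow> k \<in> I \<Longrightarrow> g k i j = g' k i j"
    and "\<And>a i j k. a \<in> I \<Longrightarrow> i \<in> I \<Longrightarrow> j \<in> I \<Longrightarrow> k \<in> I \<Longrightarrow> dg a k i j = dg' a k i j"
    and "i \<in> I" "j \<in> I"
  shows "ric g dg i j = ric g' dg' i j"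
  unfolding ric_def curv_def curv1_def using assms by (simp cong: sum.cong)

end

context superdomain
begin

lemma sderiv_coord:
  assumes "i \<in> E \<union> D" "j \<in> E \<union> D"
  shows "d i (coord D j) x = kron i j"
proof (cases "j \<in> D")
  case True
  then have c: "coord D j = (\<lambda>_. gvar j)" by (auto simp: coord_def)
  show ?thesis
  proof (cases "i \<in> D")
    case True
    then show ?thesis by (simp add: c sderiv_odd godd_deriv_gvar kron_def)
  next
    case False
    then show ?thesis using True
      by (intro grassmann_eqI) (auto simp: c sderiv_even gcoeff_even_deriv partial_const kron_def)
  qed
next
  case False
  have p: "partial i (\<lambda>x. x j) x = (if i = j then 1 else 0)"
    by (rule partial_eqI) (auto intro!: derivative_eq_intros)
  have c: "coord D j = (\<lambda>x. of_real (x j))" using False by (auto simp: coord_def)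
  show ?thesis unfolding c sderiv_of_real[OF assms(1)] using p False by (auto simp: kron_def)
qed

lemma sf_mult_kron: "sf p f \<Longrightarrow> (i = j \<Longrightarrow> even p = even q) \<Longrightarrow> sf q (\<lambda>x. f x * kron i j)"
  by (cases "i = j") (auto simp: kron_def intro: sf_parity sf_const[of _ 0])

lemma sderiv_mult_kron:
  "sf p f \<Longrightarrow> x \<in> U \<Longrightarrow> a \<in> E \<union> D \<Longrightarrow> d a (\<lambda>x. f x * kron i j) x = d a f x * kron i j"
  using sderiv_const_of_real[of a 0 x] by (cases "i = j") (auto simp: kron_def)

lemma sf_proj_change:
  assumes g: "sf (par i + par j + par k) (g k i j)" and f: "\<And>i. i \<in> E \<union> D \<Longrightarrow> sf (par i) (f i)"
    and ij: "i \<in> E \<union> D" "j \<in> E \<union> D"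
  shows "sf (par i + par j + par k) (\<lambda>x. proj_change (\<lambda>k i j. g k i j x) (\<lambda>i. f i x) k i j)"
  unfolding proj_change_def
  by (intro sf_add sf_scaleR g sf_mult_kron[OF f] ij) auto

lemma sderiv_proj_change:
  assumes g: "sf (par i + par j + par k) (g k i j)" and f: "\<And>i. i \<in> E \<union> D \<Longrightarrow> sf (par i) (f i)"
    and ij: "i \<in> E \<union> D" "j \<in> E \<union> D" and x: "x \<in> U" and a: "a \<in> E \<union> D"
  shows "d a (\<lambda>x. proj_change (\<lambda>k i j. g k i j x) (\<lambda>i. f i x) k i j) x =
    proj_change (\<lambda>k i j. d a (g k i j) x) (\<lambda>i. d a (f i) x) k i j"
proof -
  let ?p = "par i + par j + par k"
  have 1: "sf ?p (\<lambda>x. f i x * kron k j)" and 2: "sf ?p (\<lambda>x. f j x * kron k i)"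
    by (intro sf_mult_kron[OF f] ij; auto)+
  show ?thesis
    unfolding proj_change_def
    by (simp only: sderiv_add[OF sf_add[OF g 1] sf_scaleR[OF 2] x a] sderiv_add[OF g 1 x a]
        sderiv_scaleR[OF 2 x a] sderiv_mult_kron[OF f x a] ij)
qed

end

context supermap
begin

lemma pull_const: "x \<in> U \<Longrightarrow> pull (\<lambda>_. of_real r) x = of_real r"
proof -
  assume x: "x \<in> U"
  have "T k (\<lambda>_. r) x = 0" if pos: "k > 0" for k
  proof -
    obtain l where k: "k = Suc l" using pos by (metis gr0_conv_Suc)
    have "partial i (\<lambda>_. r) = (\<lambda>_. 0)" for i by (simp add: fun_eq_iff U.partial_const)
    moreover have "T l (\<lambda>_. 0) x = 0" using T_cmult[OF V.smooth_const[of 0] x, of l 0] by simp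
    ultimately show ?thesis by (simp add: k T_Suc'[OF x])
  qed
  then have "taylor (\<lambda>_. r) x = (\<Sum>k\<le>card D. if k = 0 then of_real r else 0)"
    unfolding taylor_def by (intro sum.cong refl) (auto simp: T_0)
  then have r: "taylor (\<lambda>_. r) x = of_real r" by simp
  have "pull (\<lambda>_. of_real r) x = (\<Sum>I\<in>Pow D. if I = {} then of_real r else 0)"
    unfolding subst_taylor by (intro sum.cong refl) (auto simp: r taylor_zero[OF x])
  then show ?thesis using U.fin_D by (simp add: sum.delta)
qed

lemma pull_mult_kron: "x \<in> U \<Longrightarrow> pull (\<lambda>x. f x * kron i j) x = pull f x * kron i j"
  by (cases "i = j") (simp_all add: kron_def pull_zero)

lemma pull_tr:
  assumes h: "\<And>s. s \<in> E \<union> D \<Longrightarrow> V.sf q (h s i s)" and x: "x \<in> U"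
  shows "pull (\<lambda>x. U.tr (\<lambda>k i j. h k i j x) i) x = U.tr (\<lambda>k i j. pull (h k i j) x) i"
  unfolding U.tr_def
  by (subst pull_sum[OF V.sf_scaleR[OF h] x]) (auto intro!: sum.cong pull_scaleR[OF h] x)

lemma pull_proj_change:
  assumes g: "V.sf (U.par i + U.par j + U.par k) (g k i j)" and f: "\<And>i. i \<in> E \<union> D \<Longrightarrow> V.sf (U.par i) (f i)"
    and ij: "i \<in> E \<union> D" "j \<in> E \<union> D" and x: "x \<in> U"
  shows "pull (\<lambda>x. U.proj_change (\<lambda>k i j. g k i j x) (\<lambda>i. f i x) k i j) x =
    U.proj_change (\<lambda>k i j. pull (g k i j) x) (\<lambda>i. pull (f i) x) k i j"
proof -
  let ?p = "U.par i + U.par j + U.par k"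
  have 1: "V.sf ?p (\<lambda>x. f i x * kron k j)" and 2: "V.sf ?p (\<lambda>x. f j x * kron k i)"
    by (intro V.sf_mult_kron[OF f] ij; auto)+
  show ?thesis
    unfolding U.proj_change_def
    by (simp only: pull_add[OF V.sf_add[OF g 1] V.sf_scaleR[OF 2] x] pull_add[OF g 1 x]
        pull_scaleR[OF 2 x] pull_mult_kron[OF x])
qed

end

section \<open>Coordinate transitions, their Jacobi matrices and the covector of log J\<close>

locale super_transition = supermap +
  fixes \<psi> :: "nat \<Rightarrow> superfun"
  assumes sf_psi: "i \<in> E \<union> D \<Longrightarrow> superfunction E D V (parity D i) (\<psi> i)"
    and inverse: "x \<in> U \<Longrightarrow> i \<in> E \<union> D \<Longrightarrow> subst E D \<phi> (\<psi> i) x = coord D i x"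
begin

abbreviation I :: "nat set" where "I \<equiv> E \<union> D"
abbreviation par :: "nat \<Rightarrow> nat" where "par \<equiv> parity D"
definition J :: "nat \<Rightarrow> nat \<Rightarrow> superfun" where "J i p = U.d i (\<phi> p)"
definition K :: "nat \<Rightarrow> nat \<Rightarrow> superfun" where "K p i = pull (V.d p (\<psi> i))"

text \<open>The chain rule for the old coordinates, pulled back from functions of the new ones,
  gives \<open>J K = 1\<close>; the other order follows algebraically in \<open>KJ\<close>.\<close>

sublocale jac: jacobian E U D J K
proof
  fix i j assume ij: "i \<in> I" "j \<in> I"
  show "U.sf (par i + par j) (J i j)"
    unfolding J_def by (rule U.sf_sderiv[OF sf_phi]) (use ij in auto)
  show "U.sf (par i + par j) (K i j)"
    unfolding K_def by (rule sf_pull, rule V.sf_sderiv[OF sf_psi]) (use ij in auto)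
  fix x assume x: "x \<in> U"
  have "U.d i (pull (\<psi> j)) x = U.d i (coord D j) x"
    by (rule U.sderiv_cong) (use inverse ij x in auto)
  then show "(\<Sum>l\<in>I. J i l x * K l j x) = (if i = j then 1 else 0)"
    unfolding chain_rule[OF sf_psi[OF ij(2)] x ij(1)] U.sderiv_coord[OF ij] J_def K_def kron_def .
qed

abbreviation dJ :: "nat \<Rightarrow> nat \<Rightarrow> nat \<Rightarrow> superfun" where "dJ i j r \<equiv> U.d i (J j r)"

lemma tensor_change_at:
  assumes x: "x \<in> U"
  shows "tensor_change D I (\<lambda>i j. J i j x) (\<lambda>i j. K i j x)"
  by unfold_locales (use jac.JK[OF x] jac.KJ[OF x] U.sf_homog[OF jac.sf_J x] U.sf_homog[OF jac.sf_K x]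
    in \<open>auto simp: kron_def\<close>)

lemma sf_dJ: "i \<in> I \<Longrightarrow> j \<in> I \<Longrightarrow> r \<in> I \<Longrightarrow> U.sf (par i + (par j + par r)) (dJ i j r)"
  by (intro U.sf_sderiv jac.sf_J)

lemma dJ_sym:
  assumes "x \<in> U" "a \<in> I" "i \<in> I" "p \<in> I"
  shows "dJ a i p x = sg (par a * par i) *\<^sub>R dJ i a p x"
  unfolding J_def by (rule U.sderiv_commute[OF sf_phi]) (use assms in auto)

lemma ddJ_sym:
  assumes "x \<in> U" "a \<in> I" "i \<in> I" "j \<in> I" "r \<in> I"
  shows "U.d a (dJ i j r) x = sg (par a * par i) *\<^sub>R U.d i (dJ a j r) x"
  by (rule U.sderiv_commute[OF jac.sf_J]) (use assms in auto)

definition lam :: "nat \<Rightarrow> superfun" where "lam i = U.d i jac.L"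

lemma sf_lam: "i \<in> I \<Longrightarrow> U.sf (par i) (lam i)"
  unfolding lam_def using U.sf_sderiv[OF jac.sf_L] by simp

lemma dlam_sym:
  assumes "x \<in> U" "a \<in> I" "i \<in> I"
  shows "U.d a (lam i) x = sg (par a * par i) *\<^sub>R U.d i (lam a) x"
  unfolding lam_def by (rule U.sderiv_commute[OF jac.sf_L]) (use assms in auto)

end

text \<open>The projective coefficients are written as a projective change of \<open>g\<close> by
  \<open>- tr g / (sdim' + 1)\<close>, the covector that makes them traceless by
  \<open>tr_proj_change\<close>.\<close>

locale projective_chart = superdomain +
  fixes g P :: "nat \<Rightarrow> nat \<Rightarrow> nat \<Rightarrow> superfun"
  assumes N: "sdim' \<noteq> -1"
    and sf_g: "i \<in> E \<union> D \<Longrightarrow> j \<in> E \<union> D \<Longrightarrow> k \<in> E \<union> D \<Longrightarrow> sf (par i + par j + par k) (g k i j)"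
    and sym_g: "x \<in> U \<Longrightarrow> i \<in> E \<union> D \<Longrightarrow> j \<in> E \<union> D \<Longrightarrow> k \<in> E \<union> D \<Longrightarrow>
      g k i j x = sg (par i * par j) *\<^sub>R g k j i x"
    and P: "x \<in> U \<Longrightarrow> i \<in> E \<union> D \<Longrightarrow> j \<in> E \<union> D \<Longrightarrow> k \<in> E \<union> D \<Longrightarrow>
      P k i j x = proj_change (\<lambda>k i j. g k i j x)
        (\<lambda>i. - (1 / (sdim' + 1)) *\<^sub>R tr (\<lambda>k i j. g k i j x) i) k i j"
begin

abbreviation f :: "nat \<Rightarrow> superfun" where
  "f i \<equiv> \<lambda>x. - (1 / (sdim' + 1)) *\<^sub>R tr (\<lambda>k i j. g k i j x) i"

lemma sf_tr: 
  assumes "i \<in> E \<union> D"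
  shows "sf (par i) (\<lambda>x. tr (\<lambda>k i j. g k i j x) i)"
  unfolding tr_def
proof (intro sf_sum sf_scaleR)
  fix s assume "s \<in> E \<union> D"
  from sf_g[OF assms this this] show "sf (par i) (g s i s)" by (rule sf_parity[rotated]) auto
qed

lemma sf_f: "i \<in> E \<union> D \<Longrightarrow> sf (par i) (f i)"
  by (intro sf_scaleR sf_tr)

lemma sf_P:
  assumes "i \<in> E \<union> D" "j \<in> E \<union> D" "k \<in> E \<union> D"
  shows "sf (par i + par j + par k) (P k i j)"
proof -
  have "sf (par i + par j + par k) (\<lambda>x. proj_change (\<lambda>k i j. g k i j x) (\<lambda>i. f i x) k i j)"
    by (intro sf_proj_change sf_g sf_f assms)
  then show ?thesis by (rule sf_cong[THEN iffD1, rotated]) (rule P[symmetric, OF _ assms])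
qed

lemma tr_P:
  assumes "x \<in> U" "i \<in> E \<union> D"
  shows "tr (\<lambda>k i j. P k i j x) i = 0"
proof -
  have "tr (\<lambda>k i j. P k i j x) i = tr (proj_change (\<lambda>k i j. g k i j x) (\<lambda>i. f i x)) i"
    unfolding tr_def[of "\<lambda>k i j. P k i j x"] tr_def[of "proj_change _ _"] using assms
    by (intro sum.cong refl) (simp add: P)
  also have "\<dots> = 0" unfolding tr_proj_change[OF assms(2)] using N by simp
  finally show ?thesis .
qed

lemma tr_dP:
  assumes "x \<in> U" "i \<in> E \<union> D" "a \<in> E \<union> D"
  shows "tr (\<lambda>k i j. d a (P k i j) x) i = 0"
proof -
  have s: "sf (par s + par i + par s) (\<lambda>x. sg (par s) *\<^sub>R P s i s x)" if "s \<in> E \<union> D" for s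
    by (intro sf_scaleR sf_parity[OF _ sf_P]) (use that assms in auto)
  have "tr (\<lambda>k i j. d a (P k i j) x) i = (\<Sum>s\<in>E \<union> D. d a (\<lambda>x. sg (par s) *\<^sub>R P s i s x) x)"
    unfolding tr_def by (intro sum.cong refl) (use assms in \<open>auto simp: sderiv_scaleR[OF sf_P]\<close>)
  also have "\<dots> = d a (\<lambda>x. tr (\<lambda>k i j. P k i j x) i) x"
    unfolding tr_def by (rule sderiv_sum[symmetric, OF s]) (use assms in auto)
  also have "\<dots> = d a (\<lambda>_. of_real 0) x"
    by (rule sderiv_cong) (use assms in \<open>auto simp: tr_P\<close>)
  finally show ?thesis by (simp only: sderiv_const_of_real)
qed

lemma sym_P:
  assumes x: "x \<in> U" and ij: "i \<in> E \<union> D" "j \<in> E \<union> D" "k \<in> E \<union> D"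
  shows "P k i j x = sg (par i * par j) *\<^sub>R P k j i x"
proof -
  have "conn (\<lambda>k i j. g k i j x) (\<lambda>_ _ _ _. 0)"
    unfolding conn_def by (intro ballI conjI sf_homog[OF sf_g x] sym_g[OF x]) auto
  then have "conn (proj_change (\<lambda>k i j. g k i j x) (\<lambda>i. f i x)) (\<lambda>_. proj_change (\<lambda>_ _ _. 0) (\<lambda>_. 0))"
    by (rule conn_proj_change) (use sf_homog[OF sf_f x] in auto)
  then show ?thesis
    unfolding P[OF x ij] P[OF x ij(2,1,3)] by (rule conn_sym[OF _ ij])
qed

lemma conn_P:
  assumes x: "x \<in> U"
  shows "conn (\<lambda>k i j. P k i j x) (\<lambda>a k i j. d a (P k i j) x)"
  unfolding conn_def
proof (intro ballI conjI)
  fix i j k assume ij: "i \<in> E \<union> D" "j \<in> E \<union> D" "k \<in> E \<union> D"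
  show "homog D (par i + par j + par k) (P k i j x)" by (rule sf_homog[OF sf_P[OF ij] x])
  show "P k i j x = sg (par i * par j) *\<^sub>R P k j i x" by (rule sym_P[OF x ij])
  fix a assume a: "a \<in> E \<union> D"
  have "sf (par a + (par i + par j + par k)) (d a (P k i j))" by (rule sf_sderiv[OF sf_P[OF ij] a])
  from sf_homog[OF this x] show "homog D (par a + par i + par j + par k) (d a (P k i j) x)"
    by (simp add: add.assoc)
  have "d a (P k i j) x = d a (\<lambda>x. sg (par i * par j) *\<^sub>R P k j i x) x"
    by (rule sderiv_cong[OF _ x a]) (rule sym_P[OF _ ij])
  then show "d a (P k i j) x = sg (par i * par j) *\<^sub>R d a (P k j i) x"
    using sderiv_scaleR[OF sf_P[OF ij(2,1,3)] x a] by simp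
qed

definition R :: "nat \<Rightarrow> nat \<Rightarrow> superfun" where
  "R i j x = ric0 (\<lambda>k i j. P k i j x) (\<lambda>a k i j. d a (P k i j) x) i j"

lemma sf_R_terms:
  assumes "q \<in> E \<union> D" "i \<in> E \<union> D" "j \<in> E \<union> D"
  shows "sf (par i + par j) (d q (P q i j))"
    "p \<in> E \<union> D \<Longrightarrow> sf (par i + par j) (\<lambda>x. P p q i x * P q p j x)"
proof -
  show "sf (par i + par j) (d q (P q i j))"
    by (rule sf_parity[OF _ sf_sderiv[OF sf_P]]) (use assms in auto)
  assume "p \<in> E \<union> D"
  then show "sf (par i + par j) (\<lambda>x. P p q i x * P q p j x)"
    by (intro sf_parity[OF _ sf_mult[OF sf_P sf_P]] assms) auto
qed

lemma sf_R: "i \<in> E \<union> D \<Longrightarrow> j \<in> E \<union> D \<Longrightarrow> sf (par i + par j) (R i j)"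
  unfolding R_def ric0_def by (intro sf_sum sf_scaleR sf_diff sf_R_terms)

end

locale projective_transition = super_transition E U V D \<phi> \<psi> +
  A: projective_chart E U D g P + B: projective_chart E V D h Q for E U V D \<phi> \<psi> g P h Q +
  assumes N1: "U.sdim' \<noteq> 1"
    and law: "x \<in> U \<Longrightarrow> i \<in> E \<union> D \<Longrightarrow> j \<in> E \<union> D \<Longrightarrow> r \<in> E \<union> D \<Longrightarrow>
      (\<Sum>k\<in>E \<union> D. g k i j x * U.d k (\<phi> r) x) = U.d i (U.d j (\<phi> r)) x +
      (\<Sum>p\<in>E \<union> D. \<Sum>q\<in>E \<union> D. sg (parity D p * (parity D j + parity D q)) *\<^sub>R
        (U.d i (\<phi> p) x * U.d j (\<phi> q) x * subst E D \<phi> (h r p q) x))"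
begin

abbreviation N :: real where "N \<equiv> U.sdim'"
definition c :: real where "c = 1 / (N + 1)"

lemma c_N: "(N + 1) * c = 1" "c * (N + 1) = 1" using A.N c_def by auto

lemma pull_B_tr:
  assumes "x \<in> U" "p \<in> I"
  shows "pull (\<lambda>x. U.tr (\<lambda>k i j. h k i j x) p) x = U.tr (\<lambda>k i j. pull (h k i j) x) p"
  by (rule pull_tr[where q = "par p"]) (use assms in \<open>auto intro!: V.sf_parity[OF _ B.sf_g]\<close>)

lemma pull_B_tr_zero:
  assumes x: "x \<in> U" and p: "p \<in> I"
  shows "U.tr (\<lambda>k i j. pull (Q k i j) x) p = 0"
    "a \<in> I \<Longrightarrow> U.tr (\<lambda>k i j. pull (V.d a (Q k i j)) x) p = 0"
proof -
  have "U.tr (\<lambda>k i j. pull (Q k i j) x) p = pull (\<lambda>x. U.tr (\<lambda>k i j. Q k i j x) p) x"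
    by (rule pull_tr[where q = "par p", symmetric]) (use p x in \<open>auto intro!: V.sf_parity[OF _ B.sf_P]\<close>)
  also have "\<dots> = pull (\<lambda>_. 0) x" by (rule pull_cong[OF _ x]) (rule B.tr_P[OF _ p])
  finally show "U.tr (\<lambda>k i j. pull (Q k i j) x) p = 0" by (simp only: pull_zero[OF x])
  assume a: "a \<in> I"
  have "U.tr (\<lambda>k i j. pull (V.d a (Q k i j)) x) p = pull (\<lambda>x. U.tr (\<lambda>k i j. V.d a (Q k i j) x) p) x"
    by (rule pull_tr[where q = "par a + par p" and h = "\<lambda>k i j. V.d a (Q k i j)", symmetric])
      (use p a x in \<open>auto intro!: V.sf_parity[OF _ V.sf_sderiv[OF B.sf_P]]\<close>)
  also have "\<dots> = pull (\<lambda>_. 0) x" by (rule pull_cong[OF _ x]) (rule B.tr_dP[OF _ p a])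
  finally show "U.tr (\<lambda>k i j. pull (V.d a (Q k i j)) x) p = 0" by (simp only: pull_zero[OF x])
qed

text \<open>The inhomogeneous term of \<open>trace_law\<close> is the supertrace of
  \<open>dJ K\<close>, which \<open>sderiv_L\<close> identifies with the derivative of
  \<open>log J\<close>.\<close>

lemma tr_transform:
  assumes x: "x \<in> U" and i: "i \<in> I"
  shows "U.tr (\<lambda>k i j. g k i j x) i = lam i x + (\<Sum>p\<in>I. J i p x * U.tr (\<lambda>k i j. pull (h k i j) x) p)"
proof -
  interpret tc: tensor_change D I "\<lambda>i j. J i j x" "\<lambda>i j. K i j x" "\<lambda>i j r. dJ i j r x"
    by (rule tensor_change_at[OF x])
  have "tc.conn_law (\<lambda>k i j. g k i j x) (\<lambda>k i j. pull (h k i j) x)"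
    unfolding tc.conn_law_def using law[OF x] by (simp add: J_def)
  from tc.trace_law[OF this i] show ?thesis
    using U.sf_homog[OF sf_pull[OF B.sf_g] x] unfolding lam_def jac.sderiv_L[OF x i] by simp
qed

definition G :: "nat \<Rightarrow> nat \<Rightarrow> nat \<Rightarrow> superfun" where
  "G k i j = (\<lambda>x. U.proj_change (\<lambda>k i j. P k i j x) (\<lambda>i. c *\<^sub>R lam i x) k i j)"

lemma pull_Q:
  assumes x: "x \<in> U" and ij: "i \<in> I" "j \<in> I" "k \<in> I"
  shows "pull (Q k i j) x =
    U.proj_change (\<lambda>k i j. pull (h k i j) x) (\<lambda>i. - c *\<^sub>R U.tr (\<lambda>k i j. pull (h k i j) x) i) k i j"
proof -
  have "pull (Q k i j) x = pull (\<lambda>x. U.proj_change (\<lambda>k i j. h k i j x) (\<lambda>i. B.f i x) k i j) x"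
    by (rule pull_cong[OF _ x]) (rule B.P[OF _ ij])
  also have "\<dots> = U.proj_change (\<lambda>k i j. pull (h k i j) x) (\<lambda>i. pull (B.f i) x) k i j"
    by (rule pull_proj_change[of i j k h B.f]) (rule B.sf_g B.sf_f ij x | assumption)+
  finally show ?thesis
    unfolding U.proj_change_def
    by (simp only: pull_scaleR[OF B.sf_tr x] pull_B_tr[OF x] ij c_def)
qed

lemma sf_G: "i \<in> I \<Longrightarrow> j \<in> I \<Longrightarrow> k \<in> I \<Longrightarrow> U.sf (par i + par j + par k) (G k i j)"
  unfolding G_def by (intro U.sf_proj_change A.sf_P U.sf_scaleR sf_lam)

lemma G_law:
  assumes x: "x \<in> U" and ij: "i \<in> I" "j \<in> I" "r \<in> I"
  shows "(\<Sum>k\<in>I. G k i j x * J k r x) = dJ i j r x +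
    (\<Sum>p\<in>I. \<Sum>q\<in>I. sg (par p * (par j + par q)) *\<^sub>R (J i p x * J j q x * pull (Q r p q) x))"
proof -
  interpret tc: tensor_change D I "\<lambda>i j. J i j x" "\<lambda>i j. K i j x" "\<lambda>i j r. dJ i j r x"
    by (rule tensor_change_at[OF x])
  let ?g = "\<lambda>k i j. g k i j x" and ?h = "\<lambda>k i j. pull (h k i j) x"
  let ?f = "\<lambda>i. \<Sum>p\<in>I. J i p x * (- c *\<^sub>R U.tr ?h p)" and ?f' = "\<lambda>p. - c *\<^sub>R U.tr ?h p"
  have law: "tc.conn_law ?g ?h"
    unfolding tc.conn_law_def using law[OF x] by (simp add: J_def)
  have "homog D (par p) (?f' p)" if "p \<in> I" for p
    using U.sf_homog[OF sf_pull[OF B.sf_tr[OF that]] x] unfolding pull_B_tr[OF x that] by (rule homog_scaleR)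
  then have *: "tc.conn_law (U.proj_change ?g ?f) (U.proj_change ?h ?f')"
    by (rule tc.conn_law_proj_change[OF law]) auto
  \<comment> \<open>By \<open>tr_transform\<close>, transporting the normalising covector of the new
    chart gives that of the old chart plus \<open>c lam\<close>; hence \<open>G\<close>, not
    \<open>P\<close>, obeys the law of a connection.\<close>
  have f: "?f i = c *\<^sub>R lam i x - c *\<^sub>R U.tr ?g i" if "i \<in> I" for i
    unfolding tr_transform[OF x that] by (simp add: scaleR_sum_right scaleR_add_right sum_negf)
  have G: "G k i j x = U.proj_change ?g ?f k i j" if "k \<in> I" for k
    unfolding G_def U.proj_change_def[of "\<lambda>k i j. P k i j x"] A.P[OF x ij(1,2) that]
    unfolding U.proj_change_def f[OF ij(1)] f[OF ij(2)]
    by (simp add: algebra_simps c_def scaleR_diff_right)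
  have Q: "pull (Q r p q) x = U.proj_change ?h ?f' r p q" if "p \<in> I" "q \<in> I" for p q
    by (rule pull_Q[OF x that ij(3)])
  show ?thesis
    using *[unfolded tc.conn_law_def, rule_format, OF ij] by (simp only: G Q cong: sum.cong)
qed

text \<open>The coefficients of the pulled back connection along an old coordinate field in the new
  frame, the \<open>A\<close> of \<open>tensor_change2\<close>.\<close>

definition H :: "nat \<Rightarrow> nat \<Rightarrow> nat \<Rightarrow> superfun" where
  "H i q r = (\<lambda>x. \<Sum>p\<in>I. J i p x * pull (Q r p q) x)"

lemma sf_H: "i \<in> I \<Longrightarrow> q \<in> I \<Longrightarrow> r \<in> I \<Longrightarrow> U.sf (par i + par q + par r) (H i q r)"
  unfolding H_def
  by (intro U.sf_sum U.sf_parity[OF _ U.sf_mult[OF jac.sf_J sf_pull[OF B.sf_P]]]) auto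

lemma G_law':
  assumes x: "x \<in> U" and ij: "i \<in> I" "j \<in> I" "r \<in> I"
  shows "(\<Sum>k\<in>I. G k i j x * J k r x) = dJ i j r x +
    (\<Sum>q\<in>I. sg (par i * (par j + par q)) *\<^sub>R (J j q x * H i q r x))"
proof -
  have "sg (par p * (par j + par q)) *\<^sub>R (J i p x * J j q x * pull (Q r p q) x) =
      sg (par i * (par j + par q)) *\<^sub>R (J j q x * (J i p x * pull (Q r p q) x))"
    if p: "p \<in> I" "q \<in> I" for p q
  proof -
    have "J i p x * J j q x = sg ((par i + par p) * (par j + par q)) *\<^sub>R (J j q x * J i p x)"
      by (intro grassmann_supercommute[where D = D] U.sf_homog[OF jac.sf_J x] ij p)
    moreover have "sg (par p * (par j + par q) + (par i + par p) * (par j + par q)) = sg (par i * (par j + par q))"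
      by (rule sg_cong) auto
    ultimately show ?thesis
      by (simp only: mult_scaleR_left sg_scaleR) (simp only: mult.assoc)
  qed
  then have "(\<Sum>p\<in>I. \<Sum>q\<in>I. sg (par p * (par j + par q)) *\<^sub>R (J i p x * J j q x * pull (Q r p q) x)) =
      (\<Sum>p\<in>I. \<Sum>q\<in>I. sg (par i * (par j + par q)) *\<^sub>R (J j q x * (J i p x * pull (Q r p q) x)))"
    by (intro sum.cong refl)
  also have "\<dots> = (\<Sum>q\<in>I. \<Sum>p\<in>I. sg (par i * (par j + par q)) *\<^sub>R (J j q x * (J i p x * pull (Q r p q) x)))"
    by (rule sum.swap)
  finally show ?thesis
    unfolding G_law[OF x ij] H_def by (simp only: sum_distrib_left scaleR_sum_right)
qed

lemma dH:
  assumes x: "x \<in> U" and a: "a \<in> I" and ij: "i \<in> I" "q \<in> I" "r \<in> I"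
  shows "U.d a (H i q r) x = (\<Sum>p\<in>I. dJ a i p x * pull (Q r p q) x +
    sg (par a * (par i + par p)) *\<^sub>R (J i p x * (\<Sum>t\<in>I. J a t x * pull (V.d t (Q r p q)) x)))"
proof -
  have "U.d a (H i q r) x = (\<Sum>p\<in>I. U.d a (\<lambda>x. J i p x * pull (Q r p q) x) x)"
    unfolding H_def by (rule U.sderiv_sum[OF U.sf_mult[OF jac.sf_J sf_pull[OF B.sf_P]] x a]) (use ij in auto)
  also have "\<dots> = (\<Sum>p\<in>I. dJ a i p x * pull (Q r p q) x +
    sg (par a * (par i + par p)) *\<^sub>R (J i p x * (\<Sum>t\<in>I. J a t x * pull (V.d t (Q r p q)) x)))"
  proof (rule sum.cong[OF refl])
    fix p assume p: "p \<in> I"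
    note Q = B.sf_P[OF p ij(2,3)]
    have "U.d a (pull (Q r p q)) x = (\<Sum>t\<in>I. J a t x * pull (V.d t (Q r p q)) x)"
      unfolding chain_rule[OF Q x a] J_def ..
    then show "U.d a (\<lambda>x. J i p x * pull (Q r p q) x) x = dJ a i p x * pull (Q r p q) x +
        sg (par a * (par i + par p)) *\<^sub>R (J i p x * (\<Sum>t\<in>I. J a t x * pull (V.d t (Q r p q)) x))"
      using U.sderiv_mult[OF jac.sf_J[OF ij(1) p] sf_pull[OF Q] x a] by simp
  qed
  finally show ?thesis .
qed

text \<open>\<open>G_law'\<close> holds throughout \<open>U\<close>, so both sides may be
  differentiated by the Leibniz rule.\<close>

lemma dG_law:
  assumes x: "x \<in> U" and a: "a \<in> I" and ij: "i \<in> I" "j \<in> I" "r \<in> I"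
  shows "(\<Sum>k\<in>I. U.d a (G k i j) x * J k r x + sg (par a * (par i + par j + par k)) *\<^sub>R (G k i j x * dJ a k r x)) =
    U.d a (dJ i j r) x + (\<Sum>q\<in>I. sg (par i * (par j + par q)) *\<^sub>R
      (dJ a j q x * H i q r x + sg (par a * (par j + par q)) *\<^sub>R (J j q x * U.d a (H i q r) x)))"
proof -
  have JH: "U.sf (par i + par j + par r) (\<lambda>x. J j q x * H i q r x)" if "q \<in> I" for q
    by (rule U.sf_parity[OF _ U.sf_mult[OF jac.sf_J sf_H]]) (use that ij in auto)
  have dJ': "U.sf (par i + par j + par r) (dJ i j r)"
    using sf_dJ[OF ij] by (simp add: add.assoc)
  have "(\<Sum>k\<in>I. U.d a (G k i j) x * J k r x + sg (par a * (par i + par j + par k)) *\<^sub>R (G k i j x * dJ a k r x)) =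
      U.d a (\<lambda>x. \<Sum>k\<in>I. G k i j x * J k r x) x"
    by (subst U.sderiv_sum[OF U.sf_mult[OF sf_G jac.sf_J] x a])
      (use ij in \<open>auto intro!: sum.cong simp: U.sderiv_mult[OF sf_G jac.sf_J x a]\<close>)
  also have "\<dots> = U.d a (\<lambda>x. dJ i j r x + (\<Sum>q\<in>I. sg (par i * (par j + par q)) *\<^sub>R (J j q x * H i q r x))) x"
  proof (rule U.sderiv_cong)
    fix y assume "y \<in> U"
    from G_law'[OF this ij] show "(\<Sum>k\<in>I. G k i j y * J k r y) =
        dJ i j r y + (\<Sum>q\<in>I. sg (par i * (par j + par q)) *\<^sub>R (J j q y * H i q r y))" .
  qed (fact x a)+
  also have "\<dots> = U.d a (dJ i j r) x + U.d a (\<lambda>x. \<Sum>q\<in>I. sg (par i * (par j + par q)) *\<^sub>R (J j q x * H i q r x)) x"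
    by (rule U.sderiv_add[OF dJ' U.sf_sum[OF U.sf_scaleR[OF JH]] x a])
  also have "U.d a (\<lambda>x. \<Sum>q\<in>I. sg (par i * (par j + par q)) *\<^sub>R (J j q x * H i q r x)) x =
      (\<Sum>q\<in>I. U.d a (\<lambda>x. sg (par i * (par j + par q)) *\<^sub>R (J j q x * H i q r x)) x)"
    by (rule U.sderiv_sum[OF U.sf_scaleR[OF JH] x a])
  also have "\<dots> = (\<Sum>q\<in>I. sg (par i * (par j + par q)) *\<^sub>R
      (dJ a j q x * H i q r x + sg (par a * (par j + par q)) *\<^sub>R (J j q x * U.d a (H i q r) x)))"
  proof (rule sum.cong[OF refl])
    fix q assume q: "q \<in> I"
    show "U.d a (\<lambda>x. sg (par i * (par j + par q)) *\<^sub>R (J j q x * H i q r x)) x =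
        sg (par i * (par j + par q)) *\<^sub>R
          (dJ a j q x * H i q r x + sg (par a * (par j + par q)) *\<^sub>R (J j q x * U.d a (H i q r) x))"
      unfolding U.sderiv_scaleR[OF JH[OF q] x a]
        U.sderiv_mult[OF jac.sf_J[OF ij(2) q] sf_H[OF ij(1) q ij(3)] x a] ..
  qed
  finally show ?thesis .
qed

lemma dG_eq:
  assumes "x \<in> U" "a \<in> I" "i \<in> I" "j \<in> I" "k \<in> I"
  shows "U.d a (G k i j) x =
    U.proj_change (\<lambda>k i j. U.d a (P k i j) x) (\<lambda>i. c *\<^sub>R U.d a (lam i) x) k i j"
proof -
  have "U.d a (G k i j) x = U.proj_change (\<lambda>k i j. U.d a (P k i j) x) (\<lambda>i. U.d a (\<lambda>x. c *\<^sub>R lam i x) x) k i j"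
    unfolding G_def by (rule U.sderiv_proj_change[of i j k P "\<lambda>i x. c *\<^sub>R lam i x"])
      (rule A.sf_P U.sf_scaleR sf_lam assms | assumption)+
  then show ?thesis
    unfolding U.proj_change_def by (simp only: U.sderiv_scaleR[OF sf_lam assms(1,2)] assms)
qed

lemma tensor_change2_at:
  assumes x: "x \<in> U"
  shows "tensor_change2 D I (\<lambda>i j. J i j x) (\<lambda>i j. K i j x) (\<lambda>i j r. dJ i j r x)
    (\<lambda>k i j. G k i j x) (\<lambda>k i j. pull (Q k i j) x) (\<lambda>i q r. H i q r x)
    (\<lambda>a k i j. U.d a (G k i j) x) (\<lambda>a k i j. pull (V.d a (Q k i j)) x)
    (\<lambda>a i q r. U.d a (H i q r) x) (\<lambda>a i j r. U.d a (dJ i j r) x)"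
proof -
  interpret tc: tensor_change D I "\<lambda>i j. J i j x" "\<lambda>i j. K i j x" "\<lambda>i j r. dJ i j r x"
    by (rule tensor_change_at[OF x])
  have dQ: "V.sf (par a + par i + par j + par k) (V.d a (Q k i j))"
    if "a \<in> I" "i \<in> I" "j \<in> I" "k \<in> I" for a i j k
    using V.sf_sderiv[OF B.sf_P[OF that(2,3,4)] that(1)] by (simp add: add.assoc)
  show ?thesis
    by unfold_locales (fact U.sf_homog[OF sf_pull[OF B.sf_P] x] U.sf_homog[OF sf_pull[OF dQ] x] |
        (rule H_def[THEN fun_cong] dH[OF x] G_law'[OF x] dG_law[OF x] dJ_sym[OF x] ddJ_sym[OF x]; assumption))+
qed

lemma connection_law:
  assumes x: "x \<in> U" and ij: "i \<in> I" "j \<in> I" "r \<in> I"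
  shows "(\<Sum>k\<in>I. P k i j x * J k r x) = dJ i j r x +
    (\<Sum>p\<in>I. \<Sum>q\<in>I. sg (par p * (par j + par q)) *\<^sub>R (J i p x * J j q x * pull (Q r p q) x)) -
    c *\<^sub>R (lam i x * J j r x + sg (par i * par j) *\<^sub>R (lam j x * J i r x))"
proof -
  have G: "G k i j x * J k r x = P k i j x * J k r x + c *\<^sub>R (lam i x * (kron k j * J k r x)) +
      sg (par i * par j) *\<^sub>R (c *\<^sub>R (lam j x * (kron k i * J k r x)))" for k
    unfolding G_def U.proj_change_def by (simp add: distrib_right mult.assoc)
  have "(\<Sum>k\<in>I. G k i j x * J k r x) = (\<Sum>k\<in>I. P k i j x * J k r x) + c *\<^sub>R (lam i x * J j r x) +
      sg (par i * par j) *\<^sub>R (c *\<^sub>R (lam j x * J i r x))"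
    unfolding G sum.distrib scaleR_sum_right[symmetric] sum_distrib_left[symmetric]
    by (simp only: kron_sum[OF U.fin_I ij(1)] kron_sum[OF U.fin_I ij(2)])
  then show ?thesis
    unfolding G_law[OF x ij] by (simp add: algebra_simps scaleR_add_right)
qed

text \<open>Tracelessness reduces the Ricci tensor to \<open>ric0\<close> by
  \<open>ric_formula\<close>, and pullback respects sums, scalars and products. The derivatives are
  those in the new coordinates, pulled back afterwards.\<close>

lemma pull_R:
  assumes x: "x \<in> U" and pq: "p \<in> I" "q \<in> I"
  shows "U.ric (\<lambda>k i j. pull (Q k i j) x) (\<lambda>a k i j. pull (V.d a (Q k i j)) x) p q = pull (B.R p q) x"
proof -
  have conn: "U.conn (\<lambda>k i j. pull (Q k i j) x) (\<lambda>a k i j. pull (V.d a (Q k i j)) x)"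
    unfolding U.conn_def
  proof (intro ballI conjI)
    fix i j k assume ij: "i \<in> I" "j \<in> I" "k \<in> I"
    show "homog D (par i + par j + par k) (pull (Q k i j) x)"
      by (rule U.sf_homog[OF sf_pull[OF B.sf_P[OF ij]] x])
    have "pull (Q k i j) x = pull (\<lambda>y. sg (par i * par j) *\<^sub>R Q k j i y) x"
      by (rule pull_cong[OF _ x]) (rule B.sym_P[OF _ ij])
    then show "pull (Q k i j) x = sg (par i * par j) *\<^sub>R pull (Q k j i) x"
      by (simp only: pull_scaleR[OF B.sf_P[OF ij(2,1,3)] x])
    fix a assume a: "a \<in> I"
    note sf = V.sf_sderiv[OF B.sf_P[OF ij] a] V.sf_sderiv[OF B.sf_P[OF ij(2,1,3)] a]
    show "homog D (par a + par i + par j + par k) (pull (V.d a (Q k i j)) x)"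
      using U.sf_homog[OF sf_pull[OF sf(1)] x] by (simp add: add.assoc)
    have "pull (V.d a (Q k i j)) x = pull (\<lambda>y. sg (par i * par j) *\<^sub>R V.d a (Q k j i) y) x"
      by (rule pull_cong[OF _ x]) (rule U.conn_dsym[OF B.conn_P a ij])
    then show "pull (V.d a (Q k i j)) x = sg (par i * par j) *\<^sub>R pull (V.d a (Q k j i)) x"
      by (simp only: pull_scaleR[OF sf(2) x])
  qed
  have "U.ric (\<lambda>k i j. pull (Q k i j) x) (\<lambda>a k i j. pull (V.d a (Q k i j)) x) p q =
      U.ric0 (\<lambda>k i j. pull (Q k i j) x) (\<lambda>a k i j. pull (V.d a (Q k i j)) x) p q"
    unfolding U.ric_formula[OF conn pq] using pull_B_tr_zero[OF x] pq by simp
  also have "\<dots> = pull (B.R p q) x"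
  proof -
    let ?t = "\<lambda>a y. V.d a (Q a p q) y - (\<Sum>s\<in>I. Q s a p y * Q a s q y)"
    have t: "V.sf (par p + par q) (?t a)" if "a \<in> I" for a
      by (intro V.sf_diff V.sf_sum B.sf_R_terms pq that)
    have "pull (B.R p q) x = (\<Sum>a\<in>I. pull (\<lambda>y. sg (par a * (1 + par p + par q)) *\<^sub>R ?t a y) x)"
      unfolding B.R_def U.ric0_def by (rule pull_sum[OF V.sf_scaleR[OF t] x])
    also have "\<dots> = (\<Sum>a\<in>I. sg (par a * (1 + par p + par q)) *\<^sub>R
        (pull (V.d a (Q a p q)) x - (\<Sum>s\<in>I. pull (Q s a p) x * pull (Q a s q) x)))"
    proof (rule sum.cong[OF refl])
      fix a assume a: "a \<in> I"
      have "pull (?t a) x = pull (V.d a (Q a p q)) x - pull (\<lambda>y. \<Sum>s\<in>I. Q s a p y * Q a s q y) x"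
        by (rule pull_diff[OF B.sf_R_terms(1)[OF a pq] V.sf_sum[OF B.sf_R_terms(2)[OF a pq]] x])
      also have "pull (\<lambda>y. \<Sum>s\<in>I. Q s a p y * Q a s q y) x = (\<Sum>s\<in>I. pull (\<lambda>y. Q s a p y * Q a s q y) x)"
        by (rule pull_sum[OF B.sf_R_terms(2)[OF a pq] x])
      also have "\<dots> = (\<Sum>s\<in>I. pull (Q s a p) x * pull (Q a s q) x)"
        by (intro sum.cong[OF refl] pull_mult[OF B.sf_P B.sf_P x] a pq)
      finally show "pull (\<lambda>y. sg (par a * (1 + par p + par q)) *\<^sub>R ?t a y) x = sg (par a * (1 + par p + par q)) *\<^sub>R
          (pull (V.d a (Q a p q)) x - (\<Sum>s\<in>I. pull (Q s a p) x * pull (Q a s q) x))"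
        unfolding pull_scaleR[OF t[OF a] x] by (simp only:)
    qed
    finally show ?thesis by (simp only: U.ric0_def)
  qed
  finally show ?thesis .
qed

lemma ricci_law:
  assumes x: "x \<in> U" and ij: "i \<in> I" "j \<in> I"
  shows "((N + 1) / (N - 1)) *\<^sub>R A.R i j x + (\<Sum>k\<in>I. P k i j x * lam k x) =
    U.d i (lam j) x + (\<Sum>p\<in>I. \<Sum>q\<in>I. sg (par p * (par j + par q)) *\<^sub>R
      (J i p x * J j q x * (((N + 1) / (N - 1)) *\<^sub>R pull (B.R p q) x))) - c *\<^sub>R (lam i x * lam j x)"
proof -
  interpret tc: tensor_change2 D I "\<lambda>i j. J i j x" "\<lambda>i j. K i j x" "\<lambda>i j r. dJ i j r x"
    "\<lambda>k i j. G k i j x" "\<lambda>k i j. pull (Q k i j) x" "\<lambda>i q r. H i q r x"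
    "\<lambda>a k i j. U.d a (G k i j) x" "\<lambda>a k i j. pull (V.d a (Q k i j)) x"
    "\<lambda>a i q r. U.d a (H i q r) x" "\<lambda>a i j r. U.d a (dJ i j r) x"
    by (rule tensor_change2_at[OF x])
  let ?P = "\<lambda>k i j. P k i j x" and ?dP = "\<lambda>a k i j. U.d a (P k i j) x"
    and ?f = "\<lambda>i. c *\<^sub>R lam i x" and ?df = "\<lambda>a i. c *\<^sub>R U.d a (lam i) x"
  let ?S = "\<Sum>p\<in>I. \<Sum>q\<in>I. sg (par p * (par j + par q)) *\<^sub>R (J i p x * J j q x * pull (B.R p q) x)"
  have dlam: "homog D (par a + par i) (?df a i)" if "a \<in> I" "i \<in> I" for a i
    by (intro homog_scaleR U.sf_homog[OF U.sf_sderiv[OF sf_lam] x] that)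
  have "?S = U.ric (\<lambda>k i j. G k i j x) (\<lambda>a k i j. U.d a (G k i j) x) i j"
    unfolding tc.ric_law[OF ij] by (intro sum.cong refl) (simp only: pull_R[OF x])
  also have "\<dots> = U.ric (U.proj_change ?P ?f) (\<lambda>a. U.proj_change (?dP a) (?df a)) i j"
    by (rule U.ric_cong[OF _ _ ij]) (simp only: G_def, simp only: dG_eq[OF x])
  also have "\<dots> = A.R i j x - (N - 1) *\<^sub>R (?df i j - (\<Sum>k\<in>I. P k i j x * ?f k) - ?f i * ?f j)"
    unfolding A.R_def
  proof (rule U.ric_proj_change[OF A.conn_P[OF x] ij])
    fix a i assume a: "a \<in> I" and i: "i \<in> I"
    show "?df a i = sg (par a * par i) *\<^sub>R ?df i a"
      unfolding dlam_sym[OF x a i] by (rule scaleR_left_commute)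
    show "homog D (par a + par i) (?df a i)" by (rule dlam[OF a i])
    show "U.tr (?dP a) i = 0" by (rule A.tr_dP[OF x i a])
    show "homog D (par i) (?f i)" by (rule homog_scaleR[OF U.sf_homog[OF sf_lam[OF i] x]])
    show "U.tr ?P i = 0" by (rule A.tr_P[OF x i])
  qed
  finally have "((N + 1) / (N - 1)) *\<^sub>R ?S = ((N + 1) / (N - 1)) *\<^sub>R A.R i j x
      - ((N + 1) / (N - 1) * (N - 1) * c) *\<^sub>R (U.d i (lam j) x - (\<Sum>k\<in>I. P k i j x * lam k x) - c *\<^sub>R (lam i x * lam j x))"
    by (simp add: scaleR_diff_right scaleR_sum_right mult.assoc)
  \<comment> \<open>This cancellation fixes the constant of the statement: it gives
    \<open>d lam\<close> the coefficient 1 required by the inhomogeneous term for upper index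
    0.\<close>
  also have "(N + 1) / (N - 1) * (N - 1) * c = 1" using N1 c_N by simp
  finally show ?thesis
    by (simp add: scaleR_sum_right mult_scaleR_right algebra_simps)
qed

end

section \<open>Functions on the Thomas space\<close>

lemma base_simps: "base (x(i := t)) = (if i = 0 then base x else (base x)(i := t))"
  "base x i = (if i = 0 then 0 else x i)"
  by (auto simp: base_def fun_eq_iff)

lemma partial_base: "partial i (\<lambda>x. f (base x)) = (\<lambda>x. if i = 0 then 0 else partial i f (base x))"
  by (rule ext) (simp add: partial_def base_simps)

lemma partials_base:
  "partials is (\<lambda>x. f (base x)) = (\<lambda>x. if 0 \<in> set is then 0 else partials is f (base x))"
proof (induction "is")
  case (Cons i xs)
  have "partial i (\<lambda>_. 0) = (\<lambda>_. 0)" by (rule ext) (simp add: partial_def)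
  then show ?case
    using partial_base[of i "partials xs f"] by (cases "0 \<in> set xs") (auto simp: Cons)
qed simp

lemma continuous_base: "continuous_on S base"
  unfolding base_def fun_upd_def
proof (intro continuous_on_coordinatewise_then_product)
  fix i :: nat
  show "continuous_on S (\<lambda>x. if i = 0 then 0 else x i :: real)"
    by (cases "i = 0") (auto intro: continuous_on_subset[OF continuous_on_product_coordinates])
qed

lemma smooth_base:
  assumes f: "smooth E U f" and 0: "0 \<notin> E"
  shows "smooth (insert 0 E) {x. base x \<in> U} (\<lambda>x. f (base x))"
  unfolding smooth_def
proof (intro allI impI conjI ballI)
  fix js :: "nat list" assume js: "set js \<subseteq> insert 0 E"
  have c: "continuous_on {x. base x \<in> U} (\<lambda>x. partials js f (base x))"
    and d: "base x \<in> U \<Longrightarrow> i \<in> E \<Longrightarrow> (\<lambda>t. partials js f ((base x)(i := t))) differentiable (at (x i))"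
    if "0 \<notin> set js" for x i
  proof -
    have "set js \<subseteq> E" using js that by auto
    then have s: "continuous_on U (partials js f)"
      "base x \<in> U \<Longrightarrow> i \<in> E \<Longrightarrow> (\<lambda>t. partials js f ((base x)(i := t))) differentiable (at (base x i))"
      using f unfolding smooth_def by blast+
    show "continuous_on {x. base x \<in> U} (\<lambda>x. partials js f (base x))"
      by (rule continuous_on_compose2[OF s(1) continuous_base]) auto
    assume "base x \<in> U" "i \<in> E"
    moreover from this 0 have "base x i = x i" by (auto simp: base_simps)
    ultimately show "(\<lambda>t. partials js f ((base x)(i := t))) differentiable (at (x i))"
      using s(2) by simp
  qed
  show "continuous_on {x. base x \<in> U} (partials js (\<lambda>x. f (base x)))"
    using c by (cases "0 \<in> set js") (simp_all add: partials_base)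
  fix x i assume "x \<in> {x. base x \<in> U}" "i \<in> insert 0 E"
  then show "(\<lambda>t. partials js (\<lambda>x. f (base x)) (x(i := t))) differentiable (at (x i))"
    using d[of x i] by (cases "0 \<in> set js"; cases "i = 0") (auto simp: partials_base base_simps)
qed

lemma superfunction_base:
  assumes "superfunction E D U p f" "0 \<notin> E"
  shows "superfunction (insert 0 E) D {x. base x \<in> U} p (\<lambda>x. f (base x))"
  using assms unfolding superfunction_def by (auto intro: smooth_base)

lemma sderiv_base:
  assumes "0 \<notin> D"
  shows "sderiv D i (\<lambda>x. f (base x)) = (\<lambda>x. if i = 0 then 0 else sderiv D i f (base x))"
  using assms partial_base[of i "\<lambda>y. gcoeff (f y) I" for I]
  by (auto simp: sderiv_def fun_eq_iff gcoeff_even_deriv partial_base[of _ "\<lambda>y. gcoeff (f y) I" for I]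
      intro!: grassmann_eqI)

text \<open>Valid also where \<open>f\<close> is not differentiable, as adding a constant does not
  change the set of derivatives among which \<open>deriv\<close> chooses.\<close>

lemma deriv_add_const: "deriv (\<lambda>t. c + f t) x = deriv f (x :: real)"
proof -
  have "((\<lambda>t. c + f t) has_field_derivative d) (at x) \<longleftrightarrow> (f has_field_derivative d) (at x)" for d
    using DERIV_add[of "\<lambda>t. c + f t" d x UNIV "\<lambda>_. - c" 0] DERIV_add[of "\<lambda>_. c" 0 x UNIV f d] by auto
  then show ?thesis by (simp add: deriv_def)
qed

lemma sderiv_fibre_coordinate:
  assumes "0 \<notin> D"
  shows "sderiv D i (\<lambda>x. of_real (x 0) + f (base x)) = (\<lambda>x. if i = 0 then 1 else sderiv D i f (base x))"
proof (cases "i \<in> D")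
  case True
  then show ?thesis using assms by (auto simp: sderiv_def godd_deriv_linear godd_deriv_of_real)
next
  case False
  have "partial i (\<lambda>y. (if I = {} then y 0 else 0) + gcoeff (f (base y)) I) x =
      (if i = 0 then (if I = {} then 1 else 0) else partial i (\<lambda>y. gcoeff (f y) I) (base x))" for I x
  proof (cases "i = 0")
    case True
    have "deriv (\<lambda>t. t + gcoeff (f (base x)) I) (x 0) = 1"
      by (rule DERIV_imp_deriv) (auto intro!: derivative_eq_intros)
    then show ?thesis using True by (simp add: partial_def base_simps)
  next
    case False
    then have "partial i (\<lambda>y. (if I = {} then y 0 else 0) + gcoeff (f (base y)) I) x =
        deriv (\<lambda>t. (if I = {} then x 0 else 0) + gcoeff (f ((base x)(i := t))) I) (x i)"
      by (simp add: partial_def base_simps)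
    then show ?thesis using False by (simp only: deriv_add_const) (simp add: partial_def base_simps)
  qed
  then show ?thesis using False
    by (auto simp: sderiv_def fun_eq_iff gcoeff_even_deriv intro!: grassmann_eqI)
qed

text \<open>Index tuples containing 0 differentiate along \<open>x^0\<close> a function that is
  constant in it, so they drop out; the new fibre coordinate, with its \<open>log J\<close>, never
  enters such a pullback.\<close>

lemma subst_base:
  assumes "finite E" "0 \<notin> E" "0 \<notin> D" "finite D"
    and \<phi>: "\<And>i. i \<in> E \<union> D \<Longrightarrow> \<phi>' i x = \<phi> i (base x)"
  shows "subst (insert 0 E) D \<phi>' (\<lambda>y. f (base y)) x = subst E D \<phi> f (base x)"
proof -
  have b: "base (body_map (insert 0 E) \<phi>' x) = body_map E \<phi> (base x)"
    using assms by (auto simp: body_map_def base_def fun_eq_iff)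
  have "(\<Sum>js | set js \<subseteq> insert 0 E \<and> length js = k.
        (partials js (\<lambda>y. gcoeff (f (base y)) J) (body_map (insert 0 E) \<phi>' x) / fact k) *\<^sub>R
          prod_list (map (\<lambda>i. \<phi>' i x - of_real (gbody (\<phi>' i x))) js)) =
      (\<Sum>js | set js \<subseteq> E \<and> length js = k.
        (partials js (\<lambda>y. gcoeff (f y) J) (body_map E \<phi> (base x)) / fact k) *\<^sub>R
          prod_list (map (\<lambda>i. \<phi> i (base x) - of_real (gbody (\<phi> i (base x)))) js))" for J k
  proof (rule sum.mono_neutral_cong_right)
    show "finite {js. set js \<subseteq> insert 0 E \<and> length js = k}"
      using assms(1) by (intro finite_lists_length_eq) simp
    show "{js. set js \<subseteq> E \<and> length js = k} \<subseteq> {js. set js \<subseteq> insert 0 E \<and> length js = k}" by auto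
    show "\<forall>js\<in>{js. set js \<subseteq> insert 0 E \<and> length js = k} - {js. set js \<subseteq> E \<and> length js = k}.
        (partials js (\<lambda>y. gcoeff (f (base y)) J) (body_map (insert 0 E) \<phi>' x) / fact k) *\<^sub>R
          prod_list (map (\<lambda>i. \<phi>' i x - of_real (gbody (\<phi>' i x))) js) = 0"
    proof
      fix js assume "js \<in> {js. set js \<subseteq> insert 0 E \<and> length js = k} - {js. set js \<subseteq> E \<and> length js = k}"
      then have "0 \<in> set js" by auto
      then show "(partials js (\<lambda>y. gcoeff (f (base y)) J) (body_map (insert 0 E) \<phi>' x) / fact k) *\<^sub>R
          prod_list (map (\<lambda>i. \<phi>' i x - of_real (gbody (\<phi>' i x))) js) = 0"
        using partials_base[of js "\<lambda>y. gcoeff (f y) J"] by simp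
    qed
    fix js assume js: "js \<in> {js. set js \<subseteq> E \<and> length js = k}"
    then have "map (\<lambda>i. \<phi>' i x - of_real (gbody (\<phi>' i x))) js =
        map (\<lambda>i. \<phi> i (base x) - of_real (gbody (\<phi> i (base x)))) js"
      using \<phi> by (intro map_cong) auto
    moreover have "0 \<notin> set js" using js assms(2) by auto
    ultimately show "(partials js (\<lambda>y. gcoeff (f (base y)) J) (body_map (insert 0 E) \<phi>' x) / fact k) *\<^sub>R
          prod_list (map (\<lambda>i. \<phi>' i x - of_real (gbody (\<phi>' i x))) js) =
        (partials js (\<lambda>y. gcoeff (f y) J) (body_map E \<phi> (base x)) / fact k) *\<^sub>R
          prod_list (map (\<lambda>i. \<phi> i (base x) - of_real (gbody (\<phi> i (base x)))) js)"
      using partials_base[of js "\<lambda>y. gcoeff (f y) J"] by (simp only: b if_False)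
  qed
  moreover have "map (\<lambda>i. \<phi>' i x) (sorted_list_of_set J) = map (\<lambda>i. \<phi> i (base x)) (sorted_list_of_set J)"
    if "J \<subseteq> D" for J
    using \<phi> that finite_subset[OF that assms(4)] by auto
  ultimately show ?thesis unfolding subst_def by (intro sum.cong[OF refl]) (simp only: Pow_iff)
qed

section \<open>The Thomas connection\<close>

text \<open>The matrix \<open>TJ\<close> of the change of adapted coordinates, its derivatives \<open>TdJ\<close>, and the Thomas coefficients
  \<open>TG\<close> in the old and \<open>TH\<close>, pulled back, in the new coordinates, as functions on the base.\<close>

context projective_transition
begin

definition TJ :: "nat \<Rightarrow> nat \<Rightarrow> superfun" where
  "TJ i r x = (if r = 0 then if i = 0 then 1 else lam i x else if i = 0 then 0 else J i r x)"

definition TdJ :: "nat \<Rightarrow> nat \<Rightarrow> nat \<Rightarrow> superfun" where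
  "TdJ i j r x = (if i = 0 \<or> j = 0 then 0 else if r = 0 then U.d i (lam j) x else dJ i j r x)"

definition TG :: "nat \<Rightarrow> nat \<Rightarrow> nat \<Rightarrow> superfun" where
  "TG k i j x = (if i = 0 then - c *\<^sub>R kron k j else if j = 0 then - c *\<^sub>R kron k i
     else if k = 0 then ((N + 1) / (N - 1)) *\<^sub>R A.R i j x else P k i j x)"

definition TH :: "nat \<Rightarrow> nat \<Rightarrow> nat \<Rightarrow> superfun" where
  "TH k i j x = (if i = 0 then - c *\<^sub>R kron k j else if j = 0 then - c *\<^sub>R kron k i
     else if k = 0 then ((N + 1) / (N - 1)) *\<^sub>R pull (B.R i j) x else pull (Q k i j) x)"

lemma sum_scaleR_kron:
  assumes "finite S" "j \<in> S"
  shows "(\<Sum>k\<in>S. (a *\<^sub>R kron k j) * f k) = a *\<^sub>R (f j :: grassmann)"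
    "(\<Sum>k\<in>S. w k *\<^sub>R (f k * (a *\<^sub>R kron j k))) = (w j * a) *\<^sub>R f j"
  using assms sum_single[of S j "\<lambda>k. (a *\<^sub>R kron k j) * f k"]
    sum_single[of S j "\<lambda>k. w k *\<^sub>R (f k * (a *\<^sub>R kron j k))"]
  by (auto simp: kron_def)

theorem thomas_law:
  assumes x: "x \<in> U" and 0: "0 \<notin> I" and ij: "i \<in> insert 0 I" "j \<in> insert 0 I" "r \<in> insert 0 I"
  shows "(\<Sum>k\<in>insert 0 I. TG k i j x * TJ k r x) = TdJ i j r x +
    (\<Sum>p\<in>insert 0 I. \<Sum>q\<in>insert 0 I. sg (par p * (par j + par q)) *\<^sub>R (TJ i p x * TJ j q x * TH r p q x))"
proof -
  have fin: "finite (insert 0 I)" using U.fin_I by simp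
  have par0: "par 0 = 0" using 0 by (simp add: parity_def)
  have ins: "sum F (insert 0 I) = F 0 + (sum F I :: grassmann)" for F
    by (rule sum.insert[OF U.fin_I 0])
  have nz: "k \<noteq> 0" if "k \<in> I" for k using that 0 by metis
  have vals: "TJ 0 0 x = 1" "k \<in> I \<Longrightarrow> TJ 0 k x = 0" "k \<in> I \<Longrightarrow> TJ k 0 x = lam k x"
    "k \<in> I \<Longrightarrow> l \<in> I \<Longrightarrow> TJ k l x = J k l x"
    "k \<in> I \<Longrightarrow> l \<in> I \<Longrightarrow> TG 0 k l x = ((N + 1) / (N - 1)) *\<^sub>R A.R k l x"
    "k \<in> I \<Longrightarrow> l \<in> I \<Longrightarrow> s \<in> I \<Longrightarrow> TG s k l x = P s k l x"
    "TH s 0 l x = - c *\<^sub>R kron s l" "TH s k 0 x = - c *\<^sub>R kron s k"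
    "k \<in> I \<Longrightarrow> l \<in> I \<Longrightarrow> TH 0 k l x = ((N + 1) / (N - 1)) *\<^sub>R pull (B.R k l) x"
    "k \<in> I \<Longrightarrow> l \<in> I \<Longrightarrow> s \<in> I \<Longrightarrow> TH s k l x = pull (Q s k l) x" for k l s
    using nz[of k] nz[of l] nz[of s] by (simp_all add: TJ_def TG_def TH_def del: Un_iff)
  consider "i = 0" | "i \<in> I" "j = 0" | "i \<in> I" "j \<in> I" "r = 0" | "i \<in> I" "j \<in> I" "r \<in> I"
    using ij by blast
  then show ?thesis
  proof cases
    \<comment> \<open>The Jacobi row of index 0 is \<open>(1, 0, ..., 0)\<close>, so only
      \<open>p = 0\<close> survives; both sides are \<open>- c\<close> times the entry
      \<open>TJ j r\<close>.\<close>
    case 1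
    have L: "(\<Sum>k\<in>insert 0 I. TG k i j x * TJ k r x) = - c *\<^sub>R TJ j r x"
      using sum_scaleR_kron(1)[OF fin ij(2), of "- c" "\<lambda>k. TJ k r x"] by (simp only: TG_def 1 simp_thms if_True)
    have R: "(\<Sum>p\<in>insert 0 I. \<Sum>q\<in>insert 0 I.
        sg (par p * (par j + par q)) *\<^sub>R (TJ i p x * TJ j q x * TH r p q x)) =
        (\<Sum>q\<in>insert 0 I. 1 *\<^sub>R (TJ j q x * (- c *\<^sub>R kron r q)))"
    proof -
      let ?F = "\<lambda>p. \<Sum>q\<in>insert 0 I. sg (par p * (par j + par q)) *\<^sub>R (TJ i p x * TJ j q x * TH r p q x)"
      have "TJ i p x = 0" if "p \<in> I" for p using nz[OF that] by (simp add: TJ_def 1)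
      then have "(\<Sum>p\<in>I. ?F p) = 0" by simp
      then show ?thesis
        unfolding ins[of ?F] by (simp add: par0 1 vals)
    qed
    show ?thesis
      unfolding L R sum_scaleR_kron(2)[OF fin ij(3), of "\<lambda>_. 1" "\<lambda>q. TJ j q x" "- c"] by (simp add: TdJ_def 1)
  next
    case 2
    have L: "(\<Sum>k\<in>insert 0 I. TG k i j x * TJ k r x) = - c *\<^sub>R TJ i r x"
      using sum_scaleR_kron(1)[OF fin ij(1), of "- c" "\<lambda>k. TJ k r x"] nz[OF 2(1)]
      by (simp only: TG_def 2 simp_thms if_True if_False)
    have R: "(\<Sum>p\<in>insert 0 I. \<Sum>q\<in>insert 0 I.
        sg (par p * (par j + par q)) *\<^sub>R (TJ i p x * TJ j q x * TH r p q x)) =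
        (\<Sum>p\<in>insert 0 I. 1 *\<^sub>R (TJ i p x * (- c *\<^sub>R kron r p)))"
    proof (rule sum.cong[OF refl])
      fix p
      have "TJ j q x = 0" if "q \<in> I" for q using nz[OF that] by (simp add: TJ_def 2)
      then show "(\<Sum>q\<in>insert 0 I. sg (par p * (par j + par q)) *\<^sub>R (TJ i p x * TJ j q x * TH r p q x)) =
          1 *\<^sub>R (TJ i p x * (- c *\<^sub>R kron r p))"
        unfolding ins by (simp add: par0 2 vals)
    qed
    show ?thesis
      unfolding L R sum_scaleR_kron(2)[OF fin ij(3), of "\<lambda>_. 1" "\<lambda>q. TJ i q x" "- c"] by (simp add: TdJ_def 2)
  next
    \<comment> \<open>For upper index 0 the terms with exactly one of \<open>p\<close>,
      \<open>q\<close> equal to 0 vanish, and \<open>p = q = 0\<close> gives \<open>- c\<close>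
      times \<open>lam i * lam j\<close>; what remains is \<open>ricci_law\<close>.\<close>
    case 3
    have k: "kron 0 q = 0" if "q \<in> I" for q using nz[OF that] by (simp add: kron_def)
    have L: "(\<Sum>k\<in>insert 0 I. TG k i j x * TJ k r x) =
        ((N + 1) / (N - 1)) *\<^sub>R A.R i j x + (\<Sum>k\<in>I. P k i j x * lam k x)"
      unfolding ins by (simp add: vals 3 del: Un_iff cong: sum.cong)
    have R: "(\<Sum>p\<in>insert 0 I. \<Sum>q\<in>insert 0 I.
        sg (par p * (par j + par q)) *\<^sub>R (TJ i p x * TJ j q x * TH r p q x)) =
        - c *\<^sub>R (lam i x * lam j x) + (\<Sum>p\<in>I. \<Sum>q\<in>I. sg (par p * (par j + par q)) *\<^sub>R
        (J i p x * J j q x * (((N + 1) / (N - 1)) *\<^sub>R pull (B.R p q) x)))"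
      unfolding ins by (simp add: vals 3 k kron_def[of 0 0] par0 del: Un_iff cong: sum.cong)
    show ?thesis
      unfolding L R ricci_law[OF x 3(1,2)] using nz[OF 3(1)] nz[OF 3(2)] 3(3) by (simp add: TdJ_def)
  next
    \<comment> \<open>Now \<open>p = q = 0\<close> drops out, while the terms with exactly one index
      0 produce the correction with \<open>lam\<close> in \<open>connection_law\<close>.\<close>
    case 4
    have k: "kron r 0 = 0" using nz[OF 4(3)] by (simp add: kron_def)
    have L: "(\<Sum>k\<in>insert 0 I. TG k i j x * TJ k r x) = (\<Sum>k\<in>I. P k i j x * J k r x)"
      unfolding ins by (simp add: vals 4 nz[OF 4(3)] del: Un_iff cong: sum.cong)
    have R1: "(\<Sum>q\<in>I. 1 *\<^sub>R (lam i x * J j q x * (- c *\<^sub>R kron r q))) = - c *\<^sub>R (lam i x * J j r x)"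
      using sum_scaleR_kron(2)[OF U.fin_I 4(3), of "\<lambda>_. 1" "\<lambda>q. lam i x * J j q x" "- c"] by simp
    have R2: "(\<Sum>p\<in>I. sg (par p * par j) *\<^sub>R (J i p x * lam j x * (- c *\<^sub>R kron r p))) =
        - c *\<^sub>R (sg (par i * par j) *\<^sub>R (lam j x * J i r x))"
    proof -
      have "J i r x * lam j x = sg ((par i + par r) * par j) *\<^sub>R (lam j x * J i r x)"
        by (rule grassmann_supercommute[OF U.sf_homog[OF jac.sf_J[OF 4(1,3)] x] U.sf_homog[OF sf_lam[OF 4(2)] x]])
      moreover have "sg (par r * par j + (par i + par r) * par j) = sg (par i * par j)"
        by (rule sg_cong) auto
      ultimately have "sg (par r * par j) *\<^sub>R (J i r x * lam j x) = sg (par i * par j) *\<^sub>R (lam j x * J i r x)"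
        by (simp only: sg_scaleR)
      then show ?thesis
        using sum_scaleR_kron(2)[OF U.fin_I 4(3), of "\<lambda>p. sg (par p * par j)" "\<lambda>p. J i p x * lam j x" "- c"]
        by (simp only: mult.commute[of _ "- c"] scaleR_scaleR[symmetric])
    qed
    have R: "(\<Sum>p\<in>insert 0 I. \<Sum>q\<in>insert 0 I.
        sg (par p * (par j + par q)) *\<^sub>R (TJ i p x * TJ j q x * TH r p q x)) =
        (\<Sum>q\<in>I. 1 *\<^sub>R (lam i x * J j q x * (- c *\<^sub>R kron r q))) +
        ((\<Sum>p\<in>I. sg (par p * par j) *\<^sub>R (J i p x * lam j x * (- c *\<^sub>R kron r p))) +
        (\<Sum>p\<in>I. \<Sum>q\<in>I. sg (par p * (par j + par q)) *\<^sub>R (J i p x * J j q x * pull (Q r p q) x)))"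
      unfolding ins sum.distrib by (simp add: vals 4 k par0 del: Un_iff cong: sum.cong)
    show ?thesis
      unfolding L R R1 R2 connection_law[OF x 4] using nz[OF 4(1)] nz[OF 4(2)] nz[OF 4(3)] by (simp add: TdJ_def scaleR_add_right)
  qed
qed

end

lemma thomas_space_simps [simp]:
  "evens (thomas_space M) = insert 0 (evens M)" "odds (thomas_space M) = odds M"
  "charts (thomas_space M) = charts M" "chart_dom (thomas_space M) \<alpha> = {x. base x \<in> chart_dom M \<alpha>}"
  "overlap (thomas_space M) \<alpha> \<beta> = {x. base x \<in> overlap M \<alpha> \<beta>}"
  "indices (thomas_space M) = insert 0 (indices M)" "par (thomas_space M) = par M"
  "change (thomas_space M) \<alpha> \<beta> i = (\<lambda>x. if i = 0 then of_real (x 0) + log_J M \<alpha> \<beta> (base x)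
     else change M \<alpha> \<beta> i (base x))"
  by (simp_all add: thomas_space_def indices_def par_def fun_eq_iff)

lemma minus_one_power_real: "(-1 :: grassmann) ^ n * a = sg n *\<^sub>R a" "a * (-1) ^ n = sg n *\<^sub>R a"
  by (simp_all add: minus_one_power_scaleR[where 'a = grassmann])

lemma thomas_coeffs_base: "thomas_coeffs M P \<alpha> k i j = (\<lambda>x. thomas_coeffs M P \<alpha> k i j (base x))"
  by (rule ext) (simp add: thomas_coeffs_def base_def)

section \<open>From the atlas and a member of the projective class to the local data\<close>

locale projective_structure =
  fixes n m :: nat and M :: "'c superatlas" and P \<Gamma> :: "'c coeffs"
  assumes M: "supermanifold n m M" and dim: "int n - int m \<notin> {1, -1}"
    and \<Gamma>: "symmetric_connection M \<Gamma>"
    and P: "\<alpha> \<in> charts M \<Longrightarrow> x \<in> chart_dom M \<alpha> \<Longrightarrow> i \<in> indices M \<Longrightarrow> j \<in> indices M \<Longrightarrow> k \<in> indices M \<Longrightarrow>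
      P \<alpha> k j i x = projective_coeffs M \<Gamma> \<alpha> k j i x"
begin

abbreviation E :: "nat set" where "E \<equiv> evens M"
abbreviation D :: "nat set" where "D \<equiv> odds M"

lemma index_sets: "finite E" "finite D" "E \<inter> D = {}" "0 \<notin> E" "0 \<notin> D" "sdim M = real n - real m"
  using M by (auto simp: supermanifold_def sdim_def)

lemma indices: "indices M = E \<union> D" by (simp add: indices_def)

lemma superdomains:
  assumes "\<alpha> \<in> charts M"
  shows "superdomain E (chart_dom M \<alpha>) D" "\<beta> \<in> charts M \<Longrightarrow> superdomain E (overlap M \<alpha> \<beta>) D"
  using assms M index_sets by (auto simp: supermanifold_def superdomain_def superdomain_axioms_def open_coord_def)

lemma overlap_subset: "\<alpha> \<in> charts M \<Longrightarrow> \<beta> \<in> charts M \<Longrightarrow> overlap M \<alpha> \<beta> \<subseteq> chart_dom M \<alpha>"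
  using M by (auto simp: supermanifold_def)

lemma sdim: "tensor_indices.sdim' D (E \<union> D) = sdim M"
proof -
  interpret tensor_indices D "E \<union> D" by unfold_locales (use index_sets in auto)
  have "(\<Sum>s\<in>E. sg (par s)) = (\<Sum>s\<in>E. 1)" "(\<Sum>s\<in>D. sg (par s)) = (\<Sum>s\<in>D. - 1)"
    by (rule sum.cong; use index_sets(3) in \<open>auto simp: parity_def\<close>)+
  then show ?thesis
    unfolding sdim'_def sdim_def using index_sets by (simp add: sum.union_disjoint)
qed

lemma sdim_neq: "sdim M \<noteq> 1" "sdim M \<noteq> -1"
proof -
  have "sdim M = of_int (int n - int m)" by (simp add: index_sets)
  moreover have "int n - int m \<noteq> 1" "int n - int m \<noteq> -1" using dim by auto
  ultimately show "sdim M \<noteq> 1" "sdim M \<noteq> -1"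
    by (metis of_int_1 of_int_eq_iff, metis of_int_1 of_int_eq_iff of_int_minus)
qed

lemma transition:
  assumes "\<alpha> \<in> charts M" "\<beta> \<in> charts M"
  shows "super_transition E (overlap M \<alpha> \<beta>) (overlap M \<beta> \<alpha>) D (change M \<alpha> \<beta>) (change M \<beta> \<alpha>)"
proof -
  interpret U: superdomain E "overlap M \<alpha> \<beta>" D by (rule superdomains(2)[OF assms])
  interpret V: superdomain E "overlap M \<beta> \<alpha>" D by (rule superdomains(2)[OF assms(2,1)])
  have sf: "superfunction E D (overlap M \<alpha> \<beta>) (parity D i) (change M \<alpha> \<beta> i)"
    if "\<alpha> \<in> charts M" "\<beta> \<in> charts M" "i \<in> E \<union> D" for \<alpha> \<beta> i
    using M that by (auto simp: supermanifold_def indices par_def)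
  have "body_change M \<alpha> \<beta> x \<in> overlap M \<beta> \<alpha> \<and> (\<forall>i\<in>indices M.
      pullback M \<alpha> \<beta> (change M \<beta> \<alpha> i) x = coord D i x)" if x: "x \<in> overlap M \<alpha> \<beta>" for x
  proof -
    have c: "x \<in> chart_dom M \<alpha>" using overlap_subset[OF assms] x by blast
    moreover have \<alpha>: "overlap M \<alpha> \<alpha> = chart_dom M \<alpha>"
      "\<And>i. i \<in> indices M \<Longrightarrow> change M \<alpha> \<alpha> i x = coord D i x"
      using M assms(1) c unfolding supermanifold_def by blast+
    ultimately have "x \<in> overlap M \<alpha> \<beta> \<inter> overlap M \<alpha> \<alpha>" using x by blast
    then have "body_change M \<alpha> \<beta> x \<in> overlap M \<beta> \<alpha> \<and> (\<forall>i\<in>indices M.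
        pullback M \<alpha> \<beta> (change M \<beta> \<alpha> i) x = change M \<alpha> \<alpha> i x)"
      using M assms unfolding supermanifold_def by blast
    then show ?thesis using \<alpha>(2) by simp
  qed
  then show ?thesis
    by unfold_locales (auto simp: sf assms indices body_change_def pullback_def)
qed

lemma chart:
  assumes \<alpha>: "\<alpha> \<in> charts M" and U: "U \<subseteq> chart_dom M \<alpha>" "superdomain E U D"
  shows "projective_chart E U D (\<Gamma> \<alpha>) (P \<alpha>)"
proof -
  interpret superdomain E U D by (rule U)
  have "linear_connection M \<Gamma>" using \<Gamma> by (simp add: symmetric_connection_def)
  then have 1: "sf (parity D i + parity D j + parity D k) (\<Gamma> \<alpha> k i j)"
    if "i \<in> E \<union> D" "j \<in> E \<union> D" "k \<in> E \<union> D" for i j k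
    using superfunction_subset[OF _ U(1)] that \<alpha> by (simp add: linear_connection_def indices par_def)
  have 2: "\<Gamma> \<alpha> k i j x = sg (parity D i * parity D j) *\<^sub>R \<Gamma> \<alpha> k j i x"
    if "x \<in> U" "i \<in> E \<union> D" "j \<in> E \<union> D" "k \<in> E \<union> D" for i j k x
    using \<Gamma> \<alpha> U(1) that unfolding symmetric_connection_def indices par_def minus_one_power_real by blast
  have 3: "P \<alpha> k i j x = proj_change (\<lambda>k i j. \<Gamma> \<alpha> k i j x)
      (\<lambda>i. - (1 / (sdim' + 1)) *\<^sub>R tr (\<lambda>k i j. \<Gamma> \<alpha> k i j x) i) k i j"
    if x: "x \<in> U" and ij: "i \<in> E \<union> D" "j \<in> E \<union> D" "k \<in> E \<union> D" for i j k x
  proof -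
    have "P \<alpha> k i j x = projective_coeffs M \<Gamma> \<alpha> k i j x"
      by (rule P) (use \<alpha> U(1) x ij in \<open>auto simp: indices\<close>)
    also have "\<dots> = \<Gamma> \<alpha> k i j x - (1 / (sdim M + 1)) *\<^sub>R
        (tr (\<lambda>k i j. \<Gamma> \<alpha> k i j x) i * kron k j + sg (parity D i * parity D j) *\<^sub>R
          (tr (\<lambda>k i j. \<Gamma> \<alpha> k i j x) j * kron k i))"
      unfolding projective_coeffs_def tr_def indices par_def minus_one_power_real
      by (simp add: sum.distrib sum_distrib_right scaleR_sum_right power_add mult.commute)
    finally show ?thesis
      by (simp add: proj_change_def sdim scaleR_add_right scaleR_left_commute)
  qed
  show ?thesis
    by unfold_locales (fact 1 2 3 | simp add: sdim sdim_neq)+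
qed

lemma thomas_coeffs_eq:
  assumes "base y = y"
  shows "thomas_coeffs M P \<alpha> k i j y = (if i = 0 then - (1 / (sdim M + 1)) *\<^sub>R kron k j
     else if j = 0 then - (1 / (sdim M + 1)) *\<^sub>R kron k i
     else if k = 0 then ((sdim M + 1) / (sdim M - 1)) *\<^sub>R tensor_indices.ric0 D (E \<union> D)
       (\<lambda>k i j. P \<alpha> k i j y) (\<lambda>a k i j. sderiv D a (P \<alpha> k i j) y) i j
     else P \<alpha> k i j y)"
proof -
  interpret tensor_indices D "E \<union> D" by unfold_locales (use index_sets in auto)
  show ?thesis
    by (simp add: thomas_coeffs_def assms ric0_def minus_one_power_real indices par_def pd_def)
qed

text \<open>0 is not an index of \<open>M\<close>, and the points of a chart domain vanish off the
  even indices.\<close>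

lemma base_eq: "\<alpha> \<in> charts M \<Longrightarrow> y \<in> chart_dom M \<alpha> \<Longrightarrow> base y = y"
  using open_coord.outside[OF superdomain.axioms(1)[OF superdomains(1)], of \<alpha> y 0] index_sets
  by (auto simp: base_def)

lemma superfunction_thomas:
  assumes \<alpha>: "\<alpha> \<in> charts M" and ij: "i \<in> insert 0 (E \<union> D)" "j \<in> insert 0 (E \<union> D)" "k \<in> insert 0 (E \<union> D)"
  shows "superfunction E D (chart_dom M \<alpha>) (par M i + par M j + par M k) (thomas_coeffs M P \<alpha> k i j)"
proof -
  interpret C: projective_chart E "chart_dom M \<alpha>" D "\<Gamma> \<alpha>" "P \<alpha>"
    by (rule chart[OF \<alpha> order_refl superdomains(1)[OF \<alpha>]])
  have 0: "C.par 0 = 0" "par M = C.par" using index_sets by (auto simp: parity_def par_def fun_eq_iff)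
  have kron: "C.sf p (\<lambda>_. a *\<^sub>R kron i j)" if "i = j \<Longrightarrow> even p" for p a i j
    using C.sf_mult_kron[OF C.sf_const[OF homog_scaleR[OF homog_1]], of i j p a] that by simp
  consider "i = 0" | "i \<noteq> 0" "j = 0" | "i \<in> E \<union> D" "j \<in> E \<union> D" "i \<noteq> 0" "j \<noteq> 0" "k = 0"
    | "i \<in> E \<union> D" "j \<in> E \<union> D" "k \<in> E \<union> D" "i \<noteq> 0" "j \<noteq> 0" "k \<noteq> 0"
    using ij by blast
  then have "C.sf (C.par i + C.par j + C.par k) (\<lambda>y. if i = 0 then - (1 / (sdim M + 1)) *\<^sub>R kron k j
     else if j = 0 then - (1 / (sdim M + 1)) *\<^sub>R kron k i
     else if k = 0 then ((sdim M + 1) / (sdim M - 1)) *\<^sub>R C.R i j y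
     else P \<alpha> k i j y)"
  proof cases
    case 1
    show ?thesis unfolding 1 simp_thms if_True by (rule kron) (simp add: 0)
  next
    case 2
    show ?thesis using 2(1) unfolding 2(2) simp_thms if_True by (simp only: if_False) (rule kron, simp add: 0)
  next
    case 3
    show ?thesis
      using 3(3,4) C.sf_scaleR[OF C.sf_R[OF 3(1,2)]] unfolding 3(5) by (simp add: 0(1))
  next
    case 4
    show ?thesis using 4(4-6) C.sf_P[OF 4(1,2,3)] by simp
  qed
  then show ?thesis
    unfolding 0(2) by (rule C.sf_cong[THEN iffD1, rotated]) (simp add: thomas_coeffs_eq base_eq[OF \<alpha>] C.R_def)
qed

lemma projective_transition:
  assumes "\<alpha> \<in> charts M" "\<beta> \<in> charts M"
  shows "projective_transition E (overlap M \<alpha> \<beta>) (overlap M \<beta> \<alpha>) D (change M \<alpha> \<beta>) (change M \<beta> \<alpha>)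
    (\<Gamma> \<alpha>) (P \<alpha>) (\<Gamma> \<beta>) (P \<beta>)"
proof -
  interpret super_transition E "overlap M \<alpha> \<beta>" "overlap M \<beta> \<alpha>" D "change M \<alpha> \<beta>" "change M \<beta> \<alpha>"
    by (rule transition[OF assms])
  interpret A: projective_chart E "overlap M \<alpha> \<beta>" D "\<Gamma> \<alpha>" "P \<alpha>"
    by (rule chart[OF assms(1) overlap_subset[OF assms] superdomains(2)[OF assms]])
  interpret B: projective_chart E "overlap M \<beta> \<alpha>" D "\<Gamma> \<beta>" "P \<beta>"
    by (rule chart[OF assms(2) overlap_subset[OF assms(2,1)] superdomains(2)[OF assms(2,1)]])
  show ?thesis
  proof
    show "U.sdim' \<noteq> 1" by (simp add: sdim sdim_neq)
    fix x i j r assume "x \<in> overlap M \<alpha> \<beta>" "i \<in> E \<union> D" "j \<in> E \<union> D" "r \<in> E \<union> D"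
    then have "(\<Sum>k\<in>indices M. \<Gamma> \<alpha> k i j x * pd M k (change M \<alpha> \<beta> r) x) =
        pd M i (pd M j (change M \<alpha> \<beta> r)) x + (\<Sum>p\<in>indices M. \<Sum>q\<in>indices M.
           (-1) ^ (Defs.par M p * (Defs.par M j + Defs.par M q)) *
           pd M i (change M \<alpha> \<beta> p) x * pd M j (change M \<alpha> \<beta> q) x * pullback M \<alpha> \<beta> (\<Gamma> \<beta> r p q) x)"
      using \<Gamma> assms unfolding symmetric_connection_def linear_connection_def indices by blast
    then show "(\<Sum>k\<in>E \<union> D. \<Gamma> \<alpha> k i j x * U.d k (change M \<alpha> \<beta> r) x) = U.d i (U.d j (change M \<alpha> \<beta> r)) x +
      (\<Sum>p\<in>E \<union> D. \<Sum>q\<in>E \<union> D. sg (parity D p * (parity D j + parity D q)) *\<^sub>R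
        (U.d i (change M \<alpha> \<beta> p) x * U.d j (change M \<alpha> \<beta> q) x * subst E D (change M \<alpha> \<beta>) (\<Gamma> \<beta> r p q) x))"
      by (simp add: indices pd_def par_def pullback_def minus_one_power_real mult.assoc)
  qed
qed

lemma thomas_connection: "linear_connection (thomas_space M) (thomas_coeffs M P)"
  unfolding linear_connection_def thomas_space_simps
proof (intro conjI ballI)
  fix \<alpha> i j k assume "\<alpha> \<in> charts M" "i \<in> insert 0 (indices M)" "j \<in> insert 0 (indices M)" "k \<in> insert 0 (indices M)"
  then show "superfunction (insert 0 E) D {x. base x \<in> chart_dom M \<alpha>} (par M i + par M j + par M k)
      (thomas_coeffs M P \<alpha> k i j)"
    by (subst thomas_coeffs_base, intro superfunction_base[OF superfunction_thomas index_sets(4)])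
      (simp_all only: indices)
next
  fix \<alpha> \<beta> x i j r
  assume charts: "\<alpha> \<in> charts M" "\<beta> \<in> charts M" and "x \<in> {x. base x \<in> overlap M \<alpha> \<beta>}"
    and ij: "i \<in> insert 0 (indices M)" "j \<in> insert 0 (indices M)" "r \<in> insert 0 (indices M)"
  then have x: "base x \<in> overlap M \<alpha> \<beta>" by simp
  interpret T: projective_transition E "overlap M \<alpha> \<beta>" "overlap M \<beta> \<alpha>" D "change M \<alpha> \<beta>" "change M \<beta> \<alpha>"
    "\<Gamma> \<alpha>" "P \<alpha>" "\<Gamma> \<beta>" "P \<beta>"
    by (rule projective_transition[OF charts])
  let ?ch = "\<lambda>i x. if i = 0 then of_real (x 0) + log_J M \<alpha> \<beta> (base x) else change M \<alpha> \<beta> i (base x)"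
  have L: "log_J M \<alpha> \<beta> = T.jac.L"
    by (simp add: fun_eq_iff log_J_def T.jac.L_def T.J_def pd_def)
  have zero: "0 \<notin> E \<union> D" using index_sets by simp
  have c: "T.c = 1 / (sdim M + 1)" by (simp add: T.c_def sdim)
  have TJ: "sderiv D k (?ch s) = (\<lambda>x. T.TJ k s (base x))" for k s
  proof (cases "s = 0")
    case True
    then show ?thesis
      using sderiv_fibre_coordinate[OF index_sets(5), of k "log_J M \<alpha> \<beta>"] by (simp add: T.TJ_def L T.lam_def fun_eq_iff)
  next
    case False
    then show ?thesis
      using sderiv_base[OF index_sets(5), of k "change M \<alpha> \<beta> s"] by (simp add: T.TJ_def T.J_def fun_eq_iff)
  qed
  have TdJ: "sderiv D i (sderiv D j (?ch r)) x = T.TdJ i j r (base x)"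
  proof -
    have "sderiv D i (\<lambda>_. 0) y = 0" "sderiv D i (\<lambda>_. 1) y = 0" for y
      using T.U.sderiv_const_of_real[of i 0 y] T.U.sderiv_const_of_real[of i 1 y] by simp_all
    moreover have "T.TJ j r = (if r = 0 then if j = 0 then (\<lambda>_. 1) else T.lam j else if j = 0 then (\<lambda>_. 0) else T.J j r)"
      by (simp add: T.TJ_def fun_eq_iff)
    ultimately show ?thesis
      unfolding TJ sderiv_base[OF index_sets(5)] by (cases "j = 0"; cases "r = 0") (simp_all add: T.TdJ_def)
  qed
  have TG: "thomas_coeffs M P \<alpha> k i j x = T.TG k i j (base x)" for k
    using base_eq[OF charts(1)] overlap_subset[OF charts] x
    by (subst thomas_coeffs_base) (auto simp: thomas_coeffs_eq T.TG_def c sdim T.A.R_def)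
  \<comment> \<open>The Thomas coefficients are constant along \<open>x^0\<close>, so their pullback
    is computed on the base by \<open>subst_base\<close>; only their values on the reverse overlap
    matter there.\<close>
  have TH: "pullback (thomas_space M) \<alpha> \<beta> (thomas_coeffs M P \<beta> r p q) x = T.TH r p q (base x)"
    if pq: "p \<in> insert 0 (E \<union> D)" "q \<in> insert 0 (E \<union> D)" for p q
  proof -
    have const: "T.pull (\<lambda>_. a *\<^sub>R kron k l) (base x) = a *\<^sub>R kron k l" for a k l
      using T.pull_const[OF x, of "if k = l then a else 0"] by (auto simp: kron_def of_real_def)
    have eq: "thomas_coeffs M P \<beta> r p q y = (if p = 0 then - T.c *\<^sub>R kron r q
        else if q = 0 then - T.c *\<^sub>R kron r p
        else if r = 0 then ((T.N + 1) / (T.N - 1)) *\<^sub>R T.B.R p q y else P \<beta> r p q y)" if "y \<in> overlap M \<beta> \<alpha>" for y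
      using base_eq[OF charts(2)] overlap_subset[OF charts(2,1)] that
      by (auto simp: thomas_coeffs_eq c sdim T.B.R_def)
    have "pullback (thomas_space M) \<alpha> \<beta> (thomas_coeffs M P \<beta> r p q) x = T.pull (thomas_coeffs M P \<beta> r p q) (base x)"
      unfolding pullback_def thomas_space_simps
      by (subst thomas_coeffs_base, rule subst_base) (use index_sets in auto)
    also have "\<dots> = T.pull (\<lambda>y. if p = 0 then - T.c *\<^sub>R kron r q
        else if q = 0 then - T.c *\<^sub>R kron r p
        else if r = 0 then ((T.N + 1) / (T.N - 1)) *\<^sub>R T.B.R p q y else P \<beta> r p q y) (base x)"
      by (rule T.pull_cong[OF eq x])
    also have "\<dots> = T.TH r p q (base x)"
    proof (cases "p = 0 \<or> q = 0")
      case True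
      then show ?thesis by (cases "p = 0") (simp_all only: T.TH_def const simp_thms if_True if_False)
    next
      case False
      then show ?thesis
        using T.pull_scaleR[OF T.B.sf_R x, of p q] pq by (simp add: T.TH_def)
    qed
    finally show ?thesis .
  qed
  show "(\<Sum>k\<in>insert 0 (indices M). thomas_coeffs M P \<alpha> k i j x * pd (thomas_space M) k (?ch r) x) =
      pd (thomas_space M) i (pd (thomas_space M) j (?ch r)) x +
      (\<Sum>p\<in>insert 0 (indices M). \<Sum>q\<in>insert 0 (indices M).
        (-1) ^ (par M p * (par M j + par M q)) * pd (thomas_space M) i (?ch p) x * pd (thomas_space M) j (?ch q) x *
        pullback (thomas_space M) \<alpha> \<beta> (thomas_coeffs M P \<beta> r p q) x)"
    unfolding TG pd_def thomas_space_simps TdJ indices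
    using T.thomas_law[OF x zero ij[unfolded indices]]
    by (simp add: TJ TH par_def minus_one_power_real mult.assoc del: sum.insert insert_iff Un_iff cong: sum.cong)
qed

end

theorem theorem3p3:
  fixes n m :: nat and M :: "'c superatlas" and P :: "'c coeffs"
  assumes "supermanifold n m M"
    and "int n - int m \<notin> {1, -1}"
    and "projective_class M P"
  shows "linear_connection (thomas_space M) (thomas_coeffs M P)"
proof -
  obtain \<Gamma> where "projective_structure n m M P \<Gamma>"
    using assms unfolding projective_class_def projective_structure_def by blast
  then show ?thesis by (rule projective_structure.thomas_connection)
qed

end
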